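(* Let $n\in\{2,3,4\}$ and let the tensor $\mathbb A$ satisfy the relaxed ellipticity condition. (i) If $\mathbf f\in\dot{\mathbf H}_\#^{s-2}$, $s\ge2$, then the anisotropic Navier-Stokes equation $$-\boldsymbol{\mathfrak L}\mathbf u+\nabla p+(\mathbf u\cdot\nabla)\mathbf u=\mathbf f$$ has a solution $(\mathbf u,p)\in\dot{\mathbf H}_{\#\sigma}^s\times\dot H_\#^{s-1}$. (ii) Moreover, if $\mathbf f\in\dot{\mathbf C}_\#^\infty$ then this equation has a solution $(\mathbf u,p)\in\dot{\mathbf C}_\#^\infty\times\dot{\mathcal C}^\infty_\#$ (with $\mathrm{div}\,\mathbf u=0$).
   Context: Repeated indices are summed from $1$ to $n$; $\partial_j=\partial/\partial x_j$. All functions and distributions are real-valued. $\mathbb A=(a_{kj}^{\alpha\beta})_{1\le k,j,\alpha,\beta\le n}$ is a tensor of real constants with the symmetry $a_{kj}^{\alpha\beta}=a_{\alpha j}^{k\beta}=a_{k\beta}^{\alpha j}$ (standing assumption). Relaxed ellipticity condition: there is a constant $C_{\mathbb A}>0$ such that $C_{\mathbb A}a_{kj}^{\alpha\beta}\zeta_{k\alpha}\zeta_{j\beta}\ge|\boldsymbol\zeta|^2:=\zeta_{k\alpha}\zeta_{k\alpha}$ for all $\boldsymbol\zeta\in\mathbb R^{n\times n}$ with $\boldsymbol\zeta=\boldsymbol\zeta^\top$ and $\sum_k\zeta_{kk}=0$. $(\boldsymbol{\mathfrak L}\mathbf u)_k:=\partial_\alpha(a_{kj}^{\alpha\beta}E_{j\beta}(\mathbf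 u))=\partial_\alpha(a_{kj}^{\alpha\beta}\partial_\beta u_j)$ with $E_{j\beta}(\mathbf u)=\frac12(\partial_ju_\beta+\partial_\beta u_j)$. $((\mathbf u\cdot\nabla)\mathbf u)_k=u_j\partial_ju_k$. The Navier-Stokes equation is considered for incompressible (divergence-free) $\mathbf u$ and is understood in the sense of (periodic) distributions. $\mathbb T=[0,1)^n$ is the flat torus; functions/distributions on it are identified with $1$-periodic ones on $\mathbb R^n$. $\mathcal C^\infty_\#$ denotes the $1$-periodic functions in $\mathcal C^\infty(\mathbb R^n)$. Fourier coefficients: $\hat g(\boldsymbol\xi)=\int_{\mathbb T}e^{-2\pi i\mathbf x\cdot\boldsymbol\xi}g(\mathbf x)d\mathbf x$, $\boldsymbol\xi\in\mathbb Z^n$, extended to periodic distributions. For $s\in\mathbb R$, $H^s_\#$ is the space of periodic distributions with finite norm $\|g\|_{H^s_\#}=\big(\sum_{\boldsymbol\xi\in\mathbb Z^n}(1+|\boldsymbol\xi|^2)^s|\hat g(\boldsymbol\xi)|^2\big)^{1/2}$; $\dot H^s_\#=\{g\in H^s_\#:\hat g(\mathbf 0)=0\}$; $\dot{\mathcal C}^\infty_\#=\{g\in\mathcal C^\infty_\#:\int_{\mathbb T}g=0\}$. Bold symbols denote $n$-component vector versions; $\dot{\mathbf H}^s_{\#\sigma}=\{\mathbf w\in\dot{\mathbf H}^s_\#:\mathrm{div}\,\mathbf w=0\}$. *)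

theory Defs
  imports "HOL-Analysis.Analysis"
begin

section \<open>Smooth periodic functions on \<open>\<real>\<^sup>n\<close>\<close>

definition partial_deriv :: "'n::finite \<Rightarrow> (real^'n \<Rightarrow> real) \<Rightarrow> real^'n \<Rightarrow> real" where
  "partial_deriv j f x = frechet_derivative f (at x) (axis j 1)"

definition partial_derivs :: "'n::finite list \<Rightarrow> (real^'n \<Rightarrow> real) \<Rightarrow> real^'n \<Rightarrow> real" where
  "partial_derivs js f = foldr partial_deriv js f"

text \<open>Differentiability of every iterated partial derivative also gives continuity of each of them,
  so this is \<open>C\<^sup>\<infinity>\<close> in the usual sense.\<close>

definition smooth :: "(real^'n::finite \<Rightarrow> real) \<Rightarrow> bool" where
  "smooth f \<longleftrightarrow> (\<forall>js x. partial_derivs js f differentiable (at x))"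

definition periodic :: "(real^'n::finite \<Rightarrow> 'b) \<Rightarrow> bool" where
  "periodic f \<longleftrightarrow> (\<forall>x k. f (x + axis k 1) = f x)"

definition torus :: "(real^'n::finite) set" where
  "torus = {x. \<forall>k. 0 \<le> x $ k \<and> x $ k < 1}"

definition periodic_smooth :: "(real^'n::finite \<Rightarrow> real) set" where
  "periodic_smooth = {f. smooth f \<and> periodic f}"

definition periodic_smooth_mean0 :: "(real^'n::finite \<Rightarrow> real) set" where
  "periodic_smooth_mean0 = {f \<in> periodic_smooth. (LINT x:torus|lborel. f x) = 0}"


section \<open>Periodic distributions\<close>

text \<open>A real-valued periodic distribution is a continuous linear functional on the Frechet space of
  real-valued smooth periodic functions, whose topology is that of uniform convergence of all
  derivatives; since that space is metrizable, continuity is sequential continuity.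
  Functionals are total functions in HOL: only their values on \<^term>\<open>periodic_smooth\<close> are
  meaningful, and identities between distributions are always stated on that set.\<close>

type_synonym 'n functional = "(real^'n \<Rightarrow> real) \<Rightarrow> real"

definition smooth_limit ::
    "(nat \<Rightarrow> real^'n::finite \<Rightarrow> real) \<Rightarrow> (real^'n \<Rightarrow> real) \<Rightarrow> bool" where
  "smooth_limit \<phi> \<psi> \<longleftrightarrow>
     (\<forall>js. uniform_limit UNIV (\<lambda>m. partial_derivs js (\<phi> m)) (partial_derivs js \<psi>) sequentially)"

definition periodic_distribution :: "'n::finite functional set" where
  "periodic_distribution = {T.
     (\<forall>\<phi>\<in>periodic_smooth. \<forall>\<psi>\<in>periodic_smooth. \<forall>a b.
        T (\<lambda>x. a * \<phi> x + b * \<psi> x) = a * T \<phi> + b * T \<psi>) \<and>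
     (\<forall>\<phi> \<psi>. (\<forall>m. \<phi> m \<in> periodic_smooth) \<longrightarrow> \<psi> \<in> periodic_smooth \<longrightarrow> smooth_limit \<phi> \<psi> \<longrightarrow>
        (\<lambda>m. T (\<phi> m)) \<longlonglongrightarrow> T \<psi>)}"

definition distr_of :: "(real^'n::finite \<Rightarrow> real) \<Rightarrow> 'n functional" where
  "distr_of g \<phi> = (LINT x:torus|lborel. g x * \<phi> x)"

definition distr_deriv :: "'n::finite \<Rightarrow> 'n functional \<Rightarrow> 'n functional" where
  "distr_deriv j T \<phi> = - T (partial_deriv j \<phi>)"

text \<open>Borel representatives suffice, since every Lebesgue measurable function agrees almost
  everywhere with a Borel measurable one.\<close>

definition represented_by :: "'n::finite functional \<Rightarrow> (real^'n \<Rightarrow> real) \<Rightarrow> bool" where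
  "represented_by T g \<longleftrightarrow> periodic g \<and> set_integrable lborel torus g \<and>
     (\<forall>\<phi>\<in>periodic_smooth. T \<phi> = distr_of g \<phi>)"

text \<open>The distribution \<open>P\<close> is the product of the regular distributions \<open>S\<close> and \<open>T\<close>.
  Distributions have no product in general, so this is a relation: it asks that \<open>S\<close> and \<open>T\<close> be
  given by periodic locally integrable functions whose pointwise product is again locally integrable,
  as is the case when both functions are square integrable. As these functions are unique almost
  everywhere, \<open>P\<close> is determined on \<^term>\<open>periodic_smooth\<close>.\<close>

definition distr_product ::
    "'n::finite functional \<Rightarrow> 'n functional \<Rightarrow> 'n functional \<Rightarrow> bool" where
  "distr_product S T P \<longleftrightarrow>
     (\<exists>g h. represented_by S g \<and> represented_by T h \<and> represented_by P (\<lambda>x. g x * h x))"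


section \<open>Fourier coefficients and Sobolev spaces\<close>

definition frequency :: "int^'n::finite \<Rightarrow> real^'n" where
  "frequency \<xi> = (\<chi> k. real_of_int (\<xi> $ k))"

text \<open>The Fourier coefficient is \<open>T\<close>, extended complex linearly, applied to
  \<open>x \<mapsto> exp (- 2 \<pi> i x \<bullet> \<xi>)\<close>.\<close>

definition fourier_coeff :: "'n::finite functional \<Rightarrow> int^'n \<Rightarrow> complex" where
  "fourier_coeff T \<xi> =
     Complex (T (\<lambda>x. cos (2 * pi * (x \<bullet> frequency \<xi>))))
             (- T (\<lambda>x. sin (2 * pi * (x \<bullet> frequency \<xi>))))"

definition sobolev :: "real \<Rightarrow> 'n::finite functional set" where
  "sobolev s = {T \<in> periodic_distribution.
     (\<lambda>\<xi>. (1 + (norm (frequency \<xi>))\<^sup>2) powr s * (cmod (fourier_coeff T \<xi>))\<^sup>2) summable_on UNIV}"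

definition sobolev_mean0 :: "real \<Rightarrow> 'n::finite functional set" where
  "sobolev_mean0 s = {T \<in> sobolev s. fourier_coeff T 0 = 0}"

definition sobolev_mean0_vec :: "real \<Rightarrow> ('n::finite \<Rightarrow> 'n functional) set" where
  "sobolev_mean0_vec s = {w. \<forall>k. w k \<in> sobolev_mean0 s}"

definition distr_div :: "('n::finite \<Rightarrow> 'n functional) \<Rightarrow> 'n functional" where
  "distr_div w \<phi> = (\<Sum>j\<in>UNIV. distr_deriv j (w j) \<phi>)"

definition sobolev_mean0_sol :: "real \<Rightarrow> ('n::finite \<Rightarrow> 'n functional) set" where
  "sobolev_mean0_sol s =
     {w \<in> sobolev_mean0_vec s. \<forall>\<phi>\<in>periodic_smooth. distr_div w \<phi> = 0}"


section \<open>The anisotropic Navier-Stokes equation\<close>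

text \<open>The value \<open>a k j \<alpha> \<beta>\<close> is the coefficient with lower indices \<open>k j\<close> and upper indices
  \<open>\<alpha> \<beta>\<close>.\<close>

type_synonym 'n tensor = "'n \<Rightarrow> 'n \<Rightarrow> 'n \<Rightarrow> 'n \<Rightarrow> real"

definition tensor_symmetric :: "'n tensor \<Rightarrow> bool" where
  "tensor_symmetric a \<longleftrightarrow>
     (\<forall>k j \<alpha> \<beta>. a k j \<alpha> \<beta> = a \<alpha> j k \<beta> \<and> a k j \<alpha> \<beta> = a k \<beta> \<alpha> j)"

definition relaxed_elliptic :: "'n::finite tensor \<Rightarrow> bool" where
  "relaxed_elliptic a \<longleftrightarrow>
     (\<exists>C>0. \<forall>\<zeta> :: real^'n^'n. \<zeta> = transpose \<zeta> \<longrightarrow> trace \<zeta> = 0 \<longrightarrow>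
        C * (\<Sum>k\<in>UNIV. \<Sum>j\<in>UNIV. \<Sum>\<alpha>\<in>UNIV. \<Sum>\<beta>\<in>UNIV. a k j \<alpha> \<beta> * \<zeta> $ k $ \<alpha> * \<zeta> $ j $ \<beta>)
          \<ge> (\<Sum>k\<in>UNIV. \<Sum>\<alpha>\<in>UNIV. \<zeta> $ k $ \<alpha> * \<zeta> $ k $ \<alpha>))"

definition strain :: "('n::finite \<Rightarrow> 'n functional) \<Rightarrow> 'n \<Rightarrow> 'n \<Rightarrow> 'n functional" where
  "strain u j \<beta> \<phi> = (distr_deriv j (u \<beta>) \<phi> + distr_deriv \<beta> (u j) \<phi>) / 2"

definition stokes_op ::
    "'n::finite tensor \<Rightarrow> ('n \<Rightarrow> 'n functional) \<Rightarrow> 'n \<Rightarrow> 'n functional" where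
  "stokes_op a u k \<phi> =
     (\<Sum>\<alpha>\<in>UNIV. distr_deriv \<alpha> (\<lambda>\<psi>. \<Sum>j\<in>UNIV. \<Sum>\<beta>\<in>UNIV. a k j \<alpha> \<beta> * strain u j \<beta> \<psi>) \<phi>)"

definition navier_stokes ::
    "'n::finite tensor \<Rightarrow> ('n \<Rightarrow> 'n functional) \<Rightarrow> 'n functional \<Rightarrow> ('n \<Rightarrow> 'n functional) \<Rightarrow> bool"
  where
  "navier_stokes a u p f \<longleftrightarrow>
     (\<exists>N. (\<forall>j k. distr_product (u j) (distr_deriv j (u k)) (N j k)) \<and>
          (\<forall>k. \<forall>\<phi>\<in>periodic_smooth.
             - stokes_op a u k \<phi> + distr_deriv k p \<phi> + (\<Sum>j\<in>UNIV. N j k \<phi>) = f k \<phi>))"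

end

theory Submission
  imports Defs "HOL-Analysis.Analysis"
begin

text \<open>On the Fourier side the equation reads \<open>M(\<xi>) u(\<xi>) + 2 \<pi> i p(\<xi>) \<xi> + (u \<cdot> \<nabla>u)(\<xi>) = f(\<xi>)\<close>. For
  \<open>\<xi> \<cdot> w = 0\<close> the symmetric part of \<open>w \<otimes> \<xi>\<close> is trace free, so relaxed ellipticity and the symmetries of
  the tensor make the symbol \<open>M(\<xi>)\<close> coercive on divergence-free amplitudes. The convective term is
  orthogonal to the velocity, so every Galerkin truncation is solvable by Brouwer's theorem with a bound
  in \<open>H\<^sup>1\<close> that does not depend on the truncation; compactness of coefficientwise convergence gives a weak solution, and the
  component of the equation along \<open>\<xi>\<close> defines the pressure.

  Regularity rests on the product estimate \<open>H\<^sup>1 \<cdot> H\<^sup>1 \<subseteq> L\<^sup>2\<close>, which holds up to dimension four and is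
  critical there. In the weighted norm with weight \<open>min |\<xi>| R\<close> to the power \<open>s - 1\<close> the convolution is split into a
  part that is small in the critical norm and finitely many frequencies, which yields a bound uniform in
  \<open>R\<close> and hence the full regularity in a single step. Distributions are recovered from
  their coefficients by the density of trigonometric polynomials (Fejer) and the Riesz--Fischer theorem.\<close>

section \<open>Compactness and Brouwer's theorem\<close>

text \<open>In dimension four the bilinear estimate is scale invariant: no power of the frequency is
  left over, so the energy bound, whatever its size, cannot be made small by giving up a little
  regularity. What can be made small is the tail of the convergent series that defines the energy of
  one fixed solution. Where this tail starts depends on that solution, so regularity is qualitative
  and is proved for a given solution rather than along the approximations. The forcing is not small
  either, so there is no contraction: existence rests on a fixed point of the Galerkin map scaled
  into a large ball, and the energy identity shows afterwards that the scaling is inactive. The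
  solution is built once, from square summable data, and its regularity is then read off for each
  order separately; hence one field serves all orders at once, and smooth data give a smooth
  solution. Estimates run with extended nonnegative sums over the lattice, while reality of the
  fields is carried by the conjugate symmetry between \<open>\<xi>\<close> and
  \<open>- \<xi>\<close>.\<close>

lemma pointwise_convergent_subsequence:
  fixes X :: "nat \<Rightarrow> 'i::countable \<Rightarrow> 'b::heine_borel"
  assumes "\<And>n i. X n i \<in> K i" "\<And>i. compact (K i)"
  obtains r x where "strict_mono (r :: nat \<Rightarrow> nat)" "\<And>i. x i \<in> K i" "\<And>i. (\<lambda>n. X (r n) i) \<longlonglongrightarrow> x i"
proof -
  \<comment> \<open>Tychonoff. The index type is countable, so the product topology is first
    countable and compactness gives subsequences without a diagonal argument.\<close>
  have "compact (PiE UNIV K)"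
  proof -
    have "compactin (product_topology (\<lambda>i. euclidean::'b topology) UNIV) (PiE UNIV K)"
      unfolding compactin_PiE using assms(2) by auto
    then show ?thesis
      unfolding euclidean_product_topology by simp
  qed
  then have "seq_compact (PiE UNIV K)"
    by (rule compact_imp_seq_compact)
  moreover have "\<forall>n. X n \<in> PiE UNIV K"
    using assms(1) by auto
  ultimately obtain x r where x: "x \<in> PiE UNIV K" "strict_mono r" "(X \<circ> r) \<longlonglongrightarrow> x"
    unfolding seq_compact_def by metis
  have "(\<lambda>n. X (r n) i) \<longlonglongrightarrow> x i" for i
  proof -
    have "isCont (\<lambda>y::'i \<Rightarrow> 'b. y i) x"
      using continuous_on_product_coordinates[of i] by (metis continuous_on_eq_continuous_at open_UNIV UNIV_I)
    then show ?thesis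
      using isCont_tendsto_compose[OF _ x(3)] by (fastforce simp: o_def)
  qed
  with x show thesis
    by (intro that[of r x]) auto
qed

text \<open>The dimension is a variable \<open>n\<close>, because it will be the number of real
  unknowns of a truncation. Points are therefore functions on \<open>nat\<close>, continuity is
  sequential and coordinatewise, and the fixed point comes from Kuhn's combinatorial lemma on ever
  finer grids.\<close>

lemma brouwer_unit_cube:
  fixes g :: "(nat \<Rightarrow> real) \<Rightarrow> nat \<Rightarrow> real"
  assumes range: "\<And>x i. i < n \<Longrightarrow> 0 \<le> g x i \<and> g x i \<le> 1"
    and cont: "\<And>X x i. i < n \<Longrightarrow> (\<And>j. (\<lambda>m. X m j) \<longlonglongrightarrow> x j) \<Longrightarrow> (\<lambda>m. g (X m) i) \<longlonglongrightarrow> g x i"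
  obtains x where "\<And>i. i < n \<Longrightarrow> g x i = x i"
proof -
  define pt where "pt = (\<lambda>p (q::nat \<Rightarrow> nat) i. if i < n then real (q i) / real p else 0)"
  \<comment> \<open>Label 0 marks coordinates that \<open>g\<close> does not decrease, label 1 those
    that it does not increase. On the faces the label is prescribed as Kuhn's lemma demands; this is
    consistent because \<open>g\<close> takes values in the unit cube.\<close>
  define label where "label = (\<lambda>p q i. if q i = 0 then 0 else if q i = p then 1
      else if g (pt p q) i \<ge> pt p q i then 0 else (1::nat))"
  have lab0: "pt p q i \<le> g (pt p q) i" if "i < n" "label p q i = 0" for p q i
    using that range[of i "pt p q"] by (auto simp: label_def pt_def split: if_splits)
  have lab1: "g (pt p q) i \<le> pt p q i" if "i < n" "label p q i = 1" "p > 0" for p q i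
    using that range[of i "pt p q"] by (auto simp: label_def pt_def split: if_splits)
  \<comment> \<open>\<open>near q r\<close> says that \<open>r\<close> is a vertex of the grid cell
    with lowest corner \<open>q\<close>.\<close>
  define near where "near = (\<lambda>(q::nat \<Rightarrow> nat) r. \<forall>j<n. q j \<le> r j \<and> r j \<le> q j + 1)"
  have "\<exists>q. (\<forall>i<n. q i < p) \<and> (\<forall>i<n. \<exists>r s. near q r \<and> near q s \<and> label p r i = 0 \<and> label p s i = 1)"
    if p: "p > 0" for p
  proof (rule kuhn_lemma[of p n "label p"])
    show "\<forall>x. (\<forall>i<n. x i \<le> p) \<longrightarrow> (\<forall>i<n. label p x i = 0 \<or> label p x i = 1)"
      by (auto simp: label_def)
    show "\<forall>x. (\<forall>i<n. x i \<le> p) \<longrightarrow> (\<forall>i<n. x i = 0 \<longrightarrow> label p x i = 0)"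
      "\<forall>x. (\<forall>i<n. x i \<le> p) \<longrightarrow> (\<forall>i<n. x i = p \<longrightarrow> label p x i = 1)"
      using p by (auto simp: label_def)
    fix q assume q: "\<forall>i<n. q i < p" "\<forall>i<n. \<exists>r s. (\<forall>j<n. q j \<le> r j \<and> r j \<le> q j + 1) \<and>
      (\<forall>j<n. q j \<le> s j \<and> s j \<le> q j + 1) \<and> label p r i \<noteq> label p s i"
    have "\<exists>r s. near q r \<and> near q s \<and> label p r i = 0 \<and> label p s i = 1" if "i < n" for i
    proof -
      obtain r s where rs: "near q r" "near q s" "label p r i \<noteq> label p s i"
        using q(2)[rule_format, OF \<open>i < n\<close>] by (auto simp: near_def)
      moreover have "label p r i = 0 \<or> label p r i = 1" "label p s i = 0 \<or> label p s i = 1"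
        by (auto simp: label_def)
      ultimately consider "label p r i = 0" "label p s i = 1" | "label p s i = 0" "label p r i = 1"
        by fastforce
      then show ?thesis
        using rs(1,2) by cases blast+
    qed
    with q(1) show "\<exists>q. (\<forall>i<n. q i < p) \<and> (\<forall>i<n. \<exists>r s. near q r \<and> near q s \<and> label p r i = 0 \<and> label p s i = 1)"
      by blast
  qed (fact p)
  then have "\<forall>p\<in>{0<..}. \<exists>q. (\<forall>i<n. q i < p) \<and>
      (\<forall>i<n. \<exists>r s. near q r \<and> near q s \<and> label p r i = 0 \<and> label p s i = 1)"
    by blast
  from bchoice[OF this] obtain q where q1: "\<And>p i. p > 0 \<Longrightarrow> i < n \<Longrightarrow> q p i < p"
    and q2: "\<forall>p\<in>{0<..}. \<forall>i\<in>{..<n}. \<exists>r s. near (q p) r \<and> near (q p) s \<and> label p r i = 0 \<and> label p s i = 1"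
    by (elim exE) (smt (verit, best) greaterThan_iff lessThan_iff)
  define good where "good = (\<lambda>i p r s. near (q p) r \<and> near (q p) s \<and> label p r i = 0 \<and> label p s i = 1)"
  have q3: "\<exists>r s. good i p r s" if "p > 0" "i < n" for i p
    using q2 that by (auto simp: good_def)
  \<comment> \<open>Lowest corners of the Kuhn cells at mesh \<open>1 / (m + 1)\<close>; the
    successor keeps the mesh parameter positive.\<close>
  define X where "X = (\<lambda>m. pt (Suc m) (q (Suc m)))"
  have "X m i \<in> {0..1}" for m i
    using q1[of "Suc m" i] by (auto simp: X_def pt_def divide_simps)
  then obtain t x where t: "strict_mono (t :: nat \<Rightarrow> nat)" and x: "\<And>i. (\<lambda>m. X (t m) i) \<longlonglongrightarrow> x i"
    by (rule pointwise_convergent_subsequence[of X "\<lambda>_. {0..1}"]) auto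
  \<comment> \<open>All vertices of a cell lie within the mesh size of its corner in each
    coordinate, so any choice of vertices inherits the limit of the corners.\<close>
  have lim: "(\<lambda>m. pt (Suc (t m)) (Y (Suc (t m))) j) \<longlonglongrightarrow> x j"
    if Y: "\<And>p. p > 0 \<Longrightarrow> near (q p) (Y p)" for Y j
  proof (rule Lim_transform[OF x])
    have "\<bar>X (t m) j - pt (Suc (t m)) (Y (Suc (t m))) j\<bar> \<le> inverse (real (Suc m))" for m
    proof (cases "j < n")
      case True
      let ?p = "Suc (t m)"
      have "q ?p j \<le> Y ?p j" "Y ?p j \<le> q ?p j + 1"
        using Y[of ?p] True by (auto simp: near_def)
      then have "\<bar>real (q ?p j) - real (Y ?p j)\<bar> \<le> 1"
        by linarith
      then have "\<bar>real (q ?p j) - real (Y ?p j)\<bar> / real ?p \<le> 1 / real ?p"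
        by (intro divide_right_mono) auto
      also have "\<dots> \<le> 1 / real (Suc m)"
        using seq_suble[OF t, of m] by (simp add: divide_simps)
      finally show ?thesis
        using True by (simp add: X_def pt_def abs_divide inverse_eq_divide flip: diff_divide_distrib)
    qed (simp add: X_def pt_def)
    then show "(\<lambda>m. pt (Suc (t m)) (Y (Suc (t m))) j - X (t m) j) \<longlonglongrightarrow> 0"
      by (intro Lim_null_comparison[OF _ LIMSEQ_inverse_real_of_nat]) (auto simp: abs_minus_commute)
  qed
  \<comment> \<open>In each coordinate the vertices labelled 0 give \<open>x i \<le> g x i\<close>
    in the limit, and those labelled 1 give the reverse.\<close>
  have "g x i = x i" if i: "i < n" for i
  proof (rule antisym)
    obtain r s where "\<And>p. p > 0 \<Longrightarrow> good i p (r p) (s p)"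
      using q3[OF _ i] by metis
    then have R: "\<And>p. p > 0 \<Longrightarrow> near (q p) (r p) \<and> label p (r p) i = 0"
      and S: "\<And>p. p > 0 \<Longrightarrow> near (q p) (s p) \<and> label p (s p) i = 1"
      by (auto simp: good_def)
    note limR = lim[OF conjunct1[OF R]] and limS = lim[OF conjunct1[OF S]]
    show "x i \<le> g x i"
      using lab0[OF i] R
      by (intro LIMSEQ_le[OF limR cont[OF i limR]]) auto
    show "g x i \<le> x i"
      using lab1[OF i] S
      by (intro LIMSEQ_le[OF cont[OF i limS] limS]) auto
  qed
  then show thesis by (rule that)
qed

text \<open>An enumeration of \<open>I\<close> and the affine map from the unit interval onto the
  interval from \<open>- R\<close> to \<open>R\<close> reduce this to the unit cube.\<close>

lemma brouwer_finite_cube: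
  fixes g :: "('i \<Rightarrow> real) \<Rightarrow> 'i \<Rightarrow> real"
  assumes fin: "finite I" and R: "R > 0"
    and range: "\<And>x i. i \<in> I \<Longrightarrow> \<bar>g x i\<bar> \<le> R"
    and cont: "\<And>X x i. i \<in> I \<Longrightarrow> (\<And>j. (\<lambda>m. X m j) \<longlonglongrightarrow> x j) \<Longrightarrow> (\<lambda>m. g (X m) i) \<longlonglongrightarrow> g x i"
  obtains x where "\<And>i. i \<in> I \<Longrightarrow> g x i = x i"
proof -
  obtain h where h: "bij_betw h {0..<card I} I"
    using ex_bij_betw_nat_finite[OF fin] by blast
  define k where "k = inv_into {0..<card I} h"
  have kh: "k i < card I" "h (k i) = i" if "i \<in> I" for i
    using that h unfolding k_def
    by (metis atLeastLessThan_iff bij_betw_imp_surj_on inv_into_into, metis bij_betw_inv_into_right)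
  have hI: "h j \<in> I" "k (h j) = j" if "j < card I" for j
    using that h unfolding k_def by (auto simp: bij_betw_def)
  define up where "up = (\<lambda>(y::nat \<Rightarrow> real) i. 2 * R * y (k i) - R)"
  obtain y where y: "\<And>j. j < card I \<Longrightarrow> (g (up y) (h j) + R) / (2 * R) = y j"
  proof (rule brouwer_unit_cube[where n = "card I" and g = "\<lambda>y j. (g (up y) (h j) + R) / (2 * R)"])
    show "0 \<le> (g (up x) (h i) + R) / (2 * R) \<and> (g (up x) (h i) + R) / (2 * R) \<le> 1"
      if "i < card I" for x i
      using range[OF hI(1)[OF that], of "up x"] R by (auto simp: divide_simps abs_le_iff)
    show "(\<lambda>m. (g (up (X m)) (h i) + R) / (2 * R)) \<longlonglongrightarrow> (g (up x) (h i) + R) / (2 * R)"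
      if "i < card I" "\<And>j. (\<lambda>m. X m j) \<longlonglongrightarrow> x j" for X x i
      using R by (intro tendsto_intros cont hI that) (auto simp: up_def intro!: tendsto_intros that)
  qed blast
  have "g (up y) i = up y i" if "i \<in> I" for i
    using y[OF kh(1)[OF that]] kh(2)[OF that] R by (simp add: up_def divide_simps mult.commute)
  then show thesis by (rule that)
qed

text \<open>A bound on the norm bounds every coordinate along \<open>Basis\<close>, so this is the
  cube indexed by pairs of an index and a basis vector. Unknowns valued in \<open>complex^'n\<close>
  need this form.\<close>

lemma brouwer_finite_product:
  fixes g :: "('i \<Rightarrow> 'b::euclidean_space) \<Rightarrow> 'i \<Rightarrow> 'b"
  assumes fin: "finite I" and R: "R > 0"
    and range: "\<And>x i. i \<in> I \<Longrightarrow> norm (g x i) \<le> R"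
    and cont: "\<And>X x i. i \<in> I \<Longrightarrow> (\<And>j. (\<lambda>m. X m j) \<longlonglongrightarrow> x j) \<Longrightarrow> (\<lambda>m. g (X m) i) \<longlonglongrightarrow> g x i"
  obtains x where "\<And>i. i \<in> I \<Longrightarrow> g x i = x i"
proof -
  define up where "up = (\<lambda>(y::'i \<times> 'b \<Rightarrow> real) i. \<Sum>b\<in>Basis. y (i, b) *\<^sub>R b)"
  obtain y where y: "\<And>i. i \<in> I \<times> Basis \<Longrightarrow> g (up y) (fst i) \<bullet> snd i = y i"
  proof (rule brouwer_finite_cube[where I = "I \<times> Basis" and g = "\<lambda>y i. g (up y) (fst i) \<bullet> snd i" and R = R])
    show "\<bar>g (up x) (fst i) \<bullet> snd i\<bar> \<le> R" if "i \<in> I \<times> Basis" for x i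
      using that range[of "fst i" "up x"] Basis_le_norm[of "snd i" "g (up x) (fst i)"] by auto
    show "(\<lambda>m. g (up (X m)) (fst i) \<bullet> snd i) \<longlonglongrightarrow> g (up x) (fst i) \<bullet> snd i"
      if "i \<in> I \<times> Basis" "\<And>j. (\<lambda>m. X m j) \<longlonglongrightarrow> x j" for X x i
      using that(1)
      by (intro tendsto_intros cont) (auto simp: up_def intro!: tendsto_intros that)
  qed (use fin R in auto)
  have "g (up y) i = up y i" if "i \<in> I" for i
  proof (rule euclidean_eqI)
    fix b :: 'b assume b: "b \<in> Basis"
    then show "g (up y) i \<bullet> b = up y i \<bullet> b"
      using y[of "(i, b)"] that by (simp add: up_def inner_sum_left inner_Basis if_distrib sum.If_cases cong: if_cong)
  qed
  then show thesis by (rule that)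
qed

section \<open>Lattice sums\<close>

definition nu :: "int^'n::finite \<Rightarrow> real" where
  "nu \<xi> = norm (frequency \<xi>)"

text \<open>Cubes serve as truncations: lattice sums over them factor over the coordinates, and
  their invariance under negation keeps truncated fields real.\<close>

definition cube :: "nat \<Rightarrow> (int^'n::finite) set" where
  "cube N = {\<xi>. \<forall>k. \<bar>\<xi> $ k\<bar> \<le> int N}"

lemma frequency_simps [simp]:
  "frequency 0 = 0" "frequency (- \<xi>) = - frequency \<xi>"
  "frequency (\<xi> + \<eta>) = frequency \<xi> + frequency \<eta>" "frequency (\<xi> - \<eta>) = frequency \<xi> - frequency \<eta>"
  "frequency \<xi> $ k = of_int (\<xi> $ k)" "frequency \<xi> = 0 \<longleftrightarrow> \<xi> = 0"
  by (auto simp: frequency_def vec_eq_iff)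

lemma nu_simps [simp]: "nu 0 = 0" "nu (- \<xi>) = nu \<xi>" "nu \<xi> \<ge> 0" "nu \<xi> = 0 \<longleftrightarrow> \<xi> = 0" "nu \<xi> > 0 \<longleftrightarrow> \<xi> \<noteq> 0"
  by (auto simp: nu_def)

lemma nu_triangle: "nu (\<xi> + \<eta>) \<le> nu \<xi> + nu \<eta>"
  by (simp add: nu_def norm_triangle_ineq)

lemma component_le_nu: "\<bar>of_int (\<xi> $ k)\<bar> \<le> nu \<xi>"
  using component_le_norm_cart[of "frequency \<xi>" k] by (simp add: nu_def)

text \<open>A nonzero integer vector has a component of modulus at least 1. This spectral gap lets
  norms weighted by \<open>nu\<close> control unweighted ones on fields of zero mean.\<close>

lemma nu_ge_1: "nu \<xi> \<ge> 1" if "\<xi> \<noteq> 0"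
proof -
  obtain k where "\<xi> $ k \<noteq> 0"
    using \<open>\<xi> \<noteq> 0\<close> by (metis vec_eq_iff zero_index)
  then have "1 \<le> \<bar>of_int (\<xi> $ k) :: real\<bar>"
    by linarith
  then show ?thesis
    using component_le_nu[of \<xi> k] by linarith
qed

lemma mem_cube_nu: "\<xi> \<in> cube N" if "nu \<xi> \<le> real N"
proof -
  have "\<bar>\<xi> $ k\<bar> \<le> int N" for k
    using component_le_nu[of \<xi> k] that by linarith
  then show ?thesis
    by (auto simp: cube_def)
qed

lemma bij_betw_cube: "bij_betw vec_lambda (UNIV \<rightarrow>\<^sub>E {- int N..int N}) (cube N :: (int^'n::finite) set)"
proof (rule bij_betw_byWitness[where f' = vec_nth])
  show "\<forall>a\<in>UNIV \<rightarrow>\<^sub>E {- int N..int N}. vec_nth (vec_lambda a) = a"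
    by (auto simp: fun_eq_iff)
  show "\<forall>a'\<in>cube N. vec_lambda (vec_nth a') = a'"
    by (auto simp: vec_eq_iff)
  have 1: "\<And>x::int. \<bar>x\<bar> \<le> int N \<longleftrightarrow> - int N \<le> x \<and> x \<le> int N"
    by linarith
  show "vec_lambda ` (UNIV \<rightarrow>\<^sub>E {- int N..int N}) \<subseteq> cube N"
    by (auto simp: cube_def PiE_iff 1)
  show "vec_nth ` cube N \<subseteq> UNIV \<rightarrow>\<^sub>E {- int N..int N}"
    by (auto simp: cube_def PiE_iff 1)
qed

lemma finite_cube [simp]: "finite (cube N)"
  using bij_betw_finite[OF bij_betw_cube[of N]] by (simp add: finite_PiE)

lemma cube_uminus [simp]: "- \<xi> \<in> cube N \<longleftrightarrow> \<xi> \<in> cube N"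
  by (auto simp: cube_def)

lemma cube_mono: "N \<le> M \<Longrightarrow> cube N \<subseteq> cube M"
proof
  fix x assume "N \<le> M" "x \<in> cube N"
  then have "\<bar>x $ k\<bar> \<le> int M" for k
    unfolding cube_def by (metis (mono_tags) mem_Collect_eq of_nat_mono order_trans)
  then show "x \<in> cube M" by (simp add: cube_def)
qed

lemma Un_cube [simp]: "(\<Union>N. cube N) = UNIV"
proof -
  have "\<xi> \<in> cube (nat \<lceil>nu \<xi>\<rceil>)" for \<xi> :: "int^'n::finite"
    by (rule mem_cube_nu) linarith
  then show ?thesis by blast
qed

lemma finite_subset_cube:
  assumes "finite F"
  obtains N where "F \<subseteq> cube N"
proof -
  have "F \<subseteq> (\<Union>N. cube N)" by simp
  moreover have "cube N \<subseteq> cube M \<or> cube M \<subseteq> cube N" for N M :: nat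
    using cube_mono[of N M] cube_mono[of M N] by (meson nle_le)
  ultimately obtain B where "B \<in> range cube" "F \<subseteq> B"
    using finite_subset_Union_chain[OF assms, of "range cube" UNIV]
    by (auto simp: subset_chain_def) blast
  then show thesis using that by blast
qed

lemma sum_cube_prod:
  fixes w :: "int \<Rightarrow> real"
  shows "(\<Sum>\<xi>\<in>(cube N :: (int^'n::finite) set). \<Prod>k\<in>UNIV. w (\<xi> $ k)) = (\<Sum>m=-int N..int N. w m) ^ CARD('n)"
proof -
  have "(\<Sum>m=-int N..int N. w m) ^ CARD('n) = (\<Prod>k\<in>(UNIV::'n set). \<Sum>m=-int N..int N. w m)"
    by simp
  also have "\<dots> = (\<Sum>g\<in>UNIV \<rightarrow>\<^sub>E {-int N..int N}. \<Prod>k\<in>(UNIV::'n set). w (g k))"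
    by (rule prod_sum_PiE) auto
  also have "\<dots> = (\<Sum>\<xi>\<in>(cube N :: (int^'n) set). \<Prod>k\<in>UNIV. w (\<xi> $ k))"
    using sum.reindex_bij_betw[OF bij_betw_cube, of "\<lambda>\<xi>. \<Prod>k\<in>UNIV. w (\<xi> $ k)"] by simp
  finally show ?thesis ..
qed

lemma sum_symmetric_interval_Suc:
  fixes w :: "int \<Rightarrow> real"
  shows "(\<Sum>m=-int (Suc N)..int (Suc N). w m) = (\<Sum>m=-int N..int N. w m) + w (int (Suc N)) + w (- int (Suc N))"
proof -
  have "{-int (Suc N)..int (Suc N)} = insert (int (Suc N)) (insert (- int (Suc N)) {-int N..int N})"
    by auto
  then show ?thesis by simp
qed

text \<open>Passing to the next radius adds \<open>2 / y\<close>, where \<open>y\<close> is the new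
  root, \<open>x\<close> the old one and \<open>1 / y \<le> 2 * (y - x)\<close>. The constant 5
  covers this increment and the three terms of the base case; the maximum with 1 takes care of
  \<open>m = 0\<close>.\<close>

lemma sum_inverse_sqrt_le:
  "(\<Sum>m=-int (Suc N)..int (Suc N). 1 / sqrt (max 1 \<bar>of_int m\<bar>)) \<le> 5 * sqrt (real (Suc N))"
proof -
  define S where "S = (\<lambda>N. \<Sum>m=-int N..int N. 1 / sqrt (max 1 \<bar>real_of_int m\<bar>))"
  have "S (Suc N) \<le> 5 * sqrt (real (Suc N))"
  proof (induction N)
    case 0
    have "{-1..1::int} = {-1, 0, 1}" by auto
    then show ?case by (simp add: S_def)
  next
    case (Suc N)
    define x y where "x = sqrt (real (Suc N))" and "y = sqrt (real (Suc (Suc N)))"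
    have pos: "x > 0" "y > 0" "x \<le> y" by (auto simp: x_def y_def)
    have "y ^ 2 - x ^ 2 = 1" by (simp add: x_def y_def)
    then have "1 = (y - x) * (y + x)"
      by (simp add: power2_eq_square algebra_simps)
    also have "\<dots> \<le> (y - x) * (2 * y)"
      using pos by (intro mult_left_mono) auto
    finally have "1 / y \<le> 2 * (y - x)"
      using pos by (simp add: field_simps)
    moreover have "2 * z \<le> 5 * (y - x)" if "z \<le> 2 * (y - x)" for z
      using that pos by argo
    ultimately have "2 * (1 / y) \<le> 5 * (y - x)"
      by blast
    moreover have "S (Suc (Suc N)) = S (Suc N) + 2 * (1 / y)"
      unfolding S_def by (subst sum_symmetric_interval_Suc) (simp add: max_def add.commute y_def)
    ultimately show ?case
      using Suc.IH pos unfolding x_def[symmetric] y_def[symmetric] by (simp add: algebra_simps)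
  qed
  then show ?thesis by (simp add: S_def)
qed

text \<open>This is where the restriction on the dimension enters.\<close>

lemma sum_inverse_nu_squared_le:
  fixes F :: "(int^'n::finite) set"
  assumes n: "CARD('n) \<le> 4" and F: "finite F" "\<And>\<eta>. \<eta> \<in> F \<Longrightarrow> \<eta> \<noteq> 0 \<and> nu \<eta> \<le> r"
  shows "(\<Sum>\<eta>\<in>F. 1 / (nu \<eta>)\<^sup>2) \<le> 625 * r\<^sup>2"
proof (cases "F = {}")
  case False
  then obtain \<eta>0 where \<eta>0: "\<eta>0 \<in> F" by blast
  then have r: "r \<ge> 1" using F(2)[OF \<eta>0] nu_ge_1[of \<eta>0] by linarith
  \<comment> \<open>\<open>Suc N\<close> is the integer part of \<open>r\<close>, which is at least
    1 because \<open>F\<close> contains a nonzero frequency.\<close>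
  define N where "N = nat \<lfloor>r\<rfloor> - 1"
  have N: "real (Suc N) \<le> r" "r < real (Suc N) + 1"
    using r by (auto simp: N_def)
  have le4: "x ^ CARD('n) \<le> x ^ 4" if "x \<ge> 1" for x :: real
    using n that by (intro power_increasing) auto
  have sub: "F \<subseteq> cube (Suc N)"
  proof
    fix \<eta> assume "\<eta> \<in> F"
    have "\<bar>\<eta> $ k\<bar> \<le> int (Suc N)" for k
      using component_le_nu[of \<eta> k] F(2)[OF \<open>\<eta> \<in> F\<close>] N by linarith
    then show "\<eta> \<in> cube (Suc N)" by (auto simp: cube_def)
  qed
  \<comment> \<open>Every component is at most \<open>nu \<eta>\<close>, so a product of at most
    four roots is at most the square of \<open>nu \<eta>\<close>. The resulting majorant factors
    over the coordinates.\<close>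
  have "1 / (nu \<eta>)\<^sup>2 \<le> (\<Prod>k\<in>UNIV. 1 / sqrt (max 1 \<bar>of_int (\<eta> $ k)\<bar>))" if "\<eta> \<in> F" for \<eta>
  proof -
    have nu1: "nu \<eta> \<ge> 1" using nu_ge_1 F(2) that by blast
    have "(\<Prod>k\<in>UNIV. sqrt (max 1 \<bar>of_int (\<eta> $ k)\<bar>)) \<le> (\<Prod>k\<in>(UNIV::'n set). sqrt (nu \<eta>))"
      using component_le_nu[of \<eta>] nu1 by (intro prod_mono) auto
    also have "\<dots> \<le> sqrt (nu \<eta>) ^ 4"
      using le4[of "sqrt (nu \<eta>)"] nu1 by simp
    also have "\<dots> = (sqrt (nu \<eta>) ^ 2) ^ 2"
      by (simp add: power2_eq_square power4_eq_xxxx)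
    also have "\<dots> = (nu \<eta>)\<^sup>2"
      using nu1 by simp
    finally have "(\<Prod>k\<in>UNIV. sqrt (max 1 \<bar>of_int (\<eta> $ k)\<bar>)) \<le> (nu \<eta>)\<^sup>2" .
    moreover have "(\<Prod>k\<in>UNIV. sqrt (max 1 \<bar>of_int (\<eta> $ k)\<bar>)) > 0"
      by (intro prod_pos) auto
    ultimately have "1 / (nu \<eta>)\<^sup>2 \<le> 1 / (\<Prod>k\<in>UNIV. sqrt (max 1 \<bar>of_int (\<eta> $ k)\<bar>))"
      using nu1 by (intro divide_left_mono mult_pos_pos) auto
    then show ?thesis by (simp add: prod_dividef)
  qed
  then have "(\<Sum>\<eta>\<in>F. 1 / (nu \<eta>)\<^sup>2) \<le> (\<Sum>\<eta>\<in>F. \<Prod>k\<in>UNIV. 1 / sqrt (max 1 \<bar>of_int (\<eta> $ k)\<bar>))"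
    by (rule sum_mono)
  also have "\<dots> \<le> (\<Sum>\<eta>\<in>(cube (Suc N) :: (int^'n) set). \<Prod>k\<in>UNIV. 1 / sqrt (max 1 \<bar>of_int (\<eta> $ k)\<bar>))"
    by (rule sum_mono2) (use sub in \<open>auto intro!: prod_nonneg\<close>)
  also have "\<dots> = (\<Sum>m=-int (Suc N)..int (Suc N). 1 / sqrt (max 1 \<bar>of_int m\<bar>)) ^ CARD('n)"
    by (rule sum_cube_prod)
  also have "\<dots> \<le> (5 * sqrt (real (Suc N))) ^ CARD('n)"
    by (intro power_mono sum_inverse_sqrt_le sum_nonneg) auto
  also have "\<dots> \<le> (5 * sqrt r) ^ CARD('n)"
    using N by (intro power_mono mult_left_mono) auto
  also have "\<dots> \<le> (5 * sqrt r) ^ 4"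
    using r real_sqrt_ge_one[OF r] by (intro le4) linarith
  \<comment> \<open>The constant 625 is the fourth power of the one-dimensional 5.\<close>
  also have "\<dots> = 625 * (sqrt r ^ 2) ^ 2"
    by (simp add: power2_eq_square power4_eq_xxxx)
  also have "\<dots> = 625 * r\<^sup>2"
    using r by simp
  finally show ?thesis .
qed auto

text \<open>Lattice sums as integrals against counting measure: values may be infinite, so
  exchanging, shifting and Cauchy-Schwarz carry no summability side conditions.\<close>

abbreviation nsum :: "('a \<Rightarrow> ennreal) \<Rightarrow> ennreal" where
  "nsum f \<equiv> \<integral>\<^sup>+x. f x \<partial>count_space UNIV"

lemma nsum_swap: "nsum (\<lambda>x. nsum (\<lambda>y. f x y)) = nsum (\<lambda>y. nsum (\<lambda>x. f x y))"
  using nn_integral_fst_count_space[of "case_prod f"] nn_integral_snd_count_space[of "case_prod f"] by simp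

lemma nsum_shift:
  fixes f :: "'a::ab_group_add \<Rightarrow> ennreal"
  shows "nsum (\<lambda>x. f (x + c)) = nsum f" "nsum (\<lambda>x. f (c + x)) = nsum f" "nsum (\<lambda>x. f (x - c)) = nsum f" "nsum (\<lambda>x. f (c - x)) = nsum f"
proof -
  have "bij (\<lambda>x. x + c)" "bij (\<lambda>x. c + x)"
    by (auto intro!: bij_betwI[where g = "\<lambda>x. x - c"])
  moreover have "bij (\<lambda>x. x - c)"
    by (auto intro!: bij_betwI[where g = "\<lambda>x. x + c"])
  moreover have "bij (\<lambda>x. c - x)"
    by (auto intro!: bij_betwI[where g = "\<lambda>x. c - x"])
  ultimately show "nsum (\<lambda>x. f (x + c)) = nsum f" "nsum (\<lambda>x. f (c + x)) = nsum f" "nsum (\<lambda>x. f (x - c)) = nsum f" "nsum (\<lambda>x. f (c - x)) = nsum f"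
    by (auto intro: nn_integral_bij_count_space)
qed

lemma nsum_Cauchy_Schwarz: "(nsum (\<lambda>x. f x * g x))\<^sup>2 \<le> nsum (\<lambda>x. (f x)\<^sup>2) * nsum (\<lambda>x. (g x)\<^sup>2)"
  by (rule Cauchy_Schwarz_nn_integral) auto

text \<open>The lattice is the increasing union of the finite cubes, so monotone convergence reduces
  the claim to finite sums.\<close>

lemma nsum_leI:
  fixes f :: "int^'n::finite \<Rightarrow> ennreal"
  assumes "\<And>F. finite F \<Longrightarrow> sum f F \<le> K"
  shows "nsum f \<le> K"
proof -
  have "f \<xi> = (SUP N. f \<xi> * indicator (cube N) \<xi>)" for \<xi>
  proof (rule antisym)
    obtain N where "\<xi> \<in> cube N" using Un_cube by blast
    then show "f \<xi> \<le> (SUP N. f \<xi> * indicator (cube N) \<xi>)"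
      by (intro SUP_upper2[of N]) auto
  qed (auto intro!: SUP_least split: split_indicator)
  then have "nsum f = nsum (\<lambda>\<xi>. SUP N. f \<xi> * indicator (cube N) \<xi>)"
    by simp
  also have "\<dots> = (SUP N. nsum (\<lambda>\<xi>. f \<xi> * indicator (cube N) \<xi>))"
    using cube_mono by (intro nn_integral_monotone_convergence_SUP)
      (auto simp: incseq_def le_fun_def split: split_indicator intro!: mult_left_mono)
  also have "\<dots> = (SUP N. sum f (cube N))"
    by (simp add: nn_integral_count_space_indicator[symmetric] nn_integral_count_space_finite)
  also have "\<dots> \<le> K"
    by (intro SUP_least assms) auto
  finally show ?thesis .
qed

lemma sum_le_nsum: "finite F \<Longrightarrow> sum f F \<le> nsum f"
proof -
  assume F: "finite F"
  then have "sum f F = nsum (\<lambda>x. f x * indicator F x)"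
    by (simp add: nn_integral_count_space_indicator[symmetric] nn_integral_count_space_finite)
  also have "\<dots> \<le> nsum f"
    by (intro nn_integral_mono) (auto split: split_indicator)
  finally show ?thesis .
qed

lemma le_nsum: "f x \<le> nsum f"
  using sum_le_nsum[of "{x}" f] by simp

text \<open>The bridge between \<open>summable_on\<close>, in which Sobolev membership is stated,
  and the extended sums in which the convolution estimates are carried out.\<close>

lemma nsum_real_summable:
  fixes f :: "int^'n::finite \<Rightarrow> real"
  assumes f: "\<And>x. 0 \<le> f x" 
  shows "f summable_on UNIV \<longleftrightarrow> nsum (\<lambda>x. ennreal (f x)) < \<infinity>"
    and "f summable_on UNIV \<Longrightarrow> nsum (\<lambda>x. ennreal (f x)) = ennreal (infsum f UNIV)"
proof -
  have le: "nsum (\<lambda>x. ennreal (f x)) \<le> ennreal (infsum f UNIV)" if "f summable_on UNIV"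
    using that f by (intro nsum_leI) (auto simp: sum_nonneg intro!: ennreal_leI finite_sum_le_infsum)
  show *: "f summable_on UNIV \<longleftrightarrow> nsum (\<lambda>x. ennreal (f x)) < \<infinity>"
  proof
    assume "f summable_on UNIV"
    then show "nsum (\<lambda>x. ennreal (f x)) < \<infinity>"
      using le ennreal_less_top le_less_trans by fastforce
  next
    assume fin: "nsum (\<lambda>x. ennreal (f x)) < \<infinity>"
    have "sum f F \<le> enn2real (nsum (\<lambda>x. ennreal (f x)))" if "finite F" for F
    proof -
      have "ennreal (sum f F) \<le> nsum (\<lambda>x. ennreal (f x))"
        using sum_le_nsum[OF that, of "\<lambda>x. ennreal (f x)"] f by simp
      then show ?thesis
        using fin f by (simp add: ennreal_le_iff2 flip: ennreal_enn2real_if)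
          (metis enn2real_ennreal enn2real_mono fin infinity_ennreal_def sum_nonneg)
    qed
    then show "f summable_on UNIV"
      using f by (intro nonneg_bdd_above_summable_on) (auto simp: bdd_above_def)
  qed
  assume s: "f summable_on UNIV"
  show "nsum (\<lambda>x. ennreal (f x)) = ennreal (infsum f UNIV)"
  proof (rule antisym[OF le[OF s]])
    have fin: "nsum (\<lambda>x. ennreal (f x)) < \<infinity>" using * s by blast
    have "sum f F \<le> enn2real (nsum (\<lambda>x. ennreal (f x)))" if "finite F" for F
      using sum_le_nsum[OF that, of "\<lambda>x. ennreal (f x)"] f fin
      by simp (metis enn2real_ennreal enn2real_mono sum_nonneg)
    then have "infsum f UNIV \<le> enn2real (nsum (\<lambda>x. ennreal (f x)))"
      using s by (intro infsum_le_finite_sums) auto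
    then show "ennreal (infsum f UNIV) \<le> nsum (\<lambda>x. ennreal (f x))"
      using fin by (metis ennreal_enn2real ennreal_leI infinity_ennreal_def)
  qed
qed

section \<open>Convolution estimates\<close>

abbreviation enu :: "int^'n::finite \<Rightarrow> ennreal" where
  "enu \<xi> \<equiv> ennreal (nu \<xi>)"

text \<open>The part of a convolution in which the first factor has the lower frequency, a crude
  paraproduct. Up to a factor 2 it controls the full convolution of a family with itself.\<close>

definition half_conv :: "(int^'n::finite \<Rightarrow> ennreal) \<Rightarrow> (int^'n \<Rightarrow> ennreal) \<Rightarrow> int^'n \<Rightarrow> ennreal" where
  "half_conv a b \<xi> = nsum (\<lambda>\<eta>. if nu \<eta> \<le> nu (\<xi> - \<eta>) then a \<eta> * b (\<xi> - \<eta>) else 0)"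

lemma enu_square_ge: "(a \<xi>)\<^sup>2 \<le> (enu \<xi> * a \<xi>)\<^sup>2" if "\<xi> \<noteq> 0 \<or> a \<xi> = 0"
proof (cases "\<xi> = 0")
  case False
  then have "1 * a \<xi> \<le> enu \<xi> * a \<xi>"
    using nu_ge_1 by (intro mult_right_mono) auto
  then show ?thesis by (simp add: power_mono)
qed (use that in auto)

text \<open>A crude pointwise bound, used only to decide finiteness or vanishing before the sharp
  estimate is applied.\<close>

lemma half_conv_le_Cauchy_Schwarz: "(half_conv a b \<xi>)\<^sup>2 \<le> nsum (\<lambda>\<eta>. (a \<eta>)\<^sup>2) * nsum (\<lambda>\<eta>. (b \<eta>)\<^sup>2)"
proof -
  have "half_conv a b \<xi> \<le> nsum (\<lambda>\<eta>. a \<eta> * b (\<xi> - \<eta>))"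
    unfolding half_conv_def by (intro nn_integral_mono) auto
  then have "(half_conv a b \<xi>)\<^sup>2 \<le> (nsum (\<lambda>\<eta>. a \<eta> * b (\<xi> - \<eta>)))\<^sup>2"
    by (intro power_mono) auto
  also have "\<dots> \<le> nsum (\<lambda>\<eta>. (a \<eta>)\<^sup>2) * nsum (\<lambda>\<eta>. (b (\<xi> - \<eta>))\<^sup>2)"
    by (rule nsum_Cauchy_Schwarz)
  also have "nsum (\<lambda>\<eta>. (b (\<xi> - \<eta>))\<^sup>2) = nsum (\<lambda>\<eta>. (b \<eta>)\<^sup>2)"
    by (rule nsum_shift(4)[of "\<lambda>\<eta>. (b \<eta>)\<^sup>2"])
  finally show ?thesis .
qed

text \<open>The kernel \<open>1 / (\<nu> \<eta> \<nu> \<zeta>)\<close> restricted to \<open>\<nu> \<eta> \<le> \<nu> \<zeta>\<close> is square summable in \<open>\<eta>\<close> uniformly in \<open>\<zeta>\<close>,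
  so the Cauchy--Schwarz inequality has to be applied at fixed \<open>\<zeta>\<close>; at fixed \<open>\<xi> = \<eta> + \<zeta>\<close> it would
  lose a logarithm in dimension four.\<close>

lemma trilinear_bound:
  fixes a b c :: "int^'n::finite \<Rightarrow> ennreal"
  assumes n: "CARD('n) \<le> 4" and a0: "a 0 = 0" and b0: "b 0 = 0"
  shows "(nsum (\<lambda>\<xi>. c \<xi> * half_conv a b \<xi>))\<^sup>2
    \<le> 625 * nsum (\<lambda>\<eta>. (enu \<eta> * a \<eta>)\<^sup>2) * nsum (\<lambda>\<zeta>. (enu \<zeta> * b \<zeta>)\<^sup>2) * nsum (\<lambda>\<xi>. (c \<xi>)\<^sup>2)"
proof -
  define K where "K = (\<lambda>(\<eta> :: int^'n) (\<zeta> :: int^'n). if \<eta> \<noteq> 0 \<and> nu \<eta> \<le> nu \<zeta> then ennreal (1 / (nu \<eta> * nu \<zeta>)) else 0)"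
  define h where "h = (\<lambda>\<zeta>. nsum (\<lambda>\<eta>. (enu \<eta> * a \<eta> * c (\<eta> + \<zeta>)) * K \<eta> \<zeta>))"
  define A where "A = nsum (\<lambda>\<eta>. (enu \<eta> * a \<eta>)\<^sup>2)"
  define B where "B = nsum (\<lambda>\<zeta>. (enu \<zeta> * b \<zeta>)\<^sup>2)"
  \<comment> \<open>Up to dimension four, the sum of \<open>1 / (nu \<eta>)^2\<close> over
    frequencies below \<open>nu \<zeta>\<close> grows at most like the square of
    \<open>nu \<zeta>\<close>, which the second factor of the kernel divides out.\<close>
  have K: "nsum (\<lambda>\<eta>. (K \<eta> \<zeta>)\<^sup>2) \<le> 625" for \<zeta>
  proof (rule nsum_leI)
    fix F :: "(int^'n) set" assume F: "finite F"
    let ?F = "{\<eta>\<in>F. \<eta> \<noteq> 0 \<and> nu \<eta> \<le> nu \<zeta>}"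
    have "(\<Sum>\<eta>\<in>F. (K \<eta> \<zeta>)\<^sup>2) = (\<Sum>\<eta>\<in>?F. ennreal (1 / (nu \<eta>)\<^sup>2 / (nu \<zeta>)\<^sup>2))"
      using F by (intro sum.mono_neutral_cong_right)
        (auto simp: K_def ennreal_power power_mult_distrib power_divide)
    also have "\<dots> = ennreal ((\<Sum>\<eta>\<in>?F. 1 / (nu \<eta>)\<^sup>2) / (nu \<zeta>)\<^sup>2)"
      by (simp add: sum_ennreal sum_divide_distrib)
    also have "\<dots> \<le> ennreal 625"
    proof (intro ennreal_leI)
      have le: "(\<Sum>\<eta>\<in>?F. 1 / (nu \<eta>)\<^sup>2) \<le> 625 * (nu \<zeta>)\<^sup>2"
        using F by (intro sum_inverse_nu_squared_le n) auto
      show "(\<Sum>\<eta>\<in>?F. 1 / (nu \<eta>)\<^sup>2) / (nu \<zeta>)\<^sup>2 \<le> 625"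
      proof (cases "\<zeta> = 0")
        case False
        then show ?thesis using le by (simp add: divide_simps)
      qed simp
    qed
    finally show "(\<Sum>\<eta>\<in>F. (K \<eta> \<zeta>)\<^sup>2) \<le> 625" by simp
  qed
  \<comment> \<open>The kernel cancels the two weights wherever it is nonzero; at the frequency 0,
    which it drops, the coefficients vanish by assumption.\<close>
  have cancel: "(if nu \<eta> \<le> nu \<zeta> then a \<eta> * b \<zeta> else 0) = enu \<zeta> * b \<zeta> * (enu \<eta> * a \<eta> * K \<eta> \<zeta>)" for \<eta> \<zeta>
  proof (cases "\<eta> = 0 \<or> \<zeta> = 0 \<or> \<not> nu \<eta> \<le> nu \<zeta>")
    case False
    then have "enu \<zeta> * (enu \<eta> * ennreal (1 / (nu \<eta> * nu \<zeta>))) = 1"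
      by (simp flip: ennreal_mult)
    then show ?thesis
      using False by (simp add: K_def mult_ac)
  qed (auto simp: a0 b0 K_def)
  have "nsum (\<lambda>\<xi>. c \<xi> * half_conv a b \<xi>)
      = nsum (\<lambda>\<xi>. nsum (\<lambda>\<eta>. c (\<eta> + (\<xi> - \<eta>)) * (enu (\<xi> - \<eta>) * b (\<xi> - \<eta>) * (enu \<eta> * a \<eta> * K \<eta> (\<xi> - \<eta>)))))"
    by (simp add: half_conv_def cancel nn_integral_cmult)
  also have "\<dots> = nsum (\<lambda>\<eta>. nsum (\<lambda>\<xi>. c (\<eta> + (\<xi> - \<eta>)) * (enu (\<xi> - \<eta>) * b (\<xi> - \<eta>) * (enu \<eta> * a \<eta> * K \<eta> (\<xi> - \<eta>)))))"
    by (rule nsum_swap)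
  also have "\<dots> = nsum (\<lambda>\<eta>. nsum (\<lambda>\<zeta>. c (\<eta> + \<zeta>) * (enu \<zeta> * b \<zeta> * (enu \<eta> * a \<eta> * K \<eta> \<zeta>))))"
    by (intro nn_integral_cong nsum_shift(3))
  also have "\<dots> = nsum (\<lambda>\<zeta>. nsum (\<lambda>\<eta>. c (\<eta> + \<zeta>) * (enu \<zeta> * b \<zeta> * (enu \<eta> * a \<eta> * K \<eta> \<zeta>))))"
    by (rule nsum_swap)
  also have "\<dots> = nsum (\<lambda>\<zeta>. (enu \<zeta> * b \<zeta>) * h \<zeta>)"
    unfolding h_def by (subst nn_integral_cmult[symmetric]) (auto intro!: nn_integral_cong simp: mult_ac)
  finally have "(nsum (\<lambda>\<xi>. c \<xi> * half_conv a b \<xi>))\<^sup>2 \<le> B * nsum (\<lambda>\<zeta>. (h \<zeta>)\<^sup>2)"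
    unfolding B_def by (simp only: nsum_Cauchy_Schwarz)
  also have "B * nsum (\<lambda>\<zeta>. (h \<zeta>)\<^sup>2) \<le> B * nsum (\<lambda>\<zeta>. 625 * nsum (\<lambda>\<eta>. (enu \<eta> * a \<eta>)\<^sup>2 * (c (\<eta> + \<zeta>))\<^sup>2))"
  proof (intro mult_left_mono nn_integral_mono)
    fix \<zeta>
    \<comment> \<open>The second Cauchy-Schwarz inequality, in \<open>\<eta>\<close> at fixed
      \<open>\<zeta>\<close>, spends the uniform bound on the kernel.\<close>
    have "(h \<zeta>)\<^sup>2 \<le> nsum (\<lambda>\<eta>. (enu \<eta> * a \<eta> * c (\<eta> + \<zeta>))\<^sup>2) * nsum (\<lambda>\<eta>. (K \<eta> \<zeta>)\<^sup>2)"
      unfolding h_def by (rule nsum_Cauchy_Schwarz)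
    also have "\<dots> \<le> nsum (\<lambda>\<eta>. (enu \<eta> * a \<eta> * c (\<eta> + \<zeta>))\<^sup>2) * 625"
      by (intro mult_left_mono K) auto
    finally show "(h \<zeta>)\<^sup>2 \<le> 625 * nsum (\<lambda>\<eta>. (enu \<eta> * a \<eta>)\<^sup>2 * (c (\<eta> + \<zeta>))\<^sup>2)"
      by (simp add: power_mult_distrib mult.commute)
  qed simp
  also have "nsum (\<lambda>\<zeta>. 625 * nsum (\<lambda>\<eta>. (enu \<eta> * a \<eta>)\<^sup>2 * (c (\<eta> + \<zeta>))\<^sup>2)) = 625 * nsum (\<lambda>\<zeta>. nsum (\<lambda>\<eta>. (enu \<eta> * a \<eta>)\<^sup>2 * (c (\<eta> + \<zeta>))\<^sup>2))"
    by (rule nn_integral_cmult) auto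
  also have "nsum (\<lambda>\<zeta>. nsum (\<lambda>\<eta>. (enu \<eta> * a \<eta>)\<^sup>2 * (c (\<eta> + \<zeta>))\<^sup>2))
      = nsum (\<lambda>\<eta>. nsum (\<lambda>\<zeta>. (enu \<eta> * a \<eta>)\<^sup>2 * (c (\<eta> + \<zeta>))\<^sup>2))"
    by (rule nsum_swap)
  also have "\<dots> = nsum (\<lambda>\<eta>. (enu \<eta> * a \<eta>)\<^sup>2 * nsum (\<lambda>\<xi>. (c \<xi>)\<^sup>2))"
    by (simp add: nn_integral_cmult nsum_shift(2)[of "\<lambda>\<xi>. (c \<xi>)\<^sup>2"])
  also have "\<dots> = A * nsum (\<lambda>\<xi>. (c \<xi>)\<^sup>2)"
    by (simp add: A_def nn_integral_multc)
  finally show ?thesis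
    unfolding A_def[symmetric] B_def[symmetric] by (simp add: mult_ac)
qed

text \<open>The critical product estimate \<open>H\<^sup>1 \<cdot> H\<^sup>1 \<subseteq> L\<^sup>2\<close>, by duality from the trilinear bound.\<close>

lemma half_conv_bound:
  fixes a b :: "int^'n::finite \<Rightarrow> ennreal"
  assumes n: "CARD('n) \<le> 4" and a0: "a 0 = 0" and b0: "b 0 = 0"
  shows "nsum (\<lambda>\<xi>. (half_conv a b \<xi>)\<^sup>2) \<le> 625 * nsum (\<lambda>\<eta>. (enu \<eta> * a \<eta>)\<^sup>2) * nsum (\<lambda>\<zeta>. (enu \<zeta> * b \<zeta>)\<^sup>2)"
    (is "_ \<le> 625 * ?A * ?B")
proof (cases "?A = \<infinity> \<or> ?B = \<infinity>")
  \<comment> \<open>Zero times infinity is 0 in \<open>ennreal\<close>, so one infinite norm does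
    not make the right-hand side infinite when the other norm vanishes; the half convolution must
    then be shown to vanish too.\<close>
  case True
  have "half_conv a b \<xi> = 0" if "?A = 0 \<or> ?B = 0" for \<xi>
  proof -
    have "(half_conv a b \<xi>)\<^sup>2 \<le> nsum (\<lambda>\<eta>. (a \<eta>)\<^sup>2) * nsum (\<lambda>\<eta>. (b \<eta>)\<^sup>2)"
      by (rule half_conv_le_Cauchy_Schwarz)
    moreover have "nsum (\<lambda>\<eta>. (a \<eta>)\<^sup>2) = 0 \<or> nsum (\<lambda>\<eta>. (b \<eta>)\<^sup>2) = 0"
      using that a0 b0 by (auto simp: nn_integral_0_iff_AE AE_count_space) metis+
    ultimately show ?thesis by auto
  qed
  with True show ?thesis
    by (cases "?A = 0 \<or> ?B = 0") (auto simp: ennreal_mult_top ennreal_top_mult ennreal_mult_eq_top_iff)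
next
  case False
  show ?thesis
  proof (rule nsum_leI)
    fix F :: "(int^'n) set" assume F: "finite F"
    \<comment> \<open>Duality: testing with the half convolution itself, cut off to
      \<open>F\<close>, gives \<open>G * G \<le> 625 * A * B * G\<close> in terms of the two norms.
      The cut-off makes \<open>G\<close> finite, which permits dividing by it.\<close>
    define c where "c = (\<lambda>\<xi>. half_conv a b \<xi> * indicator F \<xi>)"
    define G where "G = (\<Sum>\<xi>\<in>F. (half_conv a b \<xi>)\<^sup>2)"
    have G1: "nsum (\<lambda>\<xi>. c \<xi> * half_conv a b \<xi>) = G"
    proof -
      have "(\<lambda>\<xi>. c \<xi> * half_conv a b \<xi>) = (\<lambda>\<xi>. (half_conv a b \<xi>)\<^sup>2 * indicator F \<xi>)"
        by (auto simp: c_def power2_eq_square mult_ac)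
      then show ?thesis
        using F by (simp add: G_def nn_integral_count_space_indicator[symmetric] nn_integral_count_space_finite)
    qed
    have G2: "nsum (\<lambda>\<xi>. (c \<xi>)\<^sup>2) = G"
    proof -
      have "(\<lambda>\<xi>. (c \<xi>)\<^sup>2) = (\<lambda>\<xi>. (half_conv a b \<xi>)\<^sup>2 * indicator F \<xi>)"
        by (auto simp: c_def fun_eq_iff split: split_indicator)
      then show ?thesis
        using F by (simp add: G_def nn_integral_count_space_indicator[symmetric] nn_integral_count_space_finite)
    qed
    have "(half_conv a b \<xi>)\<^sup>2 < \<infinity>" for \<xi>
    proof -
      have "nsum (\<lambda>\<eta>. (a \<eta>)\<^sup>2) \<le> ?A" "nsum (\<lambda>\<eta>. (b \<eta>)\<^sup>2) \<le> ?B"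
        using a0 b0 by (auto intro!: nn_integral_mono enu_square_ge)
      then have "nsum (\<lambda>\<eta>. (a \<eta>)\<^sup>2) * nsum (\<lambda>\<eta>. (b \<eta>)\<^sup>2) < \<infinity>"
        using False by (auto simp: ennreal_mult_less_top less_top top_unique ennreal_mult_eq_top_iff)
      then show ?thesis
        using half_conv_le_Cauchy_Schwarz le_less_trans by blast
    qed
    then have Gfin: "G < \<infinity>"
      using F by (simp add: G_def ennreal_sum_less_top)
    have GG: "G * G \<le> (625 * ?A * ?B) * G"
      using trilinear_bound[where a = a and b = b and c = c, OF n a0 b0] by (simp only: G1 G2 power2_eq_square[of G])
    show "G \<le> 625 * ?A * ?B"
    proof (cases "G = 0")
      case False
      then show ?thesis
        using GG Gfin ennreal_mult_le_mult_iff[of G G "625 * ?A * ?B"] by (simp add: mult.commute less_top)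
    qed auto
  qed
qed

text \<open>Young's inequality: convolution with an absolutely summable family is bounded on square
  summable ones.\<close>

lemma nsum_conv_bound:
  fixes a b :: "int^'n::finite \<Rightarrow> ennreal"
  shows "nsum (\<lambda>\<xi>. (nsum (\<lambda>\<eta>. a \<eta> * b (\<xi> - \<eta>)))\<^sup>2) \<le> (nsum a)\<^sup>2 * nsum (\<lambda>\<zeta>. (b \<zeta>)\<^sup>2)"
proof -
  \<comment> \<open>A square root of the kernel, so that Cauchy-Schwarz can put one half on each
    factor. \<open>enn2real\<close> sends infinity to 0, hence the separate treatment of infinite
    values.\<close>
  define r where "r = (\<lambda>\<eta>. ennreal (sqrt (enn2real (a \<eta>))))"
  show ?thesis
  proof (cases "\<exists>\<eta>. a \<eta> = \<infinity>")
    case True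
    then have "nsum a = \<infinity>"
      using le_nsum[of a] by (metis infinity_ennreal_def top.extremum_uniqueI)
    show ?thesis
    proof (cases "nsum (\<lambda>\<zeta>. (b \<zeta>)\<^sup>2) = 0")
      case True
      then have "b = (\<lambda>_. 0)"
        by (auto simp: nn_integral_0_iff_AE AE_count_space)
      then show ?thesis by simp
    qed (auto simp: \<open>nsum a = \<infinity>\<close> ennreal_top_mult)
  next
    case False
    then have r: "r \<eta> * r \<eta> = a \<eta>" for \<eta>
      by (cases "a \<eta>") (auto simp: r_def simp flip: ennreal_mult)
    have "nsum (\<lambda>\<xi>. (nsum (\<lambda>\<eta>. a \<eta> * b (\<xi> - \<eta>)))\<^sup>2) \<le> nsum (\<lambda>\<xi>. nsum a * nsum (\<lambda>\<eta>. a \<eta> * (b (\<xi> - \<eta>))\<^sup>2))"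
    proof (rule nn_integral_mono)
      fix \<xi>
      have "nsum (\<lambda>\<eta>. a \<eta> * b (\<xi> - \<eta>)) = nsum (\<lambda>\<eta>. r \<eta> * (r \<eta> * b (\<xi> - \<eta>)))"
        by (simp add: r flip: mult.assoc)
      then have "(nsum (\<lambda>\<eta>. a \<eta> * b (\<xi> - \<eta>)))\<^sup>2 \<le> nsum (\<lambda>\<eta>. (r \<eta>)\<^sup>2) * nsum (\<lambda>\<eta>. (r \<eta> * b (\<xi> - \<eta>))\<^sup>2)"
        by (simp only: nsum_Cauchy_Schwarz)
      then show "(nsum (\<lambda>\<eta>. a \<eta> * b (\<xi> - \<eta>)))\<^sup>2 \<le> nsum a * nsum (\<lambda>\<eta>. a \<eta> * (b (\<xi> - \<eta>))\<^sup>2)"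
        by (simp add: power_mult_distrib) (simp add: power2_eq_square r)
    qed
    also have "\<dots> = nsum a * nsum (\<lambda>\<eta>. nsum (\<lambda>\<xi>. a \<eta> * (b (\<xi> - \<eta>))\<^sup>2))"
      by (subst nn_integral_cmult) (auto intro: arg_cong[OF nsum_swap])
    also have "\<dots> = nsum a * nsum (\<lambda>\<eta>. a \<eta> * nsum (\<lambda>\<zeta>. (b \<zeta>)\<^sup>2))"
      by (simp add: nn_integral_cmult nsum_shift(3)[of "\<lambda>\<xi>. (b \<xi>)\<^sup>2"])
    also have "\<dots> = (nsum a)\<^sup>2 * nsum (\<lambda>\<zeta>. (b \<zeta>)\<^sup>2)"
      by (simp add: nn_integral_multc power2_eq_square mult.assoc)
    finally show ?thesis .
  qed
qed

section \<open>Galerkin approximation\<close>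

text \<open>Bilinear, without conjugation: up to the factor \<open>2 * pi * \<i>\<close> this is the
  Fourier coefficient of a divergence.\<close>

definition dot :: "int^'n::finite \<Rightarrow> complex^'n \<Rightarrow> complex" where
  "dot \<xi> w = (\<Sum>k\<in>UNIV. of_int (\<xi> $ k) * w $ k)"

definition cfreq :: "int^'n::finite \<Rightarrow> complex^'n" where
  "cfreq \<xi> = (\<chi> k. of_int (\<xi> $ k))"

text \<open>Real fields are those with \<open>u (- \<xi>) = vcnj (u \<xi>)\<close>.\<close>

definition vcnj :: "complex^'n::finite \<Rightarrow> complex^'n" where
  "vcnj w = (\<chi> k. cnj (w $ k))"

lemma vcnj_nth [simp]: "vcnj w $ k = cnj (w $ k)"
  by (simp add: vcnj_def)

lemma vcnj_simps [simp]:
  "vcnj (v + w) = vcnj v + vcnj w" "vcnj (v - w) = vcnj v - vcnj w" "vcnj (r *\<^sub>R v) = r *\<^sub>R vcnj v"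
  "vcnj (z *s v) = cnj z *s vcnj v" "vcnj (vcnj v) = v" "norm (vcnj v) = norm v" "vcnj 0 = 0"
  by (auto simp: vec_eq_iff norm_vec_def)

lemma vcnj_sum: "vcnj (sum f A) = (\<Sum>x\<in>A. vcnj (f x))"
  by (simp add: vec_eq_iff)

lemma vcnj_cfreq [simp]: "vcnj (cfreq \<xi>) = cfreq \<xi>"
  by (simp add: vec_eq_iff cfreq_def)

lemma cfreq_uminus [simp]: "cfreq (- \<xi>) = - cfreq \<xi>"
  by (simp add: vec_eq_iff cfreq_def)

lemma dot_simps [simp]:
  "dot \<xi> (v + w) = dot \<xi> v + dot \<xi> w" "dot \<xi> (v - w) = dot \<xi> v - dot \<xi> w"
  "dot \<xi> (z *s v) = z * dot \<xi> v" "dot \<xi> (r *\<^sub>R v) = r *\<^sub>R dot \<xi> v" "dot (- \<xi>) v = - dot \<xi> v"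
  "dot (\<xi> + \<eta>) v = dot \<xi> v + dot \<eta> v" "dot (\<xi> - \<eta>) v = dot \<xi> v - dot \<eta> v"
  "dot \<xi> (vcnj v) = cnj (dot \<xi> v)" "dot 0 v = 0" "dot \<xi> 0 = 0"
  by (auto simp: dot_def algebra_simps sum.distrib sum_subtractf sum_negf sum_distrib_left scaleR_conv_of_real[where 'a = complex])

lemma nu_squared: "(nu \<xi>)\<^sup>2 = (\<Sum>k\<in>UNIV. (of_int (\<xi> $ k))\<^sup>2)"
  by (simp add: nu_def norm_vec_def L2_set_def sum_nonneg)

lemma dot_cfreq [simp]: "dot \<xi> (cfreq \<xi>) = of_real ((nu \<xi>)\<^sup>2)"
  by (simp add: dot_def cfreq_def nu_squared del: of_real_power) (simp add: power2_eq_square)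

lemma norm_vscale: "norm (z *s v) = cmod z * norm (v :: complex^'n::finite)"
  by (simp add: norm_vec_def L2_set_right_distrib[symmetric] norm_mult)

lemma cmod_dot_le: "cmod (dot \<xi> w) \<le> nu \<xi> * norm w"
proof -
  have "cmod (dot \<xi> w) \<le> (\<Sum>k\<in>UNIV. \<bar>of_int (\<xi> $ k)\<bar> * \<bar>cmod (w $ k)\<bar>)"
    unfolding dot_def by (intro order_trans[OF norm_sum] sum_mono) (simp add: norm_mult)
  also have "\<dots> \<le> L2_set (\<lambda>k. of_int (\<xi> $ k)) UNIV * L2_set (\<lambda>k. cmod (w $ k)) UNIV"
    by (rule L2_set_mult_ineq)
  also have "\<dots> = nu \<xi> * norm w"
    by (simp add: nu_def norm_vec_def L2_set_def)
  finally show ?thesis .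
qed

lemma inner_vscale: "v \<bullet> (z *s w) = Re (z * (\<Sum>k\<in>UNIV. cnj (v $ k) * w $ k))"
proof -
  have "v \<bullet> (z *s w) = Re (\<Sum>k\<in>UNIV. z * (cnj (v $ k) * w $ k))"
    by (simp add: inner_vec_def inner_complex_def algebra_simps)
  then show ?thesis by (simp only: sum_distrib_left)
qed

text \<open>The inner product on \<open>complex^'n\<close> is the real part of the Hermitian one. A
  pressure gradient is therefore orthogonal to every amplitude with \<open>dot \<xi> w = 0\<close>,
  and testing an equation with such an amplitude eliminates the pressure.\<close>

lemma inner_cfreq: "w \<bullet> (z *s cfreq \<xi>) = Re (z * cnj (dot \<xi> w))"
  by (simp add: inner_vscale dot_def cfreq_def mult.commute)

text \<open>Isolates what the analysis uses of the viscous operator. Coercivity is asked only on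
  divergence-free amplitudes, which is all that relaxed ellipticity delivers; \<open>M_cnj\<close>
  expresses that the operator maps real fields to real fields.\<close>

locale stokes_symbol =
  fixes M :: "int^'n::finite \<Rightarrow> complex^'n \<Rightarrow> complex^'n" and c :: real
  assumes linear_M: "linear (M \<xi>)"
    and c_pos: "c > 0"
    and elliptic: "dot \<xi> w = 0 \<Longrightarrow> c * (nu \<xi>)\<^sup>2 * (norm w)\<^sup>2 \<le> w \<bullet> M \<xi> w"
    and M_cnj: "M (- \<xi>) (vcnj w) = vcnj (M \<xi> w)"
begin

lemma M_diff: "M \<xi> (v - w) = M \<xi> v - M \<xi> w"
  by (rule linear_diff[OF linear_M])

lemma M_zero [simp]: "M \<xi> 0 = 0"
  by (rule linear_0[OF linear_M])

text \<open>The difference of two solutions is tested with itself: the pressure terms drop out and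
  coercivity forces it to vanish.\<close>

lemma solution_unique:
  assumes "\<xi> \<noteq> 0" "dot \<xi> v = 0" "dot \<xi> w = 0" "M \<xi> v + p *s cfreq \<xi> = M \<xi> w + q *s cfreq \<xi>"
  shows "v = w"
proof -
  have M: "M \<xi> (v - w) = (q - p) *s cfreq \<xi>"
    using assms(4) by (simp add: M_diff vec_eq_iff algebra_simps)
  have "(v - w) \<bullet> M \<xi> (v - w) = 0"
    unfolding M inner_cfreq using assms by simp
  with elliptic[of \<xi> "v - w"] have "c * (nu \<xi>)\<^sup>2 * (norm (v - w))\<^sup>2 \<le> 0"
    using assms by simp
  moreover have "c * (nu \<xi>)\<^sup>2 > 0"
    using c_pos assms(1) by simp
  ultimately show ?thesis
    by (metis eq_iff_diff_eq_0 mult_le_cancel_left_pos mult_zero_right norm_eq_zero power2_less_eq_zero_iff)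
qed

text \<open>The operator compressed to divergence-free amplitudes is completed by the identity on
  the complementary direction. The result is an endomorphism of a finite-dimensional space, so
  injectivity yields a linear inverse.\<close>

lemma solution_exists:
  assumes "\<xi> \<noteq> 0"
  shows "\<exists>S. linear S \<and> (\<forall>F. dot \<xi> (S F) = 0 \<and> (\<exists>p. M \<xi> (S F) + p *s cfreq \<xi> = F))"
proof -
  \<comment> \<open>Projection along \<open>cfreq \<xi>\<close> onto divergence-free amplitudes, the
    Leray projection at one frequency.\<close>
  define P where "P = (\<lambda>w. w - (dot \<xi> w / of_real ((nu \<xi>)\<^sup>2)) *s cfreq \<xi>)"
  define L where "L = (\<lambda>w. P (M \<xi> (P w)) + (w - P w))"
  have nu: "complex_of_real ((nu \<xi>)\<^sup>2) \<noteq> 0"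
    using assms by simp
  have dotP: "dot \<xi> (P w) = 0" for w
    using nu by (simp add: P_def del: of_real_power)
  have PP: "P (P w) = P w" for w
    using dotP[of w] by (subst P_def) simp
  have linP: "linear P"
    unfolding P_def
    by (rule linearI) (auto simp: vec_eq_iff field_simps add_divide_distrib scaleR_conv_of_real[where 'a = complex])
  have linL: "linear L"
    unfolding L_def
    using linear_compose[OF linear_compose[OF linP linear_M] linP] linP
    by (intro linear_compose_add linear_compose_sub) (auto simp: o_def linear_ident)
  have PL: "P (L w) = P (M \<xi> (P w))" for w
    by (simp add: L_def linear_add[OF linP] linear_diff[OF linP] PP)
  have key: "w = P w \<and> P (M \<xi> w) = P F" if "L w = P F" for w F
  proof -
    have "P (M \<xi> (P w)) = P F"
      using PL[of w] that by (simp add: PP)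
    moreover from this have "w = P w"
      using that by (simp add: L_def)
    ultimately show ?thesis by metis
  qed
  have solves: "dot \<xi> w = 0 \<and> (\<exists>p. M \<xi> w + p *s cfreq \<xi> = F)" if "L w = P F" for w F
  proof (intro conjI exI)
    show "dot \<xi> w = 0"
      using key[OF that] dotP by metis
    \<comment> \<open>Equality of the projections leaves a difference along
      \<open>cfreq \<xi>\<close>; its coefficient is the pressure.\<close>
    have "M \<xi> w - (dot \<xi> (M \<xi> w) / of_real ((nu \<xi>)\<^sup>2)) *s cfreq \<xi>
        = F - (dot \<xi> F / of_real ((nu \<xi>)\<^sup>2)) *s cfreq \<xi>"
      using key[OF that] by (simp add: P_def)
    then show "M \<xi> w + ((dot \<xi> F - dot \<xi> (M \<xi> w)) / of_real ((nu \<xi>)\<^sup>2)) *s cfreq \<xi> = F"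
      by (simp add: vec_eq_iff diff_divide_distrib algebra_simps)
  qed
  have "inj L"
  proof (subst linear_injective_0[OF linL], intro allI impI)
    fix w assume "L w = 0"
    then have "L w = P 0" by (simp add: linear_0[OF linP])
    then obtain p where "dot \<xi> w = 0" "M \<xi> w + p *s cfreq \<xi> = 0"
      using solves by blast
    then show "w = 0"
      using solution_unique[OF assms, of w 0 p 0] by simp
  qed
  then obtain L' where L': "linear L'" "\<And>x. L (L' x) = x"
    using linear_injective_isomorphism[OF linL] by blast
  then have "L (L' (P F)) = P F" for F by blast
  with solves have "\<forall>F. dot \<xi> ((L' \<circ> P) F) = 0 \<and> (\<exists>p. M \<xi> ((L' \<circ> P) F) + p *s cfreq \<xi> = F)"
    by simp
  moreover have "linear (L' \<circ> P)"
    using linP L'(1) by (rule linear_compose)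
  ultimately show ?thesis by blast
qed

text \<open>For \<open>\<xi> \<noteq> 0\<close> the choice is unambiguous by
  \<open>solution_unique\<close>, and only the velocity is kept.\<close>

definition solve :: "int^'n \<Rightarrow> complex^'n \<Rightarrow> complex^'n" where
  "solve \<xi> = (SOME S. linear S \<and> (\<forall>F. dot \<xi> (S F) = 0 \<and> (\<exists>p. M \<xi> (S F) + p *s cfreq \<xi> = F)))"

lemma
  assumes "\<xi> \<noteq> 0"
  shows linear_solve: "linear (solve \<xi>)"
    and dot_solve: "dot \<xi> (solve \<xi> F) = 0"
    and solve_eq: "\<exists>p. M \<xi> (solve \<xi> F) + p *s cfreq \<xi> = F"
  using someI_ex[OF solution_exists[OF assms], folded solve_def] by blast+

text \<open>Conjugating the equation at \<open>\<xi>\<close> gives the equation at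
  \<open>- \<xi>\<close>, with pressure coefficient \<open>- cnj p\<close> because
  \<open>cfreq\<close> is odd; uniqueness identifies the velocities.\<close>

lemma solve_cnj:
  assumes "\<xi> \<noteq> 0"
  shows "solve (- \<xi>) (vcnj F) = vcnj (solve \<xi> F)"
proof -
  obtain p where p: "M \<xi> (solve \<xi> F) + p *s cfreq \<xi> = F"
    using solve_eq[OF assms] by blast
  have "vcnj (M \<xi> (solve \<xi> F) + p *s cfreq \<xi>) = vcnj F"
    by (simp only: p)
  then have "M (- \<xi>) (vcnj (solve \<xi> F)) + (- cnj p) *s cfreq (- \<xi>) = vcnj F"
    by (simp add: M_cnj vec_eq_iff)
  moreover obtain q where "M (- \<xi>) (solve (- \<xi>) (vcnj F)) + q *s cfreq (- \<xi>) = vcnj F"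
    using solve_eq[of "- \<xi>"] assms by auto
  ultimately show ?thesis
    using assms dot_solve[OF assms, of F] dot_solve[of "- \<xi>" "vcnj F"]
    by (intro solution_unique[of "- \<xi>" "solve (- \<xi>) (vcnj F)" "vcnj (solve \<xi> F)" q "- cnj p"]) simp_all
qed

text \<open>Testing with the solution removes the pressure, and coercivity then gains two
  derivatives.\<close>

lemma norm_solve_le:
  assumes "\<xi> \<noteq> 0"
  shows "norm (solve \<xi> F) \<le> norm F / (c * (nu \<xi>)\<^sup>2)"
proof -
  let ?w = "solve \<xi> F"
  obtain p where p: "M \<xi> ?w + p *s cfreq \<xi> = F"
    using solve_eq[OF assms] by blast
  have "?w \<bullet> M \<xi> ?w = ?w \<bullet> F"
    using arg_cong[OF p, of "\<lambda>v. ?w \<bullet> v"] dot_solve[OF assms, of F] by (simp add: inner_add_right inner_cfreq)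
  then have "c * (nu \<xi>)\<^sup>2 * (norm ?w)\<^sup>2 \<le> ?w \<bullet> F"
    using elliptic[OF dot_solve[OF assms, of F]] by simp
  also have "\<dots> \<le> norm ?w * norm F"
    by (rule norm_cauchy_schwarz)
  finally have "norm ?w * (c * (nu \<xi>)\<^sup>2 * norm ?w) \<le> norm ?w * norm F"
    by (simp add: power2_eq_square mult_ac)
  then have "c * (nu \<xi>)\<^sup>2 * norm ?w \<le> norm F"
    by (cases "?w = 0") auto
  then show ?thesis
    using c_pos assms by (simp add: field_simps)
qed

end

text \<open>The involution sending \<open>(\<xi>, \<eta>)\<close> to
  \<open>(\<xi> - \<eta>, - \<eta>)\<close> conjugates the trilinear summand \<open>X\<close>. The
  factor \<open>\<i>\<close> then reverses the sign of the real part, so the sum equals its own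
  negative.\<close>

lemma convection_energy:
  fixes u :: "int^'n::finite \<Rightarrow> complex^'n"
  assumes sym: "\<And>\<xi>. u (- \<xi>) = vcnj (u \<xi>)" and supp: "\<And>\<xi>. \<xi> \<notin> cube N \<Longrightarrow> u \<xi> = 0"
    and dfree: "\<And>\<xi>. dot \<xi> (u \<xi>) = 0"
  shows "(\<Sum>\<xi>\<in>cube N. u \<xi> \<bullet> (\<Sum>\<eta>\<in>cube N. (2 * pi * \<i> * dot \<xi> (u \<eta>)) *s u (\<xi> - \<eta>))) = 0"
proof -
  define s where "s = (\<lambda>(\<xi>, \<eta>). u \<xi> \<bullet> ((2 * pi * \<i> * dot \<xi> (u \<eta>)) *s u (\<xi> - \<eta>)))"
  define X where "X = (\<lambda>\<xi> \<eta>. dot \<xi> (u \<eta>) * (\<Sum>k\<in>UNIV. cnj (u \<xi> $ k) * u (\<xi> - \<eta>) $ k))"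
  \<comment> \<open>Requiring \<open>\<xi> - \<eta>\<close> to lie in the cube discards only zero
    terms and makes the index set invariant under the involution.\<close>
  define A :: "((int^'n) \<times> (int^'n)) set" where "A = {(\<xi>, \<eta>) \<in> cube N \<times> cube N. \<xi> - \<eta> \<in> cube N}"
  have s0: "s (\<xi>, \<eta>) = 0" if "\<xi> - \<eta> \<notin> cube N" for \<xi> \<eta>
    by (simp add: s_def supp[OF that])
  have sX: "s (\<xi>, \<eta>) = Re (2 * pi * \<i> * X \<xi> \<eta>)" for \<xi> \<eta>
    by (simp only: s_def X_def inner_vscale prod.case mult.assoc)
  have "(\<Sum>\<xi>\<in>cube N. u \<xi> \<bullet> (\<Sum>\<eta>\<in>cube N. (2 * pi * \<i> * dot \<xi> (u \<eta>)) *s u (\<xi> - \<eta>)))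
      = sum s (cube N \<times> cube N)"
    by (simp add: s_def inner_sum_right sum.cartesian_product)
  moreover have "sum s (cube N \<times> cube N) = sum s A"
    unfolding A_def by (rule sum.mono_neutral_right) (auto intro: s0)
  moreover have "sum s A = - sum s A"
  proof -
  have "sum s A = (\<Sum>x\<in>A. s (fst x - snd x, - snd x))"
    unfolding A_def
    by (rule sum.reindex_bij_witness[where i = "\<lambda>x. (fst x - snd x, - snd x)" and j = "\<lambda>x. (fst x - snd x, - snd x)"]) auto
  also have "\<dots> = (\<Sum>x\<in>A. - s x)"
  proof (rule sum.cong[OF refl], clarify)
    fix \<xi> \<eta> :: "int^'n"
    \<comment> \<open>The divergence condition at \<open>\<eta>\<close> removes the second half of
      the multiplier.\<close>
    have "dot (\<xi> - \<eta>) (u (- \<eta>)) = cnj (dot \<xi> (u \<eta>))"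
      using dfree[of "\<eta>"] by (simp add: sym)
    then have "X (\<xi> - \<eta>) (- \<eta>) = cnj (X \<xi> \<eta>)"
      by (simp add: X_def mult.commute)
    then show "s (fst (\<xi>, \<eta>) - snd (\<xi>, \<eta>), - snd (\<xi>, \<eta>)) = - s (\<xi>, \<eta>)"
      by (simp add: sX)
  qed
  finally show ?thesis by (simp add: sum_negf)
  qed
  ultimately show ?thesis by linarith
qed

context stokes_symbol
begin

text \<open>A Leray-Schauder argument: Brouwer is applied to a scaled Galerkin map. The energy
  estimate holds for fixed points of the scaled map with the same constant, and it rules out that
  the scaling acted at all.\<close>

lemma galerkin_solution:
  fixes f :: "int^'n \<Rightarrow> complex^'n"
  assumes f_sym: "\<And>\<xi>. f (- \<xi>) = vcnj (f \<xi>)" and fE: "(\<Sum>\<xi>\<in>cube N. (norm (f \<xi>))\<^sup>2) \<le> E"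
  obtains u where "\<And>\<xi>. u (- \<xi>) = vcnj (u \<xi>)" "\<And>\<xi>. \<xi> \<notin> cube N \<Longrightarrow> u \<xi> = 0" "u 0 = 0"
    "\<And>\<xi>. dot \<xi> (u \<xi>) = 0" "(\<Sum>\<xi>\<in>cube N. (nu \<xi>)\<^sup>2 * (norm (u \<xi>))\<^sup>2) \<le> E / c\<^sup>2"
    "\<And>\<xi>. \<xi> \<in> cube N \<Longrightarrow> \<xi> \<noteq> 0 \<Longrightarrow>
      u \<xi> = solve \<xi> (f \<xi> - (\<Sum>\<eta>\<in>cube N. (2 * pi * \<i> * dot \<xi> (u \<eta>)) *s u (\<xi> - \<eta>)))"
proof -
  define I where "I = cube N - {0 :: int^'n}"
  \<comment> \<open>Projection onto conjugate symmetric fields supported on the nonzero truncated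
    frequencies. Built into \<open>T\<close>, it makes the fixed point a real field.\<close>
  define real_part where "real_part = (\<lambda>(z :: int^'n \<Rightarrow> complex^'n) \<xi>.
    if \<xi> \<in> I then (1/2) *\<^sub>R (z \<xi> + vcnj (z (- \<xi>))) else 0)"
  define B where "B = (\<lambda>(u :: int^'n \<Rightarrow> complex^'n) \<xi>.
    \<Sum>\<eta>\<in>cube N. (2 * pi * \<i> * dot \<xi> (u \<eta>)) *s u (\<xi> - \<eta>))"
  define T where "T = (\<lambda>z \<xi>. solve \<xi> (f \<xi> - B (real_part z) \<xi>))"
  define \<Phi> where "\<Phi> = (\<lambda>z. \<Sum>\<xi>\<in>I. norm (T z \<xi>))"
  have E: "E \<ge> 0"
    using fE by (meson order_trans sum_nonneg zero_le_power2)
  \<comment> \<open>Exceeds every value of the sum of norms that the energy bound allows, by way of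
    \<open>norm v \<le> 1 + (norm v)^2\<close>; the final 1 makes the excess strict.\<close>
  define R where "R = real (card I) + E / c\<^sup>2 + 1"
  have R: "R > 0"
    using E c_pos by (simp add: R_def add_nonneg_pos)
  \<comment> \<open>A continuous scaling that keeps each component of \<open>T z\<close> within
    \<open>R\<close>, so that Brouwer applies whatever the size of the data.\<close>
  define lam where "lam = (\<lambda>z. 1 / max 1 (\<Phi> z / R))"
  have I0: "\<xi> \<in> I \<Longrightarrow> \<xi> \<noteq> 0" "finite I" "- \<xi> \<in> I \<longleftrightarrow> \<xi> \<in> I" for \<xi>
    by (auto simp: I_def)
  obtain z where z: "\<And>\<xi>. \<xi> \<in> I \<Longrightarrow> lam z *\<^sub>R T z \<xi> = z \<xi>"
  proof (rule brouwer_finite_product[where g = "\<lambda>z \<xi>. lam z *\<^sub>R T z \<xi>" and I = I and R = R])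
    show "norm (lam z *\<^sub>R T z \<xi>) \<le> R" if "\<xi> \<in> I" for z \<xi>
    proof -
      have "norm (T z \<xi>) \<le> \<Phi> z"
        unfolding \<Phi>_def using that I0(2) by (intro member_le_sum) auto
      also have "\<Phi> z \<le> R * max 1 (\<Phi> z / R)"
        using R by (simp add: max_def divide_simps)
      finally show ?thesis
        using R by (simp add: lam_def divide_simps mult.commute)
    qed
    fix X :: "nat \<Rightarrow> int^'n \<Rightarrow> complex^'n" and x \<xi>
    assume \<xi>: "\<xi> \<in> I" and X: "\<And>j. (\<lambda>m. X m j) \<longlonglongrightarrow> x j"
    have lim_vcnj: "(\<lambda>m. vcnj (v m)) \<longlonglongrightarrow> vcnj w" if "v \<longlonglongrightarrow> w" for v w
      using that unfolding vcnj_def by (intro tendsto_intros)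
    have lim_real: "(\<lambda>m. real_part (X m) \<eta>) \<longlonglongrightarrow> real_part x \<eta>" for \<eta>
      by (auto simp: real_part_def intro!: tendsto_intros X lim_vcnj)
    have lim_B: "(\<lambda>m. B (real_part (X m)) \<eta>) \<longlonglongrightarrow> B (real_part x) \<eta>" for \<eta>
      unfolding B_def dot_def vector_scalar_mult_def by (intro tendsto_intros lim_real)
    have lim_T: "(\<lambda>m. T (X m) \<eta>) \<longlonglongrightarrow> T x \<eta>" if "\<eta> \<in> I" for \<eta>
    proof -
      have "bounded_linear (solve \<eta>)"
        using linear_solve I0(1)[OF that] linear_conv_bounded_linear by blast
      then show ?thesis
        unfolding T_def by (rule bounded_linear.tendsto) (intro tendsto_diff tendsto_const lim_B)
    qed
    have "(\<lambda>m. \<Phi> (X m)) \<longlonglongrightarrow> \<Phi> x"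
      unfolding \<Phi>_def by (intro tendsto_intros lim_T)
    then have "(\<lambda>m. lam (X m)) \<longlonglongrightarrow> lam x"
      unfolding lam_def using R by (intro tendsto_intros) auto
    then show "(\<lambda>m. lam (X m) *\<^sub>R T (X m) \<xi>) \<longlonglongrightarrow> lam x *\<^sub>R T x \<xi>"
      using lim_T[OF \<xi>] by (intro tendsto_intros)
  qed (use R I0 in auto)
  define u where "u = real_part z"
  have lam: "0 < lam z" "lam z \<le> 1"
    by (auto simp: lam_def divide_simps)
  have u_sym: "u (- \<xi>) = vcnj (u \<xi>)" for \<xi>
    by (cases "\<xi> \<in> I") (auto simp: u_def real_part_def I0 add.commute)
  have u_supp: "u \<xi> = 0" if "\<xi> \<notin> I" for \<xi>
    using that by (simp add: u_def real_part_def)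
  have cube_diff: "\<xi> - \<eta> = - (\<eta> - \<xi>)" for \<xi> \<eta> :: "int^'n" by simp
  have B_sym: "B u (- \<xi>) = vcnj (B u \<xi>)" for \<xi>
  proof -
    have "B u (- \<xi>) = (\<Sum>\<eta>\<in>cube N. (2 * pi * \<i> * dot (- \<xi>) (u (- \<eta>))) *s u (- \<xi> - (- \<eta>)))"
      unfolding B_def by (rule sum.reindex_bij_witness[where i = uminus and j = uminus]) auto
    also have "\<dots> = (\<Sum>\<eta>\<in>cube N. vcnj ((2 * pi * \<i> * dot \<xi> (u \<eta>)) *s u (\<xi> - \<eta>)))"
    proof (rule sum.cong[OF refl])
      fix \<eta>
      have "u (- \<xi> - (- \<eta>)) = vcnj (u (\<xi> - \<eta>))"
        using u_sym[of "\<xi> - \<eta>"] by simp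
      then show "(2 * pi * \<i> * dot (- \<xi>) (u (- \<eta>))) *s u (- \<xi> - (- \<eta>)) = vcnj ((2 * pi * \<i> * dot \<xi> (u \<eta>)) *s u (\<xi> - \<eta>))"
        by (simp add: u_sym)
    qed
    finally show ?thesis
      by (simp add: B_def vcnj_sum)
  qed
  have T_sym: "T z (- \<xi>) = vcnj (T z \<xi>)" if "\<xi> \<in> I" for \<xi>
    using solve_cnj[OF I0(1)[OF that], of "f \<xi> - B u \<xi>"] by (simp add: T_def u_def[symmetric] f_sym B_sym)
  \<comment> \<open>\<open>T z\<close> is conjugate symmetric, hence so is the fixed point
    \<open>z\<close> on \<open>I\<close>, and taking \<open>real_part\<close> does not change it
    there.\<close>
  have uT: "u \<xi> = lam z *\<^sub>R T z \<xi>" if "\<xi> \<in> I" for \<xi>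
  proof -
    have "u \<xi> = (1/2) *\<^sub>R (z \<xi> + vcnj (z (- \<xi>)))"
      using that by (simp add: u_def real_part_def)
    also have "\<dots> = (1/2) *\<^sub>R (lam z *\<^sub>R T z \<xi> + lam z *\<^sub>R T z \<xi>)"
      using z[OF that] z[OF iffD2[OF I0(3) that]] T_sym[OF that] by (metis vcnj_simps(3,5))
    finally show ?thesis
      by (simp flip: scaleR_left_distrib scaleR_2)
  qed
  have u_dot: "dot \<xi> (u \<xi>) = 0" for \<xi>
    using dot_solve[of \<xi>] by (cases "\<xi> \<in> I") (auto simp: uT T_def I0 u_supp)
  \<comment> \<open>The pressure drops out because \<open>u \<xi>\<close> is divergence-free. The
    scaling multiplies forcing and convection alike.\<close>
  have energy1: "c * (nu \<xi>)\<^sup>2 * (norm (u \<xi>))\<^sup>2 \<le> lam z * (u \<xi> \<bullet> f \<xi>) - lam z * (u \<xi> \<bullet> B u \<xi>)" for \<xi>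
  proof (cases "\<xi> \<in> I")
    case True
    obtain p where p: "M \<xi> (T z \<xi>) + p *s cfreq \<xi> = f \<xi> - B u \<xi>"
      using solve_eq[OF I0(1)[OF True]] unfolding T_def u_def by blast
    have "M \<xi> (T z \<xi>) = f \<xi> - B u \<xi> - p *s cfreq \<xi>"
      using p by (simp add: algebra_simps)
    then have "M \<xi> (u \<xi>) = lam z *\<^sub>R (f \<xi> - B u \<xi> - p *s cfreq \<xi>)"
      by (simp only: uT[OF True] linear_scale[OF linear_M])
    then have "u \<xi> \<bullet> M \<xi> (u \<xi>) = lam z * (u \<xi> \<bullet> f \<xi> - u \<xi> \<bullet> B u \<xi> - 0)"
      by (simp only: inner_scaleR_right inner_diff_right inner_cfreq u_dot) simp
    then have "u \<xi> \<bullet> M \<xi> (u \<xi>) = lam z * (u \<xi> \<bullet> f \<xi>) - lam z * (u \<xi> \<bullet> B u \<xi>)"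
      by (simp add: right_diff_distrib)
    then show ?thesis
      using elliptic[OF u_dot[of \<xi>]] by simp
  qed (simp add: u_supp)
  have Bsum: "(\<Sum>\<xi>\<in>cube N. u \<xi> \<bullet> B u \<xi>) = 0"
    unfolding B_def by (intro convection_energy u_sym u_dot) (auto simp: u_supp I_def)
  \<comment> \<open>Young's inequality balanced so that half of the dissipation absorbs the
    velocity; the factor \<open>(nu \<xi>)^2\<close> is inserted by the spectral gap.\<close>
  have young: "lam z * (u \<xi> \<bullet> f \<xi>) \<le> c / 2 * (nu \<xi>)\<^sup>2 * (norm (u \<xi>))\<^sup>2 + (norm (f \<xi>))\<^sup>2 / (2 * c)" for \<xi>
  proof (cases "\<xi> \<in> I")
    case True
    define x y where "x = norm (u \<xi>)" and "y = norm (f \<xi>)"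
    have nu1: "1 \<le> (nu \<xi>)\<^sup>2"
      using nu_ge_1[OF I0(1)[OF True]] by (simp add: one_le_power)
    have "lam z * (u \<xi> \<bullet> f \<xi>) \<le> lam z * (x * y)"
      using lam norm_cauchy_schwarz[of "u \<xi>" "f \<xi>"] by (intro mult_left_mono) (auto simp: x_def y_def)
    also have "\<dots> \<le> 1 * (x * y)"
      using lam by (intro mult_right_mono) (auto simp: x_def y_def)
    also have "\<dots> \<le> c / 2 * x\<^sup>2 + y\<^sup>2 / (2 * c)"
    proof -
      have "0 \<le> (c * x - y)\<^sup>2" by simp
      then have "2 * c * (x * y) \<le> c\<^sup>2 * x\<^sup>2 + y\<^sup>2"
        by (simp add: power2_eq_square algebra_simps)
      then have "(2 * c * (x * y)) / (2 * c) \<le> (c\<^sup>2 * x\<^sup>2 + y\<^sup>2) / (2 * c)"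
        using c_pos by (intro divide_right_mono) auto
      then show ?thesis
        using c_pos by (simp add: add_divide_distrib power2_eq_square)
    qed
    also have "c / 2 * x\<^sup>2 \<le> c / 2 * (nu \<xi>)\<^sup>2 * x\<^sup>2"
      using nu1 c_pos mult_right_mono[OF nu1, of "c / 2 * x\<^sup>2"] by (simp add: mult_ac)
    finally show ?thesis by (simp add: x_def y_def)
  qed (use c_pos in \<open>simp add: u_supp\<close>)
  \<comment> \<open>The convective term sums to zero, so its factor \<open>lam z\<close> is
    harmless.\<close>
  have energy: "(\<Sum>\<xi>\<in>cube N. (nu \<xi>)\<^sup>2 * (norm (u \<xi>))\<^sup>2) \<le> E / c\<^sup>2"
  proof -
    define D where "D = (\<Sum>\<xi>\<in>cube N. (nu \<xi>)\<^sup>2 * (norm (u \<xi>))\<^sup>2)"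
    have "c * D = (\<Sum>\<xi>\<in>cube N. c * (nu \<xi>)\<^sup>2 * (norm (u \<xi>))\<^sup>2)"
      by (simp add: D_def sum_distrib_left mult.assoc)
    also have "\<dots> \<le> (\<Sum>\<xi>\<in>cube N. c / 2 * (nu \<xi>)\<^sup>2 * (norm (u \<xi>))\<^sup>2 + (norm (f \<xi>))\<^sup>2 / (2 * c) - lam z * (u \<xi> \<bullet> B u \<xi>))"
      using energy1 young by (intro sum_mono) (smt (verit, best))
    also have "\<dots> = c / 2 * D + (\<Sum>\<xi>\<in>cube N. (norm (f \<xi>))\<^sup>2) / (2 * c) - lam z * (\<Sum>\<xi>\<in>cube N. u \<xi> \<bullet> B u \<xi>)"
      by (simp add: D_def sum.distrib sum_subtractf sum_distrib_left sum_divide_distrib mult.assoc)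
    also have "\<dots> \<le> c / 2 * D + E / (2 * c)"
      using fE c_pos by (simp add: Bsum divide_right_mono)
    finally have "c * D / 2 \<le> E / (2 * c)" by simp
    then have "D \<le> E / c\<^sup>2"
      using c_pos by (simp add: field_simps power2_eq_square)
    then show ?thesis by (simp add: D_def)
  qed
  \<comment> \<open>Were the scaling active, the norms would sum to exactly \<open>R\<close>, which
    is more than the energy allows.\<close>
  have "lam z = 1"
  proof (rule ccontr)
    assume "lam z \<noteq> 1"
    then have lamR: "lam z * \<Phi> z = R"
      using R by (auto simp: lam_def max_def split: if_splits)
    have "R = (\<Sum>\<xi>\<in>I. norm (u \<xi>))"
      using lam by (simp add: lamR[symmetric] \<Phi>_def sum_distrib_left uT)
    also have "\<dots> \<le> (\<Sum>\<xi>\<in>I. 1 + (nu \<xi>)\<^sup>2 * (norm (u \<xi>))\<^sup>2)"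
    proof (rule sum_mono)
      fix \<xi> assume "\<xi> \<in> I"
      then have "1 \<le> (nu \<xi>)\<^sup>2"
        using nu_ge_1[OF I0(1)] by (simp add: one_le_power)
      then have "1 * (norm (u \<xi>))\<^sup>2 \<le> (nu \<xi>)\<^sup>2 * (norm (u \<xi>))\<^sup>2"
        by (intro mult_right_mono) auto
      moreover have "norm (u \<xi>) \<le> 1 + (norm (u \<xi>))\<^sup>2"
        by (smt (verit) power2_eq_square mult_left_le self_le_power zero_le_power2 pos2 one_le_power norm_ge_zero)
      ultimately show "norm (u \<xi>) \<le> 1 + (nu \<xi>)\<^sup>2 * (norm (u \<xi>))\<^sup>2" by simp
    qed
    also have "\<dots> = card I + (\<Sum>\<xi>\<in>I. (nu \<xi>)\<^sup>2 * (norm (u \<xi>))\<^sup>2)"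
      by (simp add: sum.distrib)
    also have "(\<Sum>\<xi>\<in>I. (nu \<xi>)\<^sup>2 * (norm (u \<xi>))\<^sup>2) \<le> (\<Sum>\<xi>\<in>cube N. (nu \<xi>)\<^sup>2 * (norm (u \<xi>))\<^sup>2)"
      by (rule sum_mono2) (auto simp: I_def)
    also note energy
    finally show False by (simp add: R_def)
  qed
  then have "u \<xi> = solve \<xi> (f \<xi> - B u \<xi>)" if "\<xi> \<in> cube N" "\<xi> \<noteq> 0" for \<xi>
    using uT[of \<xi>] that by (simp add: I_def T_def u_def)
  then show thesis
    using u_sym u_dot energy u_supp by (intro that[of u]) (auto simp: I_def B_def)
qed

end

section \<open>Passage to the limit\<close>

text \<open>A uniform tail bound of order \<open>1 / L\<close> stands in for a dominating series:
  the energy controls the coefficients uniformly in a square-summed sense but not by one fixed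
  summable majorant.\<close>

lemma LIMSEQ_sum_uniform_tails:
  fixes g :: "nat \<Rightarrow> int^'n::finite \<Rightarrow> 'b::banach"
  assumes lim: "\<And>\<eta>. (\<lambda>m. g m \<eta>) \<longlonglongrightarrow> h \<eta>"
    and tail: "\<And>m L F. finite F \<Longrightarrow> L > 0 \<Longrightarrow> F \<inter> cube L = {} \<Longrightarrow> (\<Sum>\<eta>\<in>F. norm (g m \<eta>)) \<le> D / real L"
    and supp: "\<And>m \<eta>. \<eta> \<notin> S m \<Longrightarrow> g m \<eta> = 0" and fin: "\<And>m. finite (S m)"
  shows "(\<lambda>x. norm (h x)) summable_on UNIV" "(\<lambda>m. \<Sum>\<eta>\<in>S m. g m \<eta>) \<longlonglongrightarrow> infsum h UNIV"
proof -
  have tail_h: "(\<Sum>\<eta>\<in>F. norm (h \<eta>)) \<le> D / real L" if "finite F" "L > 0" "F \<inter> cube L = {}" for L F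
  proof (rule LIMSEQ_le_const2)
    show "(\<lambda>m. \<Sum>\<eta>\<in>F. norm (g m \<eta>)) \<longlonglongrightarrow> (\<Sum>\<eta>\<in>F. norm (h \<eta>))"
      by (intro tendsto_intros lim)
  qed (intro exI allI impI tail that)
  have D: "D \<ge> 0"
    using tail[of "{}" 1 undefined] by simp
  show abs: "(\<lambda>x. norm (h x)) summable_on UNIV"
  proof (rule nonneg_bdd_above_summable_on)
    show "bdd_above (sum (\<lambda>x. norm (h x)) ` {F. F \<subseteq> UNIV \<and> finite F})"
    proof (rule bdd_aboveI2)
      fix F :: "(int^'n) set" assume "F \<in> {F. F \<subseteq> UNIV \<and> finite F}"
      then have F: "finite F" by simp
      have "sum (\<lambda>x. norm (h x)) F = sum (\<lambda>x. norm (h x)) (F \<inter> cube 1) + sum (\<lambda>x. norm (h x)) (F - cube 1)"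
        using F by (rule sum.Int_Diff)
      also have "\<dots> \<le> sum (\<lambda>x. norm (h x)) (cube 1) + D / real 1"
        using F by (intro add_mono sum_mono2 tail_h) auto
      finally show "sum (\<lambda>x. norm (h x)) F \<le> sum (\<lambda>x. norm (h x)) (cube 1) + D / real 1" .
    qed
  qed auto
  then have hs: "h summable_on UNIV" by (rule abs_summable_summable)
  show "(\<lambda>m. \<Sum>\<eta>\<in>S m. g m \<eta>) \<longlonglongrightarrow> infsum h UNIV"
  proof (rule LIMSEQ_I)
    fix r :: real assume r: "r > 0"
    obtain L :: nat where L0: "L > 0" and LD: "D / real L < r / 3"
    proof -
      obtain L :: nat where "real L > 3 * D / r" using reals_Archimedean2 by blast
      moreover have "3 * D / r \<ge> 0" using D r by simp
      ultimately have "real L > 0" "3 * D < r * real L"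
        using r by (linarith, simp add: field_simps)
      then have "L > 0" "D / real L < r / 3" using r by (auto simp: divide_simps mult.commute)
      then show thesis by (rule that)
    qed
    have "(\<lambda>m. \<Sum>\<eta>\<in>cube L. g m \<eta>) \<longlonglongrightarrow> (\<Sum>\<eta>\<in>cube L. h \<eta>)"
      by (intro tendsto_intros lim)
    then obtain m0 where m0: "\<And>m. m \<ge> m0 \<Longrightarrow> norm ((\<Sum>\<eta>\<in>cube L. g m \<eta>) - (\<Sum>\<eta>\<in>cube L. h \<eta>)) < r / 3"
      using LIMSEQ_D[of _ _ "r / 3"] r by (metis divide_pos_pos zero_less_numeral)
    have sp: "infsum h UNIV = (\<Sum>\<eta>\<in>cube L. h \<eta>) + infsum h (- cube L)"
      using infsum_Un_disjoint[of h "cube L" "- cube L"] summable_on_subset_banach[OF hs]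
      by simp
    have "norm (infsum h (- cube L)) \<le> infsum (\<lambda>x. norm (h x)) (- cube L)"
      using summable_on_subset_banach[OF abs, of "- cube L"] by (intro norm_infsum_bound) auto
    also have "\<dots> \<le> D / real L"
      using summable_on_subset_banach[OF abs, of "- cube L"]
      by (intro infsum_le_finite_sums tail_h L0) auto
    finally have t2: "norm (infsum h (- cube L)) \<le> D / real L" .
    have "norm ((\<Sum>\<eta>\<in>S m. g m \<eta>) - infsum h UNIV) < r" if "m \<ge> m0" for m
    proof -
      have "(\<Sum>\<eta>\<in>S m. g m \<eta>) = (\<Sum>\<eta>\<in>S m \<union> cube L. g m \<eta>)"
        using fin by (intro sum.mono_neutral_left) (auto intro: supp)
      also have "\<dots> = (\<Sum>\<eta>\<in>cube L. g m \<eta>) + (\<Sum>\<eta>\<in>S m - cube L. g m \<eta>)"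
        using sum.union_disjoint[of "cube L" "S m - cube L" "g m"] fin by (simp add: Un_commute)
      \<comment> \<open>Three contributions: the fixed cube, where finitely many terms converge, and
        the tails of \<open>g m\<close> and of \<open>h\<close> outside it.\<close>
      finally have e: "(\<Sum>\<eta>\<in>S m. g m \<eta>) - infsum h UNIV
          = ((\<Sum>\<eta>\<in>cube L. g m \<eta>) - (\<Sum>\<eta>\<in>cube L. h \<eta>)) + (\<Sum>\<eta>\<in>S m - cube L. g m \<eta>) - infsum h (- cube L)"
        by (simp add: sp)
      have tri: "norm (x + y - z) \<le> norm x + norm y + norm z" for x y z :: 'b
        using norm_triangle_ineq[of x y] norm_triangle_ineq4[of "x + y" z] by linarith
      have "norm (\<Sum>\<eta>\<in>S m - cube L. g m \<eta>) \<le> D / real L"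
        using fin by (intro order_trans[OF norm_sum] tail L0) auto
      then show ?thesis
        unfolding e using m0[OF that] t2 LD by (intro le_less_trans[OF tri]) linarith
    qed
    then show "\<exists>no. \<forall>m\<ge>no. norm ((\<Sum>\<eta>\<in>S m. g m \<eta>) - infsum h UNIV) < r" by blast
  qed
qed

text \<open>Outside \<open>cube L\<close> the first factor satisfies
  \<open>L * a \<eta> \<le> nu \<eta> * a \<eta>\<close>, and the inequality of arithmetic and
  geometric means shares the product between two copies of the energy. The decay is uniform over all
  Galerkin solutions, which is what lets the quadratic term pass to the limit.\<close>

lemma conv_tail_bound:
  fixes a :: "int^'n::finite \<Rightarrow> real"
  assumes a0: "a 0 = 0" and a: "\<And>\<xi>. a \<xi> \<ge> 0"
    and K: "\<And>F. finite F \<Longrightarrow> (\<Sum>\<eta>\<in>F. (nu \<eta>)\<^sup>2 * (a \<eta>)\<^sup>2) \<le> K"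
    and F: "finite F" and L: "L > 0" and FL: "F \<inter> cube L = {}"
  shows "(\<Sum>\<eta>\<in>F. a \<eta> * a (\<xi> - \<eta>)) \<le> K / real L"
proof -
  have "a \<eta> * a (\<xi> - \<eta>) \<le> ((nu \<eta>)\<^sup>2 * (a \<eta>)\<^sup>2 / real L + (nu (\<xi> - \<eta>))\<^sup>2 * (a (\<xi> - \<eta>))\<^sup>2 / real L) / 2"
    if \<eta>: "\<eta> \<in> F" for \<eta>
  proof -
    have "\<eta> \<notin> cube L" using that FL by blast
    then have "nu \<eta> \<ge> real L"
      using mem_cube_nu[of \<eta> L] by linarith
    then have 1: "real L * real L \<le> (nu \<eta>)\<^sup>2"
      by (simp add: power2_eq_square mult_mono)
    have "a (\<xi> - \<eta>) \<le> nu (\<xi> - \<eta>) * a (\<xi> - \<eta>)"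
    proof (cases "\<xi> - \<eta> = 0")
      case False
      then show ?thesis
        using mult_right_mono[OF nu_ge_1[OF False] a[of "\<xi> - \<eta>"]] by simp
    qed (simp add: a0)
    then have 2: "(a (\<xi> - \<eta>))\<^sup>2 \<le> (nu (\<xi> - \<eta>))\<^sup>2 * (a (\<xi> - \<eta>))\<^sup>2"
      using power_mono[of "a (\<xi> - \<eta>)" "nu (\<xi> - \<eta>) * a (\<xi> - \<eta>)" 2] a by (simp add: power_mult_distrib)
    have "2 * (real L * (a \<eta> * a (\<xi> - \<eta>))) \<le> real L * real L * (a \<eta>)\<^sup>2 + (a (\<xi> - \<eta>))\<^sup>2"
      using zero_le_power2[of "real L * a \<eta> - a (\<xi> - \<eta>)"] by (simp add: power2_eq_square algebra_simps)
    also have "\<dots> \<le> (nu \<eta>)\<^sup>2 * (a \<eta>)\<^sup>2 + (nu (\<xi> - \<eta>))\<^sup>2 * (a (\<xi> - \<eta>))\<^sup>2"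
      using 1 2 by (intro add_mono mult_right_mono) auto
    finally show ?thesis
      using L by (simp add: field_simps)
  qed
  then have "(\<Sum>\<eta>\<in>F. a \<eta> * a (\<xi> - \<eta>)) \<le> (\<Sum>\<eta>\<in>F. ((nu \<eta>)\<^sup>2 * (a \<eta>)\<^sup>2 / real L + (nu (\<xi> - \<eta>))\<^sup>2 * (a (\<xi> - \<eta>))\<^sup>2 / real L) / 2)"
    by (rule sum_mono)
  also have "\<dots> = ((\<Sum>\<eta>\<in>F. (nu \<eta>)\<^sup>2 * (a \<eta>)\<^sup>2) / real L + (\<Sum>\<eta>\<in>F. (nu (\<xi> - \<eta>))\<^sup>2 * (a (\<xi> - \<eta>))\<^sup>2) / real L) / 2"
    by (simp add: sum.distrib sum_divide_distrib add_divide_distrib)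
  also have "(\<Sum>\<eta>\<in>F. (nu (\<xi> - \<eta>))\<^sup>2 * (a (\<xi> - \<eta>))\<^sup>2) = (\<Sum>\<eta>\<in>(\<lambda>\<eta>. \<xi> - \<eta>) ` F. (nu \<eta>)\<^sup>2 * (a \<eta>)\<^sup>2)"
    by (simp add: sum.reindex inj_on_def)
  also have "((\<Sum>\<eta>\<in>F. (nu \<eta>)\<^sup>2 * (a \<eta>)\<^sup>2) / real L + (\<Sum>\<eta>\<in>(\<lambda>\<eta>. \<xi> - \<eta>) ` F. (nu \<eta>)\<^sup>2 * (a \<eta>)\<^sup>2) / real L) / 2
      \<le> (K / real L + K / real L) / 2"
    using F L by (intro divide_right_mono add_mono K) auto
  finally show ?thesis by simp
qed

text \<open>Divergence form: the multiplier is \<open>dot \<xi> (u \<eta>)\<close> instead of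
  \<open>dot (\<xi> - \<eta>) (u \<eta>)\<close>, with the same value for divergence-free
  \<open>u\<close>. The derivative thus sits on the outer frequency and leaves the
  convolution.\<close>

definition convection :: "(int^'n::finite \<Rightarrow> complex^'n) \<Rightarrow> int^'n \<Rightarrow> complex^'n" where
  "convection u \<xi> = (\<Sum>\<^sub>\<infinity>\<eta>. (2 * pi * \<i> * dot \<xi> (u \<eta>)) *s u (\<xi> - \<eta>))"

lemma norm_convection_term_le:
  "norm ((2 * pi * \<i> * dot \<xi> v) *s w) \<le> 2 * pi * nu \<xi> * (norm v * norm w)"
proof -
  have "norm ((2 * pi * \<i> * dot \<xi> v) *s w) = 2 * pi * (cmod (dot \<xi> v) * norm w)"
    by (simp add: norm_vscale norm_mult)
  also have "\<dots> \<le> 2 * pi * (nu \<xi> * norm v * norm w)"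
    by (intro mult_left_mono mult_right_mono cmod_dot_le) auto
  finally show ?thesis by (simp add: mult_ac)
qed

context stokes_symbol
begin

lemma weak_solution_exists:
  fixes f :: "int^'n \<Rightarrow> complex^'n"
  assumes f_sym: "\<And>\<xi>. f (- \<xi>) = vcnj (f \<xi>)" and f2: "(\<lambda>\<xi>. (norm (f \<xi>))\<^sup>2) summable_on UNIV"
  obtains u where "\<And>\<xi>. u (- \<xi>) = vcnj (u \<xi>)" "u 0 = 0" "\<And>\<xi>. dot \<xi> (u \<xi>) = 0"
    "(\<lambda>\<xi>. (nu \<xi>)\<^sup>2 * (norm (u \<xi>))\<^sup>2) summable_on UNIV"
    "\<And>\<xi>. (\<lambda>\<eta>. norm ((2 * pi * \<i> * dot \<xi> (u \<eta>)) *s u (\<xi> - \<eta>))) summable_on UNIV"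
    "\<And>\<xi>. \<xi> \<noteq> 0 \<Longrightarrow> u \<xi> = solve \<xi> (f \<xi> - convection u \<xi>)"
proof -
  define E where "E = infsum (\<lambda>\<xi>. (norm (f \<xi>))\<^sup>2) UNIV"
  define K where "K = E / c\<^sup>2"
  have fE: "(\<Sum>\<xi>\<in>cube N. (norm (f \<xi>))\<^sup>2) \<le> E" for N
    unfolding E_def using f2 by (intro finite_sum_le_infsum) auto
  \<comment> \<open>All properties of one Galerkin solution in a single predicate, so that one
    choice produces the whole sequence.\<close>
  define ok where "ok = (\<lambda>N u. (\<forall>\<xi>. u (- \<xi>) = vcnj (u \<xi>)) \<and> (\<forall>\<xi>. \<xi> \<notin> cube N \<longrightarrow> u \<xi> = 0) \<and> u 0 = 0 \<and>
    (\<forall>\<xi>. dot \<xi> (u \<xi>) = 0) \<and> (\<Sum>\<xi>\<in>cube N. (nu \<xi>)\<^sup>2 * (norm (u \<xi>))\<^sup>2) \<le> K \<and>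
    (\<forall>\<xi>. \<xi> \<in> cube N \<longrightarrow> \<xi> \<noteq> 0 \<longrightarrow>
      u \<xi> = solve \<xi> (f \<xi> - (\<Sum>\<eta>\<in>cube N. (2 * pi * \<i> * dot \<xi> (u \<eta>)) *s u (\<xi> - \<eta>)))))"
  have "\<exists>u. ok N u" for N
  proof (rule galerkin_solution[OF f_sym fE, of N])
    fix u assume "\<And>\<xi>. u (- \<xi>) = vcnj (u \<xi>)" "\<And>\<xi>. \<xi> \<notin> cube N \<Longrightarrow> u \<xi> = 0" "u 0 = 0"
      "\<And>\<xi>. dot \<xi> (u \<xi>) = 0" "(\<Sum>\<xi>\<in>cube N. (nu \<xi>)\<^sup>2 * (norm (u \<xi>))\<^sup>2) \<le> E / c\<^sup>2"
      "\<And>\<xi>. \<xi> \<in> cube N \<Longrightarrow> \<xi> \<noteq> 0 \<Longrightarrow>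
        u \<xi> = solve \<xi> (f \<xi> - (\<Sum>\<eta>\<in>cube N. (2 * pi * \<i> * dot \<xi> (u \<eta>)) *s u (\<xi> - \<eta>)))"
    then have "ok N u"
      unfolding ok_def K_def by (intro conjI allI impI)
    then show ?thesis by blast
  qed
  then have "\<forall>N. \<exists>u. ok N u" by blast
  from choice[OF this] obtain U where "\<And>N. ok N (U N)" by blast
  then have U_sym: "\<And>N \<xi>. U N (- \<xi>) = vcnj (U N \<xi>)" and U_supp: "\<And>N \<xi>. \<xi> \<notin> cube N \<Longrightarrow> U N \<xi> = 0"
    and U_0: "\<And>N. U N 0 = 0" and U_dot: "\<And>N \<xi>. dot \<xi> (U N \<xi>) = 0"
    and U_energy: "\<And>N. (\<Sum>\<xi>\<in>cube N. (nu \<xi>)\<^sup>2 * (norm (U N \<xi>))\<^sup>2) \<le> K"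
    and U_eq: "\<And>N \<xi>. \<xi> \<in> cube N \<Longrightarrow> \<xi> \<noteq> 0 \<Longrightarrow>
      U N \<xi> = solve \<xi> (f \<xi> - (\<Sum>\<eta>\<in>cube N. (2 * pi * \<i> * dot \<xi> (U N \<eta>)) *s U N (\<xi> - \<eta>)))"
    unfolding ok_def by blast+
  have U_sum: "(\<Sum>\<xi>\<in>F. (nu \<xi>)\<^sup>2 * (norm (U N \<xi>))\<^sup>2) \<le> K" if "finite F" for F N
  proof -
    have "(\<Sum>\<xi>\<in>F. (nu \<xi>)\<^sup>2 * (norm (U N \<xi>))\<^sup>2) = (\<Sum>\<xi>\<in>F \<inter> cube N. (nu \<xi>)\<^sup>2 * (norm (U N \<xi>))\<^sup>2)"
      using that by (intro sum.mono_neutral_right) (auto simp: U_supp)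
    also have "\<dots> \<le> (\<Sum>\<xi>\<in>cube N. (nu \<xi>)\<^sup>2 * (norm (U N \<xi>))\<^sup>2)"
      by (intro sum_mono2) auto
    also have "\<dots> \<le> K" by (rule U_energy)
    finally show ?thesis .
  qed
  have K0: "K \<ge> 0" using U_sum[of "{}"] by simp
  \<comment> \<open>By the spectral gap the energy bounds each coefficient uniformly in
    \<open>N\<close>, which is all that coefficientwise compactness asks for.\<close>
  have "U N \<xi> \<in> cball 0 (sqrt K)" for N \<xi>
  proof (cases "\<xi> = 0")
    case False
    have "1 * (norm (U N \<xi>))\<^sup>2 \<le> (nu \<xi>)\<^sup>2 * (norm (U N \<xi>))\<^sup>2"
      using nu_ge_1[OF False] by (intro mult_right_mono) (auto simp: one_le_power)
    also have "\<dots> \<le> K" using U_sum[of "{\<xi>}" N] by simp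
    finally show ?thesis by (simp add: real_le_rsqrt)
  qed (use K0 in \<open>simp add: U_0\<close>)
  then obtain t u where t: "strict_mono t" and u: "\<And>\<xi>. (\<lambda>m. U (t m) \<xi>) \<longlonglongrightarrow> u \<xi>"
    by (rule pointwise_convergent_subsequence[of U "\<lambda>_. cball 0 (sqrt K)"]) auto
  have u_sum: "(\<Sum>\<xi>\<in>F. (nu \<xi>)\<^sup>2 * (norm (u \<xi>))\<^sup>2) \<le> K" if "finite F" for F
  proof (rule LIMSEQ_le_const2)
    show "(\<lambda>m. \<Sum>\<xi>\<in>F. (nu \<xi>)\<^sup>2 * (norm (U (t m) \<xi>))\<^sup>2) \<longlonglongrightarrow> (\<Sum>\<xi>\<in>F. (nu \<xi>)\<^sup>2 * (norm (u \<xi>))\<^sup>2)"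
      by (intro tendsto_intros u)
  qed (intro exI allI impI U_sum that)
  have u0: "u 0 = 0"
    using u[of 0] by (simp add: U_0 LIMSEQ_const_iff)
  have u_sym: "u (- \<xi>) = vcnj (u \<xi>)" for \<xi>
  proof -
    have "(\<lambda>m. vcnj (U (t m) \<xi>)) \<longlonglongrightarrow> vcnj (u \<xi>)"
      unfolding vcnj_def by (intro tendsto_vec_lambda tendsto_cnj tendsto_vec_nth u)
    moreover have "(\<lambda>m. vcnj (U (t m) \<xi>)) \<longlonglongrightarrow> u (- \<xi>)"
      using u[of "- \<xi>"] by (simp only: U_sym)
    ultimately show ?thesis using LIMSEQ_unique by blast
  qed
  have lim_dot: "(\<lambda>m. dot \<xi> (U (t m) \<eta>)) \<longlonglongrightarrow> dot \<xi> (u \<eta>)" for \<xi> \<eta>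
    unfolding dot_def by (intro tendsto_intros u)
  have u_dot: "dot \<xi> (u \<xi>) = 0" for \<xi>
    using lim_dot[of \<xi> \<xi>] by (simp add: U_dot LIMSEQ_const_iff)
  have conv: "(\<lambda>\<eta>. norm ((2 * pi * \<i> * dot \<xi> (u \<eta>)) *s u (\<xi> - \<eta>))) summable_on UNIV"
    "(\<lambda>m. \<Sum>\<eta>\<in>cube (t m). (2 * pi * \<i> * dot \<xi> (U (t m) \<eta>)) *s U (t m) (\<xi> - \<eta>)) \<longlonglongrightarrow> convection u \<xi>" for \<xi>
  proof -
    have 1: "(\<lambda>m. (2 * pi * \<i> * dot \<xi> (U (t m) \<eta>)) *s U (t m) (\<xi> - \<eta>)) \<longlonglongrightarrow> (2 * pi * \<i> * dot \<xi> (u \<eta>)) *s u (\<xi> - \<eta>)" for \<eta>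
      unfolding vector_scalar_mult_def by (intro tendsto_intros u lim_dot)
    have 2: "(\<Sum>\<eta>\<in>F. norm ((2 * pi * \<i> * dot \<xi> (U (t m) \<eta>)) *s U (t m) (\<xi> - \<eta>))) \<le> (2 * pi * nu \<xi> * K) / real L"
      if F: "finite F" and L: "L > 0" and FL: "F \<inter> cube L = {}" for m L F
    proof -
      have "(\<Sum>\<eta>\<in>F. norm ((2 * pi * \<i> * dot \<xi> (U (t m) \<eta>)) *s U (t m) (\<xi> - \<eta>)))
          \<le> (\<Sum>\<eta>\<in>F. 2 * pi * nu \<xi> * (norm (U (t m) \<eta>) * norm (U (t m) (\<xi> - \<eta>))))"
        by (intro sum_mono norm_convection_term_le)
      also have "\<dots> = 2 * pi * nu \<xi> * (\<Sum>\<eta>\<in>F. norm (U (t m) \<eta>) * norm (U (t m) (\<xi> - \<eta>)))"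
        by (simp add: sum_distrib_left)
      also have "\<dots> \<le> 2 * pi * nu \<xi> * (K / real L)"
        using F L FL by (intro mult_left_mono conv_tail_bound U_sum) (auto simp: U_0)
      finally show ?thesis by simp
    qed
    have 3: "(2 * pi * \<i> * dot \<xi> (U (t m) \<eta>)) *s U (t m) (\<xi> - \<eta>) = 0" if "\<eta> \<notin> cube (t m)" for m \<eta>
      using that by (simp add: U_supp)
    note * = LIMSEQ_sum_uniform_tails[where S = "\<lambda>m. cube (t m)", OF 1 2 3]
    show "(\<lambda>\<eta>. norm ((2 * pi * \<i> * dot \<xi> (u \<eta>)) *s u (\<xi> - \<eta>))) summable_on UNIV"
      by (rule *(1)) auto
    show "(\<lambda>m. \<Sum>\<eta>\<in>cube (t m). (2 * pi * \<i> * dot \<xi> (U (t m) \<eta>)) *s U (t m) (\<xi> - \<eta>)) \<longlonglongrightarrow> convection u \<xi>"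
      unfolding convection_def by (rule *(2)) auto
  qed
  have eq: "u \<xi> = solve \<xi> (f \<xi> - convection u \<xi>)" if \<xi>: "\<xi> \<noteq> 0" for \<xi>
  proof (rule LIMSEQ_unique[OF u])
    obtain N where "\<xi> \<in> cube N" using Un_cube by blast
    \<comment> \<open>Each fixed frequency is eventually inside the truncation, and from then on its
      Galerkin equation holds.\<close>
    then have "\<xi> \<in> cube (t m)" if "m \<ge> N" for m
      using that seq_suble[OF t, of m] cube_mono[of N "t m"] by auto
    then have ev: "\<forall>\<^sub>F m in sequentially. solve \<xi> (f \<xi> - (\<Sum>\<eta>\<in>cube (t m). (2 * pi * \<i> * dot \<xi> (U (t m) \<eta>)) *s U (t m) (\<xi> - \<eta>))) = U (t m) \<xi>"
      unfolding eventually_sequentially by (intro exI[of _ N] allI impI U_eq[symmetric] \<xi>)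
    have "bounded_linear (solve \<xi>)"
      using linear_solve[OF \<xi>] linear_conv_bounded_linear by blast
    then have "(\<lambda>m. solve \<xi> (f \<xi> - (\<Sum>\<eta>\<in>cube (t m). (2 * pi * \<i> * dot \<xi> (U (t m) \<eta>)) *s U (t m) (\<xi> - \<eta>)))) \<longlonglongrightarrow> solve \<xi> (f \<xi> - convection u \<xi>)"
      by (rule bounded_linear.tendsto) (intro tendsto_diff tendsto_const conv)
    then show "(\<lambda>m. U (t m) \<xi>) \<longlonglongrightarrow> solve \<xi> (f \<xi> - convection u \<xi>)"
      by (rule Lim_transform_eventually[OF _ ev])
  qed
  have "(\<lambda>\<xi>. (nu \<xi>)\<^sup>2 * (norm (u \<xi>))\<^sup>2) summable_on UNIV"
    using u_sum by (intro nonneg_bdd_above_summable_on) (auto simp: bdd_above_def)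
  then show thesis
    using that[of u] u_sym u0 u_dot conv(1) eq by blast
qed

end

section \<open>Regularity\<close>

lemma ennreal_square_add_le: "(x + y)\<^sup>2 \<le> 2 * x\<^sup>2 + 2 * (y\<^sup>2 :: ennreal)"
proof (cases "x = top \<or> y = top")
  case False
  then obtain r s where rs: "x = ennreal r" "y = ennreal s" "r \<ge> 0" "s \<ge> 0"
    by (metis ennreal_cases)
  have "(r + s)\<^sup>2 \<le> 2 * r\<^sup>2 + 2 * s\<^sup>2"
    using zero_le_power2[of "r - s"] by (simp add: power2_eq_square algebra_simps)
  then have "ennreal ((r + s)\<^sup>2) \<le> ennreal (2 * r\<^sup>2 + 2 * s\<^sup>2)"
    by (rule ennreal_leI)
  also have "ennreal (2 * r\<^sup>2 + 2 * s\<^sup>2) = 2 * (ennreal r)\<^sup>2 + 2 * (ennreal s)\<^sup>2"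
    using rs by (simp add: ennreal_mult ennreal_power)
  also have "ennreal ((r + s)\<^sup>2) = (ennreal r + ennreal s)\<^sup>2"
    using rs by (simp add: ennreal_power flip: ennreal_plus)
  finally show ?thesis
    using rs by simp
qed (auto simp: power2_eq_square ennreal_mult_top ennreal_top_mult)

lemma nsum_square_add_le:
  "nsum (\<lambda>x. (f x + g x)\<^sup>2) \<le> 2 * nsum (\<lambda>x. (f x)\<^sup>2) + 2 * nsum (\<lambda>x. (g x)\<^sup>2)"
proof -
  have "nsum (\<lambda>x. (f x + g x)\<^sup>2) \<le> nsum (\<lambda>x. 2 * (f x)\<^sup>2 + 2 * (g x)\<^sup>2)"
    by (intro nn_integral_mono ennreal_square_add_le)
  then show ?thesis by (simp add: nn_integral_add nn_integral_cmult)
qed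

lemma nsum_cmult_square: "nsum (\<lambda>x. (k * f x)\<^sup>2) = k\<^sup>2 * nsum (\<lambda>x. (f x)\<^sup>2)"
  by (simp add: power_mult_distrib nn_integral_cmult)

text \<open>Convergent sums have small tails. Subtraction is unreliable in \<open>ennreal\<close>,
  so the comparison is carried out on real values.\<close>

lemma nsum_tail_small:
  fixes f :: "int^'n::finite \<Rightarrow> ennreal"
  assumes fin: "nsum f < \<infinity>" and e: "e > 0"
  obtains F where "finite F" "nsum (\<lambda>x. f x * indicator (- F) x) \<le> ennreal e"
proof -
  have split: "nsum f = sum f F + nsum (\<lambda>x. f x * indicator (- F) x)" if "finite F" for F
  proof -
    have "nsum f = nsum (\<lambda>x. f x * indicator F x + f x * indicator (- F) x)"
      by (intro nn_integral_cong) (auto split: split_indicator)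
    also have "\<dots> = nsum (\<lambda>x. f x * indicator F x) + nsum (\<lambda>x. f x * indicator (- F) x)"
      by (simp add: nn_integral_add)
    also have "nsum (\<lambda>x. f x * indicator F x) = sum f F"
      using that by (simp add: nn_integral_count_space_indicator[symmetric] nn_integral_count_space_finite)
    finally show ?thesis .
  qed
  obtain r where r: "nsum f = ennreal r" "r \<ge> 0"
    using fin by (metis ennreal_cases infinity_ennreal_def less_irrefl)
  have "\<exists>F. finite F \<and> r - e < enn2real (sum f F)"
  proof (cases "r < e")
    case True
    then show ?thesis by (intro exI[of _ "{}"]) auto
  next
    case False
    show ?thesis
    proof (rule ccontr)
      assume n: "\<not> ?thesis"
      have "sum f F \<le> ennreal (r - e)" if F: "finite F" for F
      proof -
        have "sum f F < top"
          using sum_le_nsum[OF F, of f] fin by (metis infinity_ennreal_def le_less_trans)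
        then have "sum f F = ennreal (enn2real (sum f F))" by simp
        also have "\<dots> \<le> ennreal (r - e)"
          using n F by (intro ennreal_leI) auto
        finally show ?thesis .
      qed
      then have "nsum f \<le> ennreal (r - e)" by (rule nsum_leI)
      then show False using r e False by simp
    qed
  qed
  then obtain F where F: "finite F" "r - e < enn2real (sum f F)" by blast
  define s t where "s = sum f F" and "t = nsum (\<lambda>x. f x * indicator (- F) x)"
  have st: "ennreal r = s + t"
    using split[OF F(1)] r by (simp add: s_def t_def)
  then have "s < top" "t < top"
    by (metis ennreal_less_top ennreal_add_eq_top less_top)+
  then obtain s' t' where s't': "s = ennreal s'" "t = ennreal t'" "s' \<ge> 0" "t' \<ge> 0"
    by (metis ennreal_cases less_irrefl)
  then have "r = s' + t'"
    using st r by (simp flip: ennreal_plus)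
  then have "t' \<le> e"
    using F(2) s't' by (simp add: s_def)
  then show thesis
    using F(1) s't' by (intro that[of F]) (auto simp: t_def[symmetric] intro: ennreal_leI)
qed

text \<open>If \<open>nu \<eta> \<le> nu (\<xi> - \<eta>)\<close> then
  \<open>nu \<xi> \<le> 2 * nu (\<xi> - \<eta>)\<close>, so doubling moves the outer weight onto the
  factor of higher frequency. The other half of the convolution contributes the same by symmetry,
  whence the factor 2.\<close>

lemma weighted_conv_le:
  fixes a :: "int^'n::finite \<Rightarrow> ennreal" and g :: "real \<Rightarrow> real"
  assumes mono: "\<And>x y. 0 \<le> x \<Longrightarrow> x \<le> y \<Longrightarrow> g x \<le> g y" and nonneg: "\<And>x. 0 \<le> g x"
    and doubling: "\<And>x. 0 \<le> x \<Longrightarrow> g (2 * x) \<le> B * g x" and B: "B \<ge> 0"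
  shows "ennreal (g (nu \<xi>)) * nsum (\<lambda>\<eta>. a \<eta> * a (\<xi> - \<eta>))
    \<le> ennreal (2 * B) * half_conv a (\<lambda>\<zeta>. ennreal (g (nu \<zeta>)) * a \<zeta>) \<xi>"
proof -
  define h where "h = (\<lambda>\<eta>. if nu \<eta> \<le> nu (\<xi> - \<eta>) then a \<eta> * a (\<xi> - \<eta>) else 0)"
  have "nsum (\<lambda>\<eta>. a \<eta> * a (\<xi> - \<eta>)) \<le> nsum (\<lambda>\<eta>. h \<eta> + h (\<xi> - \<eta>))"
    by (intro nn_integral_mono) (auto simp: h_def mult.commute)
  also have "\<dots> = nsum h + nsum (\<lambda>\<eta>. h (\<xi> - \<eta>))"
    by (simp add: nn_integral_add)
  also have "\<dots> = 2 * nsum h"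
    by (simp add: nsum_shift(4)[of h] mult_2)
  finally have "ennreal (g (nu \<xi>)) * nsum (\<lambda>\<eta>. a \<eta> * a (\<xi> - \<eta>)) \<le> ennreal (g (nu \<xi>)) * (2 * nsum h)"
    by (rule mult_left_mono) simp
  also have "\<dots> = 2 * nsum (\<lambda>\<eta>. ennreal (g (nu \<xi>)) * h \<eta>)"
    by (subst nn_integral_cmult) (auto simp: mult.left_commute)
  also have "2 * nsum (\<lambda>\<eta>. ennreal (g (nu \<xi>)) * h \<eta>)
      \<le> 2 * nsum (\<lambda>\<eta>. ennreal B * (if nu \<eta> \<le> nu (\<xi> - \<eta>) then a \<eta> * (ennreal (g (nu (\<xi> - \<eta>))) * a (\<xi> - \<eta>)) else 0))"
  proof (intro mult_left_mono nn_integral_mono)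
    fix \<eta>
    show "ennreal (g (nu \<xi>)) * h \<eta>
      \<le> ennreal B * (if nu \<eta> \<le> nu (\<xi> - \<eta>) then a \<eta> * (ennreal (g (nu (\<xi> - \<eta>))) * a (\<xi> - \<eta>)) else 0)"
    proof (cases "nu \<eta> \<le> nu (\<xi> - \<eta>)")
      case True
      have "nu \<xi> \<le> 2 * nu (\<xi> - \<eta>)"
        using nu_triangle[of "\<xi> - \<eta>" \<eta>] True by simp
      then have "g (nu \<xi>) \<le> B * g (nu (\<xi> - \<eta>))"
        using mono[of "nu \<xi>"] doubling[of "nu (\<xi> - \<eta>)"] by fastforce
      then have "ennreal (g (nu \<xi>)) \<le> ennreal B * ennreal (g (nu (\<xi> - \<eta>)))"
        using B nonneg by (metis ennreal_leI ennreal_mult)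
      then have "ennreal (g (nu \<xi>)) * (a \<eta> * a (\<xi> - \<eta>)) \<le> ennreal B * ennreal (g (nu (\<xi> - \<eta>))) * (a \<eta> * a (\<xi> - \<eta>))"
        by (rule mult_right_mono) simp
      then show ?thesis
        using True by (simp add: h_def mult_ac)
    qed (simp add: h_def)
  qed simp
  also have "nsum (\<lambda>\<eta>. ennreal B * (if nu \<eta> \<le> nu (\<xi> - \<eta>) then a \<eta> * (ennreal (g (nu (\<xi> - \<eta>))) * a (\<xi> - \<eta>)) else 0))
      = ennreal B * half_conv a (\<lambda>\<zeta>. ennreal (g (nu \<zeta>)) * a \<zeta>) \<xi>"
    by (simp add: half_conv_def nn_integral_cmult)
  finally show ?thesis
    using B by (simp add: ennreal_mult mult.assoc)
qed

text \<open>The truncated weight \<open>\<omega>\<close> makes the weighted norm finite a priori. Splitting off finitely many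
  frequencies leaves a remainder that is small in the critical norm and can be absorbed; the finite
  part costs one derivative less and is absorbed by interpolation.\<close>

lemma bootstrap:
  fixes a F :: "int^'n::finite \<Rightarrow> ennreal"
  assumes n: "CARD('n) \<le> 4" and a0: "a 0 = 0" and H: "nsum (\<lambda>\<xi>. (enu \<xi> * a \<xi>)\<^sup>2) < \<infinity>"
    and FF: "nsum (\<lambda>\<xi>. (F \<xi>)\<^sup>2) < \<infinity>" and \<sigma>: "\<sigma> \<ge> 0" and D: "D \<ge> 0"
    and le: "\<And>\<xi> R. R > 0 \<Longrightarrow> enu \<xi> * (ennreal (min (nu \<xi>) R powr \<sigma>) * a \<xi>)
      \<le> ennreal D * (F \<xi> + ennreal (min (nu \<xi>) R powr \<sigma>) * nsum (\<lambda>\<eta>. a \<eta> * a (\<xi> - \<eta>)))"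
  shows "nsum (\<lambda>\<xi>. (ennreal (nu \<xi> powr (\<sigma> + 1)) * a \<xi>)\<^sup>2) < \<infinity>"
proof -
  have a_le: "(a \<xi>)\<^sup>2 \<le> (enu \<xi> * a \<xi>)\<^sup>2" for \<xi>
    using a0 by (intro enu_square_ge) auto
  have a_fin: "a \<xi> < top" for \<xi>
  proof -
    have "(a \<xi>)\<^sup>2 < top"
      using le_nsum[of "\<lambda>\<xi>. (enu \<xi> * a \<xi>)\<^sup>2" \<xi>] a_le[of \<xi>] H by (metis infinity_ennreal_def le_less_trans)
    then show ?thesis
      by (cases "a \<xi> = top") (auto simp: power2_eq_square less_top)
  qed
  \<comment> \<open>Constant of \<open>weighted_conv_le\<close> for a weight with doubling constant
    \<open>2 powr \<sigma>\<close>.\<close>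
  define \<beta> where "\<beta> = 2 * 2 powr \<sigma>"
  define \<kappa> where "\<kappa> = 2 * D\<^sup>2 * \<beta>\<^sup>2"
  define H2 where "H2 = nsum (\<lambda>\<xi>. (enu \<xi> * a \<xi>)\<^sup>2)"
  have \<kappa>: "\<kappa> \<ge> 0" by (simp add: \<kappa>_def)
  \<comment> \<open>Makes \<open>\<kappa> * (1250 * e)\<close> at most a quarter, where 1250 is 625
    times the 2 from squaring a sum; \<open>\<kappa> + 1\<close> keeps the denominator
    positive.\<close>
  define e where "e = 1 / (4 * 1250 * (\<kappa> + 1))"
  have e: "e > 0" using \<kappa> by (simp add: e_def)
  obtain F0 where F0: "finite F0" "nsum (\<lambda>\<xi>. (enu \<xi> * a \<xi>)\<^sup>2 * indicator (- F0) \<xi>) \<le> ennreal e"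
    using nsum_tail_small[OF H e] .
  define a1 a2 where "a1 = (\<lambda>\<xi>. a \<xi> * indicator F0 \<xi>)" and "a2 = (\<lambda>\<xi>. a \<xi> * indicator (- F0) \<xi>)"
  have a12: "a \<xi> = a1 \<xi> + a2 \<xi>" for \<xi>
    by (auto simp: a1_def a2_def split: split_indicator)
  have a2e: "nsum (\<lambda>\<xi>. (enu \<xi> * a2 \<xi>)\<^sup>2) \<le> ennreal e"
  proof -
    have "(\<lambda>\<xi>. (enu \<xi> * a2 \<xi>)\<^sup>2) = (\<lambda>\<xi>. (enu \<xi> * a \<xi>)\<^sup>2 * indicator (- F0) \<xi>)"
      by (auto simp: a2_def fun_eq_iff split: split_indicator)
    with F0 show ?thesis by simp
  qed
  have "nsum a1 = sum a F0"
    using F0(1) by (simp add: a1_def nn_integral_count_space_indicator[symmetric] nn_integral_count_space_finite)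
  then have "nsum a1 < top"
    using F0(1) a_fin by (simp add: ennreal_sum_less_top)
  then obtain S where S: "nsum a1 = ennreal S" "S \<ge> 0"
    by (metis ennreal_cases less_irrefl)
  \<comment> \<open>Makes \<open>\<kappa> * (2 * S^2) * \<delta>^2\<close> at most the other
    quarter.\<close>
  define \<delta> where "\<delta> = 1 / sqrt (8 * (\<kappa> + 1) * (S\<^sup>2 + 1))"
  have \<delta>: "\<delta> > 0" and \<delta>2: "\<delta>\<^sup>2 = 1 / (8 * (\<kappa> + 1) * (S\<^sup>2 + 1))"
    using \<kappa> by (auto simp: \<delta>_def power_divide add_nonneg_pos mult_pos_pos)
  \<comment> \<open>Bounds the square of the truncated weight at frequencies up to
    \<open>1 / \<delta>\<close>.\<close>
  define G where "G = ennreal ((1 / \<delta>) powr (2 * \<sigma>))"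
  \<comment> \<open>Collects everything that does not depend on the cut-off
    \<open>R\<close>.\<close>
  define A where "A = 2 * (ennreal D)\<^sup>2 * nsum (\<lambda>\<xi>. (F \<xi>)\<^sup>2) + ennreal (\<kappa> * (2 * S\<^sup>2)) * (G * H2)"
  have A: "A < top"
    using FF H by (simp add: A_def G_def H2_def ennreal_mult_less_top power2_eq_square)
  have X_le: "nsum (\<lambda>\<xi>. (enu \<xi> * (ennreal (min (nu \<xi>) R powr \<sigma>) * a \<xi>))\<^sup>2) \<le> 2 * A" if R: "R > 0" for R
  proof -
    define g where "g = (\<lambda>x. min x R powr \<sigma>)"
    define b :: "int^'n \<Rightarrow> ennreal" where "b = (\<lambda>\<xi>. ennreal (g (nu \<xi>)) * a \<xi>)"
    define X where "X = nsum (\<lambda>\<xi>. (enu \<xi> * b \<xi>)\<^sup>2)"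
    have b0: "b 0 = 0" by (simp add: b_def a0)
    have X_fin: "X < top"
    proof -
      have "X \<le> nsum (\<lambda>\<xi>. (ennreal (R powr \<sigma>))\<^sup>2 * (enu \<xi> * a \<xi>)\<^sup>2)"
        unfolding X_def
      proof (rule nn_integral_mono)
        fix \<xi> :: "int^'n"
        have "g (nu \<xi>) \<le> R powr \<sigma>"
          using R \<sigma> by (auto simp: g_def intro: powr_mono2)
        then have "enu \<xi> * b \<xi> \<le> ennreal (R powr \<sigma>) * (enu \<xi> * a \<xi>)"
          unfolding b_def by (subst mult.left_commute) (intro mult_right_mono ennreal_leI, auto)
        then show "(enu \<xi> * b \<xi>)\<^sup>2 \<le> (ennreal (R powr \<sigma>))\<^sup>2 * (enu \<xi> * a \<xi>)\<^sup>2"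
          by (metis power_mono power_mult_distrib zero_le)
      qed
      also have "\<dots> < top"
        using H by (simp add: nn_integral_cmult ennreal_mult_less_top power2_eq_square)
      finally show ?thesis .
    qed
    have half: "ennreal (g (nu \<xi>)) * nsum (\<lambda>\<eta>. a \<eta> * a (\<xi> - \<eta>)) \<le> ennreal \<beta> * half_conv a b \<xi>" for \<xi>
    proof -
      have "g (2 * x) \<le> 2 powr \<sigma> * g x" if "0 \<le> x" for x
      proof -
        have "g (2 * x) \<le> (2 * min x R) powr \<sigma>"
          unfolding g_def using that R \<sigma> by (intro powr_mono2) auto
        also have "\<dots> = 2 powr \<sigma> * g x"
          using that R by (simp add: g_def powr_mult)
        finally show ?thesis .
      qed
      moreover have "g x \<le> g y" if "0 \<le> x" "x \<le> y" for x y
        unfolding g_def using that R \<sigma> by (intro powr_mono2) auto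
      ultimately show ?thesis
        unfolding b_def \<beta>_def by (intro weighted_conv_le) (auto simp: g_def)
    qed
    \<comment> \<open>Above \<open>1 / \<delta>\<close> the additional factor \<open>nu\<close> wins
      a \<open>\<delta>\<close>; below it the weight is bounded and the energy takes over.\<close>
    have N2b: "nsum (\<lambda>\<xi>. (b \<xi>)\<^sup>2) \<le> ennreal (\<delta>\<^sup>2) * X + G * H2"
    proof -
      have "(b \<xi>)\<^sup>2 \<le> ennreal (\<delta>\<^sup>2) * (enu \<xi> * b \<xi>)\<^sup>2 + G * (enu \<xi> * a \<xi>)\<^sup>2" for \<xi>
      proof (cases "1 \<le> \<delta> * nu \<xi>")
        case True
        have "1 * b \<xi> \<le> ennreal (\<delta> * nu \<xi>) * b \<xi>"
          using True by (intro mult_right_mono) auto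
        then have "b \<xi> \<le> ennreal \<delta> * (enu \<xi> * b \<xi>)"
          using \<delta> by (simp add: ennreal_mult mult.assoc)
        then have "(b \<xi>)\<^sup>2 \<le> (ennreal \<delta> * (enu \<xi> * b \<xi>))\<^sup>2"
          by (intro power_mono) auto
        also have "\<dots> = ennreal (\<delta>\<^sup>2) * (enu \<xi> * b \<xi>)\<^sup>2"
          using \<delta> by (simp add: power_mult_distrib ennreal_power)
        finally show ?thesis by (meson le_iff_add order_trans)
      next
        case False
        then have "nu \<xi> \<le> 1 / \<delta>"
          using \<delta> by (simp add: field_simps)
        then have "g (nu \<xi>) \<le> (1 / \<delta>) powr \<sigma>"
          unfolding g_def using R \<sigma> by (intro powr_mono2) auto
        then have "b \<xi> \<le> ennreal ((1 / \<delta>) powr \<sigma>) * a \<xi>"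
          unfolding b_def by (intro mult_right_mono ennreal_leI) auto
        then have "(b \<xi>)\<^sup>2 \<le> (ennreal ((1 / \<delta>) powr \<sigma>) * a \<xi>)\<^sup>2"
          by (intro power_mono) auto
        also have "\<dots> = G * (a \<xi>)\<^sup>2"
        proof -
          have "((1 / \<delta>) powr \<sigma>)\<^sup>2 = (1 / \<delta>) powr (2 * \<sigma>)"
            by (simp add: power2_eq_square flip: powr_add)
          then show ?thesis
            by (simp only: G_def power_mult_distrib ennreal_power powr_ge_zero)
        qed
        also have "\<dots> \<le> G * (enu \<xi> * a \<xi>)\<^sup>2"
          by (intro mult_left_mono a_le) simp
        finally show ?thesis by (metis add.commute le_iff_add order_trans)
      qed
      then have "nsum (\<lambda>\<xi>. (b \<xi>)\<^sup>2) \<le> nsum (\<lambda>\<xi>. ennreal (\<delta>\<^sup>2) * (enu \<xi> * b \<xi>)\<^sup>2 + G * (enu \<xi> * a \<xi>)\<^sup>2)"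
        by (intro nn_integral_mono)
      then show ?thesis
        by (simp add: nn_integral_add nn_integral_cmult X_def H2_def)
    qed
    have N2h: "nsum (\<lambda>\<xi>. (half_conv a b \<xi>)\<^sup>2) \<le> ennreal (1250 * e) * X + ennreal (2 * S\<^sup>2) * (ennreal (\<delta>\<^sup>2) * X + G * H2)"
    proof -
      \<comment> \<open>The tail \<open>a2\<close> goes through the critical estimate with its small
        norm, the finite part \<open>a1\<close> through Young's inequality, which costs no
        derivative of \<open>b\<close>.\<close>
      have "half_conv a b \<xi> \<le> half_conv a2 b \<xi> + nsum (\<lambda>\<eta>. a1 \<eta> * b (\<xi> - \<eta>))" for \<xi>
        unfolding half_conv_def a12
        by (subst nn_integral_add[symmetric]) (auto intro!: nn_integral_mono simp: distrib_right add.commute)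
      then have "nsum (\<lambda>\<xi>. (half_conv a b \<xi>)\<^sup>2) \<le> nsum (\<lambda>\<xi>. (half_conv a2 b \<xi> + nsum (\<lambda>\<eta>. a1 \<eta> * b (\<xi> - \<eta>)))\<^sup>2)"
        by (intro nn_integral_mono power_mono) auto
      also have "\<dots> \<le> 2 * nsum (\<lambda>\<xi>. (half_conv a2 b \<xi>)\<^sup>2) + 2 * nsum (\<lambda>\<xi>. (nsum (\<lambda>\<eta>. a1 \<eta> * b (\<xi> - \<eta>)))\<^sup>2)"
        by (rule nsum_square_add_le)
      also have "\<dots> \<le> 2 * (625 * nsum (\<lambda>\<xi>. (enu \<xi> * a2 \<xi>)\<^sup>2) * X) + 2 * ((nsum a1)\<^sup>2 * nsum (\<lambda>\<xi>. (b \<xi>)\<^sup>2))"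
        unfolding X_def using a0
        by (intro add_mono mult_left_mono half_conv_bound nsum_conv_bound n b0) (auto simp: a2_def)
      also have "\<dots> \<le> 2 * (625 * ennreal e * X) + 2 * ((ennreal S)\<^sup>2 * (ennreal (\<delta>\<^sup>2) * X + G * H2))"
        unfolding S(1) by (intro add_mono mult_left_mono mult_right_mono a2e N2b) auto
      also have "\<dots> = ennreal (1250 * e) * X + ennreal (2 * S\<^sup>2) * (ennreal (\<delta>\<^sup>2) * X + G * H2)"
        using S(2) e by (simp add: ennreal_mult ennreal_power mult.assoc[symmetric])
      finally show ?thesis .
    qed
    have "X \<le> nsum (\<lambda>\<xi>. (ennreal D * F \<xi> + ennreal (D * \<beta>) * half_conv a b \<xi>)\<^sup>2)"
      unfolding X_def
    proof (intro nn_integral_mono power_mono)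
      fix \<xi> :: "int^'n"
      have "enu \<xi> * b \<xi> \<le> ennreal D * (F \<xi> + ennreal (g (nu \<xi>)) * nsum (\<lambda>\<eta>. a \<eta> * a (\<xi> - \<eta>)))"
        using le[OF R, of \<xi>] by (simp add: b_def g_def)
      also have "\<dots> \<le> ennreal D * (F \<xi> + ennreal \<beta> * half_conv a b \<xi>)"
        by (intro mult_left_mono add_left_mono half) simp
      finally show "enu \<xi> * b \<xi> \<le> ennreal D * F \<xi> + ennreal (D * \<beta>) * half_conv a b \<xi>"
        using D by (simp add: ennreal_mult distrib_left mult.assoc \<beta>_def)
    qed simp
    also have "\<dots> \<le> 2 * nsum (\<lambda>\<xi>. (ennreal D * F \<xi>)\<^sup>2) + 2 * nsum (\<lambda>\<xi>. (ennreal (D * \<beta>) * half_conv a b \<xi>)\<^sup>2)"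
      by (rule nsum_square_add_le)
    also have "\<dots> = 2 * (ennreal D)\<^sup>2 * nsum (\<lambda>\<xi>. (F \<xi>)\<^sup>2) + ennreal \<kappa> * nsum (\<lambda>\<xi>. (half_conv a b \<xi>)\<^sup>2)"
    proof -
      have "\<kappa> = 2 * (D * \<beta>)\<^sup>2"
        by (simp add: \<kappa>_def power_mult_distrib)
      moreover have "D * \<beta> \<ge> 0"
        using D by (simp add: \<beta>_def)
      ultimately have "ennreal \<kappa> = 2 * (ennreal (D * \<beta>))\<^sup>2"
        by (simp only: ennreal_mult ennreal_power zero_le_power2 ennreal_numeral zero_le_numeral)
      then show ?thesis
        by (simp only: nsum_cmult_square mult.assoc)
    qed
    also have "\<dots> \<le> 2 * (ennreal D)\<^sup>2 * nsum (\<lambda>\<xi>. (F \<xi>)\<^sup>2)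
        + ennreal \<kappa> * (ennreal (1250 * e) * X + ennreal (2 * S\<^sup>2) * (ennreal (\<delta>\<^sup>2) * X + G * H2))"
      by (intro add_left_mono mult_left_mono N2h) simp
    also have "\<dots> = A + ennreal (\<kappa> * (1250 * e) + \<kappa> * (2 * S\<^sup>2) * \<delta>\<^sup>2) * X"
      using \<kappa> e by (simp add: A_def ennreal_mult distrib_left distrib_right mult_ac add_ac)
    also have "\<dots> \<le> A + ennreal (1 / 2) * X"
    proof (intro add_left_mono mult_right_mono ennreal_leI)
      have "\<kappa> * (1250 * e) \<le> 1 / 4"
        using \<kappa> by (simp add: e_def divide_simps)
      moreover have "\<kappa> * (2 * S\<^sup>2) \<le> (\<kappa> + 1) * (2 * (S\<^sup>2 + 1))"
        using \<kappa> by (intro mult_mono) auto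
      then have "\<kappa> * (2 * S\<^sup>2) * \<delta>\<^sup>2 \<le> (\<kappa> + 1) * (2 * (S\<^sup>2 + 1)) * \<delta>\<^sup>2"
        by (intro mult_right_mono) auto
      moreover have "(\<kappa> + 1) * (2 * (S\<^sup>2 + 1)) * \<delta>\<^sup>2 = 1 / 4"
      proof -
        have *: "p * (2 * q) * (1 / (8 * p * q)) = 1 / 4" if "p > 0" "q > 0" for p q :: real
          using that by simp
        show ?thesis
          unfolding \<delta>2 using \<kappa> by (intro *) (auto simp: add_nonneg_pos)
      qed
      ultimately show "\<kappa> * (1250 * e) + \<kappa> * (2 * S\<^sup>2) * \<delta>\<^sup>2 \<le> 1 / 2" by linarith
    qed simp
    \<comment> \<open>Half of \<open>X\<close> is absorbed on the left. Since \<open>X\<close> is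
      finite this is done with real numbers.\<close>
    finally have "X \<le> A + ennreal (1 / 2) * X" .
    moreover obtain x where x: "X = ennreal x" "x \<ge> 0"
      using X_fin by (metis ennreal_cases less_irrefl)
    moreover obtain \<alpha> where \<alpha>: "A = ennreal \<alpha>" "\<alpha> \<ge> 0"
      using A by (metis ennreal_cases less_irrefl)
    moreover from x(2) \<alpha>(2) have "ennreal (\<alpha> + 1 / 2 * x) = ennreal \<alpha> + ennreal (1 / 2) * ennreal x"
      by (subst ennreal_plus, simp, simp, subst ennreal_mult) simp_all
    ultimately have xle: "ennreal x \<le> ennreal (\<alpha> + 1 / 2 * x)"
      by (simp only:)
    have "0 \<le> \<alpha> + 1 / 2 * x"
      using x(2) \<alpha>(2) by simp
    then have "x \<le> \<alpha> + 1 / 2 * x"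
      using xle by (rule iffD1[OF ennreal_le_iff])
    then have "x \<le> 2 * \<alpha>" by simp
    then have "X \<le> 2 * A"
      using x \<alpha> by (metis ennreal_leI ennreal_mult ennreal_numeral zero_le_numeral)
    then show ?thesis
      by (simp add: X_def b_def g_def)
  qed
  have "nsum (\<lambda>\<xi>. (ennreal (nu \<xi> powr (\<sigma> + 1)) * a \<xi>)\<^sup>2) \<le> 2 * A"
  proof (rule nsum_leI)
    fix T :: "(int^'n) set" assume T: "finite T"
    \<comment> \<open>A cut-off beyond all frequencies of a finite set leaves their weights
      untouched, so the bound uniform in \<open>R\<close> gives the full weight.\<close>
    define R where "R = 1 + (\<Sum>\<xi>\<in>T. nu \<xi>)"
    have R: "R > 0" by (simp add: R_def add_pos_nonneg sum_nonneg)
    have "min (nu \<xi>) R = nu \<xi>" if "\<xi> \<in> T" for \<xi>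
      using member_le_sum[OF that, of nu] T by (simp add: R_def)
    then have "(\<Sum>\<xi>\<in>T. (ennreal (nu \<xi> powr (\<sigma> + 1)) * a \<xi>)\<^sup>2) = (\<Sum>\<xi>\<in>T. (enu \<xi> * (ennreal (min (nu \<xi>) R powr \<sigma>) * a \<xi>))\<^sup>2)"
      by (intro sum.cong) (simp_all add: powr_add ennreal_mult mult_ac)
    also have "\<dots> \<le> nsum (\<lambda>\<xi>. (enu \<xi> * (ennreal (min (nu \<xi>) R powr \<sigma>) * a \<xi>))\<^sup>2)"
      by (rule sum_le_nsum[OF T])
    also have "\<dots> \<le> 2 * A" by (rule X_le[OF R])
    finally show "(\<Sum>\<xi>\<in>T. (ennreal (nu \<xi> powr (\<sigma> + 1)) * a \<xi>)\<^sup>2) \<le> 2 * A" .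
  qed
  also have "\<dots> < \<infinity>"
    using A by (simp add: ennreal_mult_less_top)
  finally show ?thesis .
qed

text \<open>The derivative falls on the outer frequency, leaving a scalar convolution of
  amplitudes.\<close>

lemma norm_convection_le:
  assumes "(\<lambda>\<eta>. norm ((2 * pi * \<i> * dot \<xi> (u \<eta>)) *s u (\<xi> - \<eta>))) summable_on UNIV"
  shows "ennreal (norm (convection u \<xi>)) \<le> ennreal (2 * pi * nu \<xi>) * nsum (\<lambda>\<eta>. ennreal (norm (u \<eta>)) * ennreal (norm (u (\<xi> - \<eta>))))"
proof -
  have "norm (convection u \<xi>) \<le> (\<Sum>\<^sub>\<infinity>\<eta>. norm ((2 * pi * \<i> * dot \<xi> (u \<eta>)) *s u (\<xi> - \<eta>)))"
    unfolding convection_def by (rule norm_infsum_bound) (rule assms)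
  then have "ennreal (norm (convection u \<xi>)) \<le> ennreal (\<Sum>\<^sub>\<infinity>\<eta>. norm ((2 * pi * \<i> * dot \<xi> (u \<eta>)) *s u (\<xi> - \<eta>)))"
    by (rule ennreal_leI)
  also have "\<dots> = nsum (\<lambda>\<eta>. ennreal (norm ((2 * pi * \<i> * dot \<xi> (u \<eta>)) *s u (\<xi> - \<eta>))))"
    by (rule nsum_real_summable(2)[symmetric]) (use assms in auto)
  also have "\<dots> \<le> nsum (\<lambda>\<eta>. ennreal (2 * pi * nu \<xi>) * (ennreal (norm (u \<eta>)) * ennreal (norm (u (\<xi> - \<eta>)))))"
  proof (rule nn_integral_mono)
    fix \<eta>
    have "ennreal (norm ((2 * pi * \<i> * dot \<xi> (u \<eta>)) *s u (\<xi> - \<eta>))) \<le> ennreal (2 * pi * nu \<xi> * (norm (u \<eta>) * norm (u (\<xi> - \<eta>))))"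
      by (rule ennreal_leI[OF norm_convection_term_le])
    then show "ennreal (norm ((2 * pi * \<i> * dot \<xi> (u \<eta>)) *s u (\<xi> - \<eta>)))
        \<le> ennreal (2 * pi * nu \<xi>) * (ennreal (norm (u \<eta>)) * ennreal (norm (u (\<xi> - \<eta>))))"
      by (simp add: ennreal_mult)
  qed
  also have "\<dots> = ennreal (2 * pi * nu \<xi>) * nsum (\<lambda>\<eta>. ennreal (norm (u \<eta>)) * ennreal (norm (u (\<xi> - \<eta>))))"
    by (rule nn_integral_cmult) auto
  finally show ?thesis .
qed

lemma bounded_linear_vcnj: "bounded_linear (vcnj :: complex^'n::finite \<Rightarrow> complex^'n)"
proof -
  have "linear (vcnj :: complex^'n \<Rightarrow> complex^'n)"
    by (rule linearI) simp_all
  then show ?thesis by (simp add: linear_conv_bounded_linear)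
qed

lemma convection_uminus:
  assumes sym: "\<And>\<xi>. u (- \<xi>) = vcnj (u \<xi>)"
    and abs: "(\<lambda>\<eta>. norm ((2 * pi * \<i> * dot \<xi> (u \<eta>)) *s u (\<xi> - \<eta>))) summable_on UNIV"
  shows "convection u (- \<xi>) = vcnj (convection u \<xi>)"
proof -
  have b: "bij_betw uminus (UNIV :: (int^'n::finite) set) UNIV"
    by (rule bij_betwI[where g = uminus]) auto
  have "convection u (- \<xi>) = (\<Sum>\<^sub>\<infinity>\<eta>. (2 * pi * \<i> * dot (- \<xi>) (u (- \<eta>))) *s u (- \<xi> - (- \<eta>)))"
    unfolding convection_def by (rule infsum_reindex_bij_betw[OF b, symmetric])
  also have "\<dots> = (\<Sum>\<^sub>\<infinity>\<eta>. vcnj ((2 * pi * \<i> * dot \<xi> (u \<eta>)) *s u (\<xi> - \<eta>)))"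
  proof (rule infsum_cong)
    fix \<eta>
    have "u (- \<xi> - (- \<eta>)) = vcnj (u (\<xi> - \<eta>))"
      using sym[of "\<xi> - \<eta>"] by simp
    then show "(2 * pi * \<i> * dot (- \<xi>) (u (- \<eta>))) *s u (- \<xi> - (- \<eta>)) = vcnj ((2 * pi * \<i> * dot \<xi> (u \<eta>)) *s u (\<xi> - \<eta>))"
      by (simp add: sym)
  qed
  also have "\<dots> = vcnj (convection u \<xi>)"
    unfolding convection_def
    by (intro infsumI has_sum_bounded_linear[OF bounded_linear_vcnj] has_sum_infsum abs_summable_summable[OF abs])
  finally show ?thesis .
qed

text \<open>For zero mean and \<open>s \<ge> 0\<close> the homogeneous and inhomogeneous weights are
  equivalent, since \<open>1 \<le> (nu \<xi>)^2\<close> off zero.\<close>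

lemma nsum_sobolev_iff:
  fixes z :: "int^'n::finite \<Rightarrow> 'b::real_normed_vector"
  assumes "z 0 = 0" "s \<ge> 0"
  shows "(\<lambda>\<xi>. (1 + (nu \<xi>)\<^sup>2) powr s * (norm (z \<xi>))\<^sup>2) summable_on UNIV
    \<longleftrightarrow> nsum (\<lambda>\<xi>. (ennreal (nu \<xi> powr s) * ennreal (norm (z \<xi>)))\<^sup>2) < \<infinity>"
proof -
  have sq: "(nu \<xi> powr s)\<^sup>2 = ((nu \<xi>)\<^sup>2) powr s" for \<xi> :: "int^'n"
    by (cases "\<xi> = 0") (simp_all add: powr_powr power2_eq_square powr_mult)
  have e: "(ennreal (nu \<xi> powr s) * ennreal (norm (z \<xi>)))\<^sup>2 = ennreal (((nu \<xi>)\<^sup>2) powr s * (norm (z \<xi>))\<^sup>2)" for \<xi>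
    by (simp add: power_mult_distrib ennreal_power ennreal_mult sq)
  have le1: "((nu \<xi>)\<^sup>2) powr s * (norm (z \<xi>))\<^sup>2 \<le> (1 + (nu \<xi>)\<^sup>2) powr s * (norm (z \<xi>))\<^sup>2" for \<xi>
    using assms by (intro mult_right_mono powr_mono2) auto
  have le2: "(1 + (nu \<xi>)\<^sup>2) powr s * (norm (z \<xi>))\<^sup>2 \<le> 2 powr s * (((nu \<xi>)\<^sup>2) powr s * (norm (z \<xi>))\<^sup>2)" for \<xi>
  proof (cases "\<xi> = 0")
    case False
    have "1 \<le> (nu \<xi>)\<^sup>2" using nu_ge_1[OF False] by (simp add: one_le_power)
    then have "(1 + (nu \<xi>)\<^sup>2) powr s \<le> (2 * (nu \<xi>)\<^sup>2) powr s"
      using assms by (intro powr_mono2) auto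
    also have "\<dots> = 2 powr s * ((nu \<xi>)\<^sup>2) powr s"
      by (simp add: powr_mult)
    finally show ?thesis
      by (simp add: mult_right_mono mult.assoc[symmetric])
  qed (use assms in simp)
  have "(\<lambda>\<xi>. (1 + (nu \<xi>)\<^sup>2) powr s * (norm (z \<xi>))\<^sup>2) summable_on UNIV
      \<longleftrightarrow> (\<lambda>\<xi>. ((nu \<xi>)\<^sup>2) powr s * (norm (z \<xi>))\<^sup>2) summable_on UNIV"
  proof
    assume "(\<lambda>\<xi>. (1 + (nu \<xi>)\<^sup>2) powr s * (norm (z \<xi>))\<^sup>2) summable_on UNIV"
    then show "(\<lambda>\<xi>. ((nu \<xi>)\<^sup>2) powr s * (norm (z \<xi>))\<^sup>2) summable_on UNIV"
      by (rule summable_on_comparison_test) (use le1 in auto)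
  next
    assume "(\<lambda>\<xi>. ((nu \<xi>)\<^sup>2) powr s * (norm (z \<xi>))\<^sup>2) summable_on UNIV"
    then have "(\<lambda>\<xi>. 2 powr s * (((nu \<xi>)\<^sup>2) powr s * (norm (z \<xi>))\<^sup>2)) summable_on UNIV"
      by (rule summable_on_cmult_right)
    then show "(\<lambda>\<xi>. (1 + (nu \<xi>)\<^sup>2) powr s * (norm (z \<xi>))\<^sup>2) summable_on UNIV"
      by (rule summable_on_comparison_test) (use le2 in auto)
  qed
  also have "\<dots> \<longleftrightarrow> nsum (\<lambda>\<xi>. ennreal (((nu \<xi>)\<^sup>2) powr s * (norm (z \<xi>))\<^sup>2)) < \<infinity>"
    by (rule nsum_real_summable(1)) auto
  finally show ?thesis by (simp only: e)
qed

context stokes_symbol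
begin

text \<open>Derivative count: the solution operator gains two and convection costs one, so weight
  \<open>s - 1\<close> on the convolution and \<open>s - 2\<close> on the forcing give
  \<open>s\<close> on the velocity. The bound on the convolution is recorded separately because the
  pressure inherits it.\<close>

lemma regularity:
  assumes n: "CARD('n) \<le> 4" and u0: "u 0 = 0" and f0: "f 0 = 0"
    and u1: "(\<lambda>\<xi>. (nu \<xi>)\<^sup>2 * (norm (u \<xi>))\<^sup>2) summable_on UNIV"
    and abs: "\<And>\<xi>. (\<lambda>\<eta>. norm ((2 * pi * \<i> * dot \<xi> (u \<eta>)) *s u (\<xi> - \<eta>))) summable_on UNIV"
    and eq: "\<And>\<xi>. \<xi> \<noteq> 0 \<Longrightarrow> u \<xi> = solve \<xi> (f \<xi> - convection u \<xi>)"
    and s: "s \<ge> 2" and fs: "(\<lambda>\<xi>. (1 + (nu \<xi>)\<^sup>2) powr (s - 2) * (norm (f \<xi>))\<^sup>2) summable_on UNIV"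
  shows "(\<lambda>\<xi>. (1 + (nu \<xi>)\<^sup>2) powr s * (norm (u \<xi>))\<^sup>2) summable_on UNIV" (is ?A)
    and "nsum (\<lambda>\<xi>. (ennreal (nu \<xi> powr (s - 1)) * nsum (\<lambda>\<eta>. ennreal (norm (u \<eta>)) * ennreal (norm (u (\<xi> - \<eta>)))))\<^sup>2) < \<infinity>" (is ?B)
proof -
  define a where "a = (\<lambda>\<xi>. ennreal (norm (u \<xi>)))"
  define F where "F = (\<lambda>\<xi>. ennreal (nu \<xi> powr (s - 2)) * ennreal (norm (f \<xi>)))"
  \<comment> \<open>1 stems from the forcing, \<open>2 * pi\<close> from the derivative in the
    convection and \<open>c\<close> from coercivity.\<close>
  define D where "D = (1 + 2 * pi) / c"
  have D: "D > 0" using c_pos by (simp add: D_def add_pos_pos)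
  have a0: "a 0 = 0" by (simp add: a_def u0)
  have H: "nsum (\<lambda>\<xi>. (enu \<xi> * a \<xi>)\<^sup>2) < \<infinity>"
  proof -
    have "(enu \<xi> * a \<xi>)\<^sup>2 = ennreal ((nu \<xi>)\<^sup>2 * (norm (u \<xi>))\<^sup>2)" for \<xi>
      by (simp add: a_def power_mult_distrib ennreal_power ennreal_mult)
    then show ?thesis
      using nsum_real_summable(1)[of "\<lambda>\<xi>. (nu \<xi>)\<^sup>2 * (norm (u \<xi>))\<^sup>2"] u1 by simp
  qed
  have FF: "nsum (\<lambda>\<xi>. (F \<xi>)\<^sup>2) < \<infinity>"
    using nsum_sobolev_iff[of f "s - 2"] fs f0 s by (simp add: F_def)
  have "nsum (\<lambda>\<xi>. (ennreal (nu \<xi> powr (s - 1 + 1)) * a \<xi>)\<^sup>2) < \<infinity>"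
  proof (rule bootstrap[where F = F and D = D, OF n a0 H FF])
    fix \<xi> :: "int^'n" and R :: real assume R: "R > 0"
    define Q where "Q = nsum (\<lambda>\<eta>. a \<eta> * a (\<xi> - \<eta>))"
    define w where "w = min (nu \<xi>) R powr (s - 1)"
    have "enu \<xi> * (ennreal w * a \<xi>) \<le> ennreal D * (F \<xi> + ennreal w * Q)"
    proof (cases "\<xi> = 0 \<or> Q = top")
      \<comment> \<open>At the zero frequency the left-hand side vanishes; elsewhere
        \<open>w > 0\<close>, so an infinite convolution makes the right-hand side infinite.\<close>
      case True
      show ?thesis
      proof (cases "\<xi> = 0")
        case False
        then have "w > 0" using R by (auto simp: w_def min_def)
        then show ?thesis using True False D by (simp add: ennreal_mult_top)
      qed (simp add: a0)
    next
      case False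
      then have nu1: "nu \<xi> \<ge> 1" and \<xi>: "\<xi> \<noteq> 0" using nu_ge_1 by auto
      obtain q where q: "Q = ennreal q" "q \<ge> 0"
        using False by (metis ennreal_cases)
      have "ennreal (norm (convection u \<xi>)) \<le> ennreal (2 * pi * nu \<xi>) * Q"
        unfolding Q_def a_def by (rule norm_convection_le[OF abs])
      then have conv: "norm (convection u \<xi>) \<le> 2 * pi * nu \<xi> * q"
        using q by (simp add: ennreal_le_iff flip: ennreal_mult)
      \<comment> \<open>The cut-off only lowers the weight, so the forcing term is bounded at full
        order \<open>s - 2\<close> uniformly in \<open>R\<close>.\<close>
      have w: "w \<ge> 0" "w \<le> nu \<xi> * nu \<xi> powr (s - 2)"
      proof -
        have "w \<le> nu \<xi> powr (s - 1)"
          unfolding w_def using R nu1 s by (intro powr_mono2) auto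
        also have "s - 1 = 1 + (s - 2)" by simp
        also have "nu \<xi> powr (1 + (s - 2)) = nu \<xi> * nu \<xi> powr (s - 2)"
          using nu1 by (subst powr_add) simp
        finally show "w \<le> nu \<xi> * nu \<xi> powr (s - 2)" .
      qed (simp add: w_def)
      have "nu \<xi> * (w * norm (u \<xi>)) \<le> nu \<xi> * (w * (norm (f \<xi> - convection u \<xi>) / (c * (nu \<xi>)\<^sup>2)))"
        using norm_solve_le[OF \<xi>, of "f \<xi> - convection u \<xi>"] w eq[OF \<xi>]
        by (intro mult_left_mono) auto
      also have "\<dots> \<le> nu \<xi> * (w * ((norm (f \<xi>) + 2 * pi * nu \<xi> * q) / (c * (nu \<xi>)\<^sup>2)))"
        using w c_pos conv norm_triangle_ineq4[of "f \<xi>" "convection u \<xi>"]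
        by (intro mult_left_mono divide_right_mono) auto
      also have "\<dots> = (w * norm (f \<xi>) / nu \<xi> + 2 * pi * (w * q)) / c"
        using nu1 \<xi> c_pos by (simp add: divide_simps power2_eq_square) (simp add: algebra_simps)
      also have "\<dots> \<le> (nu \<xi> powr (s - 2) * norm (f \<xi>) + 2 * pi * (w * q)) / c"
      proof (intro divide_right_mono add_right_mono)
        have "w * norm (f \<xi>) / nu \<xi> \<le> nu \<xi> * nu \<xi> powr (s - 2) * norm (f \<xi>) / nu \<xi>"
          using w by (intro divide_right_mono mult_right_mono) auto
        then show "w * norm (f \<xi>) / nu \<xi> \<le> nu \<xi> powr (s - 2) * norm (f \<xi>)"
          using nu1 \<xi> by simp
      qed (use c_pos in simp)
      also have "\<dots> \<le> D * (nu \<xi> powr (s - 2) * norm (f \<xi>) + w * q)"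
      proof -
        have "0 \<le> 2 * pi * (nu \<xi> powr (s - 2) * norm (f \<xi>)) + w * q"
          using w q by simp
        then show ?thesis
          unfolding D_def times_divide_eq_left using c_pos
          by (intro divide_right_mono) (simp_all add: algebra_simps)
      qed
      finally have "ennreal (nu \<xi> * (w * norm (u \<xi>))) \<le> ennreal (D * (nu \<xi> powr (s - 2) * norm (f \<xi>) + w * q))"
        by (rule ennreal_leI)
      then show ?thesis
        using w q D by (simp add: a_def F_def ennreal_mult)
    qed
    then show "enu \<xi> * (ennreal (min (nu \<xi>) R powr (s - 1)) * a \<xi>)
      \<le> ennreal D * (F \<xi> + ennreal (min (nu \<xi>) R powr (s - 1)) * nsum (\<lambda>\<eta>. a \<eta> * a (\<xi> - \<eta>)))"
      by (simp only: w_def Q_def)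
  qed (use s D in auto)
  then have us: "nsum (\<lambda>\<xi>. (ennreal (nu \<xi> powr s) * a \<xi>)\<^sup>2) < \<infinity>" by simp
  then show ?A
    using nsum_sobolev_iff[of u s] u0 s by (simp add: a_def)
  define b :: "int^'n \<Rightarrow> ennreal" where "b = (\<lambda>\<xi>. ennreal (nu \<xi> powr (s - 1)) * a \<xi>)"
  have b0: "b 0 = 0" by (simp add: b_def a0)
  have nub: "enu \<xi> * b \<xi> = ennreal (nu \<xi> powr s) * a \<xi>" for \<xi> :: "int^'n"
  proof -
    have "nu \<xi> powr (1 + (s - 1)) = nu \<xi> * nu \<xi> powr (s - 1)"
      by (subst powr_add) simp
    then show ?thesis by (simp add: b_def ennreal_mult mult.assoc)
  qed
  \<comment> \<open>With the velocity known to have order \<open>s\<close>, the untruncated weight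
    is admissible and the critical estimate bounds the convolution.\<close>
  have "ennreal (nu \<xi> powr (s - 1)) * nsum (\<lambda>\<eta>. a \<eta> * a (\<xi> - \<eta>)) \<le> ennreal (2 * 2 powr (s - 1)) * half_conv a b \<xi>" for \<xi>
    unfolding b_def using s by (intro weighted_conv_le) (auto simp: powr_mult intro: powr_mono2)
  then have "nsum (\<lambda>\<xi>. (ennreal (nu \<xi> powr (s - 1)) * nsum (\<lambda>\<eta>. a \<eta> * a (\<xi> - \<eta>)))\<^sup>2)
      \<le> nsum (\<lambda>\<xi>. (ennreal (2 * 2 powr (s - 1)) * half_conv a b \<xi>)\<^sup>2)"
    by (intro nn_integral_mono power_mono) auto
  also have "\<dots> \<le> (ennreal (2 * 2 powr (s - 1)))\<^sup>2 * (625 * nsum (\<lambda>\<eta>. (enu \<eta> * a \<eta>)\<^sup>2) * nsum (\<lambda>\<zeta>. (enu \<zeta> * b \<zeta>)\<^sup>2))"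
    unfolding nsum_cmult_square by (intro mult_left_mono half_conv_bound n a0 b0) auto
  also have "\<dots> < \<infinity>"
    using H us by (simp add: nub ennreal_mult_less_top power2_eq_square)
  finally show ?B by (simp add: a_def)
qed

theorem fourier_solution:
  fixes f :: "int^'n \<Rightarrow> complex^'n"
  assumes n: "CARD('n) \<le> 4" and M_bound: "\<And>\<xi> w. norm (M \<xi> w) \<le> C * (nu \<xi>)\<^sup>2 * norm w"
    and f_sym: "\<And>\<xi>. f (- \<xi>) = vcnj (f \<xi>)" and f0: "f 0 = 0"
    and f2: "(\<lambda>\<xi>. (norm (f \<xi>))\<^sup>2) summable_on UNIV"
  obtains u p where "\<And>\<xi>. u (- \<xi>) = vcnj (u \<xi>)" "u 0 = 0" "\<And>\<xi>. dot \<xi> (u \<xi>) = 0"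
    "\<And>\<xi>. p (- \<xi>) = cnj (p \<xi>)" "p 0 = 0"
    "\<And>\<xi>. (\<lambda>\<eta>. norm ((2 * pi * \<i> * dot \<xi> (u \<eta>)) *s u (\<xi> - \<eta>))) summable_on UNIV"
    "\<And>\<xi>. M \<xi> (u \<xi>) + (2 * pi * \<i> * p \<xi>) *s cfreq \<xi> + convection u \<xi> = f \<xi>"
    "\<And>s. s \<ge> 2 \<Longrightarrow> (\<lambda>\<xi>. (1 + (nu \<xi>)\<^sup>2) powr (s - 2) * (norm (f \<xi>))\<^sup>2) summable_on UNIV \<Longrightarrow>
      (\<lambda>\<xi>. (1 + (nu \<xi>)\<^sup>2) powr s * (norm (u \<xi>))\<^sup>2) summable_on UNIV \<and>
      (\<lambda>\<xi>. (1 + (nu \<xi>)\<^sup>2) powr (s - 1) * (cmod (p \<xi>))\<^sup>2) summable_on UNIV"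
proof -
  obtain u where u_sym: "\<And>\<xi>. u (- \<xi>) = vcnj (u \<xi>)" and u0: "u 0 = 0" and u_dot: "\<And>\<xi>. dot \<xi> (u \<xi>) = 0"
    and u1: "(\<lambda>\<xi>. (nu \<xi>)\<^sup>2 * (norm (u \<xi>))\<^sup>2) summable_on UNIV"
    and abs: "\<And>\<xi>. (\<lambda>\<eta>. norm ((2 * pi * \<i> * dot \<xi> (u \<eta>)) *s u (\<xi> - \<eta>))) summable_on UNIV"
    and eq: "\<And>\<xi>. \<xi> \<noteq> 0 \<Longrightarrow> u \<xi> = solve \<xi> (f \<xi> - convection u \<xi>)"
    by (rule weak_solution_exists[OF f_sym f2]) (rule that)
  \<comment> \<open>Momentum residual without the pressure. At nonzero frequencies it is parallel to
    \<open>cfreq \<xi>\<close>, because \<open>u \<xi>\<close> is a value of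
    \<open>solve\<close>.\<close>
  define G where "G = (\<lambda>\<xi>. f \<xi> - convection u \<xi> - M \<xi> (u \<xi>))"
  \<comment> \<open>The component of the residual along \<open>cfreq \<xi>\<close>; division by zero
    at \<open>\<xi> = 0\<close> returns 0, the normalisation to zero mean.\<close>
  define p where "p = (\<lambda>\<xi>. dot \<xi> (G \<xi>) / (2 * pi * \<i> * of_real ((nu \<xi>)\<^sup>2)))"
  have p0: "p 0 = 0" by (simp add: p_def)
  have G_sym: "G (- \<xi>) = vcnj (G \<xi>)" for \<xi>
    by (simp add: G_def f_sym convection_uminus[OF u_sym abs] u_sym M_cnj)
  have p_sym: "p (- \<xi>) = cnj (p \<xi>)" for \<xi>
    by (simp add: p_def G_sym)
  have equation: "M \<xi> (u \<xi>) + (2 * pi * \<i> * p \<xi>) *s cfreq \<xi> + convection u \<xi> = f \<xi>" for \<xi>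
  proof (cases "\<xi> = 0")
    \<comment> \<open>In divergence form the convection has no zero mode, which matches the zero
      mean of the forcing.\<close>
    case True
    have "convection u 0 = 0" by (simp add: convection_def)
    moreover have "cfreq 0 = (0 :: complex^'n)" by (simp add: cfreq_def vec_eq_iff)
    ultimately show ?thesis using True by (simp add: u0 f0)
  next
    case False
    then obtain q where q: "M \<xi> (u \<xi>) + q *s cfreq \<xi> = f \<xi> - convection u \<xi>"
      using solve_eq[of \<xi> "f \<xi> - convection u \<xi>"] eq by metis
    then have G: "G \<xi> = q *s cfreq \<xi>"
      by (simp add: G_def algebra_simps)
    have "2 * pi * \<i> * p \<xi> = q"
      using False by (simp add: p_def G)
    then show ?thesis using q by (simp add: algebra_simps)
  qed
  have regular: "(\<lambda>\<xi>. (1 + (nu \<xi>)\<^sup>2) powr s * (norm (u \<xi>))\<^sup>2) summable_on UNIV \<and>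
      (\<lambda>\<xi>. (1 + (nu \<xi>)\<^sup>2) powr (s - 1) * (cmod (p \<xi>))\<^sup>2) summable_on UNIV"
    if s: "s \<ge> 2" and fs: "(\<lambda>\<xi>. (1 + (nu \<xi>)\<^sup>2) powr (s - 2) * (norm (f \<xi>))\<^sup>2) summable_on UNIV" for s
  proof
    note reg = regularity[OF n u0 f0 u1 abs eq s fs]
    show us: "(\<lambda>\<xi>. (1 + (nu \<xi>)\<^sup>2) powr s * (norm (u \<xi>))\<^sup>2) summable_on UNIV"
      by (rule reg(1))
    define Q where "Q = (\<lambda>\<xi>. nsum (\<lambda>\<eta>. ennreal (norm (u \<eta>)) * ennreal (norm (u (\<xi> - \<eta>)))))"
    \<comment> \<open>Weighted contributions of the forcing, the convection and the viscous term to
      the pressure.\<close>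
    define x y z :: "int^'n \<Rightarrow> ennreal" where "x = (\<lambda>\<xi>. ennreal (nu \<xi> powr (s - 2)) * ennreal (norm (f \<xi>)))"
      and "y = (\<lambda>\<xi>. ennreal (2 * pi) * (ennreal (nu \<xi> powr (s - 1)) * Q \<xi>))"
      and "z = (\<lambda>\<xi>. ennreal \<bar>C\<bar> * (ennreal (nu \<xi> powr s) * ennreal (norm (u \<xi>))))"
    have "ennreal (nu \<xi> powr (s - 1)) * ennreal (cmod (p \<xi>)) \<le> x \<xi> + (y \<xi> + z \<xi>)" for \<xi>
    proof (cases "\<xi> = 0")
      case False
      then have nu1: "nu \<xi> \<ge> 1" using nu_ge_1 by auto
      define N where "N = norm (convection u \<xi>)"
      have "cmod (p \<xi>) = cmod (dot \<xi> (G \<xi>)) / (2 * pi * (nu \<xi>)\<^sup>2)"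
        by (simp add: p_def norm_divide norm_mult norm_power)
      also have "\<dots> \<le> nu \<xi> * norm (G \<xi>) / (2 * pi * (nu \<xi>)\<^sup>2)"
        by (intro divide_right_mono cmod_dot_le) simp
      also have "\<dots> = norm (G \<xi>) / nu \<xi> / (2 * pi)"
        using nu1 by (simp add: power2_eq_square)
      also have "\<dots> \<le> norm (G \<xi>) / nu \<xi> / 1"
        using nu1 pi_gt3 by (intro divide_left_mono) auto
      also have "\<dots> \<le> (norm (f \<xi>) + N + \<bar>C\<bar> * (nu \<xi>)\<^sup>2 * norm (u \<xi>)) / nu \<xi> / 1"
      proof (intro divide_right_mono)
        have "norm (M \<xi> (u \<xi>)) \<le> \<bar>C\<bar> * (nu \<xi>)\<^sup>2 * norm (u \<xi>)"
          using M_bound[of \<xi> "u \<xi>"] by (rule order_trans) (intro mult_right_mono, auto)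
        then show "norm (G \<xi>) \<le> norm (f \<xi>) + N + \<bar>C\<bar> * (nu \<xi>)\<^sup>2 * norm (u \<xi>)"
          using norm_triangle_ineq4[of "f \<xi> - convection u \<xi>" "M \<xi> (u \<xi>)"] norm_triangle_ineq4[of "f \<xi>" "convection u \<xi>"]
          by (simp add: G_def N_def)
      qed (use nu1 in auto)
      finally have "nu \<xi> powr (s - 1) * cmod (p \<xi>)
          \<le> nu \<xi> powr (s - 1) * ((norm (f \<xi>) + N + \<bar>C\<bar> * (nu \<xi>)\<^sup>2 * norm (u \<xi>)) / nu \<xi>)"
        by (intro mult_left_mono) auto
      also have "\<dots> = nu \<xi> powr (s - 2) * norm (f \<xi>) + nu \<xi> powr (s - 2) * N + \<bar>C\<bar> * (nu \<xi> powr s * norm (u \<xi>))"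
      proof -
        have "nu \<xi> powr (1 + (s - 2)) = nu \<xi> * nu \<xi> powr (s - 2)"
          by (subst powr_add) simp
        moreover have "nu \<xi> powr (2 + (s - 2)) = (nu \<xi>)\<^sup>2 * nu \<xi> powr (s - 2)"
          using nu1 by (subst powr_add) simp
        ultimately show ?thesis
          using nu1 False by (simp add: field_simps power2_eq_square)
      qed
      finally have "ennreal (nu \<xi> powr (s - 1) * cmod (p \<xi>))
        \<le> ennreal (nu \<xi> powr (s - 2) * norm (f \<xi>) + nu \<xi> powr (s - 2) * N + \<bar>C\<bar> * (nu \<xi> powr s * norm (u \<xi>)))"
        by (rule ennreal_leI)
      also have "\<dots> = x \<xi> + (ennreal (nu \<xi> powr (s - 2)) * ennreal N + z \<xi>)"
        by (simp add: x_def z_def N_def ennreal_mult add.assoc)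
      also have "\<dots> \<le> x \<xi> + (y \<xi> + z \<xi>)"
      proof (intro add_left_mono add_right_mono)
        have "ennreal (nu \<xi> powr (s - 2)) * ennreal N \<le> ennreal (nu \<xi> powr (s - 2)) * (ennreal (2 * pi * nu \<xi>) * Q \<xi>)"
          unfolding N_def Q_def by (intro mult_left_mono norm_convection_le[OF abs]) simp
        also have "\<dots> = ennreal (nu \<xi> powr (s - 2) * (2 * pi * nu \<xi>)) * Q \<xi>"
          by (simp add: ennreal_mult mult.assoc)
        also have "nu \<xi> powr (s - 2) * (2 * pi * nu \<xi>) = 2 * pi * nu \<xi> powr (1 + (s - 2))"
          by (subst powr_add) simp
        also have "ennreal (2 * pi * nu \<xi> powr (1 + (s - 2))) * Q \<xi> = y \<xi>"
          by (simp add: y_def ennreal_mult mult.assoc)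
        finally show "ennreal (nu \<xi> powr (s - 2)) * ennreal N \<le> y \<xi>" .
      qed
      finally show ?thesis by (simp add: ennreal_mult)
    qed (simp add: p0)
    then have "nsum (\<lambda>\<xi>. (ennreal (nu \<xi> powr (s - 1)) * ennreal (cmod (p \<xi>)))\<^sup>2) \<le> nsum (\<lambda>\<xi>. (x \<xi> + (y \<xi> + z \<xi>))\<^sup>2)"
      by (intro nn_integral_mono power_mono) auto
    also have "\<dots> \<le> 2 * nsum (\<lambda>\<xi>. (x \<xi>)\<^sup>2) + 2 * nsum (\<lambda>\<xi>. (y \<xi> + z \<xi>)\<^sup>2)"
      by (rule nsum_square_add_le)
    also have "\<dots> \<le> 2 * nsum (\<lambda>\<xi>. (x \<xi>)\<^sup>2) + 2 * (2 * nsum (\<lambda>\<xi>. (y \<xi>)\<^sup>2) + 2 * nsum (\<lambda>\<xi>. (z \<xi>)\<^sup>2))"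
      by (intro add_left_mono mult_left_mono nsum_square_add_le) simp
    also have "\<dots> < \<infinity>"
    proof -
      have "nsum (\<lambda>\<xi>. (x \<xi>)\<^sup>2) < \<infinity>"
        using nsum_sobolev_iff[of f "s - 2"] fs f0 s by (simp add: x_def)
      moreover have "nsum (\<lambda>\<xi>. (y \<xi>)\<^sup>2) < \<infinity>"
        unfolding y_def nsum_cmult_square using reg(2)
        by (simp add: Q_def ennreal_mult_less_top power2_eq_square)
      moreover have "nsum (\<lambda>\<xi>. (z \<xi>)\<^sup>2) < \<infinity>"
        unfolding z_def nsum_cmult_square using nsum_sobolev_iff[of u s] us u0 s
        by (simp add: ennreal_mult_less_top power2_eq_square)
      ultimately show ?thesis
        by (simp add: ennreal_mult_less_top)
    qed
    finally show "(\<lambda>\<xi>. (1 + (nu \<xi>)\<^sup>2) powr (s - 1) * (cmod (p \<xi>))\<^sup>2) summable_on UNIV"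
      using nsum_sobolev_iff[of p "s - 1"] p0 s by simp
  qed
  show thesis
    by (rule that[of u p]) (fact u_sym u0 u_dot p_sym p0 abs equation regular)+
qed

end

section \<open>Integration over the torus\<close>

definition torus_measure :: "(real^'n::finite) measure" where
  "torus_measure = restrict_space lborel torus"

lemma torus_borel [measurable]: "(torus :: (real^'n::finite) set) \<in> sets borel"
proof -
  have "{x. 0 \<le> x $ k} \<inter> {x :: real^'n. x $ k < 1} \<in> sets borel" for k
    by measurable
  then have "(\<Inter>k. {x. 0 \<le> x $ k} \<inter> {x :: real^'n. x $ k < 1}) \<in> sets borel"
    by (intro sets.finite_INT) auto
  moreover
  have "torus = (\<Inter>k. {x. 0 \<le> x $ k} \<inter> {x :: real^'n. x $ k < 1})"
    by (auto simp: torus_def)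
  ultimately show ?thesis by simp
qed

lemma emeasure_torus: "emeasure lborel (torus :: (real^'n::finite) set) = 1"
proof -
  have in1: "(1 :: real^'n) \<bullet> b = 1" if "b \<in> Basis" for b
    using that by (auto simp: Basis_vec_def inner_axis)
  have sub: "box 0 (1 :: real^'n) \<subseteq> torus" "torus \<subseteq> cbox 0 (1 :: real^'n)"
    by (auto simp: torus_def mem_box_cart less_imp_le)
  have "emeasure lborel (box 0 (1 :: real^'n)) = 1" "emeasure lborel (cbox 0 (1 :: real^'n)) = 1"
    by (simp_all add: emeasure_lborel_box emeasure_lborel_cbox in1)
  moreover have "emeasure lborel (box 0 (1 :: real^'n)) \<le> emeasure lborel (torus :: (real^'n) set)"
    "emeasure lborel (torus :: (real^'n) set) \<le> emeasure lborel (cbox 0 (1 :: real^'n))"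
    by (auto intro!: emeasure_mono sub)
  ultimately show ?thesis by (metis antisym)
qed

lemma space_torus_measure [simp]: "space torus_measure = torus"
  by (simp add: torus_measure_def space_restrict_space)

lemma emeasure_torus_measure [simp]: "emeasure torus_measure torus = 1"
  by (simp add: torus_measure_def emeasure_restrict_space emeasure_torus)

lemma measure_torus_measure [simp]: "measure torus_measure torus = 1"
  by (simp add: measure_def)

lemma finite_measure_torus: "finite_measure torus_measure"
  by (rule finite_measureI) simp

lemma borel_measurable_torus: "g \<in> borel_measurable borel \<Longrightarrow> g \<in> borel_measurable torus_measure"
  by (simp add: torus_measure_def measurable_restrict_space1)

lemma set_integrable_torus_iff:
  fixes g :: "real^'n::finite \<Rightarrow> 'b::{banach, second_countable_topology}"
  shows "set_integrable lborel torus g \<longleftrightarrow> integrable torus_measure g"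
  unfolding set_integrable_def torus_measure_def by (subst integrable_restrict_space) auto

lemma set_integral_torus:
  fixes g :: "real^'n::finite \<Rightarrow> 'b::{banach, second_countable_topology}"
  shows "(LINT x:torus|lborel. g x) = (LINT x|torus_measure. g x)"
  unfolding set_lebesgue_integral_def torus_measure_def by (subst integral_restrict_space) auto

lemma integrable_torus_bounded:
  fixes g :: "real^'n::finite \<Rightarrow> 'b::{banach, second_countable_topology}"
  assumes "g \<in> borel_measurable borel" "\<And>x. norm (g x) \<le> B"
  shows "integrable torus_measure g"
proof -
  interpret finite_measure "torus_measure :: (real^'n) measure" by (rule finite_measure_torus)
  show ?thesis
    using assms borel_measurable_torus by (intro integrable_const_bound[of _ B]) auto
qed

lemma periodic_shift:
  assumes "periodic f"
  shows "f (x + frequency v) = f (x :: real^'n::finite)"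
proof -
  have 1: "f (x + real m *\<^sub>R axis k 1) = f x" for m k x
  proof (induction m)
    case (Suc m)
    have "x + real (Suc m) *\<^sub>R axis k 1 = (x + real m *\<^sub>R axis k 1) + axis k 1"
      by (simp add: algebra_simps)
    then show ?case
      using assms Suc by (metis periodic_def)
  qed simp
  have 2: "f (x + of_int m *\<^sub>R axis k 1) = f x" for m k x
  proof (cases "m \<ge> 0")
    case True
    then show ?thesis using 1[of x "nat m" k] by simp
  next
    case False
    have "f (x + of_int m *\<^sub>R axis k 1) = f ((x + of_int m *\<^sub>R axis k 1) + real (nat (- m)) *\<^sub>R axis k 1)"
      by (rule 1[symmetric])
    then show ?thesis using False by (simp add: scaleR_left_distrib[symmetric])
  qed
  have "f (x + (\<Sum>k\<in>A. of_int (v $ k) *\<^sub>R axis k 1)) = f x" if "finite A" for A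
    using that
  proof induction
    case (insert k A)
    have "x + (\<Sum>k\<in>insert k A. of_int (v $ k) *\<^sub>R axis k 1)
        = (x + (\<Sum>k\<in>A. of_int (v $ k) *\<^sub>R axis k 1)) + of_int (v $ k) *\<^sub>R axis k 1"
      using insert by (simp add: algebra_simps)
    then show ?case by (simp only: 2 insert)
  qed simp
  moreover have "frequency v = (\<Sum>k\<in>UNIV. of_int (v $ k) *\<^sub>R axis k 1)"
    by (simp add: vec_eq_iff axis_def if_distrib sum.If_cases cong: if_cong)
  ultimately show ?thesis by simp
qed

lemma periodic_bounded:
  fixes f :: "real^'n::finite \<Rightarrow> 'b::real_normed_vector"
  assumes "periodic f" "continuous_on UNIV f"
  obtains B where "B \<ge> 0" "\<And>x. norm (f x) \<le> B"
proof -
  have "compact (f ` cbox 0 1)"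
    using assms(2) by (intro compact_continuous_image) (auto intro: continuous_on_subset)
  then obtain B where B: "\<And>x. x \<in> cbox 0 1 \<Longrightarrow> norm (f x) \<le> B"
    by (metis bounded_iff compact_imp_bounded imageI)
  have "norm (f x) \<le> B" for x
  proof -
    define v where "v = (\<chi> k. - \<lfloor>x $ k\<rfloor>)"
    have "0 \<le> (x + frequency v) $ k \<and> (x + frequency v) $ k \<le> 1" for k
      by (simp add: v_def) linarith
    then have "x + frequency v \<in> cbox 0 1"
      by (auto simp: mem_box_cart)
    from B[OF this] show ?thesis by (simp only: periodic_shift[OF assms(1)])
  qed
  moreover from this have "B \<ge> 0" by (meson norm_ge_zero order_trans)
  ultimately show thesis using that by blast
qed

text \<open>The unit cell is half open. Its translate splits into the part still inside,
  \<open>P\<close>, and the part that leaves through a face and re-enters one period lower,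
  \<open>Q\<close>; together they tile the cell again.\<close>

lemma torus_integral_translate:
  fixes f :: "real^'n::finite \<Rightarrow> real"
  assumes per: "periodic f" and meas [measurable]: "f \<in> borel_measurable borel"
    and bd: "\<And>x. \<bar>f x\<bar> \<le> B" and t: "0 < t" "t < 1"
  shows "(LINT x|torus_measure. f (x + t *\<^sub>R axis j 1)) = (LINT x|torus_measure. f x)"
proof -
  define v where "v = t *\<^sub>R (axis j 1 :: real^'n)"
  define w where "w = (t - 1) *\<^sub>R (axis j 1 :: real^'n)"
  define P where "P = {x :: real^'n. x \<in> torus \<and> t \<le> x $ j}"
  define Q where "Q = {x :: real^'n. x \<in> torus \<and> x $ j < t}"
  have PQ [measurable]: "P \<in> sets borel" "Q \<in> sets borel"
    unfolding P_def Q_def by measurable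
  have shift: "(LINT x|lborel. g (c + x)) = (LINT x|lborel. g x)" if [measurable]: "g \<in> borel_measurable borel"
    for g :: "real^'n \<Rightarrow> real" and c
    using integral_distr[of "(+) c" lborel borel g] by (simp add: lborel_distr_plus)
  have int: "integrable lborel (\<lambda>x. indicator A x * g x)" if "A \<in> sets borel" "A \<subseteq> torus"
    "g \<in> borel_measurable borel" "\<And>x. \<bar>g x\<bar> \<le> B" for A and g :: "real^'n \<Rightarrow> real"
  proof -
    have [measurable]: "A \<in> sets borel" "g \<in> borel_measurable borel" using that by auto
    have "integrable torus_measure (\<lambda>x. indicator A x * g x)"
      using that(4) by (intro integrable_torus_bounded[of _ B])
        (auto split: split_indicator intro: order_trans[OF abs_ge_zero])
    then have "integrable lborel (\<lambda>x. indicator torus x *\<^sub>R (indicator A x * g x))"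
      by (simp add: set_integrable_torus_iff[symmetric] set_integrable_def)
    moreover have "(\<lambda>x. indicator torus x *\<^sub>R (indicator A x * g x)) = (\<lambda>x. indicator A x * g x)"
      using that(2) by (intro ext) (auto simp: indicator_def)
    ultimately show ?thesis by simp
  qed
  have int_shift: "integrable lborel (\<lambda>x. g (c + x))" if "integrable lborel g" for g :: "real^'n \<Rightarrow> real" and c
  proof -
    have [measurable]: "g \<in> borel_measurable borel" using that by auto
    have "integrable (distr lborel borel ((+) c)) g"
      using that by (simp add: lborel_distr_plus)
    then show ?thesis
      by (subst (asm) integrable_distr_eq) auto
  qed
  define rest where "rest = (\<lambda>x :: real^'n. \<forall>k. k \<noteq> j \<longrightarrow> 0 \<le> x $ k \<and> x $ k < 1)"
  have torus_iff: "x \<in> torus \<longleftrightarrow> 0 \<le> x $ j \<and> x $ j < 1 \<and> rest x" for x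
    by (auto simp: torus_def rest_def)
  have comp: "(v + x) $ j = t + x $ j" "(w + x) $ j = t - 1 + x $ j" "rest (v + x) = rest x" "rest (w + x) = rest x" for x
    by (simp_all add: v_def w_def rest_def axis_def)
  have mem: "(v + x \<in> torus \<and> t \<le> (v + x) $ j) \<or> (w + x \<in> torus \<and> (w + x) $ j < t)" if "x \<in> torus" for x
    using that t unfolding torus_iff comp by (smt (verit))
  have mem2: "x \<in> torus" if "v + x \<in> torus" "t \<le> (v + x) $ j" for x
    using that t unfolding torus_iff comp by (smt (verit))
  have mem3: "x \<in> torus" if "w + x \<in> torus" "(w + x) $ j < t" for x
    using that t unfolding torus_iff comp by (smt (verit))
  have mem4: "\<not> (v + x \<in> torus \<and> w + x \<in> torus)" for x
    using t unfolding torus_iff comp by (smt (verit))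
  have fw: "f (w + x) = f (v + x)" for x
  proof -
    have "(w + x) + axis j 1 = v + x"
      by (simp add: v_def w_def algebra_simps)
    then show ?thesis using per by (metis periodic_def)
  qed
  have "(LINT x|torus_measure. f (x + v)) = (LINT x|lborel. indicator torus x * f (x + v))"
    by (simp add: set_integral_torus[symmetric] set_lebesgue_integral_def)
  also have "\<dots> = (LINT x|lborel. indicator P (v + x) * f (v + x) + indicator Q (w + x) * f (w + x))"
  proof (intro Bochner_Integration.integral_cong refl)
    fix x
    have "indicator torus x = indicator P (v + x) + (indicator Q (w + x) :: real)"
      using mem[of x] mem2[of x] mem3[of x] mem4[of x] by (auto simp: P_def Q_def split: split_indicator)
    then show "indicator torus x * f (x + v) = indicator P (v + x) * f (v + x) + indicator Q (w + x) * f (w + x)"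
      by (simp add: fw distrib_right add.commute)
  qed
  also have "\<dots> = (LINT x|lborel. indicator P (v + x) * f (v + x)) + (LINT x|lborel. indicator Q (w + x) * f (w + x))"
    using bd int_shift[OF int[of P f], of v] int_shift[OF int[of Q f], of w]
    by (intro Bochner_Integration.integral_add) (auto simp: P_def Q_def)
  also have "\<dots> = (LINT x|lborel. indicator P x * f x) + (LINT x|lborel. indicator Q x * f x)"
    by (simp add: shift[of "\<lambda>x. indicator P x * f x"] shift[of "\<lambda>x. indicator Q x * f x"])
  also have "\<dots> = (LINT x|lborel. indicator P x * f x + indicator Q x * f x)"
    using bd int[of P f] int[of Q f] by (intro Bochner_Integration.integral_add[symmetric]) (auto simp: P_def Q_def)
  also have "\<dots> = (LINT x|lborel. indicator torus x * f x)"
    by (intro Bochner_Integration.integral_cong refl) (auto simp: P_def Q_def split: split_indicator)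
  also have "\<dots> = (LINT x|torus_measure. f x)"
    by (simp add: set_integral_torus[symmetric] set_lebesgue_integral_def)
  finally show ?thesis by (simp add: v_def)
qed

text \<open>Difference quotients have zero integral by translation invariance, and the mean value
  theorem bounds them by the supremum of \<open>g\<close>, so dominated convergence reaches the
  derivative.\<close>

lemma torus_integral_derivative:
  fixes f g :: "real^'n::finite \<Rightarrow> real"
  assumes per: "periodic f" and cont: "continuous_on UNIV f" and contg: "continuous_on UNIV g" and perg: "periodic g"
    and der: "\<And>x. ((\<lambda>t. f (x + t *\<^sub>R axis j 1)) has_real_derivative g x) (at 0)"
  shows "(LINT x|torus_measure. g x) = 0"
proof -
  have [measurable]: "f \<in> borel_measurable borel" "g \<in> borel_measurable borel"
    using cont contg by (simp_all add: borel_measurable_continuous_onI)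
  obtain B where B: "\<And>x. \<bar>f x\<bar> \<le> B" using periodic_bounded[OF per cont] by (metis real_norm_def)
  obtain C where C: "\<And>x. \<bar>g x\<bar> \<le> C" using periodic_bounded[OF perg contg] by (metis real_norm_def)
  \<comment> \<open>The shift by 2 keeps every step strictly between 0 and 1, the range of the
    translation lemma.\<close>
  define t where "t = (\<lambda>m. 1 / real (m + 2))"
  have t: "0 < t m" "t m < 1" for m by (auto simp: t_def)
  define h where "h = (\<lambda>m x. (f (x + t m *\<^sub>R axis j 1) - f x) / t m)"
  have der': "((\<lambda>t. f (x + t *\<^sub>R axis j 1)) has_real_derivative g (x + s *\<^sub>R axis j 1)) (at s)" for x s
  proof -
    have "((\<lambda>t. f (x + s *\<^sub>R axis j 1 + t *\<^sub>R axis j 1)) has_real_derivative g (x + s *\<^sub>R axis j 1)) (at (s - s))"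
      using der[of "x + s *\<^sub>R axis j 1"] by simp
    then have "((\<lambda>t. f (x + s *\<^sub>R axis j 1 + (t - s) *\<^sub>R axis j 1)) has_real_derivative g (x + s *\<^sub>R axis j 1)) (at s)"
      using DERIV_shift[of "\<lambda>t. f (x + s *\<^sub>R axis j 1 + t *\<^sub>R axis j 1)" _ s "- s"] by simp
    moreover have "x + s *\<^sub>R axis j 1 + (t - s) *\<^sub>R axis j 1 = x + t *\<^sub>R axis j 1" for t
      by (simp add: algebra_simps)
    ultimately show ?thesis by simp
  qed
  have h_bd: "\<bar>h m x\<bar> \<le> C" for m x
  proof -
    obtain z where "f (x + t m *\<^sub>R axis j 1) - f (x + 0 *\<^sub>R axis j 1) = (t m - 0) * g (x + z *\<^sub>R axis j 1)"
      using MVT2[OF t(1)[of m], of "\<lambda>t. f (x + t *\<^sub>R axis j 1)" "\<lambda>s. g (x + s *\<^sub>R axis j 1)"] der' by blast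
    then have "h m x = g (x + z *\<^sub>R axis j 1)"
      using t(1)[of m] by (simp add: h_def)
    then show ?thesis using C by simp
  qed
  have h0: "(LINT x|torus_measure. h m x) = 0" for m
  proof -
    have "integrable torus_measure (\<lambda>x. f (x + t m *\<^sub>R axis j 1))" "integrable torus_measure f"
      using B by (auto intro!: integrable_torus_bounded[of _ B])
    then have "(LINT x|torus_measure. f (x + t m *\<^sub>R axis j 1) - f x)
        = (LINT x|torus_measure. f (x + t m *\<^sub>R axis j 1)) - (LINT x|torus_measure. f x)"
      by (rule Bochner_Integration.integral_diff)
    also have "\<dots> = 0"
      by (simp add: torus_integral_translate[OF per _ B t])
    finally show ?thesis by (simp add: h_def)
  qed
  have "(\<lambda>m. LINT x|torus_measure. h m x) \<longlonglongrightarrow> (LINT x|torus_measure. g x)"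
  proof (rule integral_dominated_convergence[where w = "\<lambda>_. C"])
    show "AE x in torus_measure. (\<lambda>m. h m x) \<longlonglongrightarrow> g x"
    proof (intro always_eventually allI)
      fix x
      have "((\<lambda>s. (f (x + s *\<^sub>R axis j 1) - f x) / s) \<longlongrightarrow> g x) (at 0)"
        using der[of x] by (simp add: DERIV_def)
      moreover have "filterlim t (at 0) sequentially"
      proof -
        have "t \<longlonglongrightarrow> 0"
          unfolding t_def using LIMSEQ_ignore_initial_segment[OF lim_1_over_n, of 2] by simp
        then show ?thesis
          using t by (auto simp: filterlim_at less_imp_neq[symmetric] intro!: always_eventually)
      qed
      ultimately show "(\<lambda>m. h m x) \<longlonglongrightarrow> g x"
        unfolding h_def by (rule filterlim_compose)
    qed
    show "h m \<in> borel_measurable torus_measure" for m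
      unfolding h_def by (intro borel_measurable_torus) measurable
  qed (use h_bd in \<open>auto intro!: integrable_torus_bounded borel_measurable_torus\<close>)
  then show ?thesis
    by (simp add: h0 LIMSEQ_const_iff)
qed

section \<open>Trigonometric series\<close>

definition wave :: "int^'n::finite \<Rightarrow> real^'n \<Rightarrow> complex" where
  "wave \<xi> x = cis (2 * pi * (x \<bullet> frequency \<xi>))"

lemma wave_simps [simp]:
  "cmod (wave \<xi> x) = 1" "wave 0 x = 1" "cnj (wave \<xi> x) = wave (- \<xi>) x" "wave \<xi> x * wave \<eta> x = wave (\<xi> + \<eta>) x"
  "Re (wave \<xi> x) = cos (2 * pi * (x \<bullet> frequency \<xi>))" "Im (wave \<xi> x) = sin (2 * pi * (x \<bullet> frequency \<xi>))"
  by (simp_all add: wave_def cis_cnj cis_mult inner_add_right algebra_simps)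

lemma wave_diff_arg: "wave \<xi> (x - y) = wave \<xi> x * wave (- \<xi>) y"
  by (simp add: wave_def cis_mult inner_diff_left algebra_simps)

lemma wave_add_arg: "wave \<xi> (x + y) = wave \<xi> x * wave \<xi> y"
  by (simp add: wave_def cis_mult inner_add_left algebra_simps)

lemma periodic_wave: "periodic (wave \<xi>)"
proof -
  have "wave \<xi> (axis k 1) = 1" for k
    by (simp add: wave_def inner_axis')
  then show ?thesis by (simp add: periodic_def wave_add_arg)
qed

lemma continuous_wave: "continuous_on UNIV (wave \<xi>)"
  unfolding wave_def cis_conv_exp by (intro continuous_intros)

lemma borel_measurable_wave [measurable]: "wave \<xi> \<in> borel_measurable borel"
  by (intro borel_measurable_continuous_onI continuous_wave)

text \<open>Stable under \<open>diff_coeff\<close>, so that a series with such coefficients can be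
  differentiated termwise to any order.\<close>

definition rapid :: "(int^'n::finite \<Rightarrow> complex) \<Rightarrow> bool" where
  "rapid c \<longleftrightarrow> (\<forall>m::nat. (\<lambda>\<xi>. nu \<xi> ^ m * cmod (c \<xi>)) summable_on UNIV)"

text \<open>The real part makes every coefficient family yield a real function; for conjugate
  symmetric families it discards nothing.\<close>

definition trig :: "(int^'n::finite \<Rightarrow> complex) \<Rightarrow> real^'n \<Rightarrow> real" where
  "trig c x = Re (\<Sum>\<^sub>\<infinity>\<xi>. c \<xi> * wave \<xi> x)"

definition diff_coeff :: "'n::finite \<Rightarrow> (int^'n \<Rightarrow> complex) \<Rightarrow> int^'n \<Rightarrow> complex" where
  "diff_coeff j c \<xi> = 2 * pi * \<i> * of_int (\<xi> $ j) * c \<xi>"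

lemma cmod_diff_coeff_le: "cmod (diff_coeff j c \<xi>) \<le> 2 * pi * (nu \<xi> * cmod (c \<xi>))"
  using mult_right_mono[OF component_le_nu[of \<xi> j], of "2 * pi * cmod (c \<xi>)"]
  by (simp add: diff_coeff_def norm_mult mult_ac)

lemma rapid_diff_coeff: "rapid c \<Longrightarrow> rapid (diff_coeff j c)"
  unfolding rapid_def
proof
  fix m assume c: "\<forall>m. (\<lambda>\<xi>. nu \<xi> ^ m * cmod (c \<xi>)) summable_on UNIV"
  then have "(\<lambda>\<xi>. 2 * pi * (nu \<xi> ^ Suc m * cmod (c \<xi>))) summable_on UNIV"
    by (intro summable_on_cmult_right) blast
  then show "(\<lambda>\<xi>. nu \<xi> ^ m * cmod (diff_coeff j c \<xi>)) summable_on UNIV"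
  proof (rule summable_on_comparison_test)
    fix \<xi>
    show "nu \<xi> ^ m * cmod (diff_coeff j c \<xi>) \<le> 2 * pi * (nu \<xi> ^ Suc m * cmod (c \<xi>))"
      using mult_left_mono[OF cmod_diff_coeff_le[of j c \<xi>], of "nu \<xi> ^ m"] by (simp add: mult_ac)
  qed auto
qed

lemma rapid_finite: "finite {\<xi>. c \<xi> \<noteq> 0} \<Longrightarrow> rapid c"
  unfolding rapid_def
  by (intro allI finite_nonzero_values_imp_summable_on) (auto elim!: rev_finite_subset)

lemma rapid_summable:
  assumes "rapid c"
  shows "(\<lambda>\<xi>. cmod (c \<xi>)) summable_on UNIV" "(\<lambda>\<xi>. c \<xi> * wave \<xi> x) summable_on UNIV"
proof -
  show *: "(\<lambda>\<xi>. cmod (c \<xi>)) summable_on UNIV"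
    using assms[unfolded rapid_def, rule_format, of 0] by simp
  show "(\<lambda>\<xi>. c \<xi> * wave \<xi> x) summable_on UNIV"
    by (rule abs_summable_summable) (use * in \<open>simp add: norm_mult\<close>)
qed

lemma has_sum_finite_sum:
  fixes f :: "'k \<Rightarrow> 'x \<Rightarrow> 'b::{topological_comm_monoid_add}"
  assumes "finite A" "\<And>k. k \<in> A \<Longrightarrow> (f k has_sum s k) X"
  shows "((\<lambda>x. \<Sum>k\<in>A. f k x) has_sum (\<Sum>k\<in>A. s k)) X"
  using assms by (induction A) (auto intro: has_sum_add)

lemma has_sum_minus:
  fixes f g :: "'x \<Rightarrow> complex"
  assumes "(f has_sum a) X" "(g has_sum b) X"
  shows "((\<lambda>x. f x - g x) has_sum (a - b)) X"
  using has_sum_add[OF assms(1) has_sum_uminusI[OF assms(2)]] by simp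

lemma cis_taylor: "cmod (cis t - 1 - \<i> * t) \<le> t\<^sup>2"
  using Taylor_exp[of "\<i> * t" 1] by (simp add: cis_conv_exp norm_mult power2_eq_square algebra_simps)

text \<open>The second-order remainder of a single wave is at most
  \<open>(norm h)^2 * (2 * pi * nu \<xi>)^2\<close>. This is summable against the coefficients, so
  one absolutely convergent bound gives the derivative of the whole series.\<close>

lemma trig_has_derivative:
  assumes c: "rapid c"
  shows "(trig c has_derivative (\<lambda>h. \<Sum>k\<in>UNIV. h $ k * trig (diff_coeff k c) x)) (at x)"
proof (rule has_derivativeI_sandwich[where e = 1])
  define K where "K = (2 * pi)\<^sup>2 * (\<Sum>\<^sub>\<infinity>\<xi>. nu \<xi> ^ 2 * cmod (c \<xi>))"
  show "bounded_linear (\<lambda>h. \<Sum>k\<in>UNIV. h $ k * trig (diff_coeff k c) x)"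
    by (intro bounded_linear_sum bounded_linear_mult_const bounded_linear_vec_nth)
  fix y :: "real^'a" assume y: "y \<noteq> x"
  define h where "h = y - x"
  have s: "((\<lambda>\<xi>. c \<xi> * wave \<xi> z) has_sum (\<Sum>\<^sub>\<infinity>\<xi>. c \<xi> * wave \<xi> z)) UNIV" for z
    by (intro has_sum_infsum rapid_summable c)
  have d: "((\<lambda>\<xi>. of_real (h $ k) * (diff_coeff k c \<xi> * wave \<xi> x)) has_sum
      of_real (h $ k) * (\<Sum>\<^sub>\<infinity>\<xi>. diff_coeff k c \<xi> * wave \<xi> x)) UNIV" for k
    by (intro has_sum_cmult_right has_sum_infsum rapid_summable rapid_diff_coeff c)
  define L where "L = (\<Sum>k\<in>UNIV. of_real (h $ k) * (\<Sum>\<^sub>\<infinity>\<xi>. diff_coeff k c \<xi> * wave \<xi> x))"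
  have "((\<lambda>\<xi>. \<Sum>k\<in>UNIV. of_real (h $ k) * (diff_coeff k c \<xi> * wave \<xi> x)) has_sum L) UNIV"
    unfolding L_def by (intro has_sum_finite_sum d) auto
  moreover have "(\<Sum>k\<in>UNIV. of_real (h $ k) * (diff_coeff k c \<xi> * wave \<xi> x))
      = c \<xi> * (wave \<xi> x * (\<i> * of_real (2 * pi * (h \<bullet> frequency \<xi>))))" for \<xi>
    by (simp add: diff_coeff_def inner_vec_def sum_distrib_left sum_distrib_right mult_ac)
  ultimately have "((\<lambda>\<xi>. c \<xi> * (wave \<xi> x * (\<i> * of_real (2 * pi * (h \<bullet> frequency \<xi>))))) has_sum L) UNIV"
    by simp
  then have S: "((\<lambda>\<xi>. c \<xi> * wave \<xi> y - c \<xi> * wave \<xi> x - c \<xi> * (wave \<xi> x * (\<i> * of_real (2 * pi * (h \<bullet> frequency \<xi>)))))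
      has_sum ((\<Sum>\<^sub>\<infinity>\<xi>. c \<xi> * wave \<xi> y) - (\<Sum>\<^sub>\<infinity>\<xi>. c \<xi> * wave \<xi> x) - L)) UNIV"
    by (intro has_sum_minus s)
  have T: "((\<lambda>\<xi>. (norm h)\<^sup>2 * ((2 * pi)\<^sup>2 * (nu \<xi> ^ 2 * cmod (c \<xi>)))) has_sum (norm h)\<^sup>2 * K) UNIV"
    unfolding K_def using c by (intro has_sum_cmult_right has_sum_infsum) (auto simp: rapid_def)
  have bound: "cmod ((\<Sum>\<^sub>\<infinity>\<xi>. c \<xi> * wave \<xi> y) - (\<Sum>\<^sub>\<infinity>\<xi>. c \<xi> * wave \<xi> x) - L) \<le> (norm h)\<^sup>2 * K"
  proof (rule norm_infsum_le[OF S T])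
    fix \<xi>
    define t where "t = 2 * pi * (h \<bullet> frequency \<xi>)"
    have "wave \<xi> y = wave \<xi> x * cis t"
      using wave_add_arg[of \<xi> x h] by (simp add: h_def t_def wave_def)
    then have "c \<xi> * wave \<xi> y - c \<xi> * wave \<xi> x - c \<xi> * (wave \<xi> x * (\<i> * of_real t))
        = c \<xi> * wave \<xi> x * (cis t - 1 - \<i> * t)"
      by (simp add: algebra_simps)
    then have "cmod (c \<xi> * wave \<xi> y - c \<xi> * wave \<xi> x - c \<xi> * (wave \<xi> x * (\<i> * of_real t))) = cmod (c \<xi>) * cmod (cis t - 1 - \<i> * t)"
      by (simp only: norm_mult wave_simps mult_1_right)
    also have "\<dots> \<le> cmod (c \<xi>) * t\<^sup>2"
      by (intro mult_left_mono cis_taylor) simp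
    also have "t\<^sup>2 \<le> (2 * pi * (norm h * nu \<xi>))\<^sup>2"
      using Cauchy_Schwarz_ineq2[of h "frequency \<xi>"]
      by (intro power2_le_iff_abs_le[THEN iffD2]) (auto simp: t_def abs_mult nu_def)
    then have "cmod (c \<xi>) * t\<^sup>2 \<le> cmod (c \<xi>) * (2 * pi * (norm h * nu \<xi>))\<^sup>2"
      by (rule mult_left_mono) simp
    finally show "cmod (c \<xi> * wave \<xi> y - c \<xi> * wave \<xi> x - c \<xi> * (wave \<xi> x * (\<i> * of_real (2 * pi * (h \<bullet> frequency \<xi>)))))
        \<le> (norm h)\<^sup>2 * ((2 * pi)\<^sup>2 * (nu \<xi> ^ 2 * cmod (c \<xi>)))"
      unfolding t_def[symmetric] by (simp add: power_mult_distrib mult_ac)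
  qed
  have re: "(trig c y - trig c x) - (\<Sum>k\<in>UNIV. (y - x) $ k * trig (diff_coeff k c) x)
      = Re ((\<Sum>\<^sub>\<infinity>\<xi>. c \<xi> * wave \<xi> y) - (\<Sum>\<^sub>\<infinity>\<xi>. c \<xi> * wave \<xi> x) - L)"
    by (simp add: trig_def L_def h_def)
  have "norm ((trig c y - trig c x) - (\<Sum>k\<in>UNIV. (y - x) $ k * trig (diff_coeff k c) x)) \<le> (norm h)\<^sup>2 * K"
    unfolding re real_norm_def by (rule order_trans[OF abs_Re_le_cmod bound])
  then show "norm ((trig c y - trig c x) - (\<Sum>k\<in>UNIV. (y - x) $ k * trig (diff_coeff k c) x)) / norm (y - x) \<le> norm (y - x) * K"
    using y by (simp add: h_def divide_simps power2_eq_square mult_ac)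
next
  have "((\<lambda>y. norm (y - x) * ((2 * pi)\<^sup>2 * (\<Sum>\<^sub>\<infinity>\<xi>. nu \<xi> ^ 2 * cmod (c \<xi>)))) \<longlongrightarrow> norm (x - x) * ((2 * pi)\<^sup>2 * (\<Sum>\<^sub>\<infinity>\<xi>. nu \<xi> ^ 2 * cmod (c \<xi>)))) (at x)"
    by (intro tendsto_intros)
  then show "((\<lambda>y. norm (y - x) * ((2 * pi)\<^sup>2 * (\<Sum>\<^sub>\<infinity>\<xi>. nu \<xi> ^ 2 * cmod (c \<xi>)))) \<longlongrightarrow> 0) (at x)"
    by simp
qed simp

lemma partial_deriv_eqI:
  assumes "(f has_derivative D) (at x)"
  shows "partial_deriv j f x = D (axis j 1)"
  using frechet_derivative_at[OF assms] by (simp add: partial_deriv_def)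

lemma partial_deriv_trig:
  assumes "rapid c"
  shows "partial_deriv j (trig c) = trig (diff_coeff j c)"
proof
  fix x
  have "(\<Sum>k\<in>UNIV. axis j 1 $ k * trig (diff_coeff k c) x) = (\<Sum>k\<in>UNIV. if k = j then trig (diff_coeff k c) x else 0)"
    by (rule sum.cong) (auto simp: axis_def)
  then show "partial_deriv j (trig c) x = trig (diff_coeff j c) x"
    by (simp add: partial_deriv_eqI[OF trig_has_derivative[OF assms]])
qed

lemma partial_derivs_Cons: "partial_derivs (j # js) f = partial_deriv j (partial_derivs js f)"
  by (simp add: partial_derivs_def)

lemma partial_derivs_snoc: "partial_derivs (js @ [j]) f = partial_derivs js (partial_deriv j f)"
  by (simp add: partial_derivs_def)

lemma partial_derivs_Nil [simp]: "partial_derivs [] f = f"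
  by (simp add: partial_derivs_def)

fun diff_coeffs :: "'n::finite list \<Rightarrow> (int^'n \<Rightarrow> complex) \<Rightarrow> int^'n \<Rightarrow> complex" where
  "diff_coeffs [] c = c"
| "diff_coeffs (j # js) c = diff_coeff j (diff_coeffs js c)"

lemma rapid_diff_coeffs: "rapid c \<Longrightarrow> rapid (diff_coeffs js c)"
  by (induction js) (auto intro: rapid_diff_coeff)

lemma partial_derivs_trig: "rapid c \<Longrightarrow> partial_derivs js (trig c) = trig (diff_coeffs js c)"
  by (induction js) (auto simp: partial_derivs_Cons partial_deriv_trig rapid_diff_coeffs)

lemma trig_periodic_smooth:
  assumes "rapid c"
  shows "trig c \<in> periodic_smooth"
proof -
  have "smooth (trig c)"
    unfolding smooth_def using trig_has_derivative[OF rapid_diff_coeffs[OF assms]]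
    by (auto simp: partial_derivs_trig[OF assms] differentiable_def)
  moreover have "wave \<xi> (x + axis k 1) = wave \<xi> x" for \<xi> x and k :: 'a
    using periodic_wave[of \<xi>] unfolding periodic_def by blast
  then have "periodic (trig c)"
    unfolding periodic_def by (simp add: trig_def)
  ultimately show ?thesis by (simp add: periodic_smooth_def)
qed

lemma infsum_single: "(\<Sum>\<^sub>\<infinity>\<eta>. (if \<eta> = \<xi> then a else 0) * wave \<eta> x) = a * wave \<xi> x"
proof -
  have "(\<Sum>\<^sub>\<infinity>\<eta>. (if \<eta> = \<xi> then a else 0) * wave \<eta> x) = (\<Sum>\<^sub>\<infinity>\<eta>\<in>{\<xi>}. (if \<eta> = \<xi> then a else 0) * wave \<eta> x)"
    by (rule infsum_cong_neutral) auto
  then show ?thesis by simp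
qed

lemma cos_eq_trig: "(\<lambda>x. cos (2 * pi * (x \<bullet> frequency \<xi>))) = trig (\<lambda>\<eta>. if \<eta> = \<xi> then 1 else 0)"
  by (simp add: fun_eq_iff trig_def infsum_single)

text \<open>The real part of \<open>- \<i>\<close> times a wave is its sine.\<close>

lemma sin_eq_trig: "(\<lambda>x. sin (2 * pi * (x \<bullet> frequency \<xi>))) = trig (\<lambda>\<eta>. if \<eta> = \<xi> then - \<i> else 0)"
  by (simp add: fun_eq_iff trig_def infsum_single)

lemma cos_sin_periodic_smooth:
  "(\<lambda>x. cos (2 * pi * (x \<bullet> frequency \<xi>))) \<in> periodic_smooth"
  "(\<lambda>x. sin (2 * pi * (x \<bullet> frequency \<xi>))) \<in> periodic_smooth"
  unfolding cos_eq_trig sin_eq_trig by (intro trig_periodic_smooth rapid_finite; simp)+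

section \<open>Calculus of smooth periodic functions\<close>

lemma
  assumes "f \<in> periodic_smooth"
  shows periodic_smooth_differentiable: "f differentiable (at x)"
    and periodic_smooth_periodic: "periodic f"
    and partial_deriv_periodic_smooth: "partial_deriv j f \<in> periodic_smooth"
proof -
  have f: "partial_derivs js f differentiable (at x)" "periodic f" for js x
    using assms by (auto simp: periodic_smooth_def smooth_def)
  show d: "f differentiable (at x)" for x using f(1)[of "[]"] by simp
  show "periodic f" by (rule f(2))
  have "partial_deriv j f (x + axis k 1) = partial_deriv j f x" for x k
  proof -
    have "(f has_derivative frechet_derivative f (at (x + axis k 1))) (at (x + axis k 1))"
      using d frechet_derivative_works by blast
    then have "(f \<circ> (\<lambda>y. y + axis k 1) has_derivative frechet_derivative f (at (x + axis k 1)) \<circ> (\<lambda>h. h)) (at x)"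
      by (intro diff_chain_at) (auto intro!: derivative_eq_intros)
    moreover have "f \<circ> (\<lambda>y. y + axis k 1) = f"
      using f(2) by (simp add: fun_eq_iff periodic_def)
    ultimately show ?thesis
      by (simp add: partial_deriv_eqI[of f "frechet_derivative f (at (x + axis k 1))" x] o_def) (simp add: partial_deriv_def)
  qed
  then have "periodic (partial_deriv j f)" by (simp add: periodic_def)
  moreover have "smooth (partial_deriv j f)"
    unfolding smooth_def using f(1) by (simp add: partial_derivs_snoc[symmetric])
  ultimately show "partial_deriv j f \<in> periodic_smooth" by (simp add: periodic_smooth_def)
qed

lemma periodic_smooth_continuous: "f \<in> periodic_smooth \<Longrightarrow> continuous_on UNIV f"
  using periodic_smooth_differentiable
  by (auto intro!: differentiable_imp_continuous_on simp: differentiable_on_def intro: differentiable_at_withinI)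

lemma periodic_smooth_measurable: "f \<in> periodic_smooth \<Longrightarrow> f \<in> borel_measurable borel"
  by (intro borel_measurable_continuous_onI periodic_smooth_continuous)

lemma periodic_smooth_bounded:
  assumes "f \<in> periodic_smooth"
  obtains B where "B \<ge> 0" "\<And>x. \<bar>f x\<bar> \<le> B"
  using periodic_bounded[OF periodic_smooth_periodic periodic_smooth_continuous] assms by (metis real_norm_def)

lemma periodic_smooth_integrable: "f \<in> periodic_smooth \<Longrightarrow> integrable torus_measure f"
  by (metis integrable_torus_bounded periodic_smooth_bounded periodic_smooth_measurable real_norm_def)

lemma directional_derivative:
  assumes "f differentiable (at x)"
  shows "((\<lambda>t. f (x + t *\<^sub>R axis j 1)) has_real_derivative partial_deriv j f x) (at 0)"
proof -
  have D: "(f has_derivative frechet_derivative f (at x)) (at x)"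
    using assms frechet_derivative_works by blast
  have "(f \<circ> (\<lambda>t. x + t *\<^sub>R axis j 1) has_derivative frechet_derivative f (at x) \<circ> (\<lambda>t. t *\<^sub>R axis j 1)) (at 0)"
    using D by (intro diff_chain_at) (auto intro!: derivative_eq_intros)
  moreover have "frechet_derivative f (at x) \<circ> (\<lambda>t. t *\<^sub>R axis j 1) = (*) (partial_deriv j f x)"
    using has_derivative_linear[OF D] by (auto simp: partial_deriv_def linear_cmul)
  ultimately show ?thesis by (simp add: has_field_derivative_def o_def)
qed

lemma integral_by_parts:
  assumes f: "f \<in> periodic_smooth" and g: "g \<in> periodic_smooth"
  shows "(LINT x|torus_measure. partial_deriv j f x * g x) = - (LINT x|torus_measure. f x * partial_deriv j g x)"
proof -
  have f': "partial_deriv j f \<in> periodic_smooth" and g': "partial_deriv j g \<in> periodic_smooth"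
    by (simp_all add: partial_deriv_periodic_smooth f g)
  have int: "integrable torus_measure (\<lambda>x. a x * b x)" if ab: "a \<in> periodic_smooth" "b \<in> periodic_smooth"
    for a b :: "real^'a \<Rightarrow> real"
  proof -
    obtain A B where "A \<ge> 0" "\<And>x. \<bar>a x\<bar> \<le> A" "B \<ge> 0" "\<And>x. \<bar>b x\<bar> \<le> B"
      using periodic_smooth_bounded ab by metis
    then show ?thesis
      using ab by (intro integrable_torus_bounded[of _ "A * B"])
        (auto simp: abs_mult intro!: mult_mono borel_measurable_times[OF periodic_smooth_measurable periodic_smooth_measurable])
  qed
  have "(LINT x|torus_measure. partial_deriv j f x * g x + f x * partial_deriv j g x) = 0"
  proof (rule torus_integral_derivative)
    show "periodic (\<lambda>x. f x * g x)" "periodic (\<lambda>x. partial_deriv j f x * g x + f x * partial_deriv j g x)"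
      using periodic_smooth_periodic[OF f] periodic_smooth_periodic[OF g] periodic_smooth_periodic[OF f'] periodic_smooth_periodic[OF g']
      by (simp_all add: periodic_def)
    show "continuous_on UNIV (\<lambda>x. f x * g x)" "continuous_on UNIV (\<lambda>x. partial_deriv j f x * g x + f x * partial_deriv j g x)"
      by (intro continuous_intros periodic_smooth_continuous f g f' g')+
    fix x
    show "((\<lambda>t. f (x + t *\<^sub>R axis j 1) * g (x + t *\<^sub>R axis j 1)) has_real_derivative
        partial_deriv j f x * g x + f x * partial_deriv j g x) (at 0)"
      using DERIV_mult[OF directional_derivative[of f x j] directional_derivative[of g x j]]
        periodic_smooth_differentiable[OF f] periodic_smooth_differentiable[OF g] by (simp add: add.commute mult.commute)
  qed
  then show ?thesis
    using int[OF f' g] int[OF f g'] by simp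
qed

lemma integrable_wave [simp]: "integrable torus_measure (wave \<xi>)"
  by (rule integrable_torus_bounded[of _ 1]) auto

text \<open>In a direction \<open>k\<close> with \<open>\<xi> $ k \<noteq> 0\<close>, cosine and
  sine are up to a nonzero factor derivatives of periodic functions, so they integrate to
  zero.\<close>

lemma integral_wave: "(LINT x|torus_measure. wave \<xi> x) = (if \<xi> = 0 then 1 else 0)"
proof (cases "\<xi> = 0")
  case True
  then show ?thesis by (simp add: finite_measure.emeasure_eq_measure[OF finite_measure_torus])
next
  case False
  then obtain k where k: "\<xi> $ k \<noteq> 0" by (metis vec_eq_iff zero_index)
  have fr: "(x + t *\<^sub>R axis k 1) \<bullet> frequency \<xi> = x \<bullet> frequency \<xi> + t * of_int (\<xi> $ k)" for x t
    by (simp add: inner_add_left inner_axis')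
  have per: "periodic (\<lambda>x. Re (wave \<xi> x))" "periodic (\<lambda>x. Im (wave \<xi> x))"
    using periodic_wave[of \<xi>] unfolding periodic_def by metis+
  have "(LINT x|torus_measure. 2 * pi * of_int (\<xi> $ k) * cos (2 * pi * (x \<bullet> frequency \<xi>))) = 0"
    using per
    by (intro torus_integral_derivative[where f = "\<lambda>x. sin (2 * pi * (x \<bullet> frequency \<xi>))" and j = k])
      (auto simp: fr periodic_def intro!: continuous_intros derivative_eq_intros)
  moreover have "(LINT x|torus_measure. 2 * pi * of_int (\<xi> $ k) * sin (2 * pi * (x \<bullet> frequency \<xi>))) = 0"
    using per
    by (intro torus_integral_derivative[where f = "\<lambda>x. - cos (2 * pi * (x \<bullet> frequency \<xi>))" and j = k])
      (auto simp: fr periodic_def intro!: continuous_intros derivative_eq_intros)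
  ultimately have "(LINT x|torus_measure. Re (wave \<xi> x)) = 0" "(LINT x|torus_measure. Im (wave \<xi> x)) = 0"
    using k by simp_all
  then have "Re (LINT x|torus_measure. wave \<xi> x) = 0" "Im (LINT x|torus_measure. wave \<xi> x) = 0"
    by (simp_all only: integral_Re integral_Im integrable_wave)
  then show ?thesis using False by (simp add: complex_eq_iff)
qed

section \<open>Fourier coefficients of integrable functions\<close>

lemma distr_of_eq: "distr_of g \<phi> = (LINT x|torus_measure. g x * \<phi> x)"
  by (simp add: distr_of_def set_integral_torus)

lemma integrable_mult_bounded:
  fixes g :: "real^'n::finite \<Rightarrow> 'b::{real_normed_algebra, banach, second_countable_topology}"
  assumes g: "integrable torus_measure g" and m: "\<phi> \<in> borel_measurable borel" and B: "\<And>x. norm (\<phi> x) \<le> B"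
  shows "integrable torus_measure (\<lambda>x. g x * \<phi> x)"
proof (rule Bochner_Integration.integrable_bound)
  show "integrable torus_measure (\<lambda>x. B * norm (g x))" using g by simp
  show "(\<lambda>x. g x * \<phi> x) \<in> borel_measurable torus_measure"
    using g borel_measurable_torus[OF m] by (intro borel_measurable_times) auto
  show "AE x in torus_measure. norm (g x * \<phi> x) \<le> norm (B * norm (g x))"
  proof (intro always_eventually allI)
    fix x
    have "norm (g x * \<phi> x) \<le> norm (g x) * norm (\<phi> x)" by (rule norm_mult_ineq)
    also have "\<dots> \<le> norm (g x) * B" by (intro mult_left_mono B) simp
    finally show "norm (g x * \<phi> x) \<le> norm (B * norm (g x))"
      by (simp add: mult.commute)
  qed
qed

text \<open>Identifies the encoding by cosine and sine values of a real functional with the usual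
  complex integral.\<close>

lemma fourier_coeff_distr_of:
  assumes g: "integrable torus_measure g"
  shows "fourier_coeff (distr_of g) \<xi> = (LINT x|torus_measure. of_real (g x) * wave (- \<xi>) x)"
proof -
  have int: "integrable torus_measure (\<lambda>x. complex_of_real (g x) * wave (- \<xi>) x)"
    using g by (intro integrable_mult_bounded[of _ _ 1]) auto
  have "Re (LINT x|torus_measure. of_real (g x) * wave (- \<xi>) x) = (LINT x|torus_measure. g x * cos (2 * pi * (x \<bullet> frequency \<xi>)))"
    by (subst integral_Re[OF int, symmetric]) (simp add: inner_minus_right)
  moreover have "Im (LINT x|torus_measure. of_real (g x) * wave (- \<xi>) x) = - (LINT x|torus_measure. g x * sin (2 * pi * (x \<bullet> frequency \<xi>)))"
    by (subst integral_Im[OF int, symmetric]) (simp add: inner_minus_right)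
  ultimately show ?thesis
    by (simp add: fourier_coeff_def distr_of_eq complex_eq_iff)
qed

section \<open>Periodic distributions\<close>

lemma partial_deriv_linear:
  assumes "f differentiable (at x)" "g differentiable (at x)"
  shows "partial_deriv j (\<lambda>x. a * f x + b * g x) x = a * partial_deriv j f x + b * partial_deriv j g x"
proof -
  have "(f has_derivative frechet_derivative f (at x)) (at x)" "(g has_derivative frechet_derivative g (at x)) (at x)"
    using assms frechet_derivative_works by blast+
  then have "((\<lambda>x. a * f x + b * g x) has_derivative
      (\<lambda>h. a * frechet_derivative f (at x) h + b * frechet_derivative g (at x) h)) (at x)"
    by (auto intro!: derivative_eq_intros)
  from partial_deriv_eqI[OF this] show ?thesis by (simp add: partial_deriv_def)
qed

lemma periodic_smooth_linear:
  assumes f: "f \<in> periodic_smooth" and g: "g \<in> periodic_smooth"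
  shows "(\<lambda>x. a * f x + b * g x) \<in> periodic_smooth"
proof -
  have sm: "partial_derivs js h differentiable (at x)" if "h \<in> periodic_smooth" for js h and x :: "real^'a"
    using that by (auto simp: periodic_smooth_def smooth_def)
  have "partial_derivs js (\<lambda>x. a * f x + b * g x) = (\<lambda>x. a * partial_derivs js f x + b * partial_derivs js g x)" for js
  proof (induction js)
    case (Cons j js)
    then show ?case
      by (simp add: partial_derivs_Cons) (simp add: fun_eq_iff partial_deriv_linear sm[OF f] sm[OF g])
  qed simp
  then have "smooth (\<lambda>x. a * f x + b * g x)"
    unfolding smooth_def using sm[OF f] sm[OF g] by (auto intro!: derivative_intros)
  moreover have "periodic (\<lambda>x. a * f x + b * g x)"
    using periodic_smooth_periodic[OF f] periodic_smooth_periodic[OF g] by (simp add: periodic_def)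
  ultimately show ?thesis by (simp add: periodic_smooth_def)
qed

lemma periodic_distribution_linear:
  "T \<in> periodic_distribution \<Longrightarrow> f \<in> periodic_smooth \<Longrightarrow> g \<in> periodic_smooth \<Longrightarrow>
    T (\<lambda>x. a * f x + b * g x) = a * T f + b * T g"
  by (simp add: periodic_distribution_def)

lemma periodic_distribution_scale:
  "T \<in> periodic_distribution \<Longrightarrow> f \<in> periodic_smooth \<Longrightarrow> T (\<lambda>x. a * f x) = a * T f"
  using periodic_distribution_linear[of T f f a 0] by simp

lemma periodic_distribution_lim:
  "T \<in> periodic_distribution \<Longrightarrow> (\<And>m. \<phi> m \<in> periodic_smooth) \<Longrightarrow> \<psi> \<in> periodic_smooth \<Longrightarrow>
    smooth_limit \<phi> \<psi> \<Longrightarrow> (\<lambda>m. T (\<phi> m)) \<longlonglongrightarrow> T \<psi>"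
  by (simp add: periodic_distribution_def)

lemma periodic_distribution_combination:
  assumes T: "T \<in> periodic_distribution" and S: "S \<in> periodic_distribution"
  shows "(\<lambda>\<phi>. a * T \<phi> + b * S \<phi>) \<in> periodic_distribution"
  unfolding periodic_distribution_def mem_Collect_eq
proof (intro conjI ballI allI impI)
  show "a * T (\<lambda>x. c * \<phi> x + d * \<psi> x) + b * S (\<lambda>x. c * \<phi> x + d * \<psi> x) = c * (a * T \<phi> + b * S \<phi>) + d * (a * T \<psi> + b * S \<psi>)"
    if "\<phi> \<in> periodic_smooth" "\<psi> \<in> periodic_smooth" for \<phi> \<psi> c d
    using that by (simp add: periodic_distribution_linear[OF T] periodic_distribution_linear[OF S] algebra_simps)
  show "(\<lambda>m. a * T (\<phi> m) + b * S (\<phi> m)) \<longlonglongrightarrow> a * T \<psi> + b * S \<psi>"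
    if "\<forall>m. \<phi> m \<in> periodic_smooth" "\<psi> \<in> periodic_smooth" "smooth_limit \<phi> \<psi>" for \<phi> \<psi>
    using that by (intro tendsto_intros periodic_distribution_lim[OF T] periodic_distribution_lim[OF S]) auto
qed

lemma periodic_distribution_zero: "(\<lambda>_. 0) \<in> periodic_distribution"
  by (simp add: periodic_distribution_def)

lemma periodic_distribution_sum:
  assumes "finite A" "\<And>k. k \<in> A \<Longrightarrow> T k \<in> periodic_distribution"
  shows "(\<lambda>\<phi>. \<Sum>k\<in>A. T k \<phi>) \<in> periodic_distribution"
  using assms
proof (induction A)
  case (insert k A)
  then have "(\<lambda>\<phi>. 1 * T k \<phi> + 1 * (\<Sum>k\<in>A. T k \<phi>)) \<in> periodic_distribution"
    by (intro periodic_distribution_combination) auto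
  then show ?case using insert by simp
qed (simp add: periodic_distribution_zero)

lemma periodic_distribution_deriv:
  assumes T: "T \<in> periodic_distribution"
  shows "distr_deriv j T \<in> periodic_distribution"
  unfolding periodic_distribution_def mem_Collect_eq
proof (intro conjI ballI allI impI)
  show "distr_deriv j T (\<lambda>x. c * \<phi> x + d * \<psi> x) = c * distr_deriv j T \<phi> + d * distr_deriv j T \<psi>"
    if \<phi>: "\<phi> \<in> periodic_smooth" and \<psi>: "\<psi> \<in> periodic_smooth" for \<phi> \<psi> c d
  proof -
    have "partial_deriv j (\<lambda>x. c * \<phi> x + d * \<psi> x) = (\<lambda>x. c * partial_deriv j \<phi> x + d * partial_deriv j \<psi> x)"
      using \<phi> \<psi> by (auto simp: fun_eq_iff partial_deriv_linear periodic_smooth_differentiable)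
    then show ?thesis
      using \<phi> \<psi> by (simp add: distr_deriv_def periodic_distribution_linear[OF T] partial_deriv_periodic_smooth)
  qed
  show "(\<lambda>m. distr_deriv j T (\<phi> m)) \<longlonglongrightarrow> distr_deriv j T \<psi>"
    if \<phi>: "\<forall>m. \<phi> m \<in> periodic_smooth" and \<psi>: "\<psi> \<in> periodic_smooth" and lim: "smooth_limit \<phi> \<psi>" for \<phi> \<psi>
  proof -
    have "smooth_limit (\<lambda>m. partial_deriv j (\<phi> m)) (partial_deriv j \<psi>)"
      unfolding smooth_limit_def partial_derivs_snoc[symmetric] using lim by (simp add: smooth_limit_def)
    then show ?thesis
      unfolding distr_deriv_def using \<phi> \<psi>
      by (intro tendsto_minus periodic_distribution_lim[OF T]) (auto intro: partial_deriv_periodic_smooth)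
  qed
qed

lemma periodic_distribution_distr_of:
  assumes g: "integrable torus_measure g"
  shows "distr_of g \<in> periodic_distribution"
  unfolding periodic_distribution_def mem_Collect_eq
proof (intro conjI ballI allI impI)
  have int: "integrable torus_measure (\<lambda>x. g x * \<phi> x)" if \<phi>: "\<phi> \<in> periodic_smooth" for \<phi>
  proof -
    obtain B where "\<And>x. \<bar>\<phi> x\<bar> \<le> B" using periodic_smooth_bounded[OF \<phi>] by blast
    then show ?thesis
      using \<phi> by (intro integrable_mult_bounded[OF g, of _ B] periodic_smooth_measurable) auto
  qed
  show "distr_of g (\<lambda>x. c * \<phi> x + d * \<psi> x) = c * distr_of g \<phi> + d * distr_of g \<psi>"
    if \<phi>: "\<phi> \<in> periodic_smooth" and \<psi>: "\<psi> \<in> periodic_smooth" for \<phi> \<psi> c d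
  proof -
    have "distr_of g (\<lambda>x. c * \<phi> x + d * \<psi> x) = (LINT x|torus_measure. c * (g x * \<phi> x) + d * (g x * \<psi> x))"
      by (simp add: distr_of_eq algebra_simps)
    then show ?thesis
      using int[OF \<phi>] int[OF \<psi>] by (simp add: distr_of_eq)
  qed
  show "(\<lambda>m. distr_of g (\<phi> m)) \<longlonglongrightarrow> distr_of g \<psi>"
    if \<phi>: "\<forall>m. \<phi> m \<in> periodic_smooth" and \<psi>: "\<psi> \<in> periodic_smooth" and lim: "smooth_limit \<phi> \<psi>" for \<phi> \<psi>
  proof (rule LIMSEQ_I)
    fix r :: real assume r: "r > 0"
    \<comment> \<open>The mean of the modulus of \<open>g\<close> measures the continuity of the
      functional; dividing by \<open>N + 1\<close> covers \<open>g = 0\<close>.\<close>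
    define N where "N = (LINT x|torus_measure. \<bar>g x\<bar>)"
    have N: "N \<ge> 0" by (simp add: N_def)
    have "uniform_limit UNIV \<phi> \<psi> sequentially"
      using lim[unfolded smooth_limit_def, rule_format, of "[]"] by simp
    then have "\<forall>\<^sub>F m in sequentially. \<forall>x\<in>UNIV. dist (\<phi> m x) (\<psi> x) < r / (N + 1)"
      using r N by (simp add: uniform_limit_iff)
    then obtain m0 where m0: "\<And>m x. m \<ge> m0 \<Longrightarrow> \<bar>\<phi> m x - \<psi> x\<bar> < r / (N + 1)"
      by (auto simp: eventually_sequentially dist_real_def)
    have "norm (distr_of g (\<phi> m) - distr_of g \<psi>) < r" if "m \<ge> m0" for m
    proof -
      have i: "integrable torus_measure (\<lambda>x. g x * \<phi> m x)" "integrable torus_measure (\<lambda>x. g x * \<psi> x)"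
        using int \<phi> \<psi> by auto
      have "distr_of g (\<phi> m) - distr_of g \<psi> = (LINT x|torus_measure. g x * \<phi> m x - g x * \<psi> x)"
        using i by (simp add: distr_of_eq)
      also have "norm \<dots> \<le> (LINT x|torus_measure. norm (g x * \<phi> m x - g x * \<psi> x))"
        by (rule integral_norm_bound)
      also have "\<dots> \<le> (LINT x|torus_measure. \<bar>g x\<bar> * (r / (N + 1)))"
      proof (rule integral_mono)
        fix x
        show "norm (g x * \<phi> m x - g x * \<psi> x) \<le> \<bar>g x\<bar> * (r / (N + 1))"
          using m0[OF that, of x] unfolding right_diff_distrib[symmetric] real_norm_def abs_mult
          by (intro mult_left_mono) auto
      qed (use g i in auto)
      also have "\<dots> = N * (r / (N + 1))" by (simp add: N_def)
      also have "\<dots> < r"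
        using r N by (simp add: divide_simps)
      finally show ?thesis .
    qed
    then show "\<exists>no. \<forall>m\<ge>no. norm (distr_of g (\<phi> m) - distr_of g \<psi>) < r" by blast
  qed
qed

text \<open>Differentiation exchanges the cosine and sine test functions up to sign; with the minus
  sign of the distributional derivative this becomes multiplication by
  \<open>2 * pi * \<i> * \<xi>\<close> in component \<open>j\<close>.\<close>

lemma fourier_coeff_deriv:
  fixes T :: "'n::finite functional"
  assumes T: "T \<in> periodic_distribution"
  shows "fourier_coeff (distr_deriv j T) = diff_coeff j (fourier_coeff T)"
proof
  fix \<xi> :: "int^'n"
  let ?c = "\<lambda>x. cos (2 * pi * (x \<bullet> frequency \<xi>))" and ?s = "\<lambda>x. sin (2 * pi * (x \<bullet> frequency \<xi>))"
  have fr: "(x + t *\<^sub>R axis j 1) \<bullet> frequency \<xi> = x \<bullet> frequency \<xi> + t * of_int (\<xi> $ j)" for x t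
    by (simp add: inner_add_left inner_axis')
  have "(?c has_derivative (\<lambda>h. - sin (2 * pi * (x \<bullet> frequency \<xi>)) * (2 * pi * (h \<bullet> frequency \<xi>)))) (at x)"
    "(?s has_derivative (\<lambda>h. cos (2 * pi * (x \<bullet> frequency \<xi>)) * (2 * pi * (h \<bullet> frequency \<xi>)))) (at x)" for x
    by (auto intro!: derivative_eq_intros)
  from partial_deriv_eqI[OF this(1)] partial_deriv_eqI[OF this(2)]
  have d: "partial_deriv j ?c = (\<lambda>x. - (2 * pi * of_int (\<xi> $ j)) * ?s x)"
    "partial_deriv j ?s = (\<lambda>x. (2 * pi * of_int (\<xi> $ j)) * ?c x)"
    by (auto simp: fun_eq_iff inner_axis')
  show "fourier_coeff (distr_deriv j T) \<xi> = diff_coeff j (fourier_coeff T) \<xi>"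
    unfolding fourier_coeff_def distr_deriv_def d diff_coeff_def
    by (simp only: periodic_distribution_scale[OF T] cos_sin_periodic_smooth) (simp add: complex_eq_iff)
qed

text \<open>Integration by parts: the classical derivative represents the distributional
  one.\<close>

lemma fourier_coeff_partial_deriv:
  assumes f: "f \<in> periodic_smooth"
  shows "fourier_coeff (distr_of (partial_deriv j f)) = diff_coeff j (fourier_coeff (distr_of f))"
proof -
  have "distr_of (partial_deriv j f) \<phi> = distr_deriv j (distr_of f) \<phi>" if "\<phi> \<in> periodic_smooth" for \<phi>
    using integral_by_parts[OF f that, of j] by (simp add: distr_deriv_def distr_of_eq)
  then have "fourier_coeff (distr_of (partial_deriv j f)) = fourier_coeff (distr_deriv j (distr_of f))"
    by (simp add: fun_eq_iff fourier_coeff_def cos_sin_periodic_smooth)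
  then show ?thesis
    using f by (simp add: fourier_coeff_deriv periodic_distribution_distr_of periodic_smooth_integrable)
qed

text \<open>The Fejer kernel as a squared Dirichlet kernel, so that positivity is immediate.\<close>

definition fejer_kernel :: "nat \<Rightarrow> real^'n::finite \<Rightarrow> real" where
  "fejer_kernel m z = (cmod (\<Sum>\<eta>\<in>cube m. wave \<eta> z))\<^sup>2 / card (cube m :: (int^'n) set)"

text \<open>The Fourier coefficient of \<open>fejer_kernel\<close> at \<open>\<xi>\<close>: when the
  squared Dirichlet sum is expanded, each pair with this difference contributes one wave.\<close>

definition fejer_weight :: "nat \<Rightarrow> int^'n::finite \<Rightarrow> real" where
  "fejer_weight m \<xi> = card {p \<in> cube m \<times> cube m. fst p - snd p = \<xi>} / card (cube m :: (int^'n) set)"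

lemma zero_in_cube [simp]: "0 \<in> cube m"
  by (simp add: cube_def)

lemma cube_nonempty [simp]: "cube m \<noteq> {}"
  using zero_in_cube by blast

lemma card_cube_pos [simp]: "card (cube m :: (int^'n::finite) set) > 0"
  by (simp add: card_gt_0_iff)

lemma fejer_kernel_eq:
  fixes z :: "real^'n::finite"
  shows "complex_of_real (fejer_kernel m z) = (\<Sum>p\<in>cube m \<times> cube m. wave (fst p - snd p) z) / card (cube m :: (int^'n) set)"
proof -
  let ?D = "\<Sum>\<eta>\<in>(cube m :: (int^'n) set). wave \<eta> z"
  have "complex_of_real ((cmod ?D)\<^sup>2) = ?D * cnj ?D"
    by (rule complex_norm_square)
  also have "\<dots> = (\<Sum>\<eta>\<in>cube m. \<Sum>\<zeta>\<in>cube m. wave (\<eta> - \<zeta>) z)"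
    by (simp add: sum_product)
  also have "\<dots> = (\<Sum>p\<in>cube m \<times> cube m. wave (fst p - snd p) z)"
    by (simp add: sum.cartesian_product case_prod_unfold)
  finally show ?thesis
    by (simp add: fejer_kernel_def)
qed

lemma integral_wave_shift: "(LINT y|torus_measure. wave \<xi> (x - y)) = (if \<xi> = 0 then 1 else 0)"
  by (simp add: wave_diff_arg integral_wave)

lemma continuous_fejer_kernel: "continuous_on UNIV (fejer_kernel m)"
  unfolding fejer_kernel_def wave_def cis_conv_exp by (intro continuous_intros) auto

lemma continuous_fejer_kernel_shift: "continuous_on UNIV (\<lambda>y. fejer_kernel m (x - y))"
  by (rule continuous_on_compose2[OF continuous_fejer_kernel]) (auto intro: continuous_intros)

lemma fejer_kernel_measurable: "(\<lambda>y. fejer_kernel m (x - y)) \<in> borel_measurable borel"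
  by (intro borel_measurable_continuous_onI continuous_fejer_kernel_shift)

lemma fejer_kernel_bound: "norm (fejer_kernel m z) \<le> (real (card (cube m :: (int^'n::finite) set)))\<^sup>2" for z :: "real^'n"
proof -
  let ?N = "real (card (cube m :: (int^'n) set))"
  have N: "?N \<ge> 1" using card_cube_pos[of m, where 'n = 'n] by linarith
  have "cmod (\<Sum>\<eta>\<in>(cube m :: (int^'n) set). wave \<eta> z) \<le> ?N"
    by (rule order_trans[OF norm_sum]) simp
  then have "(cmod (\<Sum>\<eta>\<in>(cube m :: (int^'n) set). wave \<eta> z))\<^sup>2 \<le> ?N\<^sup>2"
    by (intro power_mono) auto
  then have "fejer_kernel m z \<le> ?N\<^sup>2 / ?N"
    unfolding fejer_kernel_def by (intro divide_right_mono) auto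
  also have "\<dots> \<le> ?N\<^sup>2 / 1" using N by (intro divide_left_mono) auto
  finally show ?thesis by (simp add: fejer_kernel_def)
qed

lemma integrable_fejer_kernel: "integrable torus_measure (\<lambda>y. fejer_kernel m (x - y))"
  by (rule integrable_torus_bounded[OF fejer_kernel_measurable fejer_kernel_bound])

text \<open>Only pairs of frequencies that compensate \<open>\<zeta>\<close> survive integration. It
  is used for \<open>\<zeta> = 0\<close>, the total mass, and for unit vectors, which measure
  concentration.\<close>

lemma integral_fejer_kernel_wave:
  fixes x :: "real^'n::finite"
  shows "(LINT y|torus_measure. of_real (fejer_kernel m (x - y)) * wave \<zeta> (x - y))
    = card {\<eta>\<in>cube m. \<eta> + \<zeta> \<in> cube m} / card (cube m :: (int^'n) set)"
proof -
  let ?C = "cube m :: (int^'n) set" and ?P = "cube m \<times> cube m :: ((int^'n) \<times> (int^'n)) set"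
  have wi: "integrable torus_measure (\<lambda>y. wave \<xi> (x - y))" for \<xi>
    unfolding wave_diff_arg by simp
  have "(LINT y|torus_measure. of_real (fejer_kernel m (x - y)) * wave \<zeta> (x - y))
      = (LINT y|torus_measure. (\<Sum>p\<in>?P. wave (fst p - snd p + \<zeta>) (x - y)) / card ?C)"
    by (intro Bochner_Integration.integral_cong refl) (simp add: fejer_kernel_eq sum_distrib_right)
  also have "\<dots> = (\<Sum>p\<in>?P. LINT y|torus_measure. wave (fst p - snd p + \<zeta>) (x - y)) / card ?C"
    using wi by simp
  also have "(\<Sum>p\<in>?P. LINT y|torus_measure. wave (fst p - snd p + \<zeta>) (x - y)) = (\<Sum>p\<in>?P. if fst p + \<zeta> = snd p then 1 else 0)"
    unfolding integral_wave_shift by (rule sum.cong) (auto simp: algebra_simps)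
  also have "\<dots> = (\<Sum>\<eta>\<in>?C. \<Sum>\<theta>\<in>?C. if \<eta> + \<zeta> = \<theta> then 1 else 0)"
    by (simp only: sum.cartesian_product case_prod_unfold)
  also have "\<dots> = of_nat (card {\<eta>\<in>?C. \<eta> + \<zeta> \<in> ?C})"
    by (simp add: sum.delta' sum.If_cases Int_def)
  finally show ?thesis by simp
qed

text \<open>Overwriting coordinate \<open>k\<close> is a bijection between any two of the
  \<open>2 * m + 1\<close> slices.\<close>

lemma card_cube_slice:
  "(2 * m + 1) * card {\<eta>\<in>(cube m :: (int^'n::finite) set). \<eta> $ k = int m} = card (cube m :: (int^'n) set)"
proof -
  let ?S = "\<lambda>j. {\<eta>\<in>(cube m :: (int^'n) set). \<eta> $ k = j}"
  have slice: "card (?S j) = card (?S (int m))" if "j \<in> {-int m..int m}" for j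
  proof (rule bij_betw_same_card)
    show "bij_betw (\<lambda>\<eta>. \<chi> i. if i = k then int m else \<eta> $ i) (?S j) (?S (int m))"
      using that by (intro bij_betwI[where g = "\<lambda>\<eta>. \<chi> i. if i = k then j else \<eta> $ i"])
        (auto simp: cube_def vec_eq_iff)
  qed
  have "card (cube m :: (int^'n) set) = (\<Sum>j\<in>{-int m..int m}. card (?S j))"
  proof -
    have "(cube m :: (int^'n) set) = (\<Union>j\<in>{-int m..int m}. ?S j)"
      by (auto simp: cube_def) (metis abs_le_iff minus_le_iff)+
    also have "card \<dots> = (\<Sum>j\<in>{-int m..int m}. card (?S j))"
      by (rule card_UN_disjoint) (auto intro: rev_finite_subset[OF finite_cube[of m]])
    finally show ?thesis .
  qed
  also have "\<dots> = (\<Sum>j\<in>{-int m..int m}. card (?S (int m)))"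
    by (rule sum.cong[OF refl slice])
  also have "\<dots> = card {-int m..int m} * card (?S (int m))"
    by (simp only: sum_constant of_nat_id)
  also have "card {-int m..int m} = 2 * m + 1" by simp
  finally show ?thesis by simp
qed

lemma integral_fejer_kernel: "(LINT y|torus_measure. fejer_kernel m (x - y)) = 1"
proof -
  have "complex_of_real (LINT y|torus_measure. fejer_kernel m (x - y)) = (LINT y|torus_measure. complex_of_real (fejer_kernel m (x - y)))"
    by simp
  also have "\<dots> = 1"
    using integral_fejer_kernel_wave[of m x 0] by simp
  finally show ?thesis by (simp only: of_real_eq_1_iff)
qed

text \<open>\<open>1 - cos\<close> acts as a squared distance on the torus. Its kernel average is
  exactly the fraction of cube points on the face that a unit shift pushes out of the cube.\<close>

lemma integral_fejer_kernel_cos: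
  "(LINT y|torus_measure. fejer_kernel m (x - y) * (1 - cos (2 * pi * ((x - y) $ k)))) = 1 / (2 * m + 1)"
proof -
  let ?C = "cube m :: (int^'a) set"
  let ?S = "{\<eta>\<in>?C. \<eta> $ k = int m}"
  have fr: "frequency (axis k 1) = (axis k 1 :: real^'a)"
    by (simp add: vec_eq_iff axis_def)
  have wi: "integrable torus_measure (\<lambda>y. of_real (fejer_kernel m (x - y)) * wave (axis k 1) (x - y))"
    unfolding wave_diff_arg using fejer_kernel_bound[of m]
    by (intro integrable_torus_bounded[of _ "(real (card ?C))\<^sup>2"])
      (auto simp: norm_mult intro!: borel_measurable_continuous_onI continuous_intros continuous_fejer_kernel_shift continuous_wave)
  have "{\<eta>\<in>?C. \<eta> + axis k 1 \<in> ?C} = ?C - ?S"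
  proof (intro set_eqI)
    fix \<eta> :: "int^'a"
    have "\<eta> + axis k 1 \<in> ?C \<longleftrightarrow> \<eta> $ k \<noteq> int m" if \<eta>: "\<eta> \<in> ?C"
    proof -
      have *: "\<bar>\<eta> $ i\<bar> \<le> int m" for i using \<eta> by (simp add: cube_def)
      have "\<eta> + axis k 1 \<in> ?C \<longleftrightarrow> \<bar>\<eta> $ k + 1\<bar> \<le> int m"
        using * by (auto simp: cube_def axis_def)
      also have "\<dots> \<longleftrightarrow> \<eta> $ k \<noteq> int m"
        using *[of k] by auto
      finally show ?thesis .
    qed
    then show "\<eta> \<in> {\<eta>\<in>?C. \<eta> + axis k 1 \<in> ?C} \<longleftrightarrow> \<eta> \<in> ?C - ?S" by auto
  qed
  then have card: "real (card {\<eta>\<in>?C. \<eta> + axis k 1 \<in> ?C}) = real (card ?C) - real (card ?S)"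
    by (simp add: card_Diff_subset of_nat_diff card_mono)
  have "(LINT y|torus_measure. fejer_kernel m (x - y) * cos (2 * pi * ((x - y) $ k)))
      = (LINT y|torus_measure. Re (of_real (fejer_kernel m (x - y)) * wave (axis k 1) (x - y)))"
    by (simp add: fr inner_axis)
  also have "\<dots> = Re (LINT y|torus_measure. of_real (fejer_kernel m (x - y)) * wave (axis k 1) (x - y))"
    by (rule integral_Re[OF wi])
  also have "\<dots> = (real (card ?C) - real (card ?S)) / real (card ?C)"
    unfolding integral_fejer_kernel_wave card[symmetric] by simp
  also have "\<dots> = 1 - 1 / (2 * m + 1)"
  proof -
    have C: "real (card ?C) = (2 * m + 1) * real (card ?S)"
      unfolding card_cube_slice[of m k, symmetric] of_nat_mult by simp
    moreover have "real (card ?S) \<noteq> 0"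
    proof
      assume "real (card ?S) = 0"
      then have "real (card ?C) = 0"
        unfolding C by (simp only: mult_zero_right)
      then show False by simp
    qed
    ultimately show ?thesis by (simp add: diff_divide_distrib)
  qed
  finally have "(LINT y|torus_measure. fejer_kernel m (x - y) * cos (2 * pi * ((x - y) $ k))) = 1 - 1 / (2 * m + 1)" .
  moreover have "integrable torus_measure (\<lambda>y. fejer_kernel m (x - y) * cos (2 * pi * ((x - y) $ k)))"
    by (intro integrable_mult_bounded[OF integrable_fejer_kernel, of _ 1] borel_measurable_continuous_onI continuous_intros) auto
  ultimately show ?thesis
    by (simp add: right_diff_distrib integrable_fejer_kernel integral_fejer_kernel)
qed

section \<open>Fejer sums\<close>

text \<open>A Korovkin type bound: continuity is expressed through the functions
  \<open>1 - cos\<close>, whose averages against the Fejer kernel are known exactly, so that uniform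
  convergence follows from these averages alone.\<close>

lemma periodic_modulus:
  fixes \<phi> :: "real^'n::finite \<Rightarrow> real"
  assumes per: "periodic \<phi>" and cont: "continuous_on UNIV \<phi>" and e: "e > 0"
  obtains C where "C \<ge> 0" "\<And>x y. \<bar>\<phi> x - \<phi> y\<bar> \<le> e + C * (\<Sum>k\<in>UNIV. 1 - cos (2 * pi * ((x - y) $ k)))"
proof -
  obtain B where B: "B \<ge> 0" "\<And>x. \<bar>\<phi> x\<bar> \<le> B"
    using periodic_bounded[OF per cont] by (metis real_norm_def)
  define K :: "(real^'n) set" where "K = cbox (\<chi> k. -2) (\<chi> k. 2)"
  have "uniformly_continuous_on K \<phi>"
    unfolding K_def using cont by (intro compact_uniformly_continuous continuous_on_subset[OF cont]) auto
  then obtain \<delta> where \<delta>: "\<delta> > 0" "\<And>x y. x \<in> K \<Longrightarrow> y \<in> K \<Longrightarrow> dist x y < \<delta> \<Longrightarrow> \<bar>\<phi> x - \<phi> y\<bar> < e"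
    using e unfolding uniformly_continuous_on_def dist_real_def by metis
  \<comment> \<open>Coordinatewise closeness \<open>r\<close> yields distance below
    \<open>\<delta>\<close>, and \<open>r \<le> 1/2\<close> keeps \<open>2 * pi * r\<close> where
    the cosine decreases.\<close>
  define r where "r = min (1/2) (\<delta> / (CARD('n) + 1))"
  have r: "0 < r" "r \<le> 1/2" "r * CARD('n) < \<delta>"
  proof -
    show "0 < r" using \<delta> by (simp add: r_def)
    show "r \<le> 1/2" unfolding r_def by (rule min.cobounded1)
    have "r * CARD('n) < r * (CARD('n) + 1)" using \<open>0 < r\<close> by simp
    also have "\<dots> \<le> \<delta> / (CARD('n) + 1) * (CARD('n) + 1)"
      by (intro mult_right_mono) (auto simp: r_def)
    finally show "r * CARD('n) < \<delta>" by simp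
  qed
  define \<kappa> where "\<kappa> = 1 - cos (2 * pi * r)"
  have \<kappa>: "\<kappa> > 0"
    using cos_monotone_0_pi[of 0 "2 * pi * r"] r by (simp add: \<kappa>_def)
  \<comment> \<open>If some coordinates differ by at least \<open>r\<close>, the cosine sum is at
    least \<open>\<kappa>\<close>; this factor then lets it dominate the largest possible
    oscillation \<open>2 * B\<close>.\<close>
  define C where "C = 2 * B / \<kappa>"
  have C: "C \<ge> 0" using B \<kappa> by (simp add: C_def)
  have "\<bar>\<phi> x - \<phi> y\<bar> \<le> e + C * (\<Sum>k\<in>UNIV. 1 - cos (2 * pi * ((x - y) $ k)))" for x y
  proof -
    define v where "v = (\<chi> k. - \<lfloor>x $ k\<rfloor>)"
    define x' where "x' = x + frequency v"
    \<comment> \<open>Rounding to the nearest integer brings \<open>y\<close> within half a period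
      of \<open>x'\<close> in every coordinate.\<close>
    define w where "w = (\<chi> k. - \<lfloor>y $ k - x' $ k + 1/2\<rfloor>)"
    define y' where "y' = y + frequency w"
    have x': "0 \<le> x' $ k" "x' $ k < 1" for k
      by (simp_all add: x'_def v_def) linarith
    have xy': "\<bar>x' $ k - y' $ k\<bar> \<le> 1/2" for k
    proof -
      define z where "z = y $ k - x' $ k + 1/2"
      have "y' $ k = y $ k - of_int \<lfloor>z\<rfloor>" by (simp add: y'_def w_def z_def)
      moreover have "of_int \<lfloor>z\<rfloor> \<le> z" "z < of_int \<lfloor>z\<rfloor> + 1" by linarith+
      ultimately show ?thesis unfolding z_def by linarith
    qed
    have "-2 \<le> x' $ k \<and> x' $ k \<le> 2 \<and> -2 \<le> y' $ k \<and> y' $ k \<le> 2" for k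
    proof -
      have "x' $ k - y' $ k \<le> 1/2" "- (x' $ k - y' $ k) \<le> 1/2"
        using xy'[of k] by (simp_all only: abs_le_iff)
      then show ?thesis using x'[of k] by auto
    qed
    then have K: "x' \<in> K" "y' \<in> K"
      by (simp_all add: K_def mem_box_cart)
    have eq: "\<phi> x = \<phi> x'" "\<phi> y = \<phi> y'"
      by (simp_all add: x'_def y'_def periodic_shift[OF per])
    have cos_eq: "cos (2 * pi * ((x - y) $ k)) = cos (2 * pi * \<bar>x' $ k - y' $ k\<bar>)" for k
    proof -
      have "2 * pi * ((x - y) $ k) = 2 * pi * (x' $ k - y' $ k) + 2 * pi * of_int (w $ k - v $ k)"
        by (simp add: x'_def y'_def algebra_simps)
      then have "cos (2 * pi * ((x - y) $ k)) = cos (2 * pi * (x' $ k - y' $ k))"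
        by (simp only: cos_add cos_int_2pin sin_int_2pin)
      then show ?thesis
        using cos_abs_real[of "2 * pi * (x' $ k - y' $ k)"] by (simp add: abs_mult)
    qed
    show ?thesis
    proof (cases "\<forall>k. \<bar>x' $ k - y' $ k\<bar> < r")
      case True
      have "dist x' y' \<le> (\<Sum>k\<in>UNIV. \<bar>(x' - y') $ k\<bar>)"
        unfolding dist_norm by (rule norm_le_l1_cart)
      also have "\<dots> \<le> (\<Sum>k\<in>(UNIV :: 'n set). r)"
        using True by (intro sum_mono) (auto simp: less_imp_le)
      also have "\<dots> < \<delta>" using r by (simp add: mult.commute)
      finally have "\<bar>\<phi> x' - \<phi> y'\<bar> < e" by (rule \<delta>(2)[OF K])
      moreover have "0 \<le> C * (\<Sum>k\<in>UNIV. 1 - cos (2 * pi * ((x - y) $ k)))"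
        using C by (intro mult_nonneg_nonneg sum_nonneg) auto
      ultimately show ?thesis by (simp add: eq)
    next
      case False
      then obtain k where k: "r \<le> \<bar>x' $ k - y' $ k\<bar>" by (auto simp: not_less)
      have "cos (2 * pi * \<bar>x' $ k - y' $ k\<bar>) \<le> cos (2 * pi * r)"
        using k r xy'[of k] by (intro cos_monotone_0_pi_le) auto
      then have "\<kappa> \<le> 1 - cos (2 * pi * ((x - y) $ k))"
        unfolding \<kappa>_def cos_eq by simp
      also have "\<dots> \<le> (\<Sum>k\<in>UNIV. 1 - cos (2 * pi * ((x - y) $ k)))"
        by (rule member_le_sum) auto
      finally have "C * \<kappa> \<le> C * (\<Sum>k\<in>UNIV. 1 - cos (2 * pi * ((x - y) $ k)))"
        using C by (intro mult_left_mono) auto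
      moreover have "C * \<kappa> = 2 * B" using \<kappa> by (simp add: C_def)
      ultimately show ?thesis
        using B(2)[of x] B(2)[of y] e by linarith
    qed
  qed
  with C show thesis by (rule that)
qed

definition fejer :: "nat \<Rightarrow> (real^'n::finite \<Rightarrow> real) \<Rightarrow> real^'n \<Rightarrow> real" where
  "fejer m \<phi> x = (LINT y|torus_measure. fejer_kernel m (x - y) * \<phi> y)"

lemma integrable_fejer_mult:
  assumes "\<phi> \<in> borel_measurable borel" "\<And>x. \<bar>\<phi> x\<bar> \<le> B"
  shows "integrable torus_measure (\<lambda>y. fejer_kernel m (x - y) * \<phi> y)"
  using assms by (intro integrable_mult_bounded[OF integrable_fejer_kernel]) auto

text \<open>Integrating \<open>periodic_modulus\<close> against a nonnegative kernel of mass one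
  leaves \<open>e / 2\<close> and a multiple of \<open>1 / (2 * m + 1)\<close>, uniformly in the
  point.\<close>

lemma fejer_uniform_limit:
  fixes \<phi> :: "real^'n::finite \<Rightarrow> real"
  assumes per: "periodic \<phi>" and cont: "continuous_on UNIV \<phi>"
  shows "uniform_limit UNIV (\<lambda>m. fejer m \<phi>) \<phi> sequentially"
  unfolding uniform_limit_iff
proof (intro allI impI)
  fix e :: real assume e: "e > 0"
  obtain B where B: "\<And>x. \<bar>\<phi> x\<bar> \<le> B"
    using periodic_bounded[OF per cont] by (metis real_norm_def)
  obtain C where C: "C \<ge> 0"
    "\<And>x y. \<bar>\<phi> x - \<phi> y\<bar> \<le> e / 2 + C * (\<Sum>k\<in>UNIV. 1 - cos (2 * pi * ((x - y) $ k)))"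
    using periodic_modulus[OF per cont, of "e / 2"] e by (metis half_gt_zero)
  have meas: "\<phi> \<in> borel_measurable borel" using cont by (rule borel_measurable_continuous_onI)
  have bound: "\<bar>fejer m \<phi> x - \<phi> x\<bar> \<le> e / 2 + C * CARD('n) * (1 / (2 * real m + 1))" for m x
  proof -
    let ?K = "\<lambda>y. fejer_kernel m (x - y)" and ?q = "\<lambda>k y. 1 - cos (2 * pi * ((x - y) $ k))"
    have K0: "?K y \<ge> 0" for y by (simp add: fejer_kernel_def)
    have iq: "integrable torus_measure (\<lambda>y. ?K y * ?q k y)" for k
    proof (rule integrable_mult_bounded[OF integrable_fejer_kernel, of _ 2])
      show "norm (?q k y) \<le> 2" for y
        using cos_ge_minus_one[of "2 * pi * ((x - y) $ k)"] cos_le_one[of "2 * pi * ((x - y) $ k)"] by auto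
    qed (intro borel_measurable_continuous_onI continuous_intros)
    have i1: "integrable torus_measure (\<lambda>y. ?K y * \<phi> y)" "integrable torus_measure (\<lambda>y. ?K y * \<phi> x)"
      using integrable_fejer_mult[OF meas B] integrable_fejer_kernel by auto
    have i3: "integrable torus_measure (\<lambda>y. ?K y * (e / 2) + C * (\<Sum>k\<in>UNIV. ?K y * ?q k y))"
      by (intro Bochner_Integration.integrable_add integrable_mult_left integrable_mult_right
          Bochner_Integration.integrable_sum iq integrable_fejer_kernel)
    have "fejer m \<phi> x - \<phi> x = (LINT y|torus_measure. ?K y * \<phi> y) - (LINT y|torus_measure. ?K y * \<phi> x)"
      by (simp add: fejer_def integral_fejer_kernel)
    also have "\<dots> = (LINT y|torus_measure. ?K y * \<phi> y - ?K y * \<phi> x)"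
      using i1 by simp
    finally have "\<bar>fejer m \<phi> x - \<phi> x\<bar> \<le> (LINT y|torus_measure. \<bar>?K y * \<phi> y - ?K y * \<phi> x\<bar>)"
      using integral_norm_bound[of torus_measure "\<lambda>y. ?K y * \<phi> y - ?K y * \<phi> x"] by simp
    also have "\<dots> \<le> (LINT y|torus_measure. ?K y * (e / 2) + C * (\<Sum>k\<in>UNIV. ?K y * ?q k y))"
    proof (rule integral_mono)
      fix y
      have "\<bar>?K y * \<phi> y - ?K y * \<phi> x\<bar> = ?K y * \<bar>\<phi> x - \<phi> y\<bar>"
        unfolding right_diff_distrib[symmetric] abs_mult using K0 by (simp add: abs_minus_commute)
      also have "\<dots> \<le> ?K y * (e / 2 + C * (\<Sum>k\<in>UNIV. ?q k y))"
        by (intro mult_left_mono C K0)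
      finally show "\<bar>?K y * \<phi> y - ?K y * \<phi> x\<bar> \<le> ?K y * (e / 2) + C * (\<Sum>k\<in>UNIV. ?K y * ?q k y)"
        by (simp add: distrib_left sum_distrib_left mult.left_commute)
    qed (use i1 i3 in auto)
    also have "\<dots> = (LINT y|torus_measure. ?K y * (e / 2)) + (LINT y|torus_measure. C * (\<Sum>k\<in>UNIV. ?K y * ?q k y))"
      by (intro Bochner_Integration.integral_add integrable_mult_left integrable_mult_right
          Bochner_Integration.integrable_sum iq integrable_fejer_kernel)
    also have "\<dots> = e / 2 + C * (\<Sum>k\<in>(UNIV :: 'n set). 1 / (2 * real m + 1))"
      using iq by (simp only: integral_mult_right_zero integral_mult_left_zero Bochner_Integration.integral_sum integral_fejer_kernel_cos integral_fejer_kernel mult_1_left)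
    finally show ?thesis by (simp add: mult.assoc)
  qed
  have "(\<lambda>m. C * CARD('n) * (1 / (2 * real m + 1))) \<longlonglongrightarrow> C * CARD('n) * 0"
  proof (intro tendsto_mult tendsto_const)
    show "(\<lambda>m. 1 / (2 * real m + 1)) \<longlonglongrightarrow> 0"
    proof (rule Lim_null_comparison[OF _ LIMSEQ_inverse_real_of_nat])
      show "\<forall>\<^sub>F m in sequentially. norm (1 / (2 * real m + 1)) \<le> inverse (real (Suc m))"
        by (intro always_eventually allI) (simp add: divide_simps)
    qed
  qed
  then have "\<forall>\<^sub>F m in sequentially. C * CARD('n) * (1 / (2 * real m + 1)) < e / 2"
    using e by (auto dest!: order_tendstoD(2)[of _ _ _ "e / 2"])
  then show "\<forall>\<^sub>F m in sequentially. \<forall>x\<in>UNIV. dist (fejer m \<phi> x) (\<phi> x) < e"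
  proof (rule eventually_mono, intro ballI)
    fix m x assume "C * CARD('n) * (1 / (2 * real m + 1)) < e / 2"
    then show "dist (fejer m \<phi> x) (\<phi> x) < e"
      using bound[of m x] unfolding dist_real_def by linarith
  qed
qed

lemma trig_finite:
  assumes "finite F" "\<And>\<xi>. \<xi> \<notin> F \<Longrightarrow> c \<xi> = 0"
  shows "trig c x = Re (\<Sum>\<xi>\<in>F. c \<xi> * wave \<xi> x)"
proof -
  have "(\<Sum>\<^sub>\<infinity>\<xi>. c \<xi> * wave \<xi> x) = (\<Sum>\<^sub>\<infinity>\<xi>\<in>F. c \<xi> * wave \<xi> x)"
    using assms by (intro infsum_cong_neutral) auto
  then show ?thesis using assms by (simp add: trig_def)
qed

lemma fejer_weight_support: "finite {\<xi>. of_real (fejer_weight m \<xi>) * c \<xi> \<noteq> (0 :: complex)}"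
proof (rule finite_subset)
  show "{\<xi>. of_real (fejer_weight m \<xi>) * c \<xi> \<noteq> 0} \<subseteq> (\<lambda>p. fst p - snd p) ` (cube m \<times> cube m)"
  proof
    fix \<xi> assume "\<xi> \<in> {\<xi>. of_real (fejer_weight m \<xi>) * c \<xi> \<noteq> 0}"
    then have "{p \<in> cube m \<times> cube m. fst p - snd p = \<xi>} \<noteq> {}"
      by (auto simp: fejer_weight_def)
    then show "\<xi> \<in> (\<lambda>p. fst p - snd p) ` (cube m \<times> cube m)" by blast
  qed
qed simp

lemma fejer_eq_trig:
  fixes \<phi> :: "real^'n::finite \<Rightarrow> real"
  assumes meas: "\<phi> \<in> borel_measurable borel" and B: "\<And>x. \<bar>\<phi> x\<bar> \<le> B"
  shows "fejer m \<phi> = trig (\<lambda>\<xi>. of_real (fejer_weight m \<xi>) * fourier_coeff (distr_of \<phi>) \<xi>)"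
proof
  fix x
  let ?P = "cube m \<times> cube m :: ((int^'n) \<times> (int^'n)) set" and ?h = "\<lambda>p :: (int^'n) \<times> (int^'n). fst p - snd p"
  let ?N = "card (cube m :: (int^'n) set)" and ?c = "fourier_coeff (distr_of \<phi>)"
  have int: "integrable torus_measure \<phi>"
    using meas B by (intro integrable_torus_bounded) auto
  have c: "?c \<xi> = (LINT y|torus_measure. of_real (\<phi> y) * wave (- \<xi>) y)" for \<xi>
    by (rule fourier_coeff_distr_of[OF int])
  have wi: "integrable torus_measure (\<lambda>y. complex_of_real (\<phi> y) * wave \<xi> y)" for \<xi>
    using int by (intro integrable_mult_bounded[of _ _ 1]) auto
  have "complex_of_real (fejer m \<phi> x) = (LINT y|torus_measure. of_real (fejer_kernel m (x - y) * \<phi> y))"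
    unfolding fejer_def by (rule integral_of_real[symmetric]) (rule integrable_fejer_mult[OF meas B])
  also have "\<dots> = (LINT y|torus_measure. (\<Sum>p\<in>?P. wave (?h p) x * (of_real (\<phi> y) * wave (- ?h p) y)) / ?N)"
    by (intro Bochner_Integration.integral_cong refl)
      (simp only: of_real_mult fejer_kernel_eq wave_diff_arg sum_distrib_left times_divide_eq_right times_divide_eq_left mult_ac)
  also have "\<dots> = (\<Sum>p\<in>?P. wave (?h p) x * ?c (?h p)) / ?N"
    unfolding c using wi by simp
  \<comment> \<open>Pairs are grouped by their difference; the size of a group produces the
    weight.\<close>
  also have "(\<Sum>p\<in>?P. wave (?h p) x * ?c (?h p)) = (\<Sum>\<xi>\<in>?h ` ?P. \<Sum>p\<in>{p \<in> ?P. ?h p = \<xi>}. wave (?h p) x * ?c (?h p))"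
    by (rule sum.image_gen) simp
  also have "\<dots> = (\<Sum>\<xi>\<in>?h ` ?P. of_nat (card {p \<in> ?P. ?h p = \<xi>}) * (wave \<xi> x * ?c \<xi>))"
    by (rule sum.cong) auto
  also have "\<dots> / ?N = (\<Sum>\<xi>\<in>?h ` ?P. of_real (fejer_weight m \<xi>) * ?c \<xi> * wave \<xi> x)"
    by (simp add: fejer_weight_def sum_divide_distrib mult_ac)
  finally have e: "complex_of_real (fejer m \<phi> x) = (\<Sum>\<xi>\<in>?h ` ?P. of_real (fejer_weight m \<xi>) * ?c \<xi> * wave \<xi> x)" .
  have "trig (\<lambda>\<xi>. of_real (fejer_weight m \<xi>) * ?c \<xi>) x = Re (\<Sum>\<xi>\<in>?h ` ?P. of_real (fejer_weight m \<xi>) * ?c \<xi> * wave \<xi> x)"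
  proof (rule trig_finite)
    fix \<xi> assume "\<xi> \<notin> ?h ` ?P"
    then have "{p \<in> ?P. ?h p = \<xi>} = {}" by blast
    then show "of_real (fejer_weight m \<xi>) * ?c \<xi> = 0"
      unfolding fejer_weight_def by (simp only: card.empty) simp
  qed simp
  then show "fejer m \<phi> x = trig (\<lambda>\<xi>. of_real (fejer_weight m \<xi>) * ?c \<xi>) x"
    unfolding e[symmetric] by simp
qed

lemma fejer_eq_trig_smooth:
  "\<phi> \<in> periodic_smooth \<Longrightarrow> fejer m \<phi> = trig (\<lambda>\<xi>. of_real (fejer_weight m \<xi>) * fourier_coeff (distr_of \<phi>) \<xi>)"
  by (metis fejer_eq_trig periodic_smooth_bounded periodic_smooth_measurable)

lemma partial_derivs_periodic_smooth: "\<phi> \<in> periodic_smooth \<Longrightarrow> partial_derivs js \<phi> \<in> periodic_smooth"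
  by (induction js) (auto simp: partial_derivs_Cons intro: partial_deriv_periodic_smooth)

lemma fourier_coeff_partial_derivs:
  "\<phi> \<in> periodic_smooth \<Longrightarrow> fourier_coeff (distr_of (partial_derivs js \<phi>)) = diff_coeffs js (fourier_coeff (distr_of \<phi>))"
  by (induction js) (auto simp: partial_derivs_Cons fourier_coeff_partial_deriv partial_derivs_periodic_smooth)

lemma diff_coeffs_scale: "diff_coeffs js (\<lambda>\<xi>. w \<xi> * c \<xi>) = (\<lambda>\<xi>. w \<xi> * diff_coeffs js c \<xi>)"
  by (induction js) (auto simp: fun_eq_iff diff_coeff_def mult_ac)

text \<open>Differentiation and Fejer averaging both act as multipliers on coefficients and
  therefore commute; each derivative converges uniformly by \<open>fejer_uniform_limit\<close>
  applied to it.\<close>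

lemma smooth_limit_fejer:
  assumes "\<phi> \<in> periodic_smooth"
  shows "smooth_limit (\<lambda>m. fejer m \<phi>) \<phi>"
  unfolding smooth_limit_def
proof
  fix js
  have "partial_derivs js (fejer m \<phi>) = fejer m (partial_derivs js \<phi>)" for m
    using assms
    by (simp add: fejer_eq_trig_smooth partial_derivs_periodic_smooth
        partial_derivs_trig[OF rapid_finite[OF fejer_weight_support]] diff_coeffs_scale fourier_coeff_partial_derivs)
  then show "uniform_limit UNIV (\<lambda>m. partial_derivs js (fejer m \<phi>)) (partial_derivs js \<phi>) sequentially"
    using fejer_uniform_limit[of "partial_derivs js \<phi>"] partial_derivs_periodic_smooth[OF assms, of js]
    by (simp add: periodic_smooth_periodic periodic_smooth_continuous)
qed

text \<open>Linearity, one frequency at a time. The conjugate on \<open>c \<xi>\<close> appears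
  because \<open>fourier_coeff\<close> tests with the wave of negative frequency.\<close>

lemma periodic_distribution_trig:
  assumes T: "T \<in> periodic_distribution" and F: "finite F" and c: "\<And>\<xi>. \<xi> \<notin> F \<Longrightarrow> c \<xi> = 0"
  shows "T (trig c) = (\<Sum>\<xi>\<in>F. Re (cnj (c \<xi>) * fourier_coeff T \<xi>))"
  using F c
proof (induction F arbitrary: c)
  case empty
  then have "trig c = (\<lambda>x. 0 * cos (2 * pi * (x \<bullet> frequency 0)))" by (simp add: fun_eq_iff trig_def)
  then show ?case
    by (simp only: periodic_distribution_scale[OF T cos_sin_periodic_smooth(1)]) simp
next
  case (insert \<xi> F)
  let ?c = "\<lambda>x. cos (2 * pi * (x \<bullet> frequency \<xi>))" and ?s = "\<lambda>x. sin (2 * pi * (x \<bullet> frequency \<xi>))"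
  define d where "d = (\<lambda>\<eta>. if \<eta> = \<xi> then 0 else c \<eta>)"
  have d: "d \<eta> = 0" if "\<eta> \<notin> F" for \<eta> using that insert by (auto simp: d_def)
  have "trig c x = 1 * (Re (c \<xi>) * ?c x + (- Im (c \<xi>)) * ?s x) + 1 * trig d x" for x
  proof -
    have "(\<Sum>\<eta>\<in>F. c \<eta> * wave \<eta> x) = (\<Sum>\<eta>\<in>F. d \<eta> * wave \<eta> x)"
      using insert by (intro sum.cong) (auto simp: d_def)
    then show ?thesis
      using trig_finite[of "insert \<xi> F" c x] trig_finite[of F d x] insert d by simp
  qed
  then have "trig c = (\<lambda>x. 1 * (Re (c \<xi>) * ?c x + (- Im (c \<xi>)) * ?s x) + 1 * trig d x)"
    by (rule ext)
  moreover have "trig d \<in> periodic_smooth"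
    using d insert by (intro trig_periodic_smooth rapid_finite) (metis (mono_tags, lifting) finite_subset mem_Collect_eq subsetI)
  ultimately have "T (trig c) = Re (c \<xi>) * T ?c + (- Im (c \<xi>)) * T ?s + T (trig d)"
    by (simp only: periodic_distribution_linear[OF T] periodic_smooth_linear cos_sin_periodic_smooth) simp
  also have "T (trig d) = (\<Sum>\<eta>\<in>F. Re (cnj (d \<eta>) * fourier_coeff T \<eta>))"
    using d by (rule insert.IH)
  also have "\<dots> = (\<Sum>\<eta>\<in>F. Re (cnj (c \<eta>) * fourier_coeff T \<eta>))"
    using insert by (intro sum.cong) (auto simp: d_def)
  finally show ?case
    using insert by (simp add: fourier_coeff_def)
qed

text \<open>Fejer sums are trigonometric polynomials that converge in the topology of test
  functions, so the coefficients determine a distribution. It reduces identities between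
  distributions to a comparison of coefficients.\<close>

theorem periodic_distribution_eqI:
  assumes T: "T \<in> periodic_distribution" and S: "S \<in> periodic_distribution"
    and eq: "fourier_coeff T = fourier_coeff S" and \<phi>: "\<phi> \<in> periodic_smooth"
  shows "T \<phi> = S \<phi>"
proof (rule LIMSEQ_unique)
  let ?c = "\<lambda>m \<xi>. of_real (fejer_weight m \<xi>) * fourier_coeff (distr_of \<phi>) \<xi>"
  have f: "fejer m \<phi> = trig (?c m)" for m
    using \<phi> by (rule fejer_eq_trig_smooth)
  have ps: "fejer m \<phi> \<in> periodic_smooth" for m
    unfolding f by (intro trig_periodic_smooth rapid_finite fejer_weight_support)
  have "T (fejer m \<phi>) = S (fejer m \<phi>)" for m
    unfolding f
    using periodic_distribution_trig[OF T fejer_weight_support[of m], of "?c m"]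
      periodic_distribution_trig[OF S fejer_weight_support[of m], of "?c m"] eq by simp
  then show "(\<lambda>m. T (fejer m \<phi>)) \<longlonglongrightarrow> S \<phi>"
    using periodic_distribution_lim[OF S ps \<phi> smooth_limit_fejer[OF \<phi>]] by simp
  show "(\<lambda>m. T (fejer m \<phi>)) \<longlonglongrightarrow> T \<phi>"
    by (rule periodic_distribution_lim[OF T ps \<phi> smooth_limit_fejer[OF \<phi>]])
qed

section \<open>Fourier series of square integrable functions\<close>

definition partial_sum :: "(int^'n::finite \<Rightarrow> complex) \<Rightarrow> nat \<Rightarrow> real^'n \<Rightarrow> complex" where
  "partial_sum c N x = (\<Sum>\<xi>\<in>cube N. c \<xi> * wave \<xi> x)"

text \<open>Mean-square convergence of the partial sums is recorded, rather than equality of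
  coefficients, because products are computed by passing to the limit in partial sums.\<close>

definition l2_fourier :: "(real^'n::finite \<Rightarrow> real) \<Rightarrow> (int^'n \<Rightarrow> complex) \<Rightarrow> bool" where
  "l2_fourier g c \<longleftrightarrow> periodic g \<and> g \<in> borel_measurable borel \<and> integrable torus_measure (\<lambda>x. (g x)\<^sup>2) \<and>
    (\<lambda>N. LINT x|torus_measure. (cmod (of_real (g x) - partial_sum c N x))\<^sup>2) \<longlonglongrightarrow> 0"

lemma filterlim_cube: "filterlim cube (finite_subsets_at_top UNIV) sequentially"
proof (rule filterlim_finite_subsets_at_top[THEN iffD2, rule_format])
  fix X :: "(int^'n::finite) set" assume "finite X \<and> X \<subseteq> UNIV"
  then obtain N where "X \<subseteq> cube N" using finite_subset_cube by blast
  then show "\<forall>\<^sub>F m in sequentially. finite (cube m) \<and> X \<subseteq> cube m \<and> cube m \<subseteq> UNIV"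
  proof (intro eventually_sequentiallyI[of N])
    fix M assume "N \<le> M"
    with \<open>X \<subseteq> cube N\<close> cube_mono show "finite (cube M) \<and> X \<subseteq> cube M \<and> cube M \<subseteq> UNIV"
      by (metis finite_cube order_trans subset_UNIV)
  qed
qed

lemma infsum_cube_limit:
  assumes "f summable_on UNIV"
  shows "(\<lambda>N. \<Sum>\<xi>\<in>cube N. f \<xi>) \<longlonglongrightarrow> infsum f UNIV"
  using has_sum_infsum[OF assms] filterlim_cube unfolding has_sum_def by (rule filterlim_compose)

lemma infsum_cube_tail:
  fixes f :: "int^'n::finite \<Rightarrow> real"
  assumes "f summable_on UNIV"
  shows "(\<lambda>N. infsum f (- cube N)) \<longlonglongrightarrow> 0"
proof -
  have "infsum f UNIV = (\<Sum>\<xi>\<in>cube N. f \<xi>) + infsum f (- cube N)" for N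
    using infsum_Un_disjoint[of f "cube N" "- cube N"] summable_on_subset_banach[OF assms] by simp
  then have "infsum f (- cube N) = infsum f UNIV - (\<Sum>\<xi>\<in>cube N. f \<xi>)" for N
    by (metis add_diff_cancel_left')
  then show ?thesis
    using tendsto_diff[OF tendsto_const infsum_cube_limit[OF assms], of "infsum f UNIV"] by simp
qed

lemma integral_Cauchy_Schwarz:
  fixes f g :: "'a \<Rightarrow> real"
  assumes meas: "f \<in> borel_measurable M" "g \<in> borel_measurable M"
    and f2: "integrable M (\<lambda>x. (f x)\<^sup>2)" and g2: "integrable M (\<lambda>x. (g x)\<^sup>2)"
  shows "integrable M (\<lambda>x. f x * g x)"
    and "(LINT x|M. f x * g x)\<^sup>2 \<le> (LINT x|M. (f x)\<^sup>2) * (LINT x|M. (g x)\<^sup>2)"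
proof -
  show fg: "integrable M (\<lambda>x. f x * g x)"
  proof (rule Bochner_Integration.integrable_bound)
    show "integrable M (\<lambda>x. (f x)\<^sup>2 + (g x)\<^sup>2)" using f2 g2 by simp
    show "(\<lambda>x. f x * g x) \<in> borel_measurable M" using meas by simp
    show "AE x in M. norm (f x * g x) \<le> norm ((f x)\<^sup>2 + (g x)\<^sup>2)"
    proof (intro always_eventually allI)
      fix x
      have "2 * (\<bar>f x\<bar> * \<bar>g x\<bar>) \<le> (f x)\<^sup>2 + (g x)\<^sup>2"
        using zero_le_power2[of "\<bar>f x\<bar> - \<bar>g x\<bar>"] by (simp add: power2_diff)
      moreover have "0 \<le> \<bar>f x\<bar> * \<bar>g x\<bar>" by simp
      ultimately have "\<bar>f x\<bar> * \<bar>g x\<bar> \<le> (f x)\<^sup>2 + (g x)\<^sup>2" by linarith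
      then show "norm (f x * g x) \<le> norm ((f x)\<^sup>2 + (g x)\<^sup>2)" by (simp add: abs_mult)
    qed
  qed
  define A B I where "A = (LINT x|M. (f x)\<^sup>2)" and "B = (LINT x|M. (g x)\<^sup>2)" and "I = (LINT x|M. f x * g x)"
  have q: "0 \<le> A - 2 * t * I + t\<^sup>2 * B" for t
  proof -
    have "0 \<le> (LINT x|M. (f x - t * g x)\<^sup>2)" by simp
    also have "\<dots> = (LINT x|M. (f x)\<^sup>2 - 2 * t * (f x * g x) + t\<^sup>2 * (g x)\<^sup>2)"
      by (intro Bochner_Integration.integral_cong refl) (simp add: power2_eq_square algebra_simps)
    also have "\<dots> = A - 2 * t * I + t\<^sup>2 * B"
      using f2 g2 fg by (simp add: A_def B_def I_def)
    finally show ?thesis .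
  qed
  have B: "B \<ge> 0" by (simp add: B_def)
  have "I\<^sup>2 \<le> A * B"
  proof (cases "B = 0")
    case True
    have "I = 0"
    proof (rule ccontr)
      assume "I \<noteq> 0"
      \<comment> \<open>With \<open>B = 0\<close> the expression is affine in \<open>t\<close>, and
        this choice makes it -1.\<close>
      then show False using q[of "(A + 1) / (2 * I)"] True by simp
    qed
    then show ?thesis using True by simp
  next
    case False
    \<comment> \<open>\<open>I / B\<close> is the minimiser of the quadratic.\<close>
    have "0 \<le> (A - 2 * (I / B) * I + (I / B)\<^sup>2 * B) * B"
      using q[of "I / B"] B by (rule mult_nonneg_nonneg)
    also have "\<dots> = A * B - I\<^sup>2"
      using False by (simp add: power2_eq_square field_simps)
    finally show ?thesis by simp
  qed
  then show "(LINT x|M. f x * g x)\<^sup>2 \<le> (LINT x|M. (f x)\<^sup>2) * (LINT x|M. (g x)\<^sup>2)"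
    by (simp add: A_def B_def I_def)
qed

lemma torus_one_integrable: "integrable torus_measure (\<lambda>x. 1 :: real)"
  by (rule integrable_torus_bounded[of _ 1]) auto

lemma torus_integral_one: "(LINT x|torus_measure. 1 :: real) = 1"
  by (simp add: finite_measure.emeasure_eq_measure[OF finite_measure_torus])

lemma square_integrable_torus:
  fixes f :: "real^'n::finite \<Rightarrow> real"
  assumes "f \<in> borel_measurable torus_measure" "integrable torus_measure (\<lambda>x. (f x)\<^sup>2)"
  shows "integrable torus_measure f" "(LINT x|torus_measure. f x)\<^sup>2 \<le> (LINT x|torus_measure. (f x)\<^sup>2)"
  using integral_Cauchy_Schwarz[of f torus_measure "\<lambda>_. 1"] assms torus_one_integrable torus_integral_one by simp_all

lemma continuous_partial_sum: "continuous_on UNIV (partial_sum c N)"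
  unfolding partial_sum_def by (intro continuous_intros continuous_wave)

lemma partial_sum_measurable [measurable]: "partial_sum c N \<in> borel_measurable borel"
  by (intro borel_measurable_continuous_onI continuous_partial_sum)

lemma periodic_partial_sum: "periodic (partial_sum c N)"
proof -
  have "wave \<xi> (x + axis k 1) = wave \<xi> x" for \<xi> x and k :: 'a
    using periodic_wave[of \<xi>] unfolding periodic_def by blast
  then show ?thesis by (simp add: partial_sum_def periodic_def)
qed

lemma partial_sum_bounded: "cmod (partial_sum c N x) \<le> (\<Sum>\<xi>\<in>cube N. cmod (c \<xi>))"
  unfolding partial_sum_def by (rule order_trans[OF norm_sum]) (simp add: norm_mult)

lemma integral_norm_sum_wave:
  assumes "finite F"
  shows "(LINT x|torus_measure. (cmod (\<Sum>\<xi>\<in>F. c \<xi> * wave \<xi> x))\<^sup>2) = (\<Sum>\<xi>\<in>F. (cmod (c \<xi>))\<^sup>2)"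
proof -
  have int: "integrable torus_measure (\<lambda>x. c \<xi> * cnj (c \<eta>) * wave (\<xi> - \<eta>) x)" for \<xi> \<eta>
    by simp
  have meas: "integrable torus_measure (\<lambda>x. (cmod (\<Sum>\<xi>\<in>F. c \<xi> * wave \<xi> x))\<^sup>2)"
  proof (rule integrable_torus_bounded[where B = "(\<Sum>\<xi>\<in>F. cmod (c \<xi>))\<^sup>2"])
    show "norm ((cmod (\<Sum>\<xi>\<in>F. c \<xi> * wave \<xi> x))\<^sup>2) \<le> (\<Sum>\<xi>\<in>F. cmod (c \<xi>))\<^sup>2" for x
    proof -
      have "cmod (\<Sum>\<xi>\<in>F. c \<xi> * wave \<xi> x) \<le> (\<Sum>\<xi>\<in>F. cmod (c \<xi>))"
        by (rule order_trans[OF norm_sum]) (simp add: norm_mult)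
      then show ?thesis by (simp add: power_mono)
    qed
  qed (intro borel_measurable_continuous_onI continuous_intros continuous_wave)
  have "complex_of_real (LINT x|torus_measure. (cmod (\<Sum>\<xi>\<in>F. c \<xi> * wave \<xi> x))\<^sup>2)
      = (LINT x|torus_measure. complex_of_real ((cmod (\<Sum>\<xi>\<in>F. c \<xi> * wave \<xi> x))\<^sup>2))"
    by (rule integral_of_real[OF meas, symmetric])
  also have "\<dots> = (LINT x|torus_measure. (\<Sum>\<xi>\<in>F. \<Sum>\<eta>\<in>F. c \<xi> * cnj (c \<eta>) * wave (\<xi> - \<eta>) x))"
  proof (intro Bochner_Integration.integral_cong refl)
    fix x
    have t: "c \<xi> * wave \<xi> x * (cnj (c \<eta>) * wave (- \<eta>) x) = c \<xi> * cnj (c \<eta>) * wave (\<xi> - \<eta>) x" for \<xi> \<eta>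
    proof -
      have "wave \<xi> x * wave (- \<eta>) x = wave (\<xi> - \<eta>) x" by simp
      then show ?thesis by (metis mult.assoc mult.left_commute)
    qed
    show "complex_of_real ((cmod (\<Sum>\<xi>\<in>F. c \<xi> * wave \<xi> x))\<^sup>2) = (\<Sum>\<xi>\<in>F. \<Sum>\<eta>\<in>F. c \<xi> * cnj (c \<eta>) * wave (\<xi> - \<eta>) x)"
      unfolding complex_norm_square by (simp only: cnj_sum complex_cnj_mult wave_simps sum_product t)
  qed
  also have "\<dots> = (\<Sum>\<xi>\<in>F. \<Sum>\<eta>\<in>F. c \<xi> * cnj (c \<eta>) * (if \<xi> - \<eta> = 0 then 1 else 0))"
    using int by (simp add: integral_wave del: right_minus_eq)
  also have "\<dots> = (\<Sum>\<xi>\<in>F. c \<xi> * cnj (c \<xi>))"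
    using assms by (intro sum.cong) (simp_all add: if_distrib sum.delta cong: if_cong)
  also have "\<dots> = complex_of_real (\<Sum>\<xi>\<in>F. (cmod (c \<xi>))\<^sup>2)"
    by (simp add: complex_norm_square del: of_real_power)
  finally show ?thesis by (simp only: of_real_eq_iff)
qed

lemma l2_error_integrable:
  assumes g: "g \<in> borel_measurable borel" "integrable torus_measure (\<lambda>x. (g x)\<^sup>2)"
  shows "integrable torus_measure (\<lambda>x. (cmod (of_real (g x) - partial_sum c N x))\<^sup>2)"
proof (rule Bochner_Integration.integrable_bound)
  let ?S = "partial_sum c N" and ?B = "\<Sum>\<xi>\<in>cube N. cmod (c \<xi>)"
  show "integrable torus_measure (\<lambda>x. 2 * (g x)\<^sup>2 + 2 * ?B\<^sup>2)"
    using g torus_one_integrable by (intro Bochner_Integration.integrable_add integrable_mult_right) (auto intro: integrable_torus_bounded)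
  show "(\<lambda>x. (cmod (of_real (g x) - ?S x))\<^sup>2) \<in> borel_measurable torus_measure"
    using g(1) partial_sum_measurable[of c N] by (intro borel_measurable_torus) measurable
  show "AE x in torus_measure. norm ((cmod (of_real (g x) - ?S x))\<^sup>2) \<le> norm (2 * (g x)\<^sup>2 + 2 * ?B\<^sup>2)"
  proof (intro always_eventually allI)
    fix x
    have "cmod (of_real (g x) - ?S x) \<le> \<bar>g x\<bar> + ?B"
      using norm_triangle_ineq4[of "complex_of_real (g x)" "?S x"] partial_sum_bounded[of c N x] by simp
    then have "(cmod (of_real (g x) - ?S x))\<^sup>2 \<le> (\<bar>g x\<bar> + ?B)\<^sup>2" by (simp add: power_mono)
    also have "\<dots> \<le> 2 * (g x)\<^sup>2 + 2 * ?B\<^sup>2"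
      using zero_le_power2[of "\<bar>g x\<bar> - ?B"] by (simp add: power2_eq_square algebra_simps)
    finally show "norm ((cmod (of_real (g x) - ?S x))\<^sup>2) \<le> norm (2 * (g x)\<^sup>2 + 2 * ?B\<^sup>2)" by simp
  qed
qed

lemma integral_partial_sum_wave:
  "(LINT x|torus_measure. partial_sum c N x * wave (- \<xi>) x) = (if \<xi> \<in> cube N then c \<xi> else 0)"
proof -
  have "(LINT x|torus_measure. partial_sum c N x * wave (- \<xi>) x) = (LINT x|torus_measure. (\<Sum>\<eta>\<in>cube N. c \<eta> * wave (\<eta> - \<xi>) x))"
    by (simp add: partial_sum_def sum_distrib_right mult.assoc)
  also have "\<dots> = (\<Sum>\<eta>\<in>cube N. c \<eta> * (if \<eta> = \<xi> then 1 else 0))"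
    by (simp add: integral_wave)
  also have "\<dots> = (if \<xi> \<in> cube N then c \<xi> else 0)"
    by (simp add: if_distrib sum.delta cong: if_cong)
  finally show ?thesis .
qed

text \<open>By Cauchy-Schwarz, mean-square convergence survives testing with a square integrable
  function. \<open>h = 1\<close> yields the Fourier coefficients, general \<open>h\<close> the
  products.\<close>

lemma l2_fourier_integral_mult_limit:
  fixes g h :: "real^'n::finite \<Rightarrow> real"
  assumes g: "l2_fourier g c" and h: "h \<in> borel_measurable borel" "integrable torus_measure (\<lambda>x. (h x)\<^sup>2)"
  shows "(\<lambda>N. LINT x|torus_measure. partial_sum c N x * (of_real (h x) * wave \<xi> x))
    \<longlonglongrightarrow> (LINT x|torus_measure. of_real (g x) * (of_real (h x) * wave \<xi> x))"
proof (rule LIM_zero_cancel, rule Lim_null_comparison)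
  let ?S = "partial_sum c"
  have gm: "g \<in> borel_measurable borel" and g2: "integrable torus_measure (\<lambda>x. (g x)\<^sup>2)"
    and lim: "(\<lambda>N. LINT x|torus_measure. (cmod (of_real (g x) - ?S N x))\<^sup>2) \<longlonglongrightarrow> 0"
    using g by (auto simp: l2_fourier_def)
  note [measurable] = gm h(1)
  define H where "H = (LINT x|torus_measure. (h x)\<^sup>2)"
  have hi: "integrable torus_measure h"
    using square_integrable_torus(1)[OF borel_measurable_torus[OF h(1)] h(2)] .
  have hwi: "integrable torus_measure (\<lambda>x. complex_of_real (h x) * wave \<xi> x)"
    using hi by (intro integrable_mult_bounded[of _ _ 1]) auto
  have i1: "integrable torus_measure (\<lambda>x. ?S N x * (of_real (h x) * wave \<xi> x))" for N
    using integrable_mult_bounded[OF hwi partial_sum_measurable partial_sum_bounded[of c N]] by (simp add: mult.commute)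
  have ghi: "integrable torus_measure (\<lambda>x. g x * h x)"
    by (rule integral_Cauchy_Schwarz(1)[OF borel_measurable_torus[OF gm] borel_measurable_torus[OF h(1)] g2 h(2)])
  have i2: "integrable torus_measure (\<lambda>x. of_real (g x) * (of_real (h x) * wave \<xi> x))"
    using integrable_mult_bounded[OF integrable_of_real[OF ghi, where 'a = complex] borel_measurable_wave[of \<xi>], of 1] by (simp add: mult.assoc)
  have "cmod ((LINT x|torus_measure. ?S N x * (of_real (h x) * wave \<xi> x)) - (LINT x|torus_measure. of_real (g x) * (of_real (h x) * wave \<xi> x)))
      \<le> sqrt ((LINT x|torus_measure. (cmod (of_real (g x) - ?S N x))\<^sup>2) * H)" for N
  proof -
    have "(LINT x|torus_measure. ?S N x * (of_real (h x) * wave \<xi> x)) - (LINT x|torus_measure. of_real (g x) * (of_real (h x) * wave \<xi> x))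
        = (LINT x|torus_measure. ?S N x * (of_real (h x) * wave \<xi> x) - of_real (g x) * (of_real (h x) * wave \<xi> x))"
      using i1 i2 by simp
    also have "cmod \<dots> \<le> (LINT x|torus_measure. cmod (?S N x * (of_real (h x) * wave \<xi> x) - of_real (g x) * (of_real (h x) * wave \<xi> x)))"
      by (rule integral_norm_bound)
    also have "\<dots> = (LINT x|torus_measure. cmod (of_real (g x) - ?S N x) * \<bar>h x\<bar>)"
      by (intro Bochner_Integration.integral_cong refl)
        (simp add: left_diff_distrib[symmetric] norm_mult norm_minus_commute)
    finally have le: "cmod ((LINT x|torus_measure. ?S N x * (of_real (h x) * wave \<xi> x)) - (LINT x|torus_measure. of_real (g x) * (of_real (h x) * wave \<xi> x)))
        \<le> (LINT x|torus_measure. cmod (of_real (g x) - ?S N x) * \<bar>h x\<bar>)" .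
    have "(LINT x|torus_measure. cmod (of_real (g x) - ?S N x) * \<bar>h x\<bar>)\<^sup>2
        \<le> (LINT x|torus_measure. (cmod (of_real (g x) - ?S N x))\<^sup>2) * (LINT x|torus_measure. \<bar>h x\<bar>\<^sup>2)"
    proof (intro integral_Cauchy_Schwarz(2) borel_measurable_torus l2_error_integrable[OF gm g2])
      show "(\<lambda>x. cmod (of_real (g x) - ?S N x)) \<in> borel_measurable borel"
        using gm partial_sum_measurable[of c N] by measurable
      show "(\<lambda>x. \<bar>h x\<bar>) \<in> borel_measurable borel"
        using h(1) by measurable
    qed (use h(2) in simp)
    then have "(LINT x|torus_measure. cmod (of_real (g x) - ?S N x) * \<bar>h x\<bar>)
        \<le> sqrt ((LINT x|torus_measure. (cmod (of_real (g x) - ?S N x))\<^sup>2) * H)"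
      by (intro real_le_rsqrt) (simp add: H_def)
    with le show ?thesis by (rule order_trans)
  qed
  then show "\<forall>\<^sub>F N in sequentially. norm ((LINT x|torus_measure. ?S N x * (of_real (h x) * wave \<xi> x)) - (LINT x|torus_measure. of_real (g x) * (of_real (h x) * wave \<xi> x)))
      \<le> sqrt ((LINT x|torus_measure. (cmod (of_real (g x) - ?S N x))\<^sup>2) * H)"
    by simp
  have "(\<lambda>N. sqrt ((LINT x|torus_measure. (cmod (of_real (g x) - ?S N x))\<^sup>2) * H)) \<longlonglongrightarrow> sqrt (0 * H)"
    by (intro tendsto_intros lim)
  then show "(\<lambda>N. sqrt ((LINT x|torus_measure. (cmod (of_real (g x) - ?S N x))\<^sup>2) * H)) \<longlonglongrightarrow> 0" by simp
qed

lemma l2_fourier_integrable: "l2_fourier g c \<Longrightarrow> integrable torus_measure g"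
  unfolding l2_fourier_def by (elim conjE) (rule square_integrable_torus(1)[OF borel_measurable_torus])

lemma l2_fourier_coeff:
  assumes g: "l2_fourier g c"
  shows "fourier_coeff (distr_of g) = c"
proof
  fix \<xi>
  have "(\<lambda>N. LINT x|torus_measure. partial_sum c N x * (of_real 1 * wave (- \<xi>) x)) \<longlonglongrightarrow> (LINT x|torus_measure. of_real (g x) * (of_real 1 * wave (- \<xi>) x))"
    by (rule l2_fourier_integral_mult_limit[OF g, where h = "\<lambda>_. 1" and \<xi> = "- \<xi>"])
      (simp_all add: torus_one_integrable)
  then have "(\<lambda>N. if \<xi> \<in> cube N then c \<xi> else 0) \<longlonglongrightarrow> fourier_coeff (distr_of g) \<xi>"
    by (simp add: integral_partial_sum_wave fourier_coeff_distr_of[OF l2_fourier_integrable[OF g]])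
  moreover have "(\<lambda>N. if \<xi> \<in> cube N then c \<xi> else 0) \<longlonglongrightarrow> c \<xi>"
  proof (rule tendsto_eventually)
    obtain N where "\<xi> \<in> cube N" using Un_cube by blast
    then have "\<xi> \<in> cube M" if "N \<le> M" for M
      using cube_mono[OF that] by blast
    then show "\<forall>\<^sub>F N in sequentially. (if \<xi> \<in> cube N then c \<xi> else 0) = c \<xi>"
      by (intro eventually_sequentiallyI[of N]) simp
  qed
  ultimately show "fourier_coeff (distr_of g) \<xi> = c \<xi>" by (rule LIMSEQ_unique)
qed

text \<open>Replacing the first factor by its partial sums turns the coefficient of the product into
  cube sums of the convolution, which converge to the unordered sum.\<close>

lemma l2_fourier_product:
  assumes g: "l2_fourier g c" and h: "l2_fourier h d"
    and sum: "(\<lambda>\<eta>. c \<eta> * d (\<xi> - \<eta>)) summable_on UNIV"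
  shows "integrable torus_measure (\<lambda>x. g x * h x)"
    and "fourier_coeff (distr_of (\<lambda>x. g x * h x)) \<xi> = (\<Sum>\<^sub>\<infinity>\<eta>. c \<eta> * d (\<xi> - \<eta>))"
proof -
  have m: "g \<in> borel_measurable borel" "h \<in> borel_measurable borel"
    and i: "integrable torus_measure (\<lambda>x. (g x)\<^sup>2)" "integrable torus_measure (\<lambda>x. (h x)\<^sup>2)"
    using g h by (auto simp: l2_fourier_def)
  show gh: "integrable torus_measure (\<lambda>x. g x * h x)"
    using m i by (intro integral_Cauchy_Schwarz(1) borel_measurable_torus)
  have hi: "integrable torus_measure h" using l2_fourier_integrable[OF h] .
  have hwi: "integrable torus_measure (\<lambda>x. complex_of_real (h x) * wave \<eta> x)" for \<eta>
    using hi by (intro integrable_mult_bounded[of _ _ 1]) auto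
  have "(LINT x|torus_measure. partial_sum c N x * (of_real (h x) * wave (- \<xi>) x)) = (\<Sum>\<eta>\<in>cube N. c \<eta> * d (\<xi> - \<eta>))" for N
  proof -
    have "(LINT x|torus_measure. partial_sum c N x * (of_real (h x) * wave (- \<xi>) x))
        = (LINT x|torus_measure. (\<Sum>\<eta>\<in>cube N. c \<eta> * (of_real (h x) * wave (- (\<xi> - \<eta>)) x)))"
    proof (intro Bochner_Integration.integral_cong refl)
      fix x
      have t: "c \<eta> * wave \<eta> x * (of_real (h x) * wave (- \<xi>) x) = c \<eta> * (of_real (h x) * wave (- (\<xi> - \<eta>)) x)" for \<eta>
      proof -
        have "wave \<eta> x * wave (- \<xi>) x = wave (- (\<xi> - \<eta>)) x" by simp
        then show ?thesis by (metis mult.assoc mult.left_commute)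
      qed
      show "partial_sum c N x * (of_real (h x) * wave (- \<xi>) x) = (\<Sum>\<eta>\<in>cube N. c \<eta> * (of_real (h x) * wave (- (\<xi> - \<eta>)) x))"
        unfolding partial_sum_def sum_distrib_right t ..
    qed
    also have "\<dots> = (\<Sum>\<eta>\<in>cube N. c \<eta> * (LINT x|torus_measure. of_real (h x) * wave (- (\<xi> - \<eta>)) x))"
      using hwi by (subst Bochner_Integration.integral_sum) auto
    also have "\<dots> = (\<Sum>\<eta>\<in>cube N. c \<eta> * d (\<xi> - \<eta>))"
      unfolding fourier_coeff_distr_of[OF hi, symmetric] l2_fourier_coeff[OF h] ..
    finally show ?thesis .
  qed
  then have "(\<lambda>N. \<Sum>\<eta>\<in>cube N. c \<eta> * d (\<xi> - \<eta>)) \<longlonglongrightarrow> (LINT x|torus_measure. of_real (g x) * (of_real (h x) * wave (- \<xi>) x))"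
    using l2_fourier_integral_mult_limit[OF g m(2) i(2), of "- \<xi>"] by simp
  also have "(LINT x|torus_measure. of_real (g x) * (of_real (h x) * wave (- \<xi>) x)) = fourier_coeff (distr_of (\<lambda>x. g x * h x)) \<xi>"
    by (simp add: fourier_coeff_distr_of[OF gh] mult.assoc)
  finally show "fourier_coeff (distr_of (\<lambda>x. g x * h x)) \<xi> = (\<Sum>\<^sub>\<infinity>\<eta>. c \<eta> * d (\<xi> - \<eta>))"
    using infsum_cube_limit[OF sum] LIMSEQ_unique by blast
qed

lemma l2_fourier_trig:
  assumes c: "rapid c" and sym: "\<And>\<xi>. c (- \<xi>) = cnj (c \<xi>)"
  shows "l2_fourier (trig c) c"
  unfolding l2_fourier_def
proof (intro conjI)
  have ps: "trig c \<in> periodic_smooth" by (rule trig_periodic_smooth[OF c])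
  show "periodic (trig c)" "trig c \<in> borel_measurable borel"
    using ps by (auto intro: periodic_smooth_periodic periodic_smooth_measurable)
  then show i: "integrable torus_measure (\<lambda>x. (trig c x)\<^sup>2)"
  proof -
    obtain B where B: "\<And>x. \<bar>trig c x\<bar> \<le> B" using periodic_smooth_bounded[OF ps] by blast
    then have "norm ((trig c x)\<^sup>2) \<le> B\<^sup>2" for x using power_mono[OF B[of x], of 2] by simp
    then show ?thesis
      using \<open>trig c \<in> borel_measurable borel\<close> by (intro integrable_torus_bounded) auto
  qed
  note rs = rapid_summable[OF c]
  \<comment> \<open>Conjugate symmetry makes the series real, so \<open>trig\<close> is its full
    sum.\<close>
  have real: "complex_of_real (trig c x) = (\<Sum>\<^sub>\<infinity>\<xi>. c \<xi> * wave \<xi> x)" for x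
  proof -
    have b: "bij_betw uminus (UNIV :: (int^'a) set) UNIV"
      by (rule bij_betwI[where g = uminus]) auto
    have "cnj (\<Sum>\<^sub>\<infinity>\<xi>. c \<xi> * wave \<xi> x) = (\<Sum>\<^sub>\<infinity>\<xi>. cnj (c \<xi> * wave \<xi> x))"
      by (intro infsumI[symmetric] has_sum_bounded_linear[OF bounded_linear_cnj] has_sum_infsum rs)
    also have "\<dots> = (\<Sum>\<^sub>\<infinity>\<xi>. c (- \<xi>) * wave (- \<xi>) x)"
      by (simp add: sym)
    also have "\<dots> = (\<Sum>\<^sub>\<infinity>\<xi>. c \<xi> * wave \<xi> x)"
      by (rule infsum_reindex_bij_betw[OF b])
    finally have "Im (\<Sum>\<^sub>\<infinity>\<xi>. c \<xi> * wave \<xi> x) = 0"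
      by (simp add: complex_eq_iff)
    then show ?thesis by (simp add: trig_def complex_eq_iff)
  qed
  define \<tau> where "\<tau> = (\<lambda>N. infsum (\<lambda>\<xi>. cmod (c \<xi>)) (- cube N))"
  have err: "cmod (of_real (trig c x) - partial_sum c N x) \<le> \<tau> N" for x N
  proof -
    have "(\<Sum>\<^sub>\<infinity>\<xi>. c \<xi> * wave \<xi> x) = partial_sum c N x + infsum (\<lambda>\<xi>. c \<xi> * wave \<xi> x) (- cube N)"
      using infsum_Un_disjoint[of "\<lambda>\<xi>. c \<xi> * wave \<xi> x" "cube N" "- cube N"] summable_on_subset_banach[OF rs(2)]
      by (simp add: partial_sum_def)
    then have "of_real (trig c x) - partial_sum c N x = infsum (\<lambda>\<xi>. c \<xi> * wave \<xi> x) (- cube N)"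
      by (simp add: real)
    also have "cmod \<dots> \<le> infsum (\<lambda>\<xi>. cmod (c \<xi> * wave \<xi> x)) (- cube N)"
      using summable_on_subset_banach[OF rs(1), of "- cube N"] by (intro norm_infsum_bound) (simp add: norm_mult)
    finally show ?thesis by (simp add: \<tau>_def norm_mult)
  qed
  show "(\<lambda>N. LINT x|torus_measure. (cmod (of_real (trig c x) - partial_sum c N x))\<^sup>2) \<longlonglongrightarrow> 0"
  proof (rule Lim_null_comparison)
    have "(\<lambda>N. (\<tau> N)\<^sup>2) \<longlonglongrightarrow> 0\<^sup>2"
      unfolding \<tau>_def by (intro tendsto_power infsum_cube_tail rs)
    then show "(\<lambda>N. (\<tau> N)\<^sup>2) \<longlonglongrightarrow> 0" by simp
    show "\<forall>\<^sub>F N in sequentially. norm (LINT x|torus_measure. (cmod (of_real (trig c x) - partial_sum c N x))\<^sup>2) \<le> (\<tau> N)\<^sup>2"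
    proof (intro always_eventually allI)
      fix N
      have "(LINT x|torus_measure. (cmod (of_real (trig c x) - partial_sum c N x))\<^sup>2) \<le> (LINT x|(torus_measure :: (real^'a) measure). (\<tau> N)\<^sup>2 * 1)"
      proof (rule integral_mono)
        show "(cmod (of_real (trig c x) - partial_sum c N x))\<^sup>2 \<le> (\<tau> N)\<^sup>2 * 1" for x
          using power_mono[OF err[of x N], of 2] by simp
      qed (intro l2_error_integrable i integrable_mult_right torus_one_integrable \<open>trig c \<in> borel_measurable borel\<close>)+
      also have "\<dots> = (\<tau> N)\<^sup>2 * (LINT x|(torus_measure :: (real^'a) measure). 1)"
        by (rule integral_mult_right_zero)
      also have "\<dots> = (\<tau> N)\<^sup>2"
        by (simp only: torus_integral_one mult_1_right)
      finally show "norm (LINT x|torus_measure. (cmod (of_real (trig c x) - partial_sum c N x))\<^sup>2) \<le> (\<tau> N)\<^sup>2" by simp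
    qed
  qed
qed

text \<open>A subsequence with geometrically small increments converges almost everywhere, and
  Fatou's lemma gives the mean-square rate. Building the limit pointwise keeps the representative
  Borel and exactly periodic.\<close>

theorem riesz_fischer:
  fixes c :: "int^'n::finite \<Rightarrow> complex"
  assumes c2: "(\<lambda>\<xi>. (cmod (c \<xi>))\<^sup>2) summable_on UNIV" and sym: "\<And>\<xi>. c (- \<xi>) = cnj (c \<xi>)"
  obtains g where "l2_fourier g c"
proof -
  define s where "s = (\<lambda>N x. Re (partial_sum c N x))"
  have S: "partial_sum c N x = of_real (s N x)" for N x
  proof -
    have "cnj (partial_sum c N x) = (\<Sum>\<xi>\<in>cube N. c (- \<xi>) * wave (- \<xi>) x)"
      by (simp add: partial_sum_def sym)
    also have "\<dots> = partial_sum c N x"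
      unfolding partial_sum_def by (rule sum.reindex_bij_witness[where i = uminus and j = uminus]) auto
    finally show ?thesis by (simp add: s_def complex_eq_iff)
  qed
  have s_meas [measurable]: "s N \<in> borel_measurable borel" for N
    unfolding s_def by (intro borel_measurable_continuous_onI continuous_intros continuous_partial_sum)
  have s_bd: "\<bar>s N x\<bar> \<le> (\<Sum>\<xi>\<in>cube N. cmod (c \<xi>))" for N x
    using partial_sum_bounded[of c N x] by (simp add: S)
  have s_per: "s N (x + axis k 1) = s N x" for N x k
    using periodic_partial_sum[of c N] by (simp add: s_def periodic_def)
  define \<tau> where "\<tau> = (\<lambda>N. infsum (\<lambda>\<xi>. (cmod (c \<xi>))\<^sup>2) (- cube N))"
  have \<tau>0: "\<tau> N \<ge> 0" for N unfolding \<tau>_def by (rule infsum_nonneg) simp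
  have \<tau>_lim: "\<tau> \<longlonglongrightarrow> 0" unfolding \<tau>_def by (rule infsum_cube_tail[OF c2])
  have diff_int: "integrable torus_measure (\<lambda>x. (s M x - s N x)\<^sup>2)" for M N
  proof (rule integrable_torus_bounded[where B = "((\<Sum>\<xi>\<in>cube M. cmod (c \<xi>)) + (\<Sum>\<xi>\<in>cube N. cmod (c \<xi>)))\<^sup>2"])
    fix x
    have "\<bar>s M x - s N x\<bar> \<le> (\<Sum>\<xi>\<in>cube M. cmod (c \<xi>)) + (\<Sum>\<xi>\<in>cube N. cmod (c \<xi>))"
      using s_bd[of M x] s_bd[of N x] by linarith
    from power_mono[OF this, of 2]
    show "norm ((s M x - s N x)\<^sup>2) \<le> ((\<Sum>\<xi>\<in>cube M. cmod (c \<xi>)) + (\<Sum>\<xi>\<in>cube N. cmod (c \<xi>)))\<^sup>2" by simp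
  qed measurable
  have diff_le: "(LINT x|torus_measure. (s M x - s N x)\<^sup>2) \<le> \<tau> N" if "N \<le> M" for M N
  proof -
    have "(s M x - s N x)\<^sup>2 = (cmod (\<Sum>\<xi>\<in>cube M - cube N. c \<xi> * wave \<xi> x))\<^sup>2" for x
    proof -
      have "(\<Sum>\<xi>\<in>cube M - cube N. c \<xi> * wave \<xi> x) = of_real (s M x - s N x)"
        unfolding of_real_diff S[symmetric] partial_sum_def using cube_mono[OF that] by (intro sum_diff) auto
      then show ?thesis by (simp only: norm_of_real power2_abs)
    qed
    then have "(LINT x|torus_measure. (s M x - s N x)\<^sup>2) = (\<Sum>\<xi>\<in>cube M - cube N. (cmod (c \<xi>))\<^sup>2)"
      by (simp only: integral_norm_sum_wave finite_Diff finite_cube)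
    also have "\<dots> \<le> \<tau> N"
      unfolding \<tau>_def by (intro finite_sum_le_infsum summable_on_subset_banach[OF c2]) auto
    finally show ?thesis .
  qed
  have "\<exists>N0. \<forall>N\<ge>N0. \<tau> N \<le> (1/4) ^ k" for k
    using order_tendstoD(2)[OF \<tau>_lim, of "(1/4) ^ k"] by (auto simp: eventually_sequentially intro: less_imp_le)
  then have "\<forall>k. \<exists>N0. \<forall>N\<ge>N0. \<tau> N \<le> (1/4) ^ k" by blast
  from choice[OF this] obtain N0 where N0: "\<And>k N. N0 k \<le> N \<Longrightarrow> \<tau> N \<le> (1/4) ^ k" by blast
  \<comment> \<open>Summing the thresholds makes the indices nondecreasing, and adding
    \<open>k\<close> makes them unbounded.\<close>
  define n where "n = (\<lambda>k. (\<Sum>i\<le>k. N0 i) + k)"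
  have n_Suc: "n k \<le> n (Suc k)" for k by (simp add: n_def)
  have n_ge: "k \<le> n k" for k by (simp add: n_def)
  have n_tau: "\<tau> (n k) \<le> (1/4) ^ k" for k
  proof (rule N0)
    have "N0 k \<le> (\<Sum>i\<le>k. N0 i)" by (rule member_le_sum) auto
    then show "N0 k \<le> n k" by (simp add: n_def)
  qed
  define d where "d = (\<lambda>k x. \<bar>s (n (Suc k)) x - s (n k) x\<bar>)"
  have d_meas: "d k \<in> borel_measurable torus_measure" for k
    unfolding d_def by (intro borel_measurable_torus) measurable
  have d2: "integrable torus_measure (\<lambda>x. (d k x)\<^sup>2)" "(LINT x|torus_measure. (d k x)\<^sup>2) \<le> (1/4) ^ k" for k
    using diff_int[of "n (Suc k)" "n k"] order_trans[OF diff_le[OF n_Suc[of k]] n_tau[of k]] by (simp_all add: d_def)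
  \<comment> \<open>The torus has measure one, so the mean of an increment is at most its
    mean-square norm; this turns powers of 1/4 into powers of 1/2.\<close>
  have d_int: "integrable torus_measure (d k)" "(LINT x|torus_measure. d k x) \<le> (1/2) ^ k" for k
  proof -
    show "integrable torus_measure (d k)" by (rule square_integrable_torus(1)[OF d_meas d2(1)])
    have "(LINT x|torus_measure. d k x)\<^sup>2 \<le> (1/4) ^ k"
      by (rule order_trans[OF square_integrable_torus(2)[OF d_meas d2(1)] d2(2)])
    also have "(1/4 :: real) ^ k = ((1/2) ^ k)\<^sup>2"
      by (simp add: power2_eq_square flip: power_mult_distrib)
    finally show "(LINT x|torus_measure. d k x) \<le> (1/2) ^ k"
      by (rule power2_le_imp_le) simp
  qed
  have "(\<integral>\<^sup>+x. (\<Sum>k. ennreal (d k x)) \<partial>torus_measure) \<noteq> \<infinity>"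
  proof -
    have "(\<integral>\<^sup>+x. (\<Sum>k. ennreal (d k x)) \<partial>torus_measure) = (\<Sum>k. \<integral>\<^sup>+x. ennreal (d k x) \<partial>torus_measure)"
      using d_meas by (intro nn_integral_suminf) auto
    also have "\<dots> \<le> (\<Sum>k. ennreal ((1/2) ^ k))"
    proof (intro suminf_le allI)
      fix k
      have "(\<integral>\<^sup>+x. ennreal (d k x) \<partial>torus_measure) = ennreal (LINT x|torus_measure. d k x)"
        by (intro nn_integral_eq_integral d_int) (simp add: d_def)
      also have "\<dots> \<le> ennreal ((1/2) ^ k)" by (intro ennreal_leI d_int)
      finally show "(\<integral>\<^sup>+x. ennreal (d k x) \<partial>torus_measure) \<le> ennreal ((1/2) ^ k)" .
    qed auto
    also have "\<dots> = ennreal (\<Sum>k. (1/2) ^ k)"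
      by (intro suminf_ennreal2 summable_geometric) auto
    also have "\<dots> < \<infinity>" by simp
    finally show ?thesis by simp
  qed
  then have "AE x in torus_measure. (\<Sum>k. ennreal (d k x)) \<noteq> \<infinity>"
    using d_meas by (intro nn_integral_noteq_infinite) auto
  then have conv: "AE x in torus_measure. convergent (\<lambda>k. s (n k) x)"
  proof (rule AE_mp, intro AE_I2 impI)
    fix x assume "(\<Sum>k. ennreal (d k x)) \<noteq> \<infinity>"
    then have "summable (\<lambda>k. d k x)"
      by (intro summable_suminf_not_top) (auto simp: d_def)
    then have "summable (\<lambda>k. s (n (Suc k)) x - s (n k) x)"
      unfolding d_def by (rule summable_rabs_cancel)
    then have "convergent (\<lambda>m. \<Sum>k<m. s (n (Suc k)) x - s (n k) x)"
      by (simp add: summable_iff_convergent)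
    then have "convergent (\<lambda>m. s (n m) x - s (n 0) x)"
      by (simp only: sum_lessThan_telescope[of "\<lambda>k. s (n k) x"])
    then show "convergent (\<lambda>k. s (n k) x)"
      by (simp add: convergent_diff_const_right_iff)
  qed
  \<comment> \<open>Where no limit exists, \<open>lim\<close> still depends only on the sequence of
    values, which is the same at a point and at its integer translates.\<close>
  define g where "g = (\<lambda>x. lim (\<lambda>k. s (n k) x))"
  have g_meas [measurable]: "g \<in> borel_measurable borel"
    unfolding g_def by measurable
  \<comment> \<open>The index \<open>N\<close> is arbitrary and not from the subsequence, so the
    full sequence of partial sums converges.\<close>
  have fatou: "(\<integral>\<^sup>+x. ennreal ((g x - s N x)\<^sup>2) \<partial>torus_measure) \<le> ennreal (\<tau> N)" for N
  proof -
    have "(\<integral>\<^sup>+x. ennreal ((g x - s N x)\<^sup>2) \<partial>torus_measure)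
        = (\<integral>\<^sup>+x. liminf (\<lambda>k. ennreal ((s (n k) x - s N x)\<^sup>2)) \<partial>torus_measure)"
    proof (rule nn_integral_cong_AE, rule AE_mp[OF conv], intro AE_I2 impI)
      fix x assume "convergent (\<lambda>k. s (n k) x)"
      then have "(\<lambda>k. s (n k) x) \<longlonglongrightarrow> g x"
        unfolding g_def by (simp add: convergent_LIMSEQ_iff)
      then have "(\<lambda>k. ennreal ((s (n k) x - s N x)\<^sup>2)) \<longlonglongrightarrow> ennreal ((g x - s N x)\<^sup>2)"
        by (intro tendsto_intros) auto
      then show "ennreal ((g x - s N x)\<^sup>2) = liminf (\<lambda>k. ennreal ((s (n k) x - s N x)\<^sup>2))"
        using lim_imp_Liminf[OF sequentially_bot] by metis
    qed
    also have "\<dots> \<le> liminf (\<lambda>k. \<integral>\<^sup>+x. ennreal ((s (n k) x - s N x)\<^sup>2) \<partial>torus_measure)"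
    proof (rule nn_integral_liminf)
      show "(\<lambda>x. ennreal ((s (n k) x - s N x)\<^sup>2)) \<in> borel_measurable torus_measure" for k
        by (intro borel_measurable_torus) measurable
    qed
    also have "\<dots> \<le> limsup (\<lambda>k. \<integral>\<^sup>+x. ennreal ((s (n k) x - s N x)\<^sup>2) \<partial>torus_measure)"
      by (rule Liminf_le_Limsup) simp
    also have "\<dots> \<le> ennreal (\<tau> N)"
    proof (rule Limsup_bounded, rule eventually_sequentiallyI[of N])
      fix k assume "N \<le> k"
      then have "N \<le> n k" using n_ge[of k] by linarith
      have "(\<integral>\<^sup>+x. ennreal ((s (n k) x - s N x)\<^sup>2) \<partial>torus_measure) = ennreal (LINT x|torus_measure. (s (n k) x - s N x)\<^sup>2)"
        by (intro nn_integral_eq_integral diff_int) simp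
      also have "\<dots> \<le> ennreal (\<tau> N)" by (intro ennreal_leI diff_le \<open>N \<le> n k\<close>)
      finally show "(\<integral>\<^sup>+x. ennreal ((s (n k) x - s N x)\<^sup>2) \<partial>torus_measure) \<le> ennreal (\<tau> N)" .
    qed
    finally show ?thesis .
  qed
  have err_int: "integrable torus_measure (\<lambda>x. (g x - s N x)\<^sup>2)" for N
  proof (rule integrableI_bounded)
    show "(\<lambda>x. (g x - s N x)\<^sup>2) \<in> borel_measurable torus_measure"
      by (intro borel_measurable_torus) measurable
    show "(\<integral>\<^sup>+x. ennreal (norm ((g x - s N x)\<^sup>2)) \<partial>torus_measure) < \<infinity>"
      using le_less_trans[OF fatou[of N]] by simp
  qed
  have err_le: "(LINT x|torus_measure. (g x - s N x)\<^sup>2) \<le> \<tau> N" for N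
    by (rule integral_real_bounded[OF \<tau>0 fatou])
  have "l2_fourier g c"
    unfolding l2_fourier_def
  proof (intro conjI)
    show "periodic g" by (simp add: periodic_def g_def s_per)
    show "g \<in> borel_measurable borel" by (rule g_meas)
    show "integrable torus_measure (\<lambda>x. (g x)\<^sup>2)"
    proof (rule Bochner_Integration.integrable_bound)
      have "integrable torus_measure (\<lambda>x. (s 0 x)\<^sup>2)"
      proof (rule integrable_torus_bounded[where B = "(\<Sum>\<xi>\<in>cube 0. cmod (c \<xi>))\<^sup>2"])
        show "norm ((s 0 x)\<^sup>2) \<le> (\<Sum>\<xi>\<in>cube 0. cmod (c \<xi>))\<^sup>2" for x
          using power_mono[OF s_bd[of 0 x], of 2] by simp
      qed measurable
      then show "integrable torus_measure (\<lambda>x. 2 * (g x - s 0 x)\<^sup>2 + 2 * (s 0 x)\<^sup>2)"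
        using err_int[of 0] by (intro Bochner_Integration.integrable_add integrable_mult_right)
      show "(\<lambda>x. (g x)\<^sup>2) \<in> borel_measurable torus_measure"
        by (intro borel_measurable_torus) measurable
      show "AE x in torus_measure. norm ((g x)\<^sup>2) \<le> norm (2 * (g x - s 0 x)\<^sup>2 + 2 * (s 0 x)\<^sup>2)"
      proof (intro always_eventually allI)
        fix x
        have "(g x)\<^sup>2 \<le> 2 * (g x - s 0 x)\<^sup>2 + 2 * (s 0 x)\<^sup>2"
          using zero_le_power2[of "g x - 2 * s 0 x"] by (simp add: power2_eq_square algebra_simps)
        then show "norm ((g x)\<^sup>2) \<le> norm (2 * (g x - s 0 x)\<^sup>2 + 2 * (s 0 x)\<^sup>2)" by simp
      qed
    qed
    have e: "(cmod (of_real (g x) - partial_sum c N x))\<^sup>2 = (g x - s N x)\<^sup>2" for x N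
      unfolding S of_real_diff[symmetric] norm_of_real by simp
    show "(\<lambda>N. LINT x|torus_measure. (cmod (of_real (g x) - partial_sum c N x))\<^sup>2) \<longlonglongrightarrow> 0"
      unfolding e using err_le
      by (intro Lim_null_comparison[OF _ \<tau>_lim] always_eventually allI) simp
  qed
  then show thesis by (rule that)
qed

section \<open>Decay of Fourier coefficients and smoothness\<close>

definition decaying :: "(int^'n::finite \<Rightarrow> complex) \<Rightarrow> bool" where
  "decaying c \<longleftrightarrow> (\<forall>m::nat. \<exists>C. \<forall>\<xi>. nu \<xi> ^ m * cmod (c \<xi>) \<le> C)"

lemma decaying_bound:
  assumes "decaying c"
  obtains C where "C \<ge> 0" "\<And>\<xi>. (1 + nu \<xi>) ^ m * cmod (c \<xi>) \<le> C"
proof -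
  obtain A B where A: "\<And>\<xi>. nu \<xi> ^ 0 * cmod (c \<xi>) \<le> A" and B: "\<And>\<xi>. nu \<xi> ^ m * cmod (c \<xi>) \<le> B"
    using assms unfolding decaying_def by meson
  have "(1 + nu \<xi>) ^ m * cmod (c \<xi>) \<le> 2 ^ m * (A + B)" for \<xi>
  proof -
    have "(1 + nu \<xi>) ^ m \<le> (2 * max 1 (nu \<xi>)) ^ m"
      by (intro power_mono) (auto simp: max_def)
    also have "\<dots> = 2 ^ m * max 1 (nu \<xi>) ^ m" by (rule power_mult_distrib)
    also have "max 1 (nu \<xi>) ^ m \<le> 1 + nu \<xi> ^ m" by (simp add: max_def)
    finally have "(1 + nu \<xi>) ^ m * cmod (c \<xi>) \<le> 2 ^ m * (1 + nu \<xi> ^ m) * cmod (c \<xi>)"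
      by (simp add: mult_right_mono)
    also have "\<dots> = 2 ^ m * (nu \<xi> ^ 0 * cmod (c \<xi>) + nu \<xi> ^ m * cmod (c \<xi>))" by (simp add: algebra_simps)
    also have "\<dots> \<le> 2 ^ m * (A + B)"
      by (intro mult_left_mono add_mono A B) simp
    finally show ?thesis .
  qed
  moreover from this have "2 ^ m * (A + B) \<ge> 0"
    by (meson mult_nonneg_nonneg norm_ge_zero nu_simps(3) add_nonneg_nonneg order_trans zero_le_one zero_le_power)
  ultimately show thesis using that by blast
qed

text \<open>The exponent gives each of the coordinates a factor
  \<open>1 / (1 + \<bar>m\<bar>)^2\<close>; the product majorant factors and each one-dimensional
  sum is at most 3.\<close>

lemma summable_lattice: "(\<lambda>\<xi> :: int^'n::finite. 1 / (1 + nu \<xi>) ^ (2 * CARD('n))) summable_on UNIV"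
proof (rule nonneg_bdd_above_summable_on)
  let ?w = "\<lambda>m :: int. 1 / (1 + \<bar>real_of_int m\<bar>)\<^sup>2"
  \<comment> \<open>The two new terms at distance \<open>N + 1\<close> are bounded by the
    telescoping difference \<open>2 / (N + 1) - 2 / (N + 2)\<close>.\<close>
  have one_dim: "(\<Sum>m=-int N..int N. ?w m) \<le> 3 - 2 / (real N + 1)" for N
  proof (induction N)
    case (Suc N)
    have w: "?w (int (Suc N)) + ?w (- int (Suc N)) \<le> 2 / (real N + 1) - 2 / (real (Suc N) + 1)"
    proof -
      have "?w (int (Suc N)) + ?w (- int (Suc N)) = 2 / (real N + 2)\<^sup>2" by (simp add: add.commute)
      also have "\<dots> \<le> 2 / ((real N + 1) * (real N + 2))"
        by (intro divide_left_mono) (auto simp: power2_eq_square intro!: mult_mono)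
      also have "\<dots> = 2 / (real N + 1) - 2 / (real (Suc N) + 1)"
        by (simp add: divide_simps)
      finally show ?thesis .
    qed
    show ?case
      using Suc w by (subst sum_symmetric_interval_Suc) linarith
  qed simp
  show "bdd_above (sum (\<lambda>\<xi> :: int^'n. 1 / (1 + nu \<xi>) ^ (2 * CARD('n))) ` {F. F \<subseteq> UNIV \<and> finite F})"
  proof (rule bdd_aboveI2)
    fix F :: "(int^'n) set" assume "F \<in> {F. F \<subseteq> UNIV \<and> finite F}"
    then obtain N where N: "F \<subseteq> cube N" using finite_subset_cube[of F] by auto
    have "sum (\<lambda>\<xi> :: int^'n. 1 / (1 + nu \<xi>) ^ (2 * CARD('n))) F \<le> sum (\<lambda>\<xi> :: int^'n. 1 / (1 + nu \<xi>) ^ (2 * CARD('n))) (cube N)"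
      using N by (intro sum_mono2) auto
    also have "\<dots> \<le> (\<Sum>\<xi>\<in>(cube N :: (int^'n) set). \<Prod>k\<in>UNIV. ?w (\<xi> $ k))"
    proof (rule sum_mono)
      fix \<xi> :: "int^'n"
      have "(\<Prod>k\<in>UNIV. (1 + \<bar>real_of_int (\<xi> $ k)\<bar>)\<^sup>2) \<le> (\<Prod>k\<in>(UNIV :: 'n set). (1 + nu \<xi>)\<^sup>2)"
        using component_le_nu[of \<xi>] by (intro prod_mono conjI power_mono) auto
      also have "\<dots> = (1 + nu \<xi>) ^ (2 * CARD('n))" by (simp add: power_mult)
      finally have "1 / (1 + nu \<xi>) ^ (2 * CARD('n)) \<le> 1 / (\<Prod>k\<in>UNIV. (1 + \<bar>real_of_int (\<xi> $ k)\<bar>)\<^sup>2)"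
        by (intro divide_left_mono mult_pos_pos prod_pos) (auto simp: add_pos_nonneg)
      then show "1 / (1 + nu \<xi>) ^ (2 * CARD('n)) \<le> (\<Prod>k\<in>UNIV. ?w (\<xi> $ k))"
        by (simp add: prod_dividef)
    qed
    also have "\<dots> = (\<Sum>m=-int N..int N. ?w m) ^ CARD('n)" by (rule sum_cube_prod)
    also have "\<dots> \<le> 3 ^ CARD('n)"
    proof (intro power_mono sum_nonneg)
      have "2 / (real N + 1) \<ge> 0" by simp
      then show "(\<Sum>m=-int N..int N. ?w m) \<le> 3" using one_dim[of N] by linarith
    qed simp
    finally show "sum (\<lambda>\<xi> :: int^'n. 1 / (1 + nu \<xi>) ^ (2 * CARD('n))) F \<le> 3 ^ CARD('n)" .
  qed
qed simp

lemma summable_latticeI: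
  fixes f :: "int^'n::finite \<Rightarrow> real"
  assumes "\<And>\<xi>. 0 \<le> f \<xi>" "\<And>\<xi>. (1 + nu \<xi>) ^ (2 * CARD('n)) * f \<xi> \<le> C"
  shows "f summable_on UNIV"
proof (rule summable_on_comparison_test)
  show "(\<lambda>\<xi> :: int^'n. C * (1 / (1 + nu \<xi>) ^ (2 * CARD('n)))) summable_on UNIV"
    by (intro summable_on_cmult_right summable_lattice)
  fix \<xi> :: "int^'n"
  have "(1 + nu \<xi>) ^ (2 * CARD('n)) > 0" by (intro zero_less_power) (simp add: add_pos_nonneg)
  then show "f \<xi> \<le> C * (1 / (1 + nu \<xi>) ^ (2 * CARD('n)))"
    using assms(2)[of \<xi>] by (simp add: field_simps)
qed (use assms in auto)

lemma decaying_rapid: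
  fixes c :: "int^'n::finite \<Rightarrow> complex"
  assumes "decaying c"
  shows "rapid c"
  unfolding rapid_def
proof
  fix m
  obtain C where C: "\<And>\<xi>. (1 + nu \<xi>) ^ (2 * CARD('n) + m) * cmod (c \<xi>) \<le> C"
    using decaying_bound[OF assms] by blast
  show "(\<lambda>\<xi>. nu \<xi> ^ m * cmod (c \<xi>)) summable_on UNIV"
  proof (rule summable_latticeI)
    fix \<xi> :: "int^'n"
    have "(1 + nu \<xi>) ^ (2 * CARD('n)) * (nu \<xi> ^ m * cmod (c \<xi>)) \<le> (1 + nu \<xi>) ^ (2 * CARD('n)) * ((1 + nu \<xi>) ^ m * cmod (c \<xi>))"
      by (intro mult_left_mono mult_right_mono power_mono) auto
    also have "\<dots> \<le> C" using C[of \<xi>] by (simp add: power_add mult.assoc)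
    finally show "(1 + nu \<xi>) ^ (2 * CARD('n)) * (nu \<xi> ^ m * cmod (c \<xi>)) \<le> C" .
  qed simp
qed

lemma decaying_sobolev:
  fixes c :: "int^'n::finite \<Rightarrow> complex"
  assumes "decaying c"
  shows "(\<lambda>\<xi>. (1 + (nu \<xi>)\<^sup>2) powr s * (cmod (c \<xi>))\<^sup>2) summable_on UNIV"
proof -
  define m where "m = nat \<lceil>\<bar>s\<bar>\<rceil>"
  obtain C where C: "C \<ge> 0" "\<And>\<xi>. (1 + nu \<xi>) ^ (CARD('n) + m) * cmod (c \<xi>) \<le> C"
    using decaying_bound[OF assms] by blast
  show ?thesis
  proof (rule summable_latticeI)
    fix \<xi> :: "int^'n"
    have "(1 + (nu \<xi>)\<^sup>2) powr s \<le> (1 + (nu \<xi>)\<^sup>2) powr real m"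
      by (intro powr_mono) (auto simp: m_def, linarith)
    also have "\<dots> = (1 + (nu \<xi>)\<^sup>2) ^ m"
      by (simp add: powr_realpow add_pos_nonneg)
    also have "\<dots> \<le> ((1 + nu \<xi>)\<^sup>2) ^ m"
      by (intro power_mono) (auto simp: power2_eq_square algebra_simps)
    finally have "(1 + nu \<xi>) ^ (2 * CARD('n)) * ((1 + (nu \<xi>)\<^sup>2) powr s * (cmod (c \<xi>))\<^sup>2)
        \<le> (1 + nu \<xi>) ^ (2 * CARD('n)) * (((1 + nu \<xi>)\<^sup>2) ^ m * (cmod (c \<xi>))\<^sup>2)"
      by (intro mult_left_mono mult_right_mono) auto
    also have "\<dots> = ((1 + nu \<xi>) ^ (CARD('n) + m) * cmod (c \<xi>))\<^sup>2"
      by (simp add: power_mult_distrib power_add flip: power_mult) (simp add: mult.commute)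
    also have "\<dots> \<le> C\<^sup>2" using C(2)[of \<xi>] by (intro power_mono) auto
    finally show "(1 + nu \<xi>) ^ (2 * CARD('n)) * ((1 + (nu \<xi>)\<^sup>2) powr s * (cmod (c \<xi>))\<^sup>2) \<le> C\<^sup>2" .
  qed simp
qed

text \<open>A single term is bounded by the whole Sobolev sum; the order \<open>m + 2\<close>
  respects the restriction to orders at least 2.\<close>

lemma decayingI_sobolev:
  fixes c :: "int^'n::finite \<Rightarrow> complex"
  assumes "\<And>s. s \<ge> 2 \<Longrightarrow> (\<lambda>\<xi>. (1 + (nu \<xi>)\<^sup>2) powr s * (cmod (c \<xi>))\<^sup>2) summable_on UNIV"
  shows "decaying c"
  unfolding decaying_def
proof
  fix m :: nat
  let ?f = "\<lambda>\<xi> :: int^'n. (1 + (nu \<xi>)\<^sup>2) powr real (m + 2) * (cmod (c \<xi>))\<^sup>2"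
  have s: "?f summable_on UNIV" by (rule assms) simp
  have "nu \<xi> ^ m * cmod (c \<xi>) \<le> sqrt (infsum ?f UNIV)" for \<xi>
  proof (rule real_le_rsqrt)
    have "((nu \<xi>)\<^sup>2) ^ m \<le> (1 + (nu \<xi>)\<^sup>2) ^ m"
      by (intro power_mono) auto
    also have "\<dots> \<le> (1 + (nu \<xi>)\<^sup>2) ^ (m + 2)"
      by (intro power_increasing) auto
    also have "\<dots> = (1 + (nu \<xi>)\<^sup>2) powr real (m + 2)"
      by (rule powr_realpow[symmetric]) (simp add: add_pos_nonneg)
    finally have le: "((nu \<xi>)\<^sup>2) ^ m * (cmod (c \<xi>))\<^sup>2 \<le> ?f \<xi>"
      by (rule mult_right_mono) simp
    have "(nu \<xi> ^ m * cmod (c \<xi>))\<^sup>2 = ((nu \<xi>)\<^sup>2) ^ m * (cmod (c \<xi>))\<^sup>2"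
      by (simp add: power_mult_distrib flip: power_mult) (simp add: mult.commute)
    also note le
    also have "?f \<xi> \<le> infsum ?f UNIV"
      using finite_sum_le_infsum[OF s, of "{\<xi>}"] by simp
    finally show "(nu \<xi> ^ m * cmod (c \<xi>))\<^sup>2 \<le> infsum ?f UNIV" .
  qed
  then show "\<exists>C. \<forall>\<xi>. nu \<xi> ^ m * cmod (c \<xi>) \<le> C" by blast
qed

lemma nu_le_l1: "nu \<xi> \<le> (\<Sum>k\<in>UNIV. \<bar>of_int (\<xi> $ k)\<bar>)"
  using norm_le_l1_cart[of "frequency \<xi>"] by (simp add: nu_def)

text \<open>Induction on the power: one factor \<open>nu \<xi>\<close> is at most the sum of the
  moduli of the components, and each component is paid for by one derivative of
  \<open>f\<close>.\<close>

lemma periodic_smooth_decaying: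
  assumes "f \<in> periodic_smooth"
  shows "decaying (fourier_coeff (distr_of f))"
  unfolding decaying_def
proof
  fix m :: nat
  show "\<exists>C. \<forall>\<xi>. nu \<xi> ^ m * cmod (fourier_coeff (distr_of f) \<xi>) \<le> C"
    using assms
  proof (induction m arbitrary: f)
    case 0
    have int: "integrable torus_measure f" using 0 by (rule periodic_smooth_integrable)
    have "cmod (fourier_coeff (distr_of f) \<xi>) \<le> (LINT x|torus_measure. \<bar>f x\<bar>)" for \<xi>
      unfolding fourier_coeff_distr_of[OF int]
      by (rule order_trans[OF integral_norm_bound]) (simp add: norm_mult)
    then show ?case by auto
  next
    case (Suc m)
    have "\<forall>j. \<exists>C. \<forall>\<xi>. nu \<xi> ^ m * cmod (fourier_coeff (distr_of (partial_deriv j f)) \<xi>) \<le> C"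
      using Suc by (blast intro: partial_deriv_periodic_smooth)
    from choice[OF this] obtain C where C: "\<And>j \<xi>. nu \<xi> ^ m * cmod (diff_coeff j (fourier_coeff (distr_of f)) \<xi>) \<le> C j"
      unfolding fourier_coeff_partial_deriv[OF Suc.prems] by blast
    have "nu \<xi> ^ Suc m * cmod (fourier_coeff (distr_of f) \<xi>) \<le> (\<Sum>j\<in>UNIV. C j)" for \<xi>
    proof -
      let ?c = "cmod (fourier_coeff (distr_of f) \<xi>)"
      have "nu \<xi> ^ Suc m * ?c = nu \<xi> * (nu \<xi> ^ m * ?c)" by simp
      also have "\<dots> \<le> (\<Sum>k\<in>UNIV. \<bar>of_int (\<xi> $ k)\<bar>) * (nu \<xi> ^ m * ?c)"
        by (intro mult_right_mono nu_le_l1) simp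
      also have "\<dots> = (\<Sum>k\<in>UNIV. \<bar>of_int (\<xi> $ k)\<bar> * (nu \<xi> ^ m * ?c))"
        by (rule sum_distrib_right)
      also have "\<dots> \<le> (\<Sum>j\<in>UNIV. C j)"
      proof (rule sum_mono)
        fix j
        have "\<bar>of_int (\<xi> $ j)\<bar> * (nu \<xi> ^ m * ?c) \<le> 2 * pi * (\<bar>of_int (\<xi> $ j)\<bar> * (nu \<xi> ^ m * ?c))"
        proof -
          have "1 * x \<le> 2 * pi * x" if "x \<ge> 0" for x :: real
            using pi_gt3 that by (intro mult_right_mono) auto
          then show ?thesis by simp
        qed
        also have "\<dots> = nu \<xi> ^ m * cmod (diff_coeff j (fourier_coeff (distr_of f)) \<xi>)"
          by (simp add: diff_coeff_def norm_mult mult_ac)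
        also have "\<dots> \<le> C j" by (rule C)
        finally show "\<bar>of_int (\<xi> $ j)\<bar> * (nu \<xi> ^ m * ?c) \<le> C j" .
      qed
      finally show ?thesis .
    qed
    then show ?case by blast
  qed
qed

section \<open>From Fourier coefficients to distributions\<close>

text \<open>Symbol of the negative of \<open>stokes_op\<close>: the square of
  \<open>2 * pi * \<i>\<close> is negative, which cancels the minus sign. The gradient already
  replaces the strain, as the symmetry of the tensor permits.\<close>

definition tensor_symbol :: "'n::finite tensor \<Rightarrow> int^'n \<Rightarrow> complex^'n \<Rightarrow> complex^'n" where
  "tensor_symbol a \<xi> w = (\<chi> k. \<Sum>j\<in>UNIV. \<Sum>\<alpha>\<in>UNIV. \<Sum>\<beta>\<in>UNIV.
    of_real (4 * pi\<^sup>2 * a k j \<alpha> \<beta> * of_int (\<xi> $ \<alpha>) * of_int (\<xi> $ \<beta>)) * w $ j)"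

text \<open>Contraction with symmetric coefficients does not see symmetrisation; this converts
  between strain and gradient.\<close>

lemma symmetric_contraction:
  fixes b :: "'n::finite \<Rightarrow> 'n \<Rightarrow> 'a::field_char_0"
  assumes "\<And>k l. b k l = b l k"
  shows "(\<Sum>k\<in>UNIV. \<Sum>l\<in>UNIV. b k l * ((x k * y l + y k * x l) / 2)) = (\<Sum>k\<in>UNIV. \<Sum>l\<in>UNIV. b k l * (x k * y l))"
proof -
  have "(\<Sum>k\<in>UNIV. \<Sum>l\<in>UNIV. b k l * (y k * x l)) = (\<Sum>l\<in>UNIV. \<Sum>k\<in>UNIV. b k l * (y k * x l))"
    by (rule sum.swap)
  also have "\<dots> = (\<Sum>k\<in>UNIV. \<Sum>l\<in>UNIV. b k l * (x k * y l))"
    using assms by (simp add: mult.commute)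
  finally have e: "(\<Sum>k\<in>UNIV. \<Sum>l\<in>UNIV. b k l * (y k * x l)) = (\<Sum>k\<in>UNIV. \<Sum>l\<in>UNIV. b k l * (x k * y l))" .
  have "(\<Sum>k\<in>UNIV. \<Sum>l\<in>UNIV. b k l * ((x k * y l + y k * x l) / 2))
      = ((\<Sum>k\<in>UNIV. \<Sum>l\<in>UNIV. b k l * (x k * y l)) + (\<Sum>k\<in>UNIV. \<Sum>l\<in>UNIV. b k l * (y k * x l))) / 2"
    by (simp add: sum.distrib[symmetric] sum_divide_distrib distrib_left add_divide_distrib)
  then show ?thesis unfolding e by simp
qed

text \<open>The two index symmetries undo the symmetrisation in the two slots of the form, so it can
  be evaluated on the plain products of \<open>x\<close> and \<open>y\<close>. The 2 in the constant
  is the price of symmetrising: for orthogonal vectors it halves the squared norm.\<close>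

lemma relaxed_elliptic_symbol:
  fixes a :: "'n::finite tensor"
  assumes sym: "tensor_symmetric a" and C: "C > 0"
    and ell: "\<And>\<zeta> :: real^'n^'n. \<zeta> = transpose \<zeta> \<Longrightarrow> trace \<zeta> = 0 \<Longrightarrow>
        C * (\<Sum>k\<in>UNIV. \<Sum>j\<in>UNIV. \<Sum>\<alpha>\<in>UNIV. \<Sum>\<beta>\<in>UNIV. a k j \<alpha> \<beta> * \<zeta> $ k $ \<alpha> * \<zeta> $ j $ \<beta>)
          \<ge> (\<Sum>k\<in>UNIV. \<Sum>\<alpha>\<in>UNIV. \<zeta> $ k $ \<alpha> * \<zeta> $ k $ \<alpha>)"
    and xy: "(\<Sum>k\<in>UNIV. y k * x k) = 0"
  shows "(\<Sum>k\<in>UNIV. (x k)\<^sup>2) * (\<Sum>k\<in>UNIV. (y k)\<^sup>2) / (2 * C)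
    \<le> (\<Sum>k\<in>UNIV. \<Sum>j\<in>UNIV. \<Sum>\<alpha>\<in>UNIV. \<Sum>\<beta>\<in>UNIV. a k j \<alpha> \<beta> * y \<alpha> * y \<beta> * (x k * x j))"
proof -
  define \<zeta> :: "real^'n^'n" where "\<zeta> = (\<chi> k l. (x k * y l + y k * x l) / 2)"
  have s1: "a k j \<alpha> \<beta> = a \<alpha> j k \<beta>" and s2: "a k j \<alpha> \<beta> = a k \<beta> \<alpha> j" for k j \<alpha> \<beta>
    using sym unfolding tensor_symmetric_def by blast+
  have tr: "\<zeta> = transpose \<zeta>"
    by (simp add: \<zeta>_def transpose_def vec_eq_iff mult.commute add.commute)
  have "trace \<zeta> = (\<Sum>k\<in>UNIV. y k * x k)"
    by (simp add: trace_def \<zeta>_def mult.commute)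
  with xy have t0: "trace \<zeta> = 0" by simp
  have inner: "(\<Sum>j\<in>UNIV. \<Sum>\<beta>\<in>UNIV. a k j \<alpha> \<beta> * \<zeta> $ j $ \<beta>) = (\<Sum>j\<in>UNIV. \<Sum>\<beta>\<in>UNIV. a k j \<alpha> \<beta> * (x j * y \<beta>))" for k \<alpha>
    unfolding \<zeta>_def vec_lambda_beta by (rule symmetric_contraction) (rule s2)
  have "(\<Sum>k\<in>UNIV. \<Sum>j\<in>UNIV. \<Sum>\<alpha>\<in>UNIV. \<Sum>\<beta>\<in>UNIV. a k j \<alpha> \<beta> * \<zeta> $ k $ \<alpha> * \<zeta> $ j $ \<beta>)
      = (\<Sum>k\<in>UNIV. \<Sum>\<alpha>\<in>UNIV. \<Sum>j\<in>UNIV. \<Sum>\<beta>\<in>UNIV. a k j \<alpha> \<beta> * \<zeta> $ k $ \<alpha> * \<zeta> $ j $ \<beta>)"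
    by (intro sum.cong refl sum.swap)
  also have "\<dots> = (\<Sum>k\<in>UNIV. \<Sum>\<alpha>\<in>UNIV. (\<Sum>j\<in>UNIV. \<Sum>\<beta>\<in>UNIV. a k j \<alpha> \<beta> * \<zeta> $ j $ \<beta>) * \<zeta> $ k $ \<alpha>)"
    by (simp add: sum_distrib_left sum_distrib_right mult_ac)
  also have "\<dots> = (\<Sum>k\<in>UNIV. \<Sum>\<alpha>\<in>UNIV. (\<Sum>j\<in>UNIV. \<Sum>\<beta>\<in>UNIV. a k j \<alpha> \<beta> * (x j * y \<beta>)) * ((x k * y \<alpha> + y k * x \<alpha>) / 2))"
    unfolding inner by (simp add: \<zeta>_def)
  also have "\<dots> = (\<Sum>k\<in>UNIV. \<Sum>\<alpha>\<in>UNIV. (\<Sum>j\<in>UNIV. \<Sum>\<beta>\<in>UNIV. a k j \<alpha> \<beta> * (x j * y \<beta>)) * (x k * y \<alpha>))"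
    by (rule symmetric_contraction) (simp add: s1)
  also have "\<dots> = (\<Sum>k\<in>UNIV. \<Sum>\<alpha>\<in>UNIV. \<Sum>j\<in>UNIV. \<Sum>\<beta>\<in>UNIV. a k j \<alpha> \<beta> * y \<alpha> * y \<beta> * (x k * x j))"
    by (simp add: sum_distrib_left sum_distrib_right mult_ac)
  also have "\<dots> = (\<Sum>k\<in>UNIV. \<Sum>j\<in>UNIV. \<Sum>\<alpha>\<in>UNIV. \<Sum>\<beta>\<in>UNIV. a k j \<alpha> \<beta> * y \<alpha> * y \<beta> * (x k * x j))"
    by (intro sum.cong refl sum.swap)
  finally have form: "(\<Sum>k\<in>UNIV. \<Sum>j\<in>UNIV. \<Sum>\<alpha>\<in>UNIV. \<Sum>\<beta>\<in>UNIV. a k j \<alpha> \<beta> * \<zeta> $ k $ \<alpha> * \<zeta> $ j $ \<beta>)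
      = (\<Sum>k\<in>UNIV. \<Sum>j\<in>UNIV. \<Sum>\<alpha>\<in>UNIV. \<Sum>\<beta>\<in>UNIV. a k j \<alpha> \<beta> * y \<alpha> * y \<beta> * (x k * x j))" .
  \<comment> \<open>The mixed terms sum to the square of the scalar product of \<open>x\<close> and
    \<open>y\<close>, which is zero.\<close>
  have "(\<Sum>k\<in>UNIV. \<Sum>\<alpha>\<in>UNIV. \<zeta> $ k $ \<alpha> * \<zeta> $ k $ \<alpha>)
      = (\<Sum>k\<in>UNIV. \<Sum>\<alpha>\<in>UNIV. ((x k)\<^sup>2 * (y \<alpha>)\<^sup>2 + (y k)\<^sup>2 * (x \<alpha>)\<^sup>2 + 2 * ((y k * x k) * (y \<alpha> * x \<alpha>))) / 4)"
    by (intro sum.cong refl) (simp add: \<zeta>_def power2_eq_square algebra_simps)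
  also have "\<dots> = ((\<Sum>k\<in>UNIV. \<Sum>\<alpha>\<in>UNIV. (x k)\<^sup>2 * (y \<alpha>)\<^sup>2) + (\<Sum>k\<in>UNIV. \<Sum>\<alpha>\<in>UNIV. (y k)\<^sup>2 * (x \<alpha>)\<^sup>2)
      + 2 * (\<Sum>k\<in>UNIV. \<Sum>\<alpha>\<in>UNIV. (y k * x k) * (y \<alpha> * x \<alpha>))) / 4"
    by (simp only: sum_divide_distrib[symmetric] sum.distrib sum_distrib_left[symmetric])
  also have "\<dots> = (\<Sum>k\<in>UNIV. (x k)\<^sup>2) * (\<Sum>k\<in>UNIV. (y k)\<^sup>2) / 2"
    unfolding sum_product[symmetric] xy by (simp add: mult.commute)
  finally have "(\<Sum>k\<in>UNIV. (x k)\<^sup>2) * (\<Sum>k\<in>UNIV. (y k)\<^sup>2) / 2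
      \<le> C * (\<Sum>k\<in>UNIV. \<Sum>j\<in>UNIV. \<Sum>\<alpha>\<in>UNIV. \<Sum>\<beta>\<in>UNIV. a k j \<alpha> \<beta> * y \<alpha> * y \<beta> * (x k * x j))"
    using ell[OF tr t0] unfolding form by simp
  then show ?thesis using C by (simp add: field_simps)
qed

lemma stokes_symbol_tensor:
  fixes a :: "'n::finite tensor"
  assumes sym: "tensor_symmetric a" and ell: "relaxed_elliptic a"
  shows "\<exists>c. stokes_symbol (tensor_symbol a) c"
proof -
  obtain C where C: "C > 0" "\<And>\<zeta> :: real^'n^'n. \<zeta> = transpose \<zeta> \<Longrightarrow> trace \<zeta> = 0 \<Longrightarrow>
        C * (\<Sum>k\<in>UNIV. \<Sum>j\<in>UNIV. \<Sum>\<alpha>\<in>UNIV. \<Sum>\<beta>\<in>UNIV. a k j \<alpha> \<beta> * \<zeta> $ k $ \<alpha> * \<zeta> $ j $ \<beta>)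
          \<ge> (\<Sum>k\<in>UNIV. \<Sum>\<alpha>\<in>UNIV. \<zeta> $ k $ \<alpha> * \<zeta> $ k $ \<alpha>)"
    using ell unfolding relaxed_elliptic_def by blast
  have "stokes_symbol (tensor_symbol a) (4 * pi\<^sup>2 / (2 * C))"
  proof (rule stokes_symbol.intro)
    show "linear (tensor_symbol a \<xi>)" for \<xi>
      by (rule linearI) (simp_all add: tensor_symbol_def vec_eq_iff sum.distrib distrib_left scaleR_sum_right)
    show "4 * pi\<^sup>2 / (2 * C) > 0" using C by simp
    show "tensor_symbol a (- \<xi>) (vcnj w) = vcnj (tensor_symbol a \<xi> w)" for \<xi> w
      by (simp add: tensor_symbol_def vec_eq_iff)
    fix \<xi> and w :: "complex^'n" assume d: "dot \<xi> w = 0"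
    let ?y = "\<lambda>k. real_of_int (\<xi> $ k)"
    let ?Q = "\<lambda>x. \<Sum>k\<in>UNIV. \<Sum>j\<in>UNIV. \<Sum>\<alpha>\<in>UNIV. \<Sum>\<beta>\<in>UNIV. a k j \<alpha> \<beta> * ?y \<alpha> * ?y \<beta> * (x k * x j)"
    \<comment> \<open>The frequency and the tensor are real, so real and imaginary parts of
      \<open>w\<close> can be treated separately.\<close>
    have re: "(\<Sum>k\<in>UNIV. ?y k * Re (w $ k)) = 0" and im: "(\<Sum>k\<in>UNIV. ?y k * Im (w $ k)) = 0"
      using arg_cong[OF d, of Re] arg_cong[OF d, of Im] by (simp_all add: dot_def)
    have "w \<bullet> tensor_symbol a \<xi> w = 4 * pi\<^sup>2 * (?Q (\<lambda>k. Re (w $ k)) + ?Q (\<lambda>k. Im (w $ k)))"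
      by (simp add: inner_vec_def inner_complex_def tensor_symbol_def sum_distrib_left distrib_left sum.distrib[symmetric] mult_ac)
    moreover have "(\<Sum>k\<in>UNIV. (Re (w $ k))\<^sup>2) * (nu \<xi>)\<^sup>2 / (2 * C) \<le> ?Q (\<lambda>k. Re (w $ k))"
      unfolding nu_squared by (rule relaxed_elliptic_symbol[OF sym C re])
    moreover have "(\<Sum>k\<in>UNIV. (Im (w $ k))\<^sup>2) * (nu \<xi>)\<^sup>2 / (2 * C) \<le> ?Q (\<lambda>k. Im (w $ k))"
      unfolding nu_squared by (rule relaxed_elliptic_symbol[OF sym C im])
    moreover have "(norm w)\<^sup>2 = (\<Sum>k\<in>UNIV. (Re (w $ k))\<^sup>2) + (\<Sum>k\<in>UNIV. (Im (w $ k))\<^sup>2)"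
      by (simp add: norm_vec_def L2_set_def sum_nonneg cmod_power2 sum.distrib)
    ultimately have "w \<bullet> tensor_symbol a \<xi> w \<ge> 4 * pi\<^sup>2 * ((norm w)\<^sup>2 * (nu \<xi>)\<^sup>2 / (2 * C))"
      by (simp add: distrib_right add_divide_distrib)
    then show "4 * pi\<^sup>2 / (2 * C) * (nu \<xi>)\<^sup>2 * (norm w)\<^sup>2 \<le> w \<bullet> tensor_symbol a \<xi> w"
      by (simp add: mult_ac)
  qed
  then show ?thesis by blast
qed

lemma norm_nth_le_norm: "norm (v $ k) \<le> norm (v :: 'a::real_normed_vector^'n)"
  unfolding norm_vec_def by (rule member_le_L2_set) auto

lemma tensor_symbol_bound:
  fixes a :: "'n::finite tensor"
  obtains K where "\<And>\<xi> w. norm (tensor_symbol a \<xi> w) \<le> K * (nu \<xi>)\<^sup>2 * norm w"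
proof
  fix \<xi> and w :: "complex^'n"
  have t: "cmod (of_real (4 * pi\<^sup>2 * a k j \<alpha> \<beta> * of_int (\<xi> $ \<alpha>) * of_int (\<xi> $ \<beta>)) * w $ j)
      \<le> 4 * pi\<^sup>2 * \<bar>a k j \<alpha> \<beta>\<bar> * ((nu \<xi>)\<^sup>2 * norm w)" for k j \<alpha> \<beta>
  proof -
    have "\<bar>real_of_int (\<xi> $ \<alpha>)\<bar> * \<bar>real_of_int (\<xi> $ \<beta>)\<bar> * cmod (w $ j) \<le> nu \<xi> * nu \<xi> * norm w"
      by (intro mult_mono component_le_nu norm_nth_le_norm) auto
    then have "\<bar>real_of_int (\<xi> $ \<alpha>)\<bar> * \<bar>real_of_int (\<xi> $ \<beta>)\<bar> * cmod (w $ j) \<le> (nu \<xi>)\<^sup>2 * norm w"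
      by (simp add: power2_eq_square)
    from mult_left_mono[OF this, of "4 * pi\<^sup>2 * \<bar>a k j \<alpha> \<beta>\<bar>"] show ?thesis
      by (simp add: norm_mult abs_mult norm_power mult_ac)
  qed
  have "norm (tensor_symbol a \<xi> w) \<le> (\<Sum>k\<in>UNIV. cmod (tensor_symbol a \<xi> w $ k))"
    unfolding norm_vec_def by (rule L2_set_le_sum) simp
  also have "\<dots> \<le> (\<Sum>k\<in>UNIV. \<Sum>j\<in>UNIV. \<Sum>\<alpha>\<in>UNIV. \<Sum>\<beta>\<in>UNIV. 4 * pi\<^sup>2 * \<bar>a k j \<alpha> \<beta>\<bar> * ((nu \<xi>)\<^sup>2 * norm w))"
    unfolding tensor_symbol_def vec_lambda_beta
    by (intro sum_mono order_trans[OF norm_sum] t)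
  also have "\<dots> = (\<Sum>k\<in>UNIV. \<Sum>j\<in>UNIV. \<Sum>\<alpha>\<in>UNIV. \<Sum>\<beta>\<in>UNIV. 4 * pi\<^sup>2 * \<bar>a k j \<alpha> \<beta>\<bar>) * (nu \<xi>)\<^sup>2 * norm w"
    by (simp only: sum_distrib_right mult.assoc)
  finally show "norm (tensor_symbol a \<xi> w)
    \<le> (\<Sum>k\<in>UNIV. \<Sum>j\<in>UNIV. \<Sum>\<alpha>\<in>UNIV. \<Sum>\<beta>\<in>UNIV. 4 * pi\<^sup>2 * \<bar>a k j \<alpha> \<beta>\<bar>) * (nu \<xi>)\<^sup>2 * norm w" .
qed

lemma fourier_coeff_combination:
  "fourier_coeff (\<lambda>\<phi>. a * T \<phi> + b * S \<phi>) \<xi> = of_real a * fourier_coeff T \<xi> + of_real b * fourier_coeff S \<xi>"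
  by (simp add: fourier_coeff_def complex_eq_iff)

lemma fourier_coeff_sum:
  "fourier_coeff (\<lambda>\<phi>. \<Sum>k\<in>A. T k \<phi>) \<xi> = (\<Sum>k\<in>A. fourier_coeff (T k) \<xi>)"
  by (simp add: fourier_coeff_def complex_eq_iff sum_negf)

lemma fourier_coeff_scale: "fourier_coeff (\<lambda>\<phi>. a * T \<phi>) \<xi> = of_real a * fourier_coeff T \<xi>"
  using fourier_coeff_combination[of a T 0 T] by simp

lemma fourier_coeff_uminus:
  assumes T: "T \<in> periodic_distribution"
  shows "fourier_coeff T (- \<xi>) = cnj (fourier_coeff T \<xi>)"
proof -
  have "T (\<lambda>x. - sin (2 * pi * (x \<bullet> frequency \<xi>))) = - T (\<lambda>x. sin (2 * pi * (x \<bullet> frequency \<xi>)))"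
    using periodic_distribution_scale[OF T cos_sin_periodic_smooth(2), of "-1"] by simp
  then show ?thesis by (simp add: fourier_coeff_def complex_eq_iff)
qed

text \<open>Symmetry in the pair \<open>j\<close>, \<open>\<beta>\<close> replaces the strain by the
  gradient inside the operator.\<close>

lemma fourier_coeff_stokes_op:
  fixes a :: "'n::finite tensor"
  assumes sym: "tensor_symmetric a" and u: "\<And>j. u j \<in> periodic_distribution"
    and U: "\<And>j \<xi>. fourier_coeff (u j) \<xi> = U \<xi> $ j"
  shows "stokes_op a u k \<in> periodic_distribution"
    and "fourier_coeff (stokes_op a u k) \<xi> = - (tensor_symbol a \<xi> (U \<xi>) $ k)"
proof -
  have strain: "strain u j \<beta> = (\<lambda>\<phi>. 1/2 * distr_deriv j (u \<beta>) \<phi> + 1/2 * distr_deriv \<beta> (u j) \<phi>)" for j \<beta>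
    by (simp add: fun_eq_iff strain_def)
  have strain_pd: "strain u j \<beta> \<in> periodic_distribution" for j \<beta>
    unfolding strain by (intro periodic_distribution_combination periodic_distribution_deriv u)
  have strain_fc: "fourier_coeff (strain u j \<beta>) \<xi> = 2 * pi * \<i> * ((of_int (\<xi> $ j) * U \<xi> $ \<beta> + U \<xi> $ j * of_int (\<xi> $ \<beta>)) / 2)" for j \<beta> \<xi>
    unfolding strain fourier_coeff_combination fourier_coeff_deriv[OF u] diff_coeff_def U
    by (simp add: algebra_simps)
  define T where "T = (\<lambda>\<alpha> \<psi>. \<Sum>j\<in>UNIV. \<Sum>\<beta>\<in>UNIV. a k j \<alpha> \<beta> * strain u j \<beta> \<psi>)"
  have scale_pd: "(\<lambda>\<phi>. r * S \<phi>) \<in> periodic_distribution" if "S \<in> periodic_distribution" for r and S :: "'n functional"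
    using periodic_distribution_combination[OF that that, of r 0] by simp
  have T_pd: "T \<alpha> \<in> periodic_distribution" for \<alpha>
    unfolding T_def by (intro periodic_distribution_sum scale_pd strain_pd) auto
  have op: "stokes_op a u k = (\<lambda>\<phi>. \<Sum>\<alpha>\<in>UNIV. distr_deriv \<alpha> (T \<alpha>) \<phi>)"
    by (simp add: fun_eq_iff stokes_op_def T_def)
  show "stokes_op a u k \<in> periodic_distribution"
    unfolding op by (intro periodic_distribution_sum periodic_distribution_deriv T_pd) auto
  have s2: "a k j \<alpha> \<beta> = a k \<beta> \<alpha> j" for j \<alpha> \<beta>
    using sym unfolding tensor_symmetric_def by blast
  have T_fc: "fourier_coeff (T \<alpha>) \<xi> = 2 * pi * \<i> * (\<Sum>j\<in>UNIV. \<Sum>\<beta>\<in>UNIV. of_real (a k j \<alpha> \<beta>) * (U \<xi> $ j * of_int (\<xi> $ \<beta>)))" for \<alpha>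
  proof -
    have "fourier_coeff (T \<alpha>) \<xi> = (\<Sum>j\<in>UNIV. \<Sum>\<beta>\<in>UNIV. of_real (a k j \<alpha> \<beta>) * (2 * pi * \<i> * ((of_int (\<xi> $ j) * U \<xi> $ \<beta> + U \<xi> $ j * of_int (\<xi> $ \<beta>)) / 2)))"
      unfolding T_def fourier_coeff_sum fourier_coeff_scale strain_fc ..
    also have "\<dots> = 2 * pi * \<i> * (\<Sum>j\<in>UNIV. \<Sum>\<beta>\<in>UNIV. of_real (a k j \<alpha> \<beta>) * ((U \<xi> $ j * of_int (\<xi> $ \<beta>) + of_int (\<xi> $ j) * U \<xi> $ \<beta>) / 2))"
      by (simp only: sum_distrib_left mult.left_commute add.commute)
    also have "(\<Sum>j\<in>UNIV. \<Sum>\<beta>\<in>UNIV. of_real (a k j \<alpha> \<beta>) * ((U \<xi> $ j * of_int (\<xi> $ \<beta>) + of_int (\<xi> $ j) * U \<xi> $ \<beta>) / 2))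
        = (\<Sum>j\<in>UNIV. \<Sum>\<beta>\<in>UNIV. of_real (a k j \<alpha> \<beta>) * (U \<xi> $ j * of_int (\<xi> $ \<beta>)))"
      by (rule symmetric_contraction) (simp add: s2[of _ \<alpha>])
    finally show ?thesis .
  qed
  have "fourier_coeff (stokes_op a u k) \<xi> = (\<Sum>\<alpha>\<in>UNIV. 2 * pi * \<i> * of_int (\<xi> $ \<alpha>) * fourier_coeff (T \<alpha>) \<xi>)"
    unfolding op fourier_coeff_sum fourier_coeff_deriv[OF T_pd] diff_coeff_def ..
  also have "\<dots> = (\<Sum>\<alpha>\<in>UNIV. \<Sum>j\<in>UNIV. \<Sum>\<beta>\<in>UNIV. - (of_real (4 * pi\<^sup>2 * a k j \<alpha> \<beta> * of_int (\<xi> $ \<alpha>) * of_int (\<xi> $ \<beta>)) * U \<xi> $ j))"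
    unfolding T_fc sum_distrib_left
    by (intro sum.cong refl) (simp add: power2_eq_square algebra_simps)
  also have "\<dots> = - (\<Sum>\<alpha>\<in>UNIV. \<Sum>j\<in>UNIV. \<Sum>\<beta>\<in>UNIV. of_real (4 * pi\<^sup>2 * a k j \<alpha> \<beta> * of_int (\<xi> $ \<alpha>) * of_int (\<xi> $ \<beta>)) * U \<xi> $ j)"
    by (simp only: sum_negf)
  also have "(\<Sum>\<alpha>\<in>UNIV. \<Sum>j\<in>UNIV. \<Sum>\<beta>\<in>UNIV. of_real (4 * pi\<^sup>2 * a k j \<alpha> \<beta> * of_int (\<xi> $ \<alpha>) * of_int (\<xi> $ \<beta>)) * U \<xi> $ j)
      = tensor_symbol a \<xi> (U \<xi>) $ k"
    unfolding tensor_symbol_def vec_lambda_beta by (rule sum.swap)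
  finally show "fourier_coeff (stokes_op a u k) \<xi> = - (tensor_symbol a \<xi> (U \<xi>) $ k)" .
qed

lemma represented_by_distr_of: "periodic g \<Longrightarrow> integrable torus_measure g \<Longrightarrow> represented_by (distr_of g) g"
  by (simp add: represented_by_def set_integrable_torus_iff)

text \<open>Both distributions have the coefficients \<open>diff_coeff j c\<close>, so uniqueness
  identifies them.\<close>

lemma represented_by_deriv:
  assumes g: "l2_fourier g c" and h: "l2_fourier h (diff_coeff j c)"
  shows "represented_by (distr_deriv j (distr_of g)) h"
  unfolding represented_by_def
proof (intro conjI ballI)
  note gi = l2_fourier_integrable[OF g] and hi = l2_fourier_integrable[OF h]
  show "periodic h" using h by (simp add: l2_fourier_def)
  show "set_integrable lborel torus h" using hi by (simp add: set_integrable_torus_iff)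
  show "distr_deriv j (distr_of g) \<phi> = distr_of h \<phi>" if "\<phi> \<in> periodic_smooth" for \<phi>
    using that gi hi
    by (intro periodic_distribution_eqI periodic_distribution_deriv periodic_distribution_distr_of)
      (simp_all add: fourier_coeff_deriv periodic_distribution_distr_of l2_fourier_coeff[OF g] l2_fourier_coeff[OF h])
qed

lemma summable_conv:
  fixes c d :: "int^'n::finite \<Rightarrow> complex"
  assumes c: "(\<lambda>\<xi>. (cmod (c \<xi>))\<^sup>2) summable_on UNIV" and d: "(\<lambda>\<xi>. (cmod (d \<xi>))\<^sup>2) summable_on UNIV"
  shows "(\<lambda>\<eta>. c \<eta> * d (\<xi> - \<eta>)) summable_on UNIV"
proof (rule abs_summable_summable, rule summable_on_comparison_test)
  have b: "bij_betw (\<lambda>\<eta>. \<xi> - \<eta>) UNIV (UNIV :: (int^'n) set)"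
    by (rule bij_betwI[where g = "\<lambda>\<eta>. \<xi> - \<eta>"]) auto
  have "(\<lambda>\<eta>. (cmod (d (\<xi> - \<eta>)))\<^sup>2) summable_on UNIV"
    using summable_on_reindex_bij_betw[OF b, of "\<lambda>\<eta>. (cmod (d \<eta>))\<^sup>2"] d by simp
  then show "(\<lambda>\<eta>. (cmod (c \<eta>))\<^sup>2 + (cmod (d (\<xi> - \<eta>)))\<^sup>2) summable_on UNIV"
    by (intro summable_on_add c)
  fix \<eta>
  have "2 * (cmod (c \<eta>) * cmod (d (\<xi> - \<eta>))) \<le> (cmod (c \<eta>))\<^sup>2 + (cmod (d (\<xi> - \<eta>)))\<^sup>2"
    using zero_le_power2[of "cmod (c \<eta>) - cmod (d (\<xi> - \<eta>))"] by (simp add: power2_diff)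
  moreover have "0 \<le> cmod (c \<eta>) * cmod (d (\<xi> - \<eta>))" by simp
  ultimately show "norm (c \<eta> * d (\<xi> - \<eta>)) \<le> (cmod (c \<eta>))\<^sup>2 + (cmod (d (\<xi> - \<eta>)))\<^sup>2"
    unfolding norm_mult by linarith
qed simp

text \<open>Square summability of the velocity and of its gradient makes every product
  \<open>G j * H j k\<close> integrable, so the convective term is a regular distribution; the
  equation then follows by comparing coefficients.\<close>

lemma navier_stokesI:
  fixes a :: "'n::finite tensor"
  assumes sym: "tensor_symmetric a"
    and U_dot: "\<And>\<xi>. dot \<xi> (U \<xi>) = 0"
    and U_abs: "\<And>\<xi>. (\<lambda>\<eta>. norm ((2 * pi * \<i> * dot \<xi> (U \<eta>)) *s U (\<xi> - \<eta>))) summable_on UNIV"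
    and eq: "\<And>\<xi>. tensor_symbol a \<xi> (U \<xi>) + (2 * pi * \<i> * p \<xi>) *s cfreq \<xi> + convection U \<xi> = F \<xi>"
    and U2: "\<And>k. (\<lambda>\<xi>. (cmod (U \<xi> $ k))\<^sup>2) summable_on UNIV"
    and DU2: "\<And>j k. (\<lambda>\<xi>. (cmod (diff_coeff j (\<lambda>\<xi>. U \<xi> $ k) \<xi>))\<^sup>2) summable_on UNIV"
    and G: "\<And>k. l2_fourier (G k) (\<lambda>\<xi>. U \<xi> $ k)"
    and H: "\<And>j k. l2_fourier (H j k) (diff_coeff j (\<lambda>\<xi>. U \<xi> $ k))"
    and P: "l2_fourier P p"
    and f: "\<And>k. f k \<in> periodic_distribution" and fF: "\<And>k \<xi>. fourier_coeff (f k) \<xi> = F \<xi> $ k"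
  shows "navier_stokes a (\<lambda>k. distr_of (G k)) (distr_of P) f"
  unfolding navier_stokes_def
proof (intro exI[of _ "\<lambda>j k. distr_of (\<lambda>x. G j x * H j k x)"] conjI allI ballI)
  let ?N = "\<lambda>j k. distr_of (\<lambda>x. G j x * H j k x)"
  note Gi = l2_fourier_integrable[OF G] and Pi = l2_fourier_integrable[OF P]
  have prod_sum: "(\<lambda>\<eta>. U \<eta> $ j * diff_coeff j (\<lambda>\<xi>. U \<xi> $ k) (\<xi> - \<eta>)) summable_on UNIV" for j k \<xi>
    by (rule summable_conv[OF U2 DU2])
  have GHi: "integrable torus_measure (\<lambda>x. G j x * H j k x)" for j k
    by (rule l2_fourier_product(1)[OF G H prod_sum])
  have N_fc: "fourier_coeff (?N j k) \<xi> = (\<Sum>\<^sub>\<infinity>\<eta>. U \<eta> $ j * diff_coeff j (\<lambda>\<xi>. U \<xi> $ k) (\<xi> - \<eta>))" for j k \<xi>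
    by (rule l2_fourier_product(2)[OF G H prod_sum])
  have Gd: "distr_of (G k) \<in> periodic_distribution" for k
    by (rule periodic_distribution_distr_of[OF Gi])
  have G_fc: "fourier_coeff (distr_of (G k)) \<xi> = U \<xi> $ k" for k \<xi>
    by (simp add: l2_fourier_coeff[OF G])
  fix j k
  show "distr_product (distr_of (G j)) (distr_deriv j (distr_of (G k))) (?N j k)"
    unfolding distr_product_def
  proof (intro exI conjI)
    show "represented_by (distr_of (G j)) (G j)"
      using G[of j] Gi by (intro represented_by_distr_of) (auto simp: l2_fourier_def)
    show "represented_by (distr_deriv j (distr_of (G k))) (H j k)"
      by (rule represented_by_deriv[OF G H])
    show "represented_by (?N j k) (\<lambda>x. G j x * H j k x)"
      using G[of j] H[of j k] GHi by (intro represented_by_distr_of) (auto simp: l2_fourier_def periodic_def)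
  qed
  define L where "L = (\<lambda>\<phi>. (-1) * stokes_op a (\<lambda>k. distr_of (G k)) k \<phi> + 1 * distr_deriv k (distr_of P) \<phi>)"
  define W where "W = (\<lambda>\<phi>. \<Sum>j\<in>UNIV. ?N j k \<phi>)"
  note op = fourier_coeff_stokes_op[OF sym Gd G_fc]
  have L_pd: "L \<in> periodic_distribution"
    unfolding L_def
    by (intro periodic_distribution_combination op(1) periodic_distribution_deriv periodic_distribution_distr_of Pi)
  have W_pd: "W \<in> periodic_distribution"
    unfolding W_def by (intro periodic_distribution_sum periodic_distribution_distr_of GHi) auto
  have W_fc: "fourier_coeff W \<xi> = convection U \<xi> $ k" for \<xi>
  proof -
    have "((\<lambda>\<eta>. \<Sum>j\<in>UNIV. U \<eta> $ j * diff_coeff j (\<lambda>\<xi>. U \<xi> $ k) (\<xi> - \<eta>)) has_sum fourier_coeff W \<xi>) UNIV"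
      unfolding W_def fourier_coeff_sum N_fc by (intro has_sum_finite_sum has_sum_infsum prod_sum) auto
    \<comment> \<open>The product rule for coefficients gives the multiplier
      \<open>dot (\<xi> - \<eta>) (U \<eta>)\<close>; the divergence condition turns it into that of
      \<open>convection\<close>.\<close>
    moreover have "(\<Sum>j\<in>UNIV. U \<eta> $ j * diff_coeff j (\<lambda>\<xi>. U \<xi> $ k) (\<xi> - \<eta>)) = ((2 * pi * \<i> * dot \<xi> (U \<eta>)) *s U (\<xi> - \<eta>)) $ k" for \<eta>
    proof -
      have "(\<Sum>j\<in>UNIV. U \<eta> $ j * diff_coeff j (\<lambda>\<xi>. U \<xi> $ k) (\<xi> - \<eta>)) = 2 * pi * \<i> * dot (\<xi> - \<eta>) (U \<eta>) * U (\<xi> - \<eta>) $ k"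
        unfolding dot_def diff_coeff_def sum_distrib_left sum_distrib_right by (simp add: mult_ac)
      then show ?thesis by (simp add: U_dot)
    qed
    moreover have "((\<lambda>\<eta>. ((2 * pi * \<i> * dot \<xi> (U \<eta>)) *s U (\<xi> - \<eta>)) $ k) has_sum convection U \<xi> $ k) UNIV"
      unfolding convection_def
      by (intro has_sum_bounded_linear[OF bounded_linear_vec_nth] has_sum_infsum abs_summable_summable[OF U_abs])
    ultimately show ?thesis using has_sum_unique by simp blast
  qed
  have "fourier_coeff (\<lambda>\<phi>. 1 * L \<phi> + 1 * W \<phi>) = fourier_coeff (f k)"
  proof
    fix \<xi>
    have "fourier_coeff L \<xi> = tensor_symbol a \<xi> (U \<xi>) $ k + 2 * pi * \<i> * of_int (\<xi> $ k) * p \<xi>"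
      unfolding L_def fourier_coeff_combination op(2) fourier_coeff_deriv[OF periodic_distribution_distr_of[OF Pi]] l2_fourier_coeff[OF P] diff_coeff_def
      by simp
    then have "fourier_coeff (\<lambda>\<phi>. 1 * L \<phi> + 1 * W \<phi>) \<xi>
        = (tensor_symbol a \<xi> (U \<xi>) + (2 * pi * \<i> * p \<xi>) *s cfreq \<xi> + convection U \<xi>) $ k"
      unfolding fourier_coeff_combination W_fc by (simp add: cfreq_def mult_ac)
    then show "fourier_coeff (\<lambda>\<phi>. 1 * L \<phi> + 1 * W \<phi>) \<xi> = fourier_coeff (f k) \<xi>"
      by (simp only: eq fF)
  qed
  then have "1 * L \<phi> + 1 * W \<phi> = f k \<phi>" if "\<phi> \<in> periodic_smooth" for \<phi>
    using that by (intro periodic_distribution_eqI[of "\<lambda>\<phi>. 1 * L \<phi> + 1 * W \<phi>"] periodic_distribution_combination L_pd W_pd f)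
  then show "- stokes_op a (\<lambda>k. distr_of (G k)) k \<phi> + distr_deriv k (distr_of P) \<phi> + (\<Sum>j\<in>UNIV. ?N j k \<phi>) = f k \<phi>"
    if "\<phi> \<in> periodic_smooth" for \<phi>
    using that by (simp add: L_def W_def)
qed

lemma summable_norm_vec_iff:
  fixes z :: "int^'n::finite \<Rightarrow> complex^'n"
  assumes w: "\<And>\<xi>. w \<xi> \<ge> 0"
  shows "(\<lambda>\<xi>. w \<xi> * (norm (z \<xi>))\<^sup>2) summable_on UNIV \<longleftrightarrow> (\<forall>k. (\<lambda>\<xi>. w \<xi> * (cmod (z \<xi> $ k))\<^sup>2) summable_on UNIV)"
proof
  assume "(\<lambda>\<xi>. w \<xi> * (norm (z \<xi>))\<^sup>2) summable_on UNIV"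
  then show "\<forall>k. (\<lambda>\<xi>. w \<xi> * (cmod (z \<xi> $ k))\<^sup>2) summable_on UNIV"
    using w by (auto intro!: mult_left_mono power_mono norm_nth_le_norm elim!: summable_on_comparison_test)
next
  assume s: "\<forall>k. (\<lambda>\<xi>. w \<xi> * (cmod (z \<xi> $ k))\<^sup>2) summable_on UNIV"
  have "(\<lambda>\<xi>. \<Sum>k\<in>UNIV. w \<xi> * (cmod (z \<xi> $ k))\<^sup>2) summable_on UNIV"
    by (rule has_sum_imp_summable[OF has_sum_finite_sum]) (use s in \<open>auto intro: has_sum_infsum\<close>)
  moreover have "w \<xi> * (norm (z \<xi>))\<^sup>2 = (\<Sum>k\<in>UNIV. w \<xi> * (cmod (z \<xi> $ k))\<^sup>2)" for \<xi>
    by (simp add: norm_vec_def L2_set_def sum_nonneg sum_distrib_left)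
  ultimately show "(\<lambda>\<xi>. w \<xi> * (norm (z \<xi>))\<^sup>2) summable_on UNIV" by (simp only:)
qed

section \<open>Sobolev weights on coefficient families\<close>

lemma sobolev_le:
  fixes z :: "int^'n::finite \<Rightarrow> complex"
  assumes "(\<lambda>\<xi>. (1 + (nu \<xi>)\<^sup>2) powr s * (cmod (z \<xi>))\<^sup>2) summable_on UNIV" "r \<le> s"
  shows "(\<lambda>\<xi>. (1 + (nu \<xi>)\<^sup>2) powr r * (cmod (z \<xi>))\<^sup>2) summable_on UNIV"
  using assms(1) by (rule summable_on_comparison_test) (use assms(2) in \<open>auto intro!: mult_right_mono powr_mono\<close>)

text \<open>\<open>powr\<close> with exponent 0 is 1 only at a nonzero base, hence the check that
  the weight does not vanish.\<close>

lemma sobolev_zero: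
  fixes z :: "int^'n::finite \<Rightarrow> complex"
  shows "(\<lambda>\<xi>. (1 + (nu \<xi>)\<^sup>2) powr 0 * (cmod (z \<xi>))\<^sup>2) summable_on UNIV \<longleftrightarrow> (\<lambda>\<xi>. (cmod (z \<xi>))\<^sup>2) summable_on UNIV"
proof -
  have "1 + (nu \<xi>)\<^sup>2 \<noteq> 0" for \<xi> :: "int^'n"
    using zero_le_power2[of "nu \<xi>"] by linarith
  then show ?thesis by simp
qed

lemma sobolev_diff_coeff:
  fixes z :: "int^'n::finite \<Rightarrow> complex"
  assumes "(\<lambda>\<xi>. (1 + (nu \<xi>)\<^sup>2) powr s * (cmod (z \<xi>))\<^sup>2) summable_on UNIV" "s \<ge> 1"
  shows "(\<lambda>\<xi>. (cmod (diff_coeff j z \<xi>))\<^sup>2) summable_on UNIV"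
proof (rule summable_on_comparison_test)
  show "(\<lambda>\<xi>. (2 * pi)\<^sup>2 * ((1 + (nu \<xi>)\<^sup>2) powr 1 * (cmod (z \<xi>))\<^sup>2)) summable_on UNIV"
    by (intro summable_on_cmult_right sobolev_le[OF assms])
  fix \<xi>
  have "(cmod (diff_coeff j z \<xi>))\<^sup>2 \<le> (2 * pi * (nu \<xi> * cmod (z \<xi>)))\<^sup>2"
    by (intro power_mono cmod_diff_coeff_le) simp
  also have "\<dots> = (2 * pi)\<^sup>2 * ((nu \<xi>)\<^sup>2 * (cmod (z \<xi>))\<^sup>2)"
    by (simp add: power_mult_distrib)
  also have "\<dots> \<le> (2 * pi)\<^sup>2 * ((1 + (nu \<xi>)\<^sup>2) powr 1 * (cmod (z \<xi>))\<^sup>2)"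
    by (intro mult_left_mono mult_right_mono) (auto simp: powr_one_gt_zero_iff)
  finally show "(cmod (diff_coeff j z \<xi>))\<^sup>2 \<le> (2 * pi)\<^sup>2 * ((1 + (nu \<xi>)\<^sup>2) powr 1 * (cmod (z \<xi>))\<^sup>2)" .
qed simp

lemma diff_coeff_uminus: "(\<And>\<xi>. c (- \<xi>) = cnj (c \<xi>)) \<Longrightarrow> diff_coeff j c (- \<xi>) = cnj (diff_coeff j c \<xi>)"
  by (simp add: diff_coeff_def)

lemma fourier_system_solution:
  fixes a :: "'n::finite tensor" and F :: "int^'n \<Rightarrow> complex^'n"
  assumes n: "CARD('n) \<le> 4" and sym: "tensor_symmetric a" and ell: "relaxed_elliptic a"
    and F_sym: "\<And>\<xi>. F (- \<xi>) = vcnj (F \<xi>)" and F0: "F 0 = 0"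
    and F2: "\<And>k. (\<lambda>\<xi>. (cmod (F \<xi> $ k))\<^sup>2) summable_on UNIV"
  obtains U p where "\<And>k \<xi>. U (- \<xi>) $ k = cnj (U \<xi> $ k)" "\<And>k. U 0 $ k = 0" "\<And>\<xi>. dot \<xi> (U \<xi>) = 0"
    "\<And>\<xi>. p (- \<xi>) = cnj (p \<xi>)" "p 0 = 0"
    "\<And>\<xi>. (\<lambda>\<eta>. norm ((2 * pi * \<i> * dot \<xi> (U \<eta>)) *s U (\<xi> - \<eta>))) summable_on UNIV"
    "\<And>\<xi>. tensor_symbol a \<xi> (U \<xi>) + (2 * pi * \<i> * p \<xi>) *s cfreq \<xi> + convection U \<xi> = F \<xi>"
    "\<And>s k. s \<ge> 2 \<Longrightarrow> (\<And>k. (\<lambda>\<xi>. (1 + (nu \<xi>)\<^sup>2) powr (s - 2) * (cmod (F \<xi> $ k))\<^sup>2) summable_on UNIV) \<Longrightarrow>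
      (\<lambda>\<xi>. (1 + (nu \<xi>)\<^sup>2) powr s * (cmod (U \<xi> $ k))\<^sup>2) summable_on UNIV"
    "\<And>s. s \<ge> 2 \<Longrightarrow> (\<And>k. (\<lambda>\<xi>. (1 + (nu \<xi>)\<^sup>2) powr (s - 2) * (cmod (F \<xi> $ k))\<^sup>2) summable_on UNIV) \<Longrightarrow>
      (\<lambda>\<xi>. (1 + (nu \<xi>)\<^sup>2) powr (s - 1) * (cmod (p \<xi>))\<^sup>2) summable_on UNIV"
proof -
  obtain c where "stokes_symbol (tensor_symbol a) c"
    using stokes_symbol_tensor[OF sym ell] by blast
  then interpret stokes_symbol "tensor_symbol a" c .
  obtain K where K: "\<And>\<xi> w. norm (tensor_symbol a \<xi> w) \<le> K * (nu \<xi>)\<^sup>2 * norm w"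
    using tensor_symbol_bound by blast
  have F2': "(\<lambda>\<xi>. (norm (F \<xi>))\<^sup>2) summable_on UNIV"
    using summable_norm_vec_iff[of "\<lambda>_. 1" F] F2 by simp
  show thesis
  proof (rule fourier_solution[OF n K F_sym F0 F2'])
    fix U p
    assume U: "\<And>\<xi>. U (- \<xi>) = vcnj (U \<xi>)" "U 0 = 0" "\<And>\<xi>. dot \<xi> (U \<xi>) = 0"
      "\<And>\<xi>. p (- \<xi>) = cnj (p \<xi>)" "p 0 = 0"
      "\<And>\<xi>. (\<lambda>\<eta>. norm ((2 * pi * \<i> * dot \<xi> (U \<eta>)) *s U (\<xi> - \<eta>))) summable_on UNIV"
      "\<And>\<xi>. tensor_symbol a \<xi> (U \<xi>) + (2 * pi * \<i> * p \<xi>) *s cfreq \<xi> + convection U \<xi> = F \<xi>"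
      and reg: "\<And>s. s \<ge> 2 \<Longrightarrow> (\<lambda>\<xi>. (1 + (nu \<xi>)\<^sup>2) powr (s - 2) * (norm (F \<xi>))\<^sup>2) summable_on UNIV \<Longrightarrow>
      (\<lambda>\<xi>. (1 + (nu \<xi>)\<^sup>2) powr s * (norm (U \<xi>))\<^sup>2) summable_on UNIV \<and>
      (\<lambda>\<xi>. (1 + (nu \<xi>)\<^sup>2) powr (s - 1) * (cmod (p \<xi>))\<^sup>2) summable_on UNIV"
    have reg': "(\<forall>k. (\<lambda>\<xi>. (1 + (nu \<xi>)\<^sup>2) powr s * (cmod (U \<xi> $ k))\<^sup>2) summable_on UNIV) \<and>
      (\<lambda>\<xi>. (1 + (nu \<xi>)\<^sup>2) powr (s - 1) * (cmod (p \<xi>))\<^sup>2) summable_on UNIV"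
      if "s \<ge> 2" "\<And>k. (\<lambda>\<xi>. (1 + (nu \<xi>)\<^sup>2) powr (s - 2) * (cmod (F \<xi> $ k))\<^sup>2) summable_on UNIV" for s
    proof -
      have "(\<lambda>\<xi>. (1 + (nu \<xi>)\<^sup>2) powr (s - 2) * (norm (F \<xi>))\<^sup>2) summable_on UNIV"
        using that(2) by (subst summable_norm_vec_iff) auto
      from reg[OF that(1) this] show ?thesis
        by (subst (asm) summable_norm_vec_iff) auto
    qed
    show thesis
      by (rule that[of U p]) (use U reg' in \<open>simp_all\<close>)
  qed
qed

lemma sobolev_mean0_iff:
  "T \<in> sobolev_mean0 s \<longleftrightarrow> T \<in> periodic_distribution \<and> fourier_coeff T 0 = 0 \<and>
    (\<lambda>\<xi>. (1 + (nu \<xi>)\<^sup>2) powr s * (cmod (fourier_coeff T \<xi>))\<^sup>2) summable_on UNIV"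
  by (auto simp: sobolev_mean0_def sobolev_def nu_def)

lemma sobolev_mean0_mono: "T \<in> sobolev_mean0 s \<Longrightarrow> r \<le> s \<Longrightarrow> T \<in> sobolev_mean0 r"
  unfolding sobolev_mean0_iff using sobolev_le by blast

lemma distr_of_sobolev_mean0:
  assumes g: "l2_fourier g c" and c0: "c 0 = 0"
    and c: "(\<lambda>\<xi>. (1 + (nu \<xi>)\<^sup>2) powr s * (cmod (c \<xi>))\<^sup>2) summable_on UNIV"
  shows "distr_of g \<in> sobolev_mean0 s"
  unfolding sobolev_mean0_iff l2_fourier_coeff[OF g]
  by (intro conjI c c0 periodic_distribution_distr_of l2_fourier_integrable[OF g])

lemma distr_of_periodic_smooth_mean0:
  assumes "f \<in> periodic_smooth_mean0"
  shows "distr_of f \<in> sobolev_mean0 s"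
proof -
  have f: "f \<in> periodic_smooth" and m: "(LINT x|torus_measure. f x) = 0"
    using assms by (simp_all add: periodic_smooth_mean0_def set_integral_torus)
  have "fourier_coeff (distr_of f) 0 = 0"
    using m by (simp add: fourier_coeff_distr_of[OF periodic_smooth_integrable[OF f]])
  then show ?thesis
    unfolding sobolev_mean0_iff
    by (intro conjI periodic_distribution_distr_of periodic_smooth_integrable[OF f]
        decaying_sobolev periodic_smooth_decaying[OF f])
qed

lemma trig_mean0:
  assumes c: "rapid c" and sym: "\<And>\<xi>. c (- \<xi>) = cnj (c \<xi>)" and c0: "c 0 = 0"
  shows "trig c \<in> periodic_smooth_mean0"
proof -
  have "of_real (LINT x|torus_measure. trig c x) = fourier_coeff (distr_of (trig c)) 0"
    by (simp add: fourier_coeff_distr_of[OF periodic_smooth_integrable[OF trig_periodic_smooth[OF c]]])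
  then have "(LINT x|torus_measure. trig c x) = 0"
    unfolding l2_fourier_coeff[OF l2_fourier_trig[OF c sym]] c0 by simp
  then show ?thesis
    by (simp add: periodic_smooth_mean0_def set_integral_torus trig_periodic_smooth[OF c])
qed

text \<open>Existence assumes only order 0 of the data, while regularity is stated for all orders of
  one and the same pair \<open>U\<close>, \<open>p\<close>. The representatives \<open>G\<close> and
  \<open>P\<close> stay free, so Riesz-Fischer limits and smooth trigonometric series can both be
  inserted.\<close>

lemma navier_stokes_fourier:
  fixes a :: "'n::finite tensor" and f :: "'n \<Rightarrow> 'n functional"
  assumes n: "CARD('n) \<le> 4" and sym: "tensor_symmetric a" and ell: "relaxed_elliptic a"
    and f: "f \<in> sobolev_mean0_vec 0"
  obtains U p where "\<And>k \<xi>. U (- \<xi>) $ k = cnj (U \<xi> $ k)" "\<And>k. U 0 $ k = 0" "\<And>\<xi>. dot \<xi> (U \<xi>) = 0"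
    "\<And>\<xi>. p (- \<xi>) = cnj (p \<xi>)" "p 0 = 0"
    "\<And>s k. s \<ge> 2 \<Longrightarrow> f \<in> sobolev_mean0_vec (s - 2) \<Longrightarrow>
      (\<lambda>\<xi>. (1 + (nu \<xi>)\<^sup>2) powr s * (cmod (U \<xi> $ k))\<^sup>2) summable_on UNIV"
    "\<And>s. s \<ge> 2 \<Longrightarrow> f \<in> sobolev_mean0_vec (s - 2) \<Longrightarrow>
      (\<lambda>\<xi>. (1 + (nu \<xi>)\<^sup>2) powr (s - 1) * (cmod (p \<xi>))\<^sup>2) summable_on UNIV"
    "\<And>G P. (\<And>k. l2_fourier (G k) (\<lambda>\<xi>. U \<xi> $ k)) \<Longrightarrow> l2_fourier P p \<Longrightarrow>
      navier_stokes a (\<lambda>k. distr_of (G k)) (distr_of P) f"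
proof -
  define F where "F = (\<lambda>\<xi>. \<chi> k. fourier_coeff (f k) \<xi>)"
  have fs: "f k \<in> sobolev_mean0 s" if "f \<in> sobolev_mean0_vec s" for k s
    using that by (simp add: sobolev_mean0_vec_def)
  have fd: "f k \<in> periodic_distribution" and f0: "fourier_coeff (f k) 0 = 0" for k
    using fs[OF f] by (simp_all add: sobolev_mean0_iff)
  have F_nth: "fourier_coeff (f k) \<xi> = F \<xi> $ k" for k \<xi>
    by (simp add: F_def)
  have F_sob: "(\<lambda>\<xi>. (1 + (nu \<xi>)\<^sup>2) powr s * (cmod (F \<xi> $ k))\<^sup>2) summable_on UNIV" if "f \<in> sobolev_mean0_vec s" for s k
    using fs[OF that] unfolding sobolev_mean0_iff F_nth by blast
  have F_sym: "F (- \<xi>) = vcnj (F \<xi>)" for \<xi>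
    by (simp add: F_def vec_eq_iff fourier_coeff_uminus[OF fd])
  have F0: "F 0 = 0"
    by (simp add: F_def vec_eq_iff f0)
  have F2: "(\<lambda>\<xi>. (cmod (F \<xi> $ k))\<^sup>2) summable_on UNIV" for k
    using F_sob[OF f] unfolding sobolev_zero .
  show thesis
  proof (rule fourier_system_solution[OF n sym ell F_sym F0 F2])
    fix U p
    assume U_sym: "\<And>k \<xi>. U (- \<xi>) $ k = cnj (U \<xi> $ k)" and U0: "\<And>k. U 0 $ k = 0" and U_dot: "\<And>\<xi>. dot \<xi> (U \<xi>) = 0"
      and p_sym: "\<And>\<xi>. p (- \<xi>) = cnj (p \<xi>)" and p0: "p 0 = 0"
      and U_abs: "\<And>\<xi>. (\<lambda>\<eta>. norm ((2 * pi * \<i> * dot \<xi> (U \<eta>)) *s U (\<xi> - \<eta>))) summable_on UNIV"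
      and eq: "\<And>\<xi>. tensor_symbol a \<xi> (U \<xi>) + (2 * pi * \<i> * p \<xi>) *s cfreq \<xi> + convection U \<xi> = F \<xi>"
      and Ureg: "\<And>s k. s \<ge> 2 \<Longrightarrow> (\<And>k. (\<lambda>\<xi>. (1 + (nu \<xi>)\<^sup>2) powr (s - 2) * (cmod (F \<xi> $ k))\<^sup>2) summable_on UNIV) \<Longrightarrow>
      (\<lambda>\<xi>. (1 + (nu \<xi>)\<^sup>2) powr s * (cmod (U \<xi> $ k))\<^sup>2) summable_on UNIV"
      and preg: "\<And>s. s \<ge> 2 \<Longrightarrow> (\<And>k. (\<lambda>\<xi>. (1 + (nu \<xi>)\<^sup>2) powr (s - 2) * (cmod (F \<xi> $ k))\<^sup>2) summable_on UNIV) \<Longrightarrow>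
      (\<lambda>\<xi>. (1 + (nu \<xi>)\<^sup>2) powr (s - 1) * (cmod (p \<xi>))\<^sup>2) summable_on UNIV"
    have F_sob0: "(\<lambda>\<xi>. (1 + (nu \<xi>)\<^sup>2) powr (2 - 2) * (cmod (F \<xi> $ k))\<^sup>2) summable_on UNIV" for k
      using F_sob[OF f, of k] by (simp only: diff_self)
    have two: "(2::real) \<le> 2" and one: "(1::real) \<le> 2" and zero: "(0::real) \<le> 2" by simp_all
    \<comment> \<open>Order 2 is always available because the data have order 0; it makes the
      velocity gradient square summable.\<close>
    have U2s: "(\<lambda>\<xi>. (1 + (nu \<xi>)\<^sup>2) powr 2 * (cmod (U \<xi> $ k))\<^sup>2) summable_on UNIV" for k
      by (rule Ureg[OF two F_sob0])
    have U2: "(\<lambda>\<xi>. (cmod (U \<xi> $ k))\<^sup>2) summable_on UNIV" for k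
      using sobolev_le[OF U2s zero] unfolding sobolev_zero .
    have DU2: "(\<lambda>\<xi>. (cmod (diff_coeff j (\<lambda>\<xi>. U \<xi> $ k) \<xi>))\<^sup>2) summable_on UNIV" for j k
      by (rule sobolev_diff_coeff[OF U2s one])
    have "\<exists>h. l2_fourier h (diff_coeff j (\<lambda>\<xi>. U \<xi> $ k))" for j k
      using riesz_fischer[OF DU2[of j k] diff_coeff_uminus] U_sym by blast
    then obtain H where H: "\<And>j k. l2_fourier (H j k) (diff_coeff j (\<lambda>\<xi>. U \<xi> $ k))" by metis
    show thesis
    proof (rule that[of U p])
      show "navier_stokes a (\<lambda>k. distr_of (G k)) (distr_of P) f"
        if "\<And>k. l2_fourier (G k) (\<lambda>\<xi>. U \<xi> $ k)" "l2_fourier P p" for G P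
        by (rule navier_stokesI[OF sym U_dot U_abs eq U2 DU2 that(1) H that(2) fd F_nth])
    qed (fact U_sym U0 U_dot p_sym p0 | rule Ureg preg, assumption, erule F_sob)+
  qed
qed

lemma divergence_coeff: "(\<Sum>j\<in>UNIV. diff_coeff j (\<lambda>\<xi>. U \<xi> $ j) \<xi>) = 2 * pi * \<i> * dot \<xi> (U \<xi>)"
  by (simp add: diff_coeff_def dot_def sum_distrib_left mult_ac)

theorem theorem6p6:
  fixes a :: "'n::finite tensor"
  assumes "CARD('n) \<in> {2, 3, 4}"
    and "tensor_symmetric a"
    and "relaxed_elliptic a"
  shows "(\<forall>(s::real) (f :: 'n \<Rightarrow> 'n functional).
            s \<ge> 2 \<longrightarrow> f \<in> sobolev_mean0_vec (s - 2) \<longrightarrow>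
            (\<exists>u \<in> sobolev_mean0_sol s. \<exists>p \<in> sobolev_mean0 (s - 1). navier_stokes a u p f))
       \<and> (\<forall>f :: 'n \<Rightarrow> real^'n \<Rightarrow> real.
            (\<forall>k. f k \<in> periodic_smooth_mean0) \<longrightarrow>
            (\<exists>(u :: 'n \<Rightarrow> real^'n \<Rightarrow> real) (p :: real^'n \<Rightarrow> real).
               (\<forall>k. u k \<in> periodic_smooth_mean0) \<and>
               p \<in> periodic_smooth_mean0 \<and>
               (\<forall>x. (\<Sum>j\<in>UNIV. partial_deriv j (u j) x) = 0) \<and>
               navier_stokes a (\<lambda>k. distr_of (u k)) (distr_of p) (\<lambda>k. distr_of (f k))))"
proof (intro conjI allI impI)
  have n: "CARD('n) \<le> 4" using assms(1) by auto
  note solution = navier_stokes_fourier[OF n assms(2,3)]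
  {
    fix s :: real and f :: "'n \<Rightarrow> 'n functional"
    assume s: "s \<ge> 2" and f: "f \<in> sobolev_mean0_vec (s - 2)"
    \<comment> \<open>\<open>s \<ge> 2\<close> is what places the data in order 0, where existence
      starts.\<close>
    have f0: "f \<in> sobolev_mean0_vec 0"
      using f s by (auto simp: sobolev_mean0_vec_def intro: sobolev_mean0_mono)
    show "\<exists>u \<in> sobolev_mean0_sol s. \<exists>p \<in> sobolev_mean0 (s - 1). navier_stokes a u p f"
    proof (rule solution[OF f0])
      fix U p
      assume U_sym: "\<And>k \<xi>. U (- \<xi>) $ k = cnj (U \<xi> $ k)" and U0: "\<And>k. U 0 $ k = 0"
        and U_dot: "\<And>\<xi>. dot \<xi> (U \<xi>) = 0" and p_sym: "\<And>\<xi>. p (- \<xi>) = cnj (p \<xi>)" and p0: "p 0 = 0"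
        and Ureg: "\<And>s k. s \<ge> 2 \<Longrightarrow> f \<in> sobolev_mean0_vec (s - 2) \<Longrightarrow>
          (\<lambda>\<xi>. (1 + (nu \<xi>)\<^sup>2) powr s * (cmod (U \<xi> $ k))\<^sup>2) summable_on UNIV"
        and preg: "\<And>s. s \<ge> 2 \<Longrightarrow> f \<in> sobolev_mean0_vec (s - 2) \<Longrightarrow>
          (\<lambda>\<xi>. (1 + (nu \<xi>)\<^sup>2) powr (s - 1) * (cmod (p \<xi>))\<^sup>2) summable_on UNIV"
        and ns: "\<And>G P. (\<And>k. l2_fourier (G k) (\<lambda>\<xi>. U \<xi> $ k)) \<Longrightarrow> l2_fourier P p \<Longrightarrow>
          navier_stokes a (\<lambda>k. distr_of (G k)) (distr_of P) f"
      have s0: "0 \<le> s" and s1: "0 \<le> s - 1" using s by simp_all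
      have U2: "(\<lambda>\<xi>. (cmod (U \<xi> $ k))\<^sup>2) summable_on UNIV" for k
        using sobolev_le[OF Ureg[OF s f] s0] unfolding sobolev_zero .
      have p2: "(\<lambda>\<xi>. (cmod (p \<xi>))\<^sup>2) summable_on UNIV"
        using sobolev_le[OF preg[OF s f] s1] unfolding sobolev_zero .
      have "\<exists>g. l2_fourier g (\<lambda>\<xi>. U \<xi> $ k)" for k
        using riesz_fischer[OF U2 U_sym] by blast
      then obtain G where G: "\<And>k. l2_fourier (G k) (\<lambda>\<xi>. U \<xi> $ k)" by metis
      obtain P where P: "l2_fourier P p"
        using riesz_fischer[OF p2 p_sym] by blast
      let ?u = "\<lambda>k. distr_of (G k)"
      have u_pd: "?u k \<in> periodic_distribution" for k
        by (rule periodic_distribution_distr_of[OF l2_fourier_integrable[OF G]])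
      have div_pd: "distr_div ?u \<in> periodic_distribution"
        unfolding distr_div_def[abs_def] by (intro periodic_distribution_sum periodic_distribution_deriv u_pd) simp
      have "fourier_coeff (distr_div ?u) \<xi> = 0" for \<xi>
        \<comment> \<open>The coefficients of the divergence are multiples of
          \<open>dot \<xi> (U \<xi>)\<close>, so the divergence vanishes as a distribution by
          uniqueness.\<close>
        unfolding distr_div_def[abs_def] fourier_coeff_sum fourier_coeff_deriv[OF u_pd] l2_fourier_coeff[OF G]
          divergence_coeff U_dot by simp
      then have "fourier_coeff (distr_div ?u) = fourier_coeff (\<lambda>_. 0)"
        by (simp add: fun_eq_iff fourier_coeff_def complex_eq_iff)
      then have "distr_div ?u \<phi> = 0" if "\<phi> \<in> periodic_smooth" for \<phi>
        using periodic_distribution_eqI[OF div_pd periodic_distribution_zero _ that] by simp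
      moreover have "?u \<in> sobolev_mean0_vec s"
        unfolding sobolev_mean0_vec_def using distr_of_sobolev_mean0[OF G U0 Ureg[OF s f]] by simp
      ultimately have "?u \<in> sobolev_mean0_sol s"
        by (simp add: sobolev_mean0_sol_def)
      moreover have "distr_of P \<in> sobolev_mean0 (s - 1)"
        by (rule distr_of_sobolev_mean0[OF P p0 preg[OF s f]])
      ultimately show ?thesis using ns[OF G P] by blast
    qed
  }
  fix f :: "'n \<Rightarrow> real^'n \<Rightarrow> real"
  assume "\<forall>k. f k \<in> periodic_smooth_mean0"
  then have f: "(\<lambda>k. distr_of (f k)) \<in> sobolev_mean0_vec s" for s
    by (simp add: sobolev_mean0_vec_def distr_of_periodic_smooth_mean0)
  show "\<exists>u p. (\<forall>k. u k \<in> periodic_smooth_mean0) \<and> p \<in> periodic_smooth_mean0 \<and>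
      (\<forall>x. (\<Sum>j\<in>UNIV. partial_deriv j (u j) x) = 0) \<and>
      navier_stokes a (\<lambda>k. distr_of (u k)) (distr_of p) (\<lambda>k. distr_of (f k))"
  proof (rule solution[OF f])
    fix U p
    assume U_sym: "\<And>k \<xi>. U (- \<xi>) $ k = cnj (U \<xi> $ k)" and U0: "\<And>k. U 0 $ k = 0"
      and U_dot: "\<And>\<xi>. dot \<xi> (U \<xi>) = 0" and p_sym: "\<And>\<xi>. p (- \<xi>) = cnj (p \<xi>)" and p0: "p 0 = 0"
      and Ureg: "\<And>s k. s \<ge> 2 \<Longrightarrow> (\<lambda>k. distr_of (f k)) \<in> sobolev_mean0_vec (s - 2) \<Longrightarrow>
        (\<lambda>\<xi>. (1 + (nu \<xi>)\<^sup>2) powr s * (cmod (U \<xi> $ k))\<^sup>2) summable_on UNIV"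
      and preg: "\<And>s. s \<ge> 2 \<Longrightarrow> (\<lambda>k. distr_of (f k)) \<in> sobolev_mean0_vec (s - 2) \<Longrightarrow>
        (\<lambda>\<xi>. (1 + (nu \<xi>)\<^sup>2) powr (s - 1) * (cmod (p \<xi>))\<^sup>2) summable_on UNIV"
      and ns: "\<And>G P. (\<And>k. l2_fourier (G k) (\<lambda>\<xi>. U \<xi> $ k)) \<Longrightarrow> l2_fourier P p \<Longrightarrow>
        navier_stokes a (\<lambda>k. distr_of (G k)) (distr_of P) (\<lambda>k. distr_of (f k))"
    \<comment> \<open>Smooth data belong to every Sobolev space, so the same coefficients satisfy
      the bounds of all orders at once.\<close>
    have U_rapid: "rapid (\<lambda>\<xi>. U \<xi> $ k)" for k
      by (intro decaying_rapid decayingI_sobolev Ureg f)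
    \<comment> \<open>The pressure lies one order below the velocity, hence the shift to
      \<open>s + 1\<close>.\<close>
    have "(\<lambda>\<xi>. (1 + (nu \<xi>)\<^sup>2) powr s * (cmod (p \<xi>))\<^sup>2) summable_on UNIV" if "s \<ge> 2" for s
      using preg[of "s + 1", OF _ f] that by simp
    then have p_rapid: "rapid p"
      by (intro decaying_rapid decayingI_sobolev)
    let ?u = "\<lambda>k. trig (\<lambda>\<xi>. U \<xi> $ k)"
    have "(\<Sum>j\<in>UNIV. partial_deriv j (?u j) x) = 0" for x
    proof -
      have "(\<Sum>j\<in>UNIV. partial_deriv j (?u j) x) = Re (\<Sum>j\<in>UNIV. \<Sum>\<^sub>\<infinity>\<xi>. diff_coeff j (\<lambda>\<xi>. U \<xi> $ j) \<xi> * wave \<xi> x)"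
        by (simp add: partial_deriv_trig[OF U_rapid] trig_def)
      also have "(\<Sum>j\<in>UNIV. \<Sum>\<^sub>\<infinity>\<xi>. diff_coeff j (\<lambda>\<xi>. U \<xi> $ j) \<xi> * wave \<xi> x)
          = (\<Sum>\<^sub>\<infinity>\<xi>. \<Sum>j\<in>UNIV. diff_coeff j (\<lambda>\<xi>. U \<xi> $ j) \<xi> * wave \<xi> x)"
        by (intro infsumI[symmetric] has_sum_finite_sum has_sum_infsum rapid_summable rapid_diff_coeff U_rapid) simp
      also have "\<dots> = 0"
        unfolding sum_distrib_right[symmetric] divergence_coeff U_dot by simp
      finally show ?thesis by simp
    qed
    \<comment> \<open>A trigonometric series with rapid symmetric coefficients is its own
      mean-square representative, so the classical functions solve the distributional
      equation.\<close>
    then show ?thesis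
      by (intro exI[of _ ?u] exI[of _ "trig p"] conjI allI trig_mean0 ns l2_fourier_trig U_rapid U_sym U0 p_rapid p_sym p0)
  qed
qed

end
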